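(* Let $(\Sigma,D,T)$ be a torsion free affine surface equipped with a parallel (nonzero) nilpotent $(1,1)$-tensor field $T$, and let $\Phi$ be a symmetric $(0,2)$-tensor field on $\Sigma$. Then any solution $\varphi$ of the conformally Einstein equation $$2\operatorname{Hes}_\varphi+\varphi\,\rho-\tfrac14\{2\Delta\varphi+\varphi\,\tau\}\,g=0,\qquad g=g_{D,\Phi,T},\qquad(\ast)$$ is of the form $\varphi=\iota X+\phi\circ\pi$ for some function $\phi\in\mathcal{C}^\infty(\Sigma)$ and some vector field $X$ on $\Sigma$ such that $X\in\ker T$ and $\operatorname{tr}(DX)=0$. Moreover, $(T^*\Sigma,g_{D,\Phi,T})$ is conformally Einstein if and only if one of the following holds: (i) Equation $(\ast)$ admits a (positive) solution $\varphi=\phi\circ\pi$ for some $\phi\in\mathcal{C}^\infty(\Sigma)$ with $d\phi(\ker T)=0$, and the deformation tensor $\Phi$ is determined by $\phi\,\widehat\Phi+2(\operatorname{Hes}^D_\phi+\phi\,\rho^D_{sym})=0$. (ii) Equation $(\ast)$ admits a (positive) solution $\varphi=\iota X+\phi\circ\pi$ for some $\phi\in\mathcal{C}^\infty(\Sigma)$ and some non-zero vector field $X$ on $\Sigma$ such that $X\in\ker T$ and $\operatorname{tr}(DX)=0$. In case (ii), the Ricci tensor $\rho^D$ is symmetric of rank one and recurrent. Moreover, there are local coordinates $(u^1,u^2)$ on $\Sigma$ (in which the only non-zero Christoffel symbol of $D$ is ${}^u\Gamma_{11}{}^2$ and $T\partial_{u^1}=\partial_{u^2}$, $T\partial_{u^2}=0$)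 so that, for a constant $\kappa\neq0$, $\varphi(u^1,u^2,u_{1'},u_{2'})=\kappa u_{2'}+\phi(u^1,u^2)$ is a solution of $(\ast)$ if and only if (with $\partial_1=\partial_{u^1}$) $$d\phi(T\partial_1)=\tfrac{\kappa}{2}\,\Phi(T\partial_1,T\partial_1),$$ $$\operatorname{Hes}^D_\phi(\partial_1,\partial_1)+\phi\,\rho^D(\partial_1,\partial_1)=-\tfrac12\left(\phi+2\kappa\,{}^u\Gamma_{11}{}^2\right)\Phi(T\partial_1,T\partial_1)+\tfrac{\kappa}{2}\left\{2(D_{\partial_1}\Phi)(T\partial_1,\partial_1)-(D_{T\partial_1}\Phi)(\partial_1,\partial_1)\right\}.$$
   Context: A torsion free affine surface $(\Sigma,D)$ is a smooth surface $\Sigma$ with a torsion free affine connection $D$, with Christoffel symbols ${}^D\Gamma_{ij}{}^k$ (written ${}^u\Gamma_{ij}{}^k$ in coordinates $(u^1,u^2)$). Its Ricci tensor is $\rho^D(X,Y)=\operatorname{tr}\{Z\mapsto R^D(Z,X)Y\}$ with $R^D(X,Y)=[D_X,D_Y]-D_{[X,Y]}$, and $\rho^D_{sym}$ is its symmetric part; $\rho^D$ is recurrent if $D\rho^D=\omega\otimes\rho^D$ for some one-form $\omega$. $\operatorname{Hes}^D_\phi=D\,d\phi$. $\operatorname{tr}(DX)$ is the trace of the endomorphism $Y\mapsto D_YX$. $T$ parallel means $DT=0$; nilpotent means $T^2=0$. For a symmetric $(0,2)$-tensor field $\Phi$ set $\widehat\Phi(X,Y)=\Phi(TX,TY)$.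 Let $\pi\colon T^*\Sigma\to\Sigma$ be the cotangent bundle. Local coordinates $(x^i)$ on $\Sigma$ (resp. $(u^i)$) induce coordinates $(x^i,x_{i'})$ (resp. $(u^i,u_{i'})$) on $T^*\Sigma$ by writing a covector as $\sum x_{i'}dx^i$ (resp. $\sum u_{i'}du^i$). For a vector field $X$ on $\Sigma$, the evaluation is $\iota X(p,\alpha)=\alpha(X_p)$, and the complete lift $X^C$ is determined by $X^C(\iota Z)=\iota[X,Z]$ for all $Z$; $\iota T$ is the one-form with $\iota T(X^C)=\iota(TX)$; $g_D$ is the metric with $g_D(X^C,Y^C)=-\iota(D_XY+D_YX)$. Then $g_{D,\Phi,T}=\iota T\circ\iota T+g_D+\pi^*\Phi$, where $\omega_1\circ\omega_2=\frac12(\omega_1\otimes\omega_2+\omega_2\otimes\omega_1)$; it has neutral signature. In induced coordinates, with $T\partial_i=T_i^k\partial_k$, $$g_{D,\Phi,T}=2\,dx^i\circ dx_{i'}+\{\tfrac12x_{r'}x_{s'}(T_i^rT_j^s+T_j^rT_i^s)-2x_{k'}{}^D\Gamma_{ij}{}^k+\Phi_{ij}\}\,dx^i\circ dx^j .$$ In $(\ast)$, $\operatorname{Hes}_\varphi=\nabla d\varphi$, $\Delta\varphi=\operatorname{tr}_g\operatorname{Hes}_\varphi$, and $\rho$ and $\tau$ are the Ricci tensor and scalar curvature of $g$. A pseudo-Riemannian manifold $(M,g)$ is (locally) conformally Einstein if every point has an open neighborhood $\mathcal{U}$ and a positive smooth function $\varphi$ on $\mathcal{U}$ such that $(\mathcal{U},\varphi^{-2}g)$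 is Einstein; in dimension four this is equivalent to $\varphi$ being a positive solution of $(\ast)$ on $\mathcal{U}$.
   Formalization: In case (ii), the Ricci tensor is shown to be of rank one and recurrent only where it is non-zero (it may vanish), and the derivatives of Φ in the last equation are those of its components Φ(T∂1,∂1), Φ(∂1,∂1), not covariant ones; the equivalence with (i)/(ii) is read locally. *)

theory Defs
  imports "HOL-Analysis.Analysis"
begin

section \<open>Smooth functions on open subsets of Euclidean space\<close>

definition pd :: "'n::finite \<Rightarrow> (real^'n \<Rightarrow> 'b::real_normed_vector) \<Rightarrow> real^'n \<Rightarrow> 'b" where
  "pd i f x = frechet_derivative f (at x) (axis i 1)"

primrec Ck_on :: "nat \<Rightarrow> (real^'n::finite) set \<Rightarrow> (real^'n \<Rightarrow> 'b::real_normed_vector) \<Rightarrow> bool" where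
  "Ck_on 0 S f \<longleftrightarrow> continuous_on S f"
| "Ck_on (Suc k) S f \<longleftrightarrow> (\<forall>x\<in>S. f differentiable (at x)) \<and> (\<forall>i. Ck_on k S (pd i f))"

text \<open>Only used for open \<open>S\<close>, where it is the usual notion of a smooth function.\<close>

definition smooth_on :: "(real^'n::finite) set \<Rightarrow> (real^'n \<Rightarrow> 'b::real_normed_vector) \<Rightarrow> bool" where
  "smooth_on S f \<longleftrightarrow> (\<forall>k. Ck_on k S f)"


section \<open>Smooth manifolds\<close>

text \<open>A chart is a domain together with a map; the values of the map outside the domain are
  irrelevant.\<close>

type_synonym ('a, 'n) chart = "'a set \<times> ('a \<Rightarrow> real^'n)"

definition chart_inv :: "('a, 'n::finite) chart \<Rightarrow> real^'n \<Rightarrow> 'a" where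
  "chart_inv c = inv_into (fst c) (snd c)"

definition transition :: "('a, 'n::finite) chart \<Rightarrow> ('a, 'n) chart \<Rightarrow> real^'n \<Rightarrow> real^'n" where
  "transition c c' = snd c' \<circ> chart_inv c"

text \<open>\<open>jac c c' p $ k $ i\<close> is the derivative of the \<open>k\<close>-th coordinate of \<open>c'\<close> with respect to the
  \<open>i\<close>-th coordinate of \<open>c\<close>, at \<open>p\<close>.\<close>

definition jac :: "('a, 'n::finite) chart \<Rightarrow> ('a, 'n) chart \<Rightarrow> 'a \<Rightarrow> real^'n^'n" where
  "jac c c' p = jacobian (transition c c') (at (snd c p))"

definition chart_on :: "'a topology \<Rightarrow> ('a, 'n::finite) chart \<Rightarrow> bool" where
  "chart_on M c \<longleftrightarrow> openin M (fst c) \<and> open (snd c ` fst c) \<and>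
     homeomorphic_map (subtopology M (fst c)) (top_of_set (snd c ` fst c)) (snd c)"

definition compatible :: "('a, 'n::finite) chart \<Rightarrow> ('a, 'n) chart \<Rightarrow> bool" where
  "compatible c c' \<longleftrightarrow>
     smooth_on (snd c ` (fst c \<inter> fst c')) (transition c c') \<and>
     smooth_on (snd c' ` (fst c \<inter> fst c')) (transition c' c)"

text \<open>The atlas is required to be maximal, so that every local coordinate system belongs to it.\<close>

definition smooth_manifold :: "'a topology \<Rightarrow> ('a, 'n::finite) chart set \<Rightarrow> bool" where
  "smooth_manifold M A \<longleftrightarrow>
     Hausdorff_space M \<and> second_countable M \<and>
     (\<Union>c\<in>A. fst c) = topspace M \<and>
     (\<forall>c\<in>A. chart_on M c) \<and>
     (\<forall>c\<in>A. \<forall>c'\<in>A. compatible c c') \<and>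
     (\<forall>c. chart_on M c \<and> (\<forall>c'\<in>A. compatible c c') \<longrightarrow> c \<in> A)"

definition smooth_fun :: "('a, 'n::finite) chart set \<Rightarrow> 'a set \<Rightarrow> ('a \<Rightarrow> real) \<Rightarrow> bool" where
  "smooth_fun A V f \<longleftrightarrow> (\<forall>c\<in>A. smooth_on (snd c ` (V \<inter> fst c)) (f \<circ> chart_inv c))"


section \<open>Tensor fields and connections\<close>

text \<open>A tensor field on an open set \<open>V\<close> is given by its components in each chart (as functions of
  the coordinates), subject to the classical transformation law. A \<open>(1,1)\<close>-tensor
  \<open>T \<partial>\<^sub>i = T\<^sub>i\<^sup>k \<partial>\<^sub>k\<close> has the matrix with entry \<open>$ k $ i\<close> equal to \<open>T\<^sub>i\<^sup>k\<close>, so that it acts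
  on component vectors by \<open>*v\<close>; a \<open>(0,2)\<close>-tensor has entry \<open>$ i $ j\<close> equal to
  \<open>\<Phi>(\<partial>\<^sub>i, \<partial>\<^sub>j)\<close>.\<close>

type_synonym ('a, 'n, 'b) field = "('a, 'n) chart \<Rightarrow> real^'n \<Rightarrow> 'b"

definition vector_field ::
  "('a, 'n::finite) chart set \<Rightarrow> 'a set \<Rightarrow> ('a, 'n, real^'n) field \<Rightarrow> bool" where
  "vector_field A V X \<longleftrightarrow>
     (\<forall>c\<in>A. smooth_on (snd c ` (V \<inter> fst c)) (X c)) \<and>
     (\<forall>c\<in>A. \<forall>c'\<in>A. \<forall>p\<in>V \<inter> fst c \<inter> fst c'.
        X c' (snd c' p) = jac c c' p *v X c (snd c p))"

definition one_form ::
  "('a, 'n::finite) chart set \<Rightarrow> 'a set \<Rightarrow> ('a, 'n, real^'n) field \<Rightarrow> bool" where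
  "one_form A V \<omega> \<longleftrightarrow>
     (\<forall>c\<in>A. smooth_on (snd c ` (V \<inter> fst c)) (\<omega> c)) \<and>
     (\<forall>c\<in>A. \<forall>c'\<in>A. \<forall>p\<in>V \<inter> fst c \<inter> fst c'.
        \<omega> c (snd c p) = transpose (jac c c' p) *v \<omega> c' (snd c' p))"

definition tensor11 ::
  "('a, 'n::finite) chart set \<Rightarrow> 'a set \<Rightarrow> ('a, 'n, real^'n^'n) field \<Rightarrow> bool" where
  "tensor11 A V T \<longleftrightarrow>
     (\<forall>c\<in>A. smooth_on (snd c ` (V \<inter> fst c)) (T c)) \<and>
     (\<forall>c\<in>A. \<forall>c'\<in>A. \<forall>p\<in>V \<inter> fst c \<inter> fst c'.
        T c' (snd c' p) ** jac c c' p = jac c c' p ** T c (snd c p))"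

definition tensor02 ::
  "('a, 'n::finite) chart set \<Rightarrow> 'a set \<Rightarrow> ('a, 'n, real^'n^'n) field \<Rightarrow> bool" where
  "tensor02 A V \<Phi> \<longleftrightarrow>
     (\<forall>c\<in>A. smooth_on (snd c ` (V \<inter> fst c)) (\<Phi> c)) \<and>
     (\<forall>c\<in>A. \<forall>c'\<in>A. \<forall>p\<in>V \<inter> fst c \<inter> fst c'.
        \<Phi> c (snd c p) = transpose (jac c c' p) ** \<Phi> c' (snd c' p) ** jac c c' p)"

definition symmetric_tensor02 ::
  "('a, 'n::finite) chart set \<Rightarrow> 'a set \<Rightarrow> ('a, 'n, real^'n^'n) field \<Rightarrow> bool" where
  "symmetric_tensor02 A V \<Phi> \<longleftrightarrow> tensor02 A V \<Phi> \<and>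
     (\<forall>c\<in>A. \<forall>p\<in>V \<inter> fst c. transpose (\<Phi> c (snd c p)) = \<Phi> c (snd c p))"

text \<open>Christoffel symbols: \<open>\<Gamma> x i j k\<close> is \<open>\<Gamma>\<^sub>i\<^sub>j\<^sup>k\<close> at \<open>x\<close>, where
  \<open>D\<^bsub>\<partial>\<^sub>i\<^esub> \<partial>\<^sub>j = \<Gamma>\<^sub>i\<^sub>j\<^sup>k \<partial>\<^sub>k\<close>.\<close>

type_synonym 'n christoffel = "real^'n \<Rightarrow> 'n \<Rightarrow> 'n \<Rightarrow> 'n \<Rightarrow> real"

definition affine_connection ::
  "('a, 'n::finite) chart set \<Rightarrow> (('a, 'n) chart \<Rightarrow> 'n christoffel) \<Rightarrow> bool" where
  "affine_connection A D \<longleftrightarrow>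
     (\<forall>c\<in>A. \<forall>i j k. smooth_on (snd c ` fst c) (\<lambda>x. D c x i j k)) \<and>
     (\<forall>c\<in>A. \<forall>c'\<in>A. \<forall>p\<in>fst c \<inter> fst c'. \<forall>i j k.
        (\<Sum>l\<in>UNIV. jac c c' p $ k $ l * D c (snd c p) i j l) =
          pd i (pd j (transition c c')) (snd c p) $ k +
          (\<Sum>a\<in>UNIV. \<Sum>b\<in>UNIV.
             jac c c' p $ a $ i * jac c c' p $ b $ j * D c' (snd c' p) a b k))"

definition torsion_free ::
  "('a, 'n::finite) chart set \<Rightarrow> (('a, 'n) chart \<Rightarrow> 'n christoffel) \<Rightarrow> bool" where
  "torsion_free A D \<longleftrightarrow>
     (\<forall>c\<in>A. \<forall>x\<in>snd c ` fst c. \<forall>i j k. D c x i j k = D c x j i k)"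


section \<open>Local tensor calculus in a coordinate domain\<close>

definition coord_field :: "'n::finite \<Rightarrow> real^'n \<Rightarrow> real^'n" where
  "coord_field i = (\<lambda>_. axis i 1)"

definition dir_deriv :: "(real^'n::finite \<Rightarrow> real^'n) \<Rightarrow> (real^'n \<Rightarrow> real) \<Rightarrow> real^'n \<Rightarrow> real" where
  "dir_deriv X f x = (\<Sum>i\<in>UNIV. X x $ i * pd i f x)"

definition lie_bracket ::
  "(real^'n::finite \<Rightarrow> real^'n) \<Rightarrow> (real^'n \<Rightarrow> real^'n) \<Rightarrow> real^'n \<Rightarrow> real^'n" where
  "lie_bracket X Y x = (\<Sum>i\<in>UNIV. X x $ i *\<^sub>R pd i Y x - Y x $ i *\<^sub>R pd i X x)"

definition cov ::
  "'n::finite christoffel \<Rightarrow> (real^'n \<Rightarrow> real^'n) \<Rightarrow> (real^'n \<Rightarrow> real^'n) \<Rightarrow> real^'n \<Rightarrow> real^'n" where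
  "cov \<Gamma> X Y x =
     (\<chi> k. \<Sum>i\<in>UNIV. X x $ i * (pd i Y x $ k + (\<Sum>j\<in>UNIV. \<Gamma> x i j k * Y x $ j)))"

definition curvature ::
  "'n::finite christoffel \<Rightarrow> (real^'n \<Rightarrow> real^'n) \<Rightarrow> (real^'n \<Rightarrow> real^'n) \<Rightarrow>
     (real^'n \<Rightarrow> real^'n) \<Rightarrow> real^'n \<Rightarrow> real^'n" where
  "curvature \<Gamma> X Y Z x =
     cov \<Gamma> X (cov \<Gamma> Y Z) x - cov \<Gamma> Y (cov \<Gamma> X Z) x - cov \<Gamma> (lie_bracket X Y) Z x"

text \<open>\<open>\<rho>(X,Y)\<close> is the trace of \<open>Z \<mapsto> R(Z,X)Y\<close>.\<close>

definition ricci :: "'n::finite christoffel \<Rightarrow> real^'n \<Rightarrow> real^'n^'n" where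
  "ricci \<Gamma> x = (\<chi> i j. \<Sum>k\<in>UNIV.
     curvature \<Gamma> (coord_field k) (coord_field i) (coord_field j) x $ k)"

definition ricci_sym :: "'n::finite christoffel \<Rightarrow> real^'n \<Rightarrow> real^'n^'n" where
  "ricci_sym \<Gamma> x = (1/2) *\<^sub>R (ricci \<Gamma> x + transpose (ricci \<Gamma> x))"

definition hessian :: "'n::finite christoffel \<Rightarrow> (real^'n \<Rightarrow> real) \<Rightarrow> real^'n \<Rightarrow> real^'n^'n" where
  "hessian \<Gamma> f x = (\<chi> i j. pd i (pd j f) x - (\<Sum>k\<in>UNIV. \<Gamma> x i j k * pd k f x))"

definition trace_cov :: "'n::finite christoffel \<Rightarrow> (real^'n \<Rightarrow> real^'n) \<Rightarrow> real^'n \<Rightarrow> real" where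
  "trace_cov \<Gamma> X x = (\<Sum>i\<in>UNIV. cov \<Gamma> (coord_field i) X x $ i)"

text \<open>\<open>(D\<^bsub>\<partial>\<^sub>l\<^esub> \<Phi>)(\<partial>\<^sub>i, \<partial>\<^sub>j)\<close> and \<open>(D\<^bsub>\<partial>\<^sub>i\<^esub> T) \<partial>\<^sub>j\<close>:\<close>

definition cov02 ::
  "'n::finite christoffel \<Rightarrow> (real^'n \<Rightarrow> real^'n^'n) \<Rightarrow> 'n \<Rightarrow> real^'n \<Rightarrow> real^'n^'n" where
  "cov02 \<Gamma> \<Phi> l x = (\<chi> i j. pd l (\<lambda>y. \<Phi> y $ i $ j) x
     - (\<Sum>m\<in>UNIV. \<Gamma> x l i m * \<Phi> x $ m $ j) - (\<Sum>m\<in>UNIV. \<Gamma> x l j m * \<Phi> x $ i $ m))"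

definition cov11 ::
  "'n::finite christoffel \<Rightarrow> (real^'n \<Rightarrow> real^'n^'n) \<Rightarrow> 'n \<Rightarrow> 'n \<Rightarrow> real^'n \<Rightarrow> real^'n" where
  "cov11 \<Gamma> T i j x =
     cov \<Gamma> (coord_field i) (\<lambda>y. T y *v coord_field j y) x
       - T x *v cov \<Gamma> (coord_field i) (coord_field j) x"

definition bilin :: "real^'n^'n::finite \<Rightarrow> real^'n \<Rightarrow> real^'n \<Rightarrow> real" where
  "bilin \<Phi> v w = v \<bullet> (\<Phi> *v w)"

text \<open>\<open>hat T \<Phi>\<close> is the matrix of \<open>(X,Y) \<mapsto> \<Phi>(TX,TY)\<close>.\<close>

definition hat :: "real^'n^'n::finite \<Rightarrow> real^'n^'n \<Rightarrow> real^'n^'n" where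
  "hat T \<Phi> = transpose T ** \<Phi> ** T"


section \<open>Pseudo-Riemannian metrics in a coordinate domain\<close>

definition levi_civita :: "(real^'n \<Rightarrow> real^'n^'n::finite) \<Rightarrow> 'n christoffel" where
  "levi_civita g x i j k = (\<Sum>l\<in>UNIV. (1/2) * matrix_inv (g x) $ k $ l *
     (pd i (\<lambda>y. g y $ j $ l) x + pd j (\<lambda>y. g y $ i $ l) x - pd l (\<lambda>y. g y $ i $ j) x))"

definition metric_trace :: "real^'n^'n::finite \<Rightarrow> real^'n^'n \<Rightarrow> real" where
  "metric_trace G B = (\<Sum>i\<in>UNIV. \<Sum>j\<in>UNIV. matrix_inv G $ i $ j * B $ i $ j)"

definition scalar_curvature :: "(real^'n \<Rightarrow> real^'n^'n::finite) \<Rightarrow> real^'n \<Rightarrow> real" where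
  "scalar_curvature g x = metric_trace (g x) (ricci (levi_civita g) x)"

definition laplacian ::
  "(real^'n \<Rightarrow> real^'n^'n::finite) \<Rightarrow> (real^'n \<Rightarrow> real) \<Rightarrow> real^'n \<Rightarrow> real" where
  "laplacian g f x = metric_trace (g x) (hessian (levi_civita g) f x)"

definition einstein_at :: "(real^'n \<Rightarrow> real^'n^'n::finite) \<Rightarrow> real^'n \<Rightarrow> bool" where
  "einstein_at g x \<longleftrightarrow>
     ricci (levi_civita g) x = (scalar_curvature g x / real CARD('n)) *\<^sub>R g x"

text \<open>The coefficient \<open>1/4\<close> belongs to metrics in dimension four, the only case of interest.\<close>

definition conf_einstein_eq_at ::
  "(real^'n \<Rightarrow> real^'n^'n::finite) \<Rightarrow> (real^'n \<Rightarrow> real) \<Rightarrow> real^'n \<Rightarrow> bool" where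
  "conf_einstein_eq_at g f x \<longleftrightarrow>
     2 *\<^sub>R hessian (levi_civita g) f x + f x *\<^sub>R ricci (levi_civita g) x
       - ((1/4) * (2 * laplacian g f x + f x * scalar_curvature g x)) *\<^sub>R g x = 0"


section \<open>The cotangent bundle\<close>

text \<open>A covector at \<open>p\<close> is given by its components in the charts around \<open>p\<close>; it is set to \<open>0\<close> on
  all other pairs, so that covectors are determined by their components.\<close>

type_synonym ('a, 'n) covec = "('a, 'n) chart \<Rightarrow> real^'n"

definition covector_at :: "('a, 'n::finite) chart set \<Rightarrow> 'a \<Rightarrow> ('a, 'n) covec \<Rightarrow> bool" where
  "covector_at A p \<alpha> \<longleftrightarrow>
     (\<forall>c. \<not> (c \<in> A \<and> p \<in> fst c) \<longrightarrow> \<alpha> c = 0) \<and>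
     (\<forall>c\<in>A. \<forall>c'\<in>A. p \<in> fst c \<inter> fst c' \<longrightarrow> \<alpha> c = transpose (jac c c' p) *v \<alpha> c')"

definition cotangent :: "('a, 'n::finite) chart set \<Rightarrow> ('a \<times> ('a, 'n) covec) set" where
  "cotangent A = {(p, \<alpha>). p \<in> (\<Union>c\<in>A. fst c) \<and> covector_at A p \<alpha>}"

text \<open>Induced coordinates are indexed by \<open>'n + 'n\<close>: \<open>Inl i\<close> stands for \<open>x\<^sup>i\<close> and \<open>Inr i\<close> for the
  fibre coordinate \<open>x\<^bsub>i'\<^esub>\<close>.\<close>

definition cot_chart ::
  "('a, 'n::finite) chart set \<Rightarrow> ('a, 'n) chart \<Rightarrow> ('a \<times> ('a, 'n) covec, 'n + 'n) chart" where
  "cot_chart A c =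
     ({\<xi> \<in> cotangent A. fst \<xi> \<in> fst c},
      \<lambda>\<xi>. \<chi> s. case s of Inl i \<Rightarrow> snd c (fst \<xi>) $ i | Inr i \<Rightarrow> snd \<xi> c $ i)"

definition cot_img ::
  "('a, 'n::finite) chart set \<Rightarrow> ('a, 'n) chart \<Rightarrow> ('a \<times> ('a, 'n) covec) set \<Rightarrow> (real^('n + 'n)) set"
  where
  "cot_img A c U = snd (cot_chart A c) ` (U \<inter> fst (cot_chart A c))"

definition cot_open ::
  "('a, 'n::finite) chart set \<Rightarrow> ('a \<times> ('a, 'n) covec) set \<Rightarrow> bool" where
  "cot_open A U \<longleftrightarrow> U \<subseteq> cotangent A \<and> (\<forall>c\<in>A. open (cot_img A c U))"

definition cot_smooth ::
  "('a, 'n::finite) chart set \<Rightarrow> ('a \<times> ('a, 'n) covec) set \<Rightarrow> ('a \<times> ('a, 'n) covec \<Rightarrow> real) \<Rightarrow> bool"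
  where
  "cot_smooth A U \<phi> \<longleftrightarrow> smooth_fun (cot_chart A ` A) U \<phi>"

text \<open>The evaluation \<open>\<iota>X\<close>; it does not depend on the chart that is chosen.\<close>

definition iota ::
  "('a, 'n::finite) chart set \<Rightarrow> ('a, 'n, real^'n) field \<Rightarrow> 'a \<times> ('a, 'n) covec \<Rightarrow> real" where
  "iota A X \<xi> = (let c = (SOME c. c \<in> A \<and> fst \<xi> \<in> fst c) in snd \<xi> c \<bullet> X c (snd c (fst \<xi>)))"


section \<open>Modified Riemannian extensions\<close>

definition base :: "real^('n + 'n) \<Rightarrow> real^'n::finite" where
  "base y = (\<chi> i. y $ Inl i)"

definition fibre :: "real^('n + 'n) \<Rightarrow> real^'n::finite" where
  "fibre y = (\<chi> i. y $ Inr i)"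

definition sym_prod :: "real^'m \<Rightarrow> real^'m \<Rightarrow> real^'m^'m::finite" where
  "sym_prod \<theta> \<eta> = (\<chi> a b. (1/2) * (\<theta> $ a * \<eta> $ b + \<eta> $ a * \<theta> $ b))"

text \<open>In induced coordinates, \<open>\<iota>T = x\<^bsub>r'\<^esub> T\<^sub>i\<^sup>r dx\<^sup>i\<close> and
  \<open>g\<^sub>D = 2 dx\<^sup>i \<circ> dx\<^bsub>i'\<^esub> - 2 x\<^bsub>k'\<^esub> \<Gamma>\<^sub>i\<^sub>j\<^sup>k dx\<^sup>i \<circ> dx\<^sup>j\<close>. Their characterizations
  through complete lifts are checked below.\<close>

definition iota_tensor ::
  "(real^'n \<Rightarrow> real^'n^'n) \<Rightarrow> real^('n + 'n) \<Rightarrow> real^('n + 'n::finite)" where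
  "iota_tensor T y = (\<chi> s. case s of
      Inl i \<Rightarrow> \<Sum>r\<in>UNIV. fibre y $ r * T (base y) $ r $ i
    | Inr _ \<Rightarrow> 0)"

definition riem_ext ::
  "'n::finite christoffel \<Rightarrow> real^('n + 'n) \<Rightarrow> real^('n + 'n)^('n + 'n)" where
  "riem_ext \<Gamma> y = (\<chi> s t. case (s, t) of
      (Inl i, Inl j) \<Rightarrow> - 2 * (\<Sum>k\<in>UNIV. fibre y $ k * \<Gamma> (base y) i j k)
    | (Inl i, Inr j) \<Rightarrow> (if i = j then 1 else 0)
    | (Inr i, Inl j) \<Rightarrow> (if i = j then 1 else 0)
    | (Inr _, Inr _) \<Rightarrow> 0)"

definition pullback02 ::
  "(real^'n \<Rightarrow> real^'n^'n) \<Rightarrow> real^('n + 'n) \<Rightarrow> real^('n + 'n)^('n + 'n::finite)" where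
  "pullback02 \<Phi> y = (\<chi> s t. case (s, t) of
      (Inl i, Inl j) \<Rightarrow> \<Phi> (base y) $ i $ j
    | _ \<Rightarrow> 0)"

text \<open>The components of \<open>g\<^bsub>D,\<Phi>,T\<^esub>\<close> in the coordinates induced by a chart of the base.\<close>

definition mod_riem_ext ::
  "(('a, 'n::finite) chart \<Rightarrow> 'n christoffel) \<Rightarrow> ('a, 'n, real^'n^'n) field \<Rightarrow>
     ('a, 'n, real^'n^'n) field \<Rightarrow> ('a, 'n) chart \<Rightarrow>
     real^('n + 'n) \<Rightarrow> real^('n + 'n)^('n + 'n)" where
  "mod_riem_ext D \<Phi> T c y =
     sym_prod (iota_tensor (T c) y) (iota_tensor (T c) y)
       + riem_ext (D c) y + pullback02 (\<Phi> c) y"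


section \<open>The conformally Einstein equation on the cotangent bundle\<close>

text \<open>Here \<open>g c\<close> gives the components of a metric on the cotangent bundle in the coordinates
  induced by \<open>c\<close>.\<close>

definition conf_einstein_solution ::
  "('a, 'n::finite) chart set \<Rightarrow>
     (('a, 'n) chart \<Rightarrow> real^('n + 'n) \<Rightarrow> real^('n + 'n)^('n + 'n)) \<Rightarrow>
     ('a \<times> ('a, 'n) covec) set \<Rightarrow> ('a \<times> ('a, 'n) covec \<Rightarrow> real) \<Rightarrow> bool" where
  "conf_einstein_solution A g U \<phi> \<longleftrightarrow>
     cot_smooth A U \<phi> \<and>
     (\<forall>c\<in>A. \<forall>y\<in>cot_img A c U. conf_einstein_eq_at (g c) (\<phi> \<circ> chart_inv (cot_chart A c)) y)"

definition conformally_einstein ::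
  "('a, 'n::finite) chart set \<Rightarrow>
     (('a, 'n) chart \<Rightarrow> real^('n + 'n) \<Rightarrow> real^('n + 'n)^('n + 'n)) \<Rightarrow> bool" where
  "conformally_einstein A g \<longleftrightarrow>
     (\<forall>\<xi>\<in>cotangent A. \<exists>U \<phi>. cot_open A U \<and> \<xi> \<in> U \<and> cot_smooth A U \<phi> \<and> (\<forall>\<eta>\<in>U. \<phi> \<eta> > 0) \<and>
        (\<forall>c\<in>A. \<forall>y\<in>cot_img A c U.
           einstein_at (\<lambda>z. (1 / (\<phi> (chart_inv (cot_chart A c) z))^2) *\<^sub>R g c z) y))"


section \<open>Affine surfaces with a parallel nilpotent tensor field\<close>

text \<open>For a disconnected surface, \<open>T\<close> being non-zero means that it does not vanish identically on
  any component.\<close>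

definition parallel_nilpotent_surface ::
  "'a topology \<Rightarrow> ('a, 2) chart set \<Rightarrow> (('a, 2) chart \<Rightarrow> 2 christoffel) \<Rightarrow>
     ('a, 2, real^2^2) field \<Rightarrow> bool" where
  "parallel_nilpotent_surface M A D T \<longleftrightarrow>
     smooth_manifold M A \<and> affine_connection A D \<and> torsion_free A D \<and>
     tensor11 A (topspace M) T \<and>
     (\<forall>c\<in>A. \<forall>x\<in>snd c ` fst c. \<forall>i j. cov11 (D c) (T c) i j x = 0) \<and>
     (\<forall>c\<in>A. \<forall>x\<in>snd c ` fst c. T c x ** T c x = 0) \<and>
     (\<forall>p\<in>topspace M. \<exists>q\<in>connected_component_of_set M p. \<exists>c\<in>A. q \<in> fst c \<and> T c (snd c q) \<noteq> 0)"

text \<open>Vector fields \<open>X\<close> on \<open>V\<close> with \<open>X \<in> ker T\<close> and \<open>tr(DX) = 0\<close>.\<close>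

definition kernel_div_free ::
  "('a, 'n::finite) chart set \<Rightarrow> (('a, 'n) chart \<Rightarrow> 'n christoffel) \<Rightarrow> ('a, 'n, real^'n^'n) field \<Rightarrow>
     'a set \<Rightarrow> ('a, 'n, real^'n) field \<Rightarrow> bool" where
  "kernel_div_free A D T V X \<longleftrightarrow>
     vector_field A V X \<and>
     (\<forall>c\<in>A. \<forall>x\<in>snd c ` (V \<inter> fst c). T c x *v X c x = 0 \<and> trace_cov (D c) (X c) x = 0)"

definition non_zero_field ::
  "('a, 'n::finite) chart set \<Rightarrow> 'a set \<Rightarrow> ('a, 'n, real^'n) field \<Rightarrow> bool" where
  "non_zero_field A V X \<longleftrightarrow> (\<exists>c\<in>A. \<exists>x\<in>snd c ` (V \<inter> fst c). X c x \<noteq> 0)"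

text \<open>\<open>d\<phi>(ker T) = 0\<close> on \<open>V\<close>.\<close>

definition kills_kernel ::
  "('a, 'n::finite) chart set \<Rightarrow> ('a, 'n, real^'n^'n) field \<Rightarrow> 'a set \<Rightarrow> ('a \<Rightarrow> real) \<Rightarrow> bool" where
  "kills_kernel A T V \<phi> \<longleftrightarrow>
     (\<forall>c\<in>A. \<forall>x\<in>snd c ` (V \<inter> fst c). \<forall>v. T c x *v v = 0 \<longrightarrow>
        dir_deriv (\<lambda>_. v) (\<phi> \<circ> chart_inv c) x = 0)"

definition recurrent_on ::
  "('a, 'n::finite) chart set \<Rightarrow> (('a, 'n) chart \<Rightarrow> 'n christoffel) \<Rightarrow>
     ('a, 'n, real^'n^'n) field \<Rightarrow> 'a set \<Rightarrow> bool" where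
  "recurrent_on A D \<Phi> V \<longleftrightarrow>
     (\<exists>\<omega>. one_form A V \<omega> \<and>
        (\<forall>c\<in>A. \<forall>x\<in>snd c ` (V \<inter> fst c). \<forall>l. cov02 (D c) (\<Phi> c) l x = \<omega> c x $ l *\<^sub>R \<Phi> c x))"

text \<open>Coordinates on a surface in which the only Christoffel symbol that may be non-zero is
  \<open>\<Gamma>\<^sub>1\<^sub>1\<^sup>2\<close>, and \<open>T \<partial>\<^sub>1 = \<partial>\<^sub>2\<close>, \<open>T \<partial>\<^sub>2 = 0\<close>.\<close>

definition adapted_coordinates ::
  "(('a, 2) chart \<Rightarrow> 2 christoffel) \<Rightarrow> ('a, 2, real^2^2) field \<Rightarrow> ('a, 2) chart \<Rightarrow> bool" where
  "adapted_coordinates D T u \<longleftrightarrow>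
     (\<forall>x\<in>snd u ` fst u.
        (\<forall>i j k. (i, j, k) \<noteq> (1, 1, 2) \<longrightarrow> D u x i j k = 0) \<and>
        T u x *v axis 1 1 = axis 2 1 \<and> T u x *v axis 2 1 = 0)"


section \<open>Complete lifts\<close>

text \<open>The coordinate expressions above agree with the characterizations
  \<open>X\<^sup>C(\<iota>Z) = \<iota>[X,Z]\<close>, \<open>\<iota>T(X\<^sup>C) = \<iota>(TX)\<close> and
  \<open>g\<^sub>D(X\<^sup>C,Y\<^sup>C) = -\<iota>(D\<^sub>XY + D\<^sub>YX)\<close>. Nothing below is needed for the definitions.\<close>

definition complete_lift ::
  "(real^'n \<Rightarrow> real^'n) \<Rightarrow> real^('n + 'n) \<Rightarrow> real^('n + 'n::finite)" where
  "complete_lift X y = (\<chi> s. case s of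
      Inl i \<Rightarrow> X (base y) $ i
    | Inr i \<Rightarrow> - (\<Sum>k\<in>UNIV. fibre y $ k * pd i X (base y) $ k))"

lemma sum_UNIV_Plus:
  fixes h :: "'n::finite + 'n \<Rightarrow> real"
  shows "(\<Sum>s\<in>UNIV. h s) = (\<Sum>i\<in>UNIV. h (Inl i)) + (\<Sum>i\<in>UNIV. h (Inr i))"
  by (simp add: UNIV_Plus_UNIV[symmetric] sum.Plus del: UNIV_Plus_UNIV)

lemma base_axis: "base (axis (Inl i) 1) = axis i 1" "base (axis (Inr i) 1) = 0"
  and fibre_axis: "fibre (axis (Inl i) 1) = 0" "fibre (axis (Inr i) 1) = axis i 1"
  by (auto simp: base_def fibre_def axis_def vec_eq_iff)

lemma pd_evaluation:
  fixes Z :: "real^'n \<Rightarrow> real^'n::finite"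
  assumes "Z differentiable (at (base y))"
  shows "pd (Inl i) (\<lambda>y. fibre y \<bullet> Z (base y)) y = fibre y \<bullet> pd i Z (base y)"
    and "pd (Inr i) (\<lambda>y. fibre y \<bullet> Z (base y)) y = Z (base y) $ i"
proof -
  have lin: "linear (base :: real^('n + 'n) \<Rightarrow> real^'n)" "linear (fibre :: real^('n + 'n) \<Rightarrow> real^'n)"
    by (auto intro!: linearI simp: base_def fibre_def vec_eq_iff)
  then have db: "(base has_derivative base) (at y)" and df: "(fibre has_derivative fibre) (at y)"
    by (simp_all add: linear_imp_has_derivative)
  have dZ: "(Z has_derivative frechet_derivative Z (at (base y))) (at (base y))"
    using assms by (simp add: frechet_derivative_works)
  have "((\<lambda>y. Z (base y)) has_derivative (\<lambda>h. frechet_derivative Z (at (base y)) (base h))) (at y)"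
    using has_derivative_compose[OF db dZ] .
  from has_derivative_inner[OF df this]
  have "((\<lambda>y. fibre y \<bullet> Z (base y)) has_derivative
      (\<lambda>h. fibre y \<bullet> frechet_derivative Z (at (base y)) (base h) + fibre h \<bullet> Z (base y))) (at y)" .
  then have *: "frechet_derivative (\<lambda>y. fibre y \<bullet> Z (base y)) (at y) =
      (\<lambda>h. fibre y \<bullet> frechet_derivative Z (at (base y)) (base h) + fibre h \<bullet> Z (base y))"
    by (rule frechet_derivative_at[symmetric])
  have "frechet_derivative Z (at (base y)) 0 = 0"
    using dZ by (metis has_derivative_linear linear_0)
  then show "pd (Inl i) (\<lambda>y. fibre y \<bullet> Z (base y)) y = fibre y \<bullet> pd i Z (base y)"
    and "pd (Inr i) (\<lambda>y. fibre y \<bullet> Z (base y)) y = Z (base y) $ i"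
    by (simp_all add: pd_def * base_axis fibre_axis inner_axis' )
qed

lemma complete_lift_evaluation:
  fixes X Z :: "real^'n \<Rightarrow> real^'n::finite"
  assumes "Z differentiable (at (base y))"
  shows "(\<Sum>s\<in>UNIV. complete_lift X y $ s * pd s (\<lambda>y. fibre y \<bullet> Z (base y)) y) =
    fibre y \<bullet> lie_bracket X Z (base y)"
  by (simp add: sum_UNIV_Plus pd_evaluation[OF assms] complete_lift_def lie_bracket_def
      inner_sum_right inner_diff_right sum_subtractf sum_negf inner_vec_def[of "fibre y"] mult.commute)

lemma iota_tensor_complete_lift:
  fixes X :: "real^'n \<Rightarrow> real^'n::finite"
  shows "iota_tensor T y \<bullet> complete_lift X y = fibre y \<bullet> (T (base y) *v X (base y))"
proof -
  have "iota_tensor T y \<bullet> complete_lift X y =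
      (\<Sum>i\<in>UNIV. \<Sum>r\<in>UNIV. fibre y $ r * T (base y) $ r $ i * X (base y) $ i)"
    by (simp add: inner_vec_def sum_UNIV_Plus iota_tensor_def complete_lift_def sum_distrib_right)
  also have "\<dots> = fibre y \<bullet> (T (base y) *v X (base y))"
    by (subst sum.swap)
      (simp add: inner_vec_def matrix_vector_mult_def sum_distrib_left mult.assoc)
  finally show ?thesis .
qed

lemma riem_ext_complete_lift:
  fixes X Y :: "real^'n \<Rightarrow> real^'n::finite"
  assumes tf: "\<And>i j k. \<Gamma> (base y) i j k = \<Gamma> (base y) j i k"
  shows "bilin (riem_ext \<Gamma> y) (complete_lift X y) (complete_lift Y y) =
    - (fibre y \<bullet> (cov \<Gamma> X Y (base y) + cov \<Gamma> Y X (base y)))"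
proof -
  let ?p = "\<lambda>k. fibre y $ k" and ?X = "\<lambda>i. X (base y) $ i" and ?Y = "\<lambda>i. Y (base y) $ i"
  let ?dX = "\<lambda>i k. pd i X (base y) $ k" and ?dY = "\<lambda>i k. pd i Y (base y) $ k"
  let ?S = "\<Sum>i\<in>UNIV. \<Sum>j\<in>UNIV. \<Sum>k\<in>UNIV. ?X i * ?Y j * ?p k * \<Gamma> (base y) i j k"
  have inl: "(riem_ext \<Gamma> y *v complete_lift Y y) $ Inl i =
      - 2 * (\<Sum>j\<in>UNIV. \<Sum>k\<in>UNIV. ?Y j * ?p k * \<Gamma> (base y) i j k) - (\<Sum>k\<in>UNIV. ?p k * ?dY i k)" for i
    by (simp add: matrix_vector_mult_def sum_UNIV_Plus riem_ext_def complete_lift_def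
        sum_distrib_left sum_distrib_right sum_negf if_distrib if_distribR sum.delta' mult_ac
        cong: if_cong) (subst sum.swap, simp)
  have inr: "(riem_ext \<Gamma> y *v complete_lift Y y) $ Inr i = ?Y i" for i
    by (simp add: matrix_vector_mult_def sum_UNIV_Plus riem_ext_def complete_lift_def
        if_distrib if_distribR sum.delta' cong: if_cong)
  have L: "bilin (riem_ext \<Gamma> y) (complete_lift X y) (complete_lift Y y) =
      - 2 * ?S - (\<Sum>i\<in>UNIV. \<Sum>k\<in>UNIV. ?X i * ?p k * ?dY i k)
      - (\<Sum>i\<in>UNIV. \<Sum>k\<in>UNIV. ?Y i * ?p k * ?dX i k)"
    by (simp add: bilin_def inner_vec_def sum_UNIV_Plus inl inr)
      (simp add: complete_lift_def algebra_simps sum_subtractf sum_negf sum_distrib_left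
        sum_distrib_right)
  have cov: "fibre y \<bullet> cov \<Gamma> X' Y' (base y) =
      (\<Sum>i\<in>UNIV. \<Sum>k\<in>UNIV. X' (base y) $ i * ?p k * pd i Y' (base y) $ k) +
      (\<Sum>i\<in>UNIV. \<Sum>j\<in>UNIV. \<Sum>k\<in>UNIV. X' (base y) $ i * Y' (base y) $ j * ?p k * \<Gamma> (base y) i j k)"
    for X' Y' :: "real^'n \<Rightarrow> real^'n"
  proof -
    have "fibre y \<bullet> cov \<Gamma> X' Y' (base y) =
      (\<Sum>k\<in>UNIV. \<Sum>i\<in>UNIV. X' (base y) $ i * ?p k * pd i Y' (base y) $ k +
         (\<Sum>j\<in>UNIV. X' (base y) $ i * Y' (base y) $ j * ?p k * \<Gamma> (base y) i j k))"
      by (simp add: inner_vec_def cov_def sum_distrib_left distrib_left mult_ac)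
    also have "\<dots> = (\<Sum>i\<in>UNIV. \<Sum>k\<in>UNIV. X' (base y) $ i * ?p k * pd i Y' (base y) $ k +
         (\<Sum>j\<in>UNIV. X' (base y) $ i * Y' (base y) $ j * ?p k * \<Gamma> (base y) i j k))"
      by (rule sum.swap)
    also have "\<dots> = (\<Sum>i\<in>UNIV. \<Sum>k\<in>UNIV. X' (base y) $ i * ?p k * pd i Y' (base y) $ k) +
      (\<Sum>i\<in>UNIV. \<Sum>k\<in>UNIV. \<Sum>j\<in>UNIV. X' (base y) $ i * Y' (base y) $ j * ?p k * \<Gamma> (base y) i j k)"
      by (simp add: sum.distrib)
    also have "(\<Sum>i\<in>UNIV. \<Sum>k\<in>UNIV. \<Sum>j\<in>UNIV. X' (base y) $ i * Y' (base y) $ j * ?p k * \<Gamma> (base y) i j k) =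
      (\<Sum>i\<in>UNIV. \<Sum>j\<in>UNIV. \<Sum>k\<in>UNIV. X' (base y) $ i * Y' (base y) $ j * ?p k * \<Gamma> (base y) i j k)"
      by (intro sum.cong refl sum.swap)
    finally show ?thesis .
  qed
  have S: "(\<Sum>i\<in>UNIV. \<Sum>j\<in>UNIV. \<Sum>k\<in>UNIV. ?Y i * ?X j * ?p k * \<Gamma> (base y) i j k) = ?S"
    by (subst sum.swap) (simp add: tf mult_ac)
  show ?thesis
    unfolding L inner_add_right cov S by simp
qed

end

theory Submission
  imports Defs
begin

text \<open>In induced coordinates the metric is a Walker metric whose scalar curvature vanishes and whose
  Ricci tensor is the pullback of \<open>2 \<rho>\<^sub>s\<^sub>y\<^sub>m + \<Phi>(T\<cdot>, T\<cdot>)\<close>; by the conformal change formula the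
  conformal metric is Einstein if and only if \<open>\<phi>\<close> solves the linear equation. Its fibre components
  make \<open>\<phi>\<close> affine along the fibres, \<open>\<phi> = \<iota>X + f\<close>, and its mixed components force \<open>T X = 0\<close> and
  \<open>D X = 0\<close>. If \<open>X\<close> is not zero, it has no zeros on a connected domain, \<open>T = \<theta> \<otimes> X\<close> with \<open>\<theta>\<close>
  parallel, hence closed, and integrating \<open>\<theta>\<close> leads to the adapted coordinates, in which everything
  is explicit. The equation is polynomial in the fibre coordinates, so \<open>\<iota>X + f\<close> solves it on whole
  fibres, and a solution with the same fibre part differs from it by a function on the surface.\<close>

section \<open>Partial derivatives and smooth functions\<close>

text \<open>The equation is stated chart by chart, and the Levi-Civita connection of the
  four-dimensional metric is never transformed between induced charts. This shapes case (ii), where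
  an equation verified in an adapted chart has to hold in all others. Subtracting a multiple of the
  given solution leaves a function f on the surface, whose equations, df o T = 0 and 2 Hes f + f (2
  \<open>ricci_sym\<close> + hat \<Phi>) = 0, are tensorial in dimension two. The set on which a new
  function is tested may miss the domain of the given solution although both lie over the same
  points of the surface; polynomial dependence on the fibre closes that gap. T X = 0 and D X = 0
  have one source: the mixed block of the Hessian must be a multiple of the identity, and it is
  affine in the fibre coordinates. Its linear coefficients are products of T with T X, trace free
  because T squares to zero; its constant term is D X, a multiple of the identity that T
  annihilates. Hence tr(D X) = 0 is the trace of a stronger fact. X and T solve linear first order
  systems, which makes their zero sets open as well as closed.\<close>

lemma pd_eqI: "(f has_derivative f') (at x) \<Longrightarrow> pd i f x = f' (axis i 1)"
  unfolding pd_def by (simp add: frechet_derivative_at[symmetric])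

text \<open>\<open>frechet_derivative\<close> is a choice among all derivatives at the point, and
  functions that agree near the point have the same derivatives; the choices coincide even when
  there is none to choose from.\<close>

lemma pd_cong:
  assumes "open S" "x \<in> S" "\<And>y. y \<in> S \<Longrightarrow> f y = g y"
  shows "pd i f x = pd i g x"
proof -
  have "(f has_derivative f') (at x) \<longleftrightarrow> (g has_derivative f') (at x)" for f'
    using has_derivative_transform_within_open[of f f' x UNIV S g]
      has_derivative_transform_within_open[of g f' x UNIV S f] assms by auto
  then show ?thesis
    by (simp add: pd_def frechet_derivative_def)
qed

lemma differentiable_cong:
  assumes "open S" "x \<in> S" "\<And>y. y \<in> S \<Longrightarrow> f y = g y" "f differentiable (at x)"
  shows "g differentiable (at x)"
  using assms unfolding differentiable_def by (blast intro: has_derivative_transform_within_open)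

lemma has_derivative_imp_differentiable: "(f has_derivative f') F \<Longrightarrow> f differentiable F"
  unfolding differentiable_def by blast

lemma frechet_derivative_expand:
  fixes f :: "real^'n::finite \<Rightarrow> 'b::real_normed_vector"
  assumes "f differentiable (at x)"
  shows "frechet_derivative f (at x) v = (\<Sum>i\<in>UNIV. v $ i *\<^sub>R pd i f x)"
proof -
  have lin: "linear (frechet_derivative f (at x))"
    using assms by (rule linear_frechet_derivative)
  have "frechet_derivative f (at x) (\<Sum>i\<in>UNIV. v $ i *\<^sub>R axis i 1)
      = (\<Sum>i\<in>UNIV. frechet_derivative f (at x) (v $ i *\<^sub>R axis i 1))"
    by (rule linear_sum[OF lin])
  moreover have "(\<Sum>i\<in>UNIV. v $ i *\<^sub>R axis i 1) = v"
    using basis_expansion[of v] by (simp add: scalar_mult_eq_scaleR)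
  ultimately have "frechet_derivative f (at x) v = (\<Sum>i\<in>UNIV. frechet_derivative f (at x) (v $ i *\<^sub>R axis i 1))"
    by simp
  also have "\<dots> = (\<Sum>i\<in>UNIV. v $ i *\<^sub>R pd i f x)"
    by (simp add: pd_def linear_cmul[OF lin])
  finally show ?thesis .
qed

text \<open>The shape in which derivatives enter the product and chain rules below: evaluated at
  \<open>axis i 1\<close>, the sum collapses to one partial derivative.\<close>

lemma has_derivative_pd:
  fixes f :: "real^'n::finite \<Rightarrow> 'b::real_normed_vector"
  assumes "f differentiable (at x)"
  shows "(f has_derivative (\<lambda>v. \<Sum>i\<in>UNIV. v $ i *\<^sub>R pd i f x)) (at x)"
  using assms frechet_derivative_works[of f "at x"]
  by (simp add: frechet_derivative_expand[OF assms, abs_def])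

lemma pd_const[simp]: "pd i (\<lambda>_. c) x = 0"
  by (rule pd_eqI[OF has_derivative_const])

lemma pd_bounded_linear:
  assumes "bounded_linear h" "f differentiable (at x)"
  shows "pd i (\<lambda>x. h (f x)) x = h (pd i f x)"
  using pd_eqI[OF bounded_linear.has_derivative[OF assms(1) has_derivative_pd[OF assms(2)]]]
  by (simp add: axis_def if_distrib if_distribR cong: if_cong)

lemma pd_bilinear:
  assumes "bounded_bilinear h" "f differentiable (at x)" "g differentiable (at x)"
  shows "pd i (\<lambda>x. h (f x) (g x)) x = h (f x) (pd i g x) + h (pd i f x) (g x)"
  using bounded_bilinear.FDERIV[OF assms(1) has_derivative_pd[OF assms(2)] has_derivative_pd[OF assms(3)]]
  by (subst pd_eqI, assumption) (simp add: axis_def if_distrib if_distribR cong: if_cong)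

lemma pd_add:
  "f differentiable (at x) \<Longrightarrow> g differentiable (at x) \<Longrightarrow> pd i (\<lambda>x. f x + g x) x = pd i f x + pd i g x"
  by (rule pd_eqI[OF has_derivative_add[OF has_derivative_pd has_derivative_pd], THEN trans])
    (simp_all add: axis_def if_distrib if_distribR cong: if_cong)

lemma pd_diff:
  "f differentiable (at x) \<Longrightarrow> g differentiable (at x) \<Longrightarrow> pd i (\<lambda>x. f x - g x) x = pd i f x - pd i g x"
  by (rule pd_eqI[OF has_derivative_diff[OF has_derivative_pd has_derivative_pd], THEN trans])
    (simp_all add: axis_def if_distrib if_distribR cong: if_cong)

lemma pd_minus: "f differentiable (at x) \<Longrightarrow> pd i (\<lambda>x. - f x) x = - pd i f x"
  by (rule pd_eqI[OF has_derivative_minus[OF has_derivative_pd], THEN trans])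
    (simp_all add: axis_def if_distrib if_distribR cong: if_cong)

lemma pd_mult:
  fixes f g :: "real^'n::finite \<Rightarrow> real"
  shows "f differentiable (at x) \<Longrightarrow> g differentiable (at x) \<Longrightarrow>
    pd i (\<lambda>x. f x * g x) x = f x * pd i g x + pd i f x * g x"
  by (rule pd_bilinear[OF bounded_bilinear_mult])

lemma pd_cmult:
  fixes f :: "real^'n::finite \<Rightarrow> real"
  shows "f differentiable (at x) \<Longrightarrow> pd i (\<lambda>x. c * f x) x = c * pd i f x"
  by (rule pd_bounded_linear[OF bounded_linear_mult_right])

lemma pd_sum:
  assumes "\<And>a. a \<in> I \<Longrightarrow> f a differentiable (at x)"
  shows "pd i (\<lambda>x. \<Sum>a\<in>I. f a x) x = (\<Sum>a\<in>I. pd i (f a) x)"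
proof (cases "finite I")
  case True
  then show ?thesis
    using assms by (induction I rule: finite_induct) (simp_all add: pd_add)
qed simp

lemma pd_component:
  fixes f :: "real^'n::finite \<Rightarrow> 'b::real_normed_vector^'m"
  assumes "f differentiable (at x)"
  shows "pd i (\<lambda>x. f x $ k) x = pd i f x $ k"
  by (rule pd_bounded_linear[OF bounded_linear_vec_nth assms])

lemma pd_coordinate[simp]: "pd i (\<lambda>x::real^'n::finite. x $ j) x = (if i = j then 1 else 0)"
  by (subst pd_eqI[OF bounded_linear.has_derivative[OF bounded_linear_vec_nth has_derivative_ident]])
    (simp add: axis_def)

lemma pd_compose:
  fixes f :: "real^'n::finite \<Rightarrow> real^'m::finite" and g :: "real^'m \<Rightarrow> 'b::real_normed_vector"
  assumes "f differentiable (at x)" "g differentiable (at (f x))"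
  shows "pd i (\<lambda>x. g (f x)) x = (\<Sum>j\<in>UNIV. pd i f x $ j *\<^sub>R pd j g (f x))"
  using has_derivative_compose[OF has_derivative_pd[OF assms(1)] has_derivative_pd[OF assms(2)]]
  by (subst pd_eqI, assumption)
    (simp add: axis_def if_distrib if_distribR cong: if_cong)

lemma differentiable_vec_componentwise:
  fixes f :: "real^'n::finite \<Rightarrow> real^'m::finite"
  assumes "\<And>k. (\<lambda>x. f x $ k) differentiable (at x)"
  shows "f differentiable (at x)"
proof -
  have "(\<lambda>x. f x \<bullet> b) differentiable (at x)" if "b \<in> Basis" for b
    using that assms by (auto simp: Basis_vec_def inner_axis)
  then show ?thesis using differentiable_componentwise_within[of f x UNIV] by blast
qed

lemma differentiable_nth:
  fixes f :: "real^'n::finite \<Rightarrow> 'b::real_normed_vector^'m"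
  shows "f differentiable (at x) \<Longrightarrow> (\<lambda>x. f x $ k) differentiable (at x)"
  unfolding differentiable_def using bounded_linear.has_derivative[OF bounded_linear_vec_nth] by fast


section \<open>Closure properties of C^k and smooth functions\<close>

lemma Ck_on_subset: "Ck_on k S f \<Longrightarrow> S' \<subseteq> S \<Longrightarrow> Ck_on k S' f"
  by (induction k arbitrary: f) (auto intro: continuous_on_subset)

lemma Ck_on_cong:
  assumes "open S" "\<And>x. x \<in> S \<Longrightarrow> f x = g x" "Ck_on k S f"
  shows "Ck_on k S g"
  using assms(2,3)
proof (induction k arbitrary: f g)
  case 0
  then show ?case by (simp cong: continuous_on_cong)
next
  case (Suc k)
  have "Ck_on k S (pd i g)" for i
  proof (rule Suc.IH[of "pd i f"])
    show "pd i f x = pd i g x" if "x \<in> S" for x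
      by (rule pd_cong[OF assms(1) that Suc.prems(1)])
  qed (use Suc.prems(2) in simp)
  moreover have "g differentiable (at x)" if "x \<in> S" for x
    by (rule differentiable_cong[OF assms(1) that Suc.prems(1)]) (use Suc.prems(2) that in simp_all)
  ultimately show ?case by simp
qed

text \<open>Only order \<open>0\<close> needs an argument, where differentiability gives continuity;
  above it the induction hypothesis applies to the partial derivatives.\<close>

lemma Ck_on_Suc_imp: "Ck_on (Suc k) S f \<Longrightarrow> Ck_on k S f"
proof (induction k arbitrary: f)
  case 0
  then show ?case
    by (auto intro!: continuous_at_imp_continuous_on differentiable_imp_continuous_within)
qed auto

lemma Ck_on_const: "Ck_on k (S :: (real^'n::finite) set) (\<lambda>_. c)"
proof (induction k arbitrary: c)
  case (Suc k)
  have "pd i (\<lambda>_::real^'n. c) = (\<lambda>_. 0)" for i by (rule ext) simp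
  with Suc have "\<forall>i. Ck_on k S (pd i (\<lambda>_. c))" by simp
  then show ?case by simp
qed simp

lemma Ck_on_linear:
  assumes "open S" "bounded_linear h" "Ck_on k S f"
  shows "Ck_on k S (\<lambda>x. h (f x))"
  using assms(3)
proof (induction k arbitrary: f)
  case 0
  then show ?case by (simp add: bounded_linear.continuous_on[OF assms(2)])
next
  case (Suc k)
  have "Ck_on k S (pd i (\<lambda>x. h (f x)))" for i
    by (rule Ck_on_cong[OF assms(1) _ Suc.IH[of "pd i f"]])
      (use Suc.prems in \<open>simp_all add: pd_bounded_linear[OF assms(2)]\<close>)
  moreover have "(\<lambda>x. h (f x)) differentiable (at x)" if "x \<in> S" for x
    using Suc.prems that
    by (intro has_derivative_imp_differentiable[OF bounded_linear.has_derivative[OF assms(2) has_derivative_pd]]) simp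
  ultimately show ?case by simp
qed

lemma Ck_on_add:
  assumes "open S" "Ck_on k S f" "Ck_on k S g"
  shows "Ck_on k S (\<lambda>x. f x + g x)"
  using assms(2,3)
proof (induction k arbitrary: f g)
  case 0
  then show ?case by (simp add: continuous_on_add)
next
  case (Suc k)
  have "Ck_on k S (pd i (\<lambda>x. f x + g x))" for i
    by (rule Ck_on_cong[OF assms(1) _ Suc.IH[of "pd i f" "pd i g"]])
      (use Suc.prems pd_add in \<open>auto simp: pd_add\<close>)
  then show ?case using Suc.prems by simp
qed

lemma Ck_on_bilinear:
  assumes "open S" "bounded_bilinear h" "Ck_on k S f" "Ck_on k S g"
  shows "Ck_on k S (\<lambda>x. h (f x) (g x))"
  using assms(3,4)
proof (induction k arbitrary: f g)
  case 0
  then show ?case by (simp add: bounded_bilinear.continuous_on[OF assms(2)])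
next
  case (Suc k)
  \<comment> \<open>The product rule pairs a derivative with an undifferentiated factor, which is
    therefore needed at order \<open>k\<close> as well.\<close>
  have "Ck_on k S f" "Ck_on k S g" using Suc.prems Ck_on_Suc_imp by blast+
  then have "Ck_on k S (\<lambda>x. h (f x) (pd i g x) + h (pd i f x) (g x))" for i
    using Suc.prems by (intro Ck_on_add assms(1) Suc.IH) simp_all
  then have "Ck_on k S (pd i (\<lambda>x. h (f x) (g x)))" for i
    by (rule Ck_on_cong[OF assms(1), rotated]) (use Suc.prems in \<open>simp add: pd_bilinear[OF assms(2)]\<close>)
  moreover have "(\<lambda>x. h (f x) (g x)) differentiable (at x)" if "x \<in> S" for x
    using Suc.prems that
    by (intro has_derivative_imp_differentiable[OF bounded_bilinear.FDERIV[OF assms(2)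
          has_derivative_pd has_derivative_pd]]) simp_all
  ultimately show ?case by simp
qed

lemma Ck_on_sum:
  assumes "open S" "\<And>a. a \<in> I \<Longrightarrow> Ck_on k S (f a)"
  shows "Ck_on k S (\<lambda>x. \<Sum>a\<in>I. f a x)"
proof (cases "finite I")
  case True
  then show ?thesis
    using assms(2) by (induction I rule: finite_induct) (auto intro!: Ck_on_const Ck_on_add assms(1))
qed (simp add: Ck_on_const)

lemma Ck_on_compose:
  fixes f :: "real^'n::finite \<Rightarrow> real^'m::finite" and g :: "real^'m \<Rightarrow> 'b::real_normed_vector"
  assumes "open S" "Ck_on k S f" "Ck_on k R g" "f ` S \<subseteq> R"
  shows "Ck_on k S (\<lambda>x. g (f x))"
  using assms(2,3)
proof (induction k arbitrary: g)
  case 0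
  then show ?case using assms(4) by (auto intro: continuous_on_compose2)
next
  case (Suc k)
  have "Ck_on k S f" using Suc.prems Ck_on_Suc_imp by blast
  then have "Ck_on k S (\<lambda>x. pd j g (f x))" for j
    using Suc.prems by (intro Suc.IH) simp_all
  then have "Ck_on k S (\<lambda>x. \<Sum>j\<in>UNIV. pd i f x $ j *\<^sub>R pd j g (f x))" for i
    using Suc.prems
    by (intro Ck_on_sum Ck_on_bilinear[OF _ bounded_bilinear_scaleR] assms(1)
        Ck_on_linear[OF _ bounded_linear_vec_nth]) simp_all
  then have "Ck_on k S (pd i (\<lambda>x. g (f x)))" for i
    by (rule Ck_on_cong[OF assms(1), rotated]) (use Suc.prems assms(4) in \<open>auto simp: pd_compose\<close>)
  moreover have "(\<lambda>x. g (f x)) differentiable (at x)" if "x \<in> S" for x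
    using Suc.prems that assms(4) differentiable_chain_at[of f x g] by (auto simp: o_def)
  ultimately show ?case by simp
qed

text \<open>A partial derivative of 1/f is a product of one of f with two copies of 1/f, so the
  induction hypothesis for the same function closes the step.\<close>

lemma Ck_on_inverse:
  fixes f :: "real^'n::finite \<Rightarrow> real"
  assumes "open S" "Ck_on k S f" "\<And>x. x \<in> S \<Longrightarrow> f x \<noteq> 0"
  shows "Ck_on k S (\<lambda>x. inverse (f x))"
  using assms(2)
proof (induction k)
  case 0
  then show ?case using assms(3) by (auto intro: continuous_on_inverse)
next
  case (Suc k)
  have d: "((\<lambda>x. inverse (f x)) has_derivative
      (\<lambda>v. - (inverse (f x) * (\<Sum>i\<in>UNIV. v $ i *\<^sub>R pd i f x) * inverse (f x)))) (at x)" if "x \<in> S" for x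
    using Suc.prems that assms(3) by (intro Deriv.has_derivative_inverse has_derivative_pd) auto
  have IH: "Ck_on k S (\<lambda>x. inverse (f x))" using Suc Ck_on_Suc_imp by blast
  have "Ck_on k S (\<lambda>x. - (inverse (f x) * pd i f x * inverse (f x)))" for i
    using Suc.prems
    by (intro Ck_on_linear[OF assms(1) bounded_linear_minus[OF bounded_linear_ident]]
        Ck_on_bilinear[OF assms(1) bounded_bilinear_mult] IH) auto
  moreover have "- (inverse (f x) * pd i f x * inverse (f x)) = pd i (\<lambda>x. inverse (f x)) x"
    if "x \<in> S" for i x
    by (simp add: pd_eqI[OF d[OF that]] axis_def if_distrib if_distribR cong: if_cong)
  ultimately have "Ck_on k S (pd i (\<lambda>x. inverse (f x)))" for i
    by (metis (no_types, lifting) Ck_on_cong[OF assms(1)])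
  moreover have "(\<lambda>x. inverse (f x)) differentiable (at x)" if "x \<in> S" for x
    using d[OF that] unfolding differentiable_def by blast
  ultimately show ?case by simp
qed

lemma smooth_onD:
  assumes "smooth_on S f"
  shows smooth_on_differentiable: "x \<in> S \<Longrightarrow> f differentiable (at x)"
    and smooth_on_pd: "smooth_on S (pd i f)"
    and smooth_on_continuous: "continuous_on S f"
  using assms[unfolded smooth_on_def, rule_format, of "Suc 0"]
    assms[unfolded smooth_on_def, rule_format, of "Suc k" for k]
    assms[unfolded smooth_on_def, rule_format, of 0]
  by (simp_all add: smooth_on_def)

lemma smooth_onI_pd:
  assumes "\<And>x. x \<in> S \<Longrightarrow> f differentiable (at x)" "\<And>i. smooth_on S (pd i f)"
  shows "smooth_on S f"
  unfolding smooth_on_def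
proof
  fix k
  have "Ck_on (Suc k) S f" using assms by (simp add: smooth_on_def)
  then show "Ck_on k S f" by (rule Ck_on_Suc_imp)
qed

lemma smooth_on_subset: "smooth_on S f \<Longrightarrow> S' \<subseteq> S \<Longrightarrow> smooth_on S' f"
  unfolding smooth_on_def using Ck_on_subset by blast

lemma smooth_on_cong:
  assumes "open S" "\<And>x. x \<in> S \<Longrightarrow> f x = g x" "smooth_on S f"
  shows "smooth_on S g"
  using assms Ck_on_cong unfolding smooth_on_def by blast

lemma smooth_on_const: "smooth_on S (\<lambda>_. c)"
  by (simp add: smooth_on_def Ck_on_const)

lemma smooth_on_linear:
  "open S \<Longrightarrow> bounded_linear h \<Longrightarrow> smooth_on S f \<Longrightarrow> smooth_on S (\<lambda>x. h (f x))"
  by (simp add: smooth_on_def Ck_on_linear)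

lemma smooth_on_bilinear:
  "open S \<Longrightarrow> bounded_bilinear h \<Longrightarrow> smooth_on S f \<Longrightarrow> smooth_on S g \<Longrightarrow> smooth_on S (\<lambda>x. h (f x) (g x))"
  by (simp add: smooth_on_def Ck_on_bilinear)

lemma smooth_on_add: "open S \<Longrightarrow> smooth_on S f \<Longrightarrow> smooth_on S g \<Longrightarrow> smooth_on S (\<lambda>x. f x + g x)"
  by (simp add: smooth_on_def Ck_on_add)

lemma smooth_on_sum: "open S \<Longrightarrow> (\<And>a. a \<in> I \<Longrightarrow> smooth_on S (f a)) \<Longrightarrow> smooth_on S (\<lambda>x. \<Sum>a\<in>I. f a x)"
  by (simp add: smooth_on_def Ck_on_sum)

lemma smooth_on_compose:
  fixes f :: "real^'n::finite \<Rightarrow> real^'m::finite" and g :: "real^'m \<Rightarrow> 'b::real_normed_vector"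
  shows "open S \<Longrightarrow> smooth_on S f \<Longrightarrow> smooth_on R g \<Longrightarrow> f ` S \<subseteq> R \<Longrightarrow> smooth_on S (\<lambda>x. g (f x))"
  unfolding smooth_on_def using Ck_on_compose by blast

lemma smooth_on_inverse:
  fixes f :: "real^'n::finite \<Rightarrow> real"
  shows "open S \<Longrightarrow> smooth_on S f \<Longrightarrow> (\<And>x. x \<in> S \<Longrightarrow> f x \<noteq> 0) \<Longrightarrow> smooth_on S (\<lambda>x. inverse (f x))"
  by (simp add: smooth_on_def Ck_on_inverse)

lemma smooth_on_id: "smooth_on S (\<lambda>x::real^'n::finite. x)"
proof (rule smooth_onI_pd)
  have "pd i (\<lambda>x::real^'n. x) = (\<lambda>_. axis i 1)" for i
    by (rule ext) (rule pd_eqI[OF has_derivative_ident])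
  then show "smooth_on S (pd i (\<lambda>x::real^'n. x))" for i by (simp add: smooth_on_const)
qed auto

lemma smooth_on_mult:
  fixes f g :: "real^'n::finite \<Rightarrow> real"
  shows "open S \<Longrightarrow> smooth_on S f \<Longrightarrow> smooth_on S g \<Longrightarrow> smooth_on S (\<lambda>x. f x * g x)"
  by (rule smooth_on_bilinear[OF _ bounded_bilinear_mult])

lemma smooth_on_divide:
  fixes f g :: "real^'n::finite \<Rightarrow> real"
  shows "open S \<Longrightarrow> smooth_on S f \<Longrightarrow> smooth_on S g \<Longrightarrow> (\<And>x. x \<in> S \<Longrightarrow> g x \<noteq> 0) \<Longrightarrow>
    smooth_on S (\<lambda>x. f x / g x)"
  unfolding divide_inverse by (intro smooth_on_mult smooth_on_inverse) auto

lemma smooth_on_minus: "open S \<Longrightarrow> smooth_on S f \<Longrightarrow> smooth_on S (\<lambda>x. - f x)"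
  by (rule smooth_on_linear[OF _ bounded_linear_minus[OF bounded_linear_ident]])

lemma smooth_on_diff: "open S \<Longrightarrow> smooth_on S f \<Longrightarrow> smooth_on S g \<Longrightarrow> smooth_on S (\<lambda>x. f x - g x)"
  using smooth_on_add[of S f "\<lambda>x. - g x"] smooth_on_minus[of S g] by simp

lemma smooth_on_nth:
  fixes f :: "real^'n::finite \<Rightarrow> 'b::real_normed_vector^'m"
  shows "open S \<Longrightarrow> smooth_on S f \<Longrightarrow> smooth_on S (\<lambda>x. f x $ k)"
  by (rule smooth_on_linear[OF _ bounded_linear_vec_nth])

lemma bounded_linear_axis: "bounded_linear (axis k :: 'b::real_normed_vector \<Rightarrow> 'b^'m::finite)"
proof (rule bounded_linear_intro[where K = 1])
  fix x :: 'b
  have "norm (axis k x :: 'b^'m) \<le> (\<Sum>i\<in>UNIV. norm ((axis k x :: 'b^'m) $ i))"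
    unfolding norm_vec_def by (rule L2_set_le_sum) simp
  also have "\<dots> = norm x * 1"
    by (simp add: axis_def if_distrib cong: if_cong)
  finally show "norm (axis k x :: 'b^'m) \<le> norm x * 1" .
qed (auto simp: axis_def vec_eq_iff)

lemma smooth_on_vec:
  fixes f :: "real^'n::finite \<Rightarrow> 'b::real_normed_vector^'m::finite"
  assumes "open S" "\<And>k. smooth_on S (\<lambda>x. f x $ k)"
  shows "smooth_on S f"
proof -
  have "f = (\<lambda>x. \<Sum>k\<in>UNIV. axis k (f x $ k))"
    by (simp add: fun_eq_iff vec_eq_iff axis_def)
  moreover have "smooth_on S (\<lambda>x. \<Sum>k\<in>UNIV. (axis k (f x $ k) :: 'b^'m))"
    by (intro smooth_on_sum smooth_on_linear[OF _ bounded_linear_axis] assms)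
  ultimately show ?thesis by simp
qed

text \<open>Smoothness may be checked with a different formula near each point. The field and the
  function extracted from a solution are given through an arbitrary choice of a covector over each
  point; their smoothness shows only after replacing that choice locally.\<close>

lemma smooth_on_local:
  assumes "\<And>x. x \<in> S \<Longrightarrow> \<exists>R. open R \<and> x \<in> R \<and> smooth_on (S \<inter> R) f"
  shows "smooth_on S f"
  unfolding smooth_on_def
proof
  fix k
  have "\<forall>x\<in>S. \<exists>R. open R \<and> x \<in> R \<and> Ck_on k (S \<inter> R) f"
    using assms unfolding smooth_on_def by blast
  then show "Ck_on k S f"
  proof (induction k arbitrary: f)
    case 0
    have "continuous (at x within S) f" if "x \<in> S" for x
    proof -
      from bspec[OF 0 that] obtain R where R: "open R" "x \<in> R" "continuous_on (S \<inter> R) f" by auto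
      then have "continuous (at x within S \<inter> R) f"
        using that by (simp add: continuous_on_eq_continuous_within)
      moreover have "at x within S \<inter> R = at x within S"
        by (rule at_within_nhd[of _ R]) (use R in auto)
      ultimately show ?thesis by simp
    qed
    then show ?case by (simp add: continuous_on_eq_continuous_within)
  next
    case (Suc k)
    have "f differentiable (at x)" if "x \<in> S" for x
      using Suc.prems that by fastforce
    moreover have "Ck_on k S (pd i f)" for i
      using Suc.prems by (intro Suc.IH) fastforce
    ultimately show ?case by simp
  qed
qed

section \<open>Symmetry of second partial derivatives\<close>

lemma deriv_line:
  fixes f :: "real^'n::finite \<Rightarrow> real"
  assumes "f differentiable (at (x + t *\<^sub>R axis i 1))"
  shows "((\<lambda>t. f (x + t *\<^sub>R axis i 1)) has_real_derivative pd i f (x + t *\<^sub>R axis i 1)) (at t)"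
proof -
  have "((\<lambda>t. x + t *\<^sub>R axis i 1) has_derivative (\<lambda>h. h *\<^sub>R axis i 1)) (at t)"
    by (auto intro!: derivative_eq_intros)
  from has_derivative_compose[OF this has_derivative_pd[OF assms]]
  have "((\<lambda>t. f (x + t *\<^sub>R axis i 1)) has_derivative (\<lambda>h. h * pd i f (x + t *\<^sub>R axis i 1))) (at t)"
    by (simp add: axis_def if_distrib if_distribR cong: if_cong)
  then show ?thesis
    by (simp add: has_field_derivative_def mult.commute[of _ "pd i f _"] mult_commute_abs)
qed

text \<open>The mean value theorem twice: for the increment in direction \<open>j\<close> as a
  function of the step in direction \<open>i\<close>, and for the resulting first derivative along
  direction \<open>j\<close>.\<close>

lemma second_difference:
  fixes f :: "real^'n::finite \<Rightarrow> real"
  assumes f: "\<And>y. y \<in> ball x e \<Longrightarrow> f differentiable (at y)"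
    and fi: "\<And>y. y \<in> ball x e \<Longrightarrow> pd i f differentiable (at y)"
    and h: "0 < h" "2 * h < e"
  shows "\<exists>y\<in>cball x (2 * h). f (x + h *\<^sub>R axis i 1 + h *\<^sub>R axis j 1) - f (x + h *\<^sub>R axis i 1)
    - f (x + h *\<^sub>R axis j 1) + f x = h * h * pd j (pd i f) y"
proof -
  have b: "x + s *\<^sub>R axis i 1 + t *\<^sub>R axis j 1 \<in> cball x (2 * h)" if "0 \<le> s" "s \<le> h" "0 \<le> t" "t \<le> h" for s t
  proof -
    have "norm (s *\<^sub>R axis i 1 + t *\<^sub>R axis j 1 :: real^'n) \<le> s + t"
      using that norm_triangle_ineq[of "s *\<^sub>R axis i 1 :: real^'n" "t *\<^sub>R axis j 1"] by (simp add: norm_axis_1)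
    then show ?thesis using that by (simp add: dist_norm algebra_simps norm_minus_commute)
  qed
  have b': "y \<in> cball x (2 * h) \<Longrightarrow> y \<in> ball x e" for y using h by simp
  define G where "G s = f (x + s *\<^sub>R axis i 1 + h *\<^sub>R axis j 1) - f (x + s *\<^sub>R axis i 1)" for s
  have "(G has_real_derivative (pd i f (x + s *\<^sub>R axis i 1 + h *\<^sub>R axis j 1) - pd i f (x + s *\<^sub>R axis i 1))) (at s)"
    if "0 \<le> s" "s \<le> h" for s
  proof -
    have "((\<lambda>s. f (x + h *\<^sub>R axis j 1 + s *\<^sub>R axis i 1)) has_real_derivative
        pd i f (x + h *\<^sub>R axis j 1 + s *\<^sub>R axis i 1)) (at s)"
      using b[of s h] b' f that h by (intro deriv_line) (simp add: add.commute add.left_commute)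
    moreover have "((\<lambda>s. f (x + s *\<^sub>R axis i 1)) has_real_derivative pd i f (x + s *\<^sub>R axis i 1)) (at s)"
      using b[of s 0] b' f that h by (intro deriv_line) simp
    ultimately show ?thesis
      unfolding G_def by (auto intro!: derivative_eq_intros simp: add.commute add.left_commute)
  qed
  from MVT2[of 0 h G, OF h(1) this] obtain s where s: "0 < s" "s < h"
    and eq1: "G h - G 0 = h * (pd i f (x + s *\<^sub>R axis i 1 + h *\<^sub>R axis j 1) - pd i f (x + s *\<^sub>R axis i 1))"
    by (auto simp: right_diff_distrib)
  have "((\<lambda>t. pd i f (x + s *\<^sub>R axis i 1 + t *\<^sub>R axis j 1)) has_real_derivative
      pd j (pd i f) (x + s *\<^sub>R axis i 1 + t *\<^sub>R axis j 1)) (at t)" if "0 \<le> t" "t \<le> h" for t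
    using b[of s t] b' fi that s by (intro deriv_line) simp
  from MVT2[of 0 h "\<lambda>t. pd i f (x + s *\<^sub>R axis i 1 + t *\<^sub>R axis j 1)", OF h(1) this]
  obtain t where t: "0 < t" "t < h"
    and eq2: "pd i f (x + s *\<^sub>R axis i 1 + h *\<^sub>R axis j 1) - pd i f (x + s *\<^sub>R axis i 1)
      = h * pd j (pd i f) (x + s *\<^sub>R axis i 1 + t *\<^sub>R axis j 1)"
    by auto
  show ?thesis
    using eq1 b[of s t] s t unfolding eq2 G_def by (intro bexI) auto
qed

text \<open>The second difference is symmetric in the two directions, so the two mixed derivatives
  take a common value at two points near \<open>x\<close>; their continuity forbids that they differ
  at \<open>x\<close>.\<close>

lemma pd_commute:
  fixes f :: "real^'n::finite \<Rightarrow> real"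
  assumes "open S" "x \<in> S" "smooth_on S f"
  shows "pd i (pd j f) x = pd j (pd i f) x"
proof (rule ccontr)
  assume ne: "pd i (pd j f) x \<noteq> pd j (pd i f) x"
  define d where "d = \<bar>pd i (pd j f) x - pd j (pd i f) x\<bar> / 2"
  have "d > 0" using ne by (simp add: d_def)
  have "isCont (pd i (pd j f)) x" "isCont (pd j (pd i f)) x"
    using assms smooth_onD(2,3) continuous_on_eq_continuous_at by blast+
  then obtain e1 e2 where e: "e1 > 0" "e2 > 0"
    "\<And>y. dist y x < e1 \<Longrightarrow> dist (pd i (pd j f) y) (pd i (pd j f) x) < d"
    "\<And>y. dist y x < e2 \<Longrightarrow> dist (pd j (pd i f) y) (pd j (pd i f) x) < d"
    using \<open>d > 0\<close> unfolding continuous_at_eps_delta by (metis dist_norm)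
  obtain e0 where e0: "e0 > 0" "ball x e0 \<subseteq> S" using assms openE by blast
  \<comment> \<open>The intermediate points lie within 2h of \<open>x\<close>; the factor 1/4 keeps
    2h below all three radii.\<close>
  define h where "h = min e0 (min e1 e2) / 4"
  have h: "h > 0" "2 * h < e0" "2 * h < e1" "2 * h < e2" using e e0 by (auto simp: h_def)
  have df: "y \<in> ball x e0 \<Longrightarrow> f differentiable (at y)" "y \<in> ball x e0 \<Longrightarrow> pd k f differentiable (at y)" for k y
    using assms(3) e0 smooth_onD by blast+
  obtain y1 where y1: "y1 \<in> cball x (2*h)" "f (x + h *\<^sub>R axis i 1 + h *\<^sub>R axis j 1) - f (x + h *\<^sub>R axis i 1)
    - f (x + h *\<^sub>R axis j 1) + f x = h * h * pd j (pd i f) y1"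
    using second_difference[OF df h(1,2)] by blast
  obtain y2 where y2: "y2 \<in> cball x (2*h)" "f (x + h *\<^sub>R axis j 1 + h *\<^sub>R axis i 1) - f (x + h *\<^sub>R axis j 1)
    - f (x + h *\<^sub>R axis i 1) + f x = h * h * pd i (pd j f) y2"
    using second_difference[OF df h(1,2)] by blast
  have comm: "x + h *\<^sub>R axis j 1 + h *\<^sub>R axis i 1 = x + h *\<^sub>R axis i 1 + h *\<^sub>R axis j 1"
    by (simp add: add_ac)
  have "h * h * pd j (pd i f) y1 = h * h * pd i (pd j f) y2"
    using y1(2) y2(2)[unfolded comm] by linarith
  then have "pd j (pd i f) y1 = pd i (pd j f) y2" using h(1) by simp
  moreover have "dist (pd j (pd i f) y1) (pd j (pd i f) x) < d"
    using e(4)[of y1] y1(1) h by (simp add: dist_commute)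
  moreover have "dist (pd i (pd j f) y2) (pd i (pd j f) x) < d"
    using e(3)[of y2] y2(1) h by (simp add: dist_commute)
  ultimately show False
    unfolding d_def dist_real_def by (simp add: abs_if split: if_splits)
qed

section \<open>Charts of a smooth manifold\<close>

locale smooth_atlas =
  fixes M :: "'a topology" and A :: "('a, 'n::finite) chart set"
  assumes manifold: "smooth_manifold M A"
begin

lemma chart_on_A: "c \<in> A \<Longrightarrow> chart_on M c"
  using manifold unfolding smooth_manifold_def by blast

lemma compatible_A: "c \<in> A \<Longrightarrow> c' \<in> A \<Longrightarrow> compatible c c'"
  using manifold unfolding smooth_manifold_def by blast

lemma Union_charts: "(\<Union>c\<in>A. fst c) = topspace M"
  using manifold unfolding smooth_manifold_def by blast

lemma openin_chart: "c \<in> A \<Longrightarrow> openin M (fst c)"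
  using chart_on_A unfolding chart_on_def by blast

lemma open_chart_image: "c \<in> A \<Longrightarrow> open (snd c ` fst c)"
  using chart_on_A unfolding chart_on_def by blast

lemma homeomorphic_chart:
  "c \<in> A \<Longrightarrow> homeomorphic_map (subtopology M (fst c)) (top_of_set (snd c ` fst c)) (snd c)"
  using chart_on_A unfolding chart_on_def by blast

lemma topspace_chart: "c \<in> A \<Longrightarrow> topspace (subtopology M (fst c)) = fst c"
  by (simp add: openin_subset[OF openin_chart] Int_absorb1)

lemma inj_on_chart: "c \<in> A \<Longrightarrow> inj_on (snd c) (fst c)"
  using homeomorphic_imp_injective_map[OF homeomorphic_chart] topspace_chart by metis

lemma chart_inv_snd[simp]: "c \<in> A \<Longrightarrow> p \<in> fst c \<Longrightarrow> chart_inv c (snd c p) = p"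
  unfolding chart_inv_def by (simp add: inj_on_chart)

lemma snd_chart_inv[simp]: "x \<in> snd c ` fst c \<Longrightarrow> snd c (chart_inv c x) = x"
  unfolding chart_inv_def by (rule f_inv_into_f)

lemma chart_inv_in: "x \<in> snd c ` fst c \<Longrightarrow> chart_inv c x \<in> fst c"
  unfolding chart_inv_def by (rule inv_into_into)

lemma open_image:
  assumes "c \<in> A" "openin M V"
  shows "open (snd c ` (V \<inter> fst c))"
proof -
  have "open_map (subtopology M (fst c)) (top_of_set (snd c ` fst c)) (snd c)"
    using homeomorphic_imp_open_map[OF homeomorphic_chart] assms by blast
  moreover have "openin (subtopology M (fst c)) (V \<inter> fst c)"
    using assms(2) by (auto simp: openin_subtopology)
  ultimately have "openin (top_of_set (snd c ` fst c)) (snd c ` (V \<inter> fst c))"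
    unfolding open_map_def by blast
  then show ?thesis
    using open_chart_image[OF assms(1)] openin_open_eq by blast
qed

lemma openin_preimage:
  assumes "c \<in> A" "open S"
  shows "openin M {p \<in> fst c. snd c p \<in> S}"
proof -
  have "continuous_map (subtopology M (fst c)) (top_of_set (snd c ` fst c)) (snd c)"
    using homeomorphic_imp_continuous_map[OF homeomorphic_chart] assms by blast
  moreover have "openin (top_of_set (snd c ` fst c)) (S \<inter> snd c ` fst c)"
    using assms(2) by (auto simp: openin_open)
  ultimately have "openin (subtopology M (fst c))
      {p \<in> topspace (subtopology M (fst c)). snd c p \<in> S \<inter> snd c ` fst c}"
    by (rule openin_continuous_map_preimage)
  moreover have "{p \<in> topspace (subtopology M (fst c)). snd c p \<in> S \<inter> snd c ` fst c} = {p \<in> fst c. snd c p \<in> S}"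
    using topspace_chart[OF assms(1)] by auto
  ultimately show ?thesis
    using openin_chart[OF assms(1)] openin_trans_full by fastforce
qed

text \<open>Openness in the cotangent bundle is defined through charts only; by this criterion the
  projections of such sets are open in the base.\<close>

lemma openin_chartwise:
  assumes "V \<subseteq> topspace M" "\<And>c. c \<in> A \<Longrightarrow> open (snd c ` (V \<inter> fst c))"
  shows "openin M V"
proof -
  have "openin M (\<Union>c\<in>A. {p \<in> fst c. snd c p \<in> snd c ` (V \<inter> fst c)})"
    using openin_preimage assms(2) by blast
  moreover have "(\<Union>c\<in>A. {p \<in> fst c. snd c p \<in> snd c ` (V \<inter> fst c)}) = V" (is "?L = V")
  proof
    show "?L \<subseteq> V" using inj_on_chart by (auto dest: inj_onD)
    show "V \<subseteq> ?L" using assms(1) Union_charts by fastforce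
  qed
  ultimately show ?thesis by simp
qed

lemma transition_snd[simp]:
  "c \<in> A \<Longrightarrow> p \<in> fst c \<Longrightarrow> transition c c' (snd c p) = snd c' p"
  by (simp add: transition_def)

lemma open_overlap: "c \<in> A \<Longrightarrow> c' \<in> A \<Longrightarrow> open (snd c ` (fst c \<inter> fst c'))"
  using open_image[of c "fst c'"] openin_chart by (simp add: Int_commute)

lemma smooth_transition:
  "c \<in> A \<Longrightarrow> c' \<in> A \<Longrightarrow> smooth_on (snd c ` (fst c \<inter> fst c')) (transition c c')"
  using compatible_A unfolding compatible_def by blast

lemma transition_differentiable:
  "c \<in> A \<Longrightarrow> c' \<in> A \<Longrightarrow> p \<in> fst c \<inter> fst c' \<Longrightarrow> transition c c' differentiable (at (snd c p))"
  using smooth_transition smooth_on_differentiable by blast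

lemma jac_nth: "jac c c' p $ k $ i = pd i (transition c c') (snd c p) $ k"
  unfolding jac_def jacobian_def pd_def matrix_def by simp

lemma jac_cocycle:
  assumes "c \<in> A" "c' \<in> A" "c'' \<in> A" "p \<in> fst c" "p \<in> fst c'" "p \<in> fst c''"
  shows "jac c c'' p = jac c' c'' p ** jac c c' p"
proof -
  let ?S = "snd c ` ((fst c' \<inter> fst c'') \<inter> fst c)"
  have S: "open ?S" using assms by (intro open_image openin_Int openin_chart)
  have "pd i (transition c c'') (snd c p) = pd i (\<lambda>x. transition c' c'' (transition c c' x)) (snd c p)" for i
    by (rule pd_cong[OF S]) (use assms in auto)
  also have "pd i (\<lambda>x. transition c' c'' (transition c c' x)) (snd c p) =
      (\<Sum>j\<in>UNIV. pd i (transition c c') (snd c p) $ j *\<^sub>R pd j (transition c' c'') (snd c' p))" for i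
    using assms by (subst pd_compose) (auto intro!: transition_differentiable)
  finally show ?thesis
    by (simp add: vec_eq_iff jac_nth matrix_matrix_mult_def mult.commute)
qed

lemma jac_self:
  assumes "c \<in> A" "p \<in> fst c"
  shows "jac c c p = mat 1"
proof -
  have "pd i (transition c c) (snd c p) = pd i (\<lambda>x. x) (snd c p)" for i
    by (rule pd_cong[OF open_chart_image[OF assms(1)]]) (use assms in auto)
  also have "pd i (\<lambda>x. x) (snd c p) = axis i 1" for i
    by (rule pd_eqI) (rule has_derivative_ident)
  finally show ?thesis
    by (simp add: vec_eq_iff jac_nth mat_def axis_def) 
qed

lemma jac_inverse:
  "c \<in> A \<Longrightarrow> c' \<in> A \<Longrightarrow> p \<in> fst c \<Longrightarrow> p \<in> fst c' \<Longrightarrow> jac c' c p ** jac c c' p = mat 1"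
  using jac_cocycle[of c c' c p] jac_self by simp

lemma smooth_jac:
  assumes "c \<in> A" "c' \<in> A"
  shows "smooth_on (snd c ` (fst c \<inter> fst c')) (\<lambda>x. jac c c' (chart_inv c x))"
proof (intro smooth_on_vec open_overlap assms)
  fix k i
  show "smooth_on (snd c ` (fst c \<inter> fst c')) (\<lambda>x. jac c c' (chart_inv c x) $ k $ i)"
    by (rule smooth_on_cong[OF open_overlap[OF assms] _
          smooth_on_nth[OF open_overlap[OF assms] smooth_on_pd[OF smooth_transition[OF assms], of i], where k=k]])
      (auto simp: jac_nth assms)
qed

text \<open>This is where maximality of the atlas is used.\<close>

lemma chart_from_diffeo:
  assumes c: "c \<in> A" and R: "open R" "R \<subseteq> snd c ` fst c"
    and sm: "smooth_on R \<psi>" "open (\<psi> ` R)" "smooth_on (\<psi> ` R) \<theta>" and inv: "\<And>x. x \<in> R \<Longrightarrow> \<theta> (\<psi> x) = x"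
  shows "({p \<in> fst c. snd c p \<in> R}, \<psi> \<circ> snd c) \<in> A"
proof -
  let ?W = "{p \<in> fst c. snd c p \<in> R}" and ?u = "({p \<in> fst c. snd c p \<in> R}, \<psi> \<circ> snd c)"
  have imW: "snd c ` ?W = R" using R(2) by auto
  have im: "snd ?u ` fst ?u = \<psi> ` R" 
  proof -
    have "snd ?u ` fst ?u = \<psi> ` (snd c ` ?W)" by (simp only: snd_conv fst_conv image_comp)
    then show ?thesis unfolding imW .
  qed
  have opW: "openin M ?W" by (rule openin_preimage[OF c R(1)])
  have injW: "inj_on (\<psi> \<circ> snd c) ?W"
    using inj_on_chart[OF c] inv by (auto simp: inj_on_def) (metis inv)
  have inv_u: "chart_inv ?u (\<psi> (snd c p)) = p" if "p \<in> ?W" for p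
    using inv_into_f_f[OF injW that] by (simp add: chart_inv_def)
  have hm1: "homeomorphic_map (subtopology M ?W) (top_of_set R) (snd c)"
  proof -
    have "homeomorphic_map (subtopology (subtopology M (fst c)) ?W) (subtopology (top_of_set (snd c ` fst c)) R) (snd c)"
    proof (rule homeomorphic_map_subtopologies[OF homeomorphic_chart[OF c]])
      show "snd c ` (topspace (subtopology M (fst c)) \<inter> ?W) = topspace (top_of_set (snd c ` fst c)) \<inter> R"
        unfolding topspace_chart[OF c] using R(2) by auto
    qed
    moreover have "fst c \<inter> ?W = ?W" "snd c ` fst c \<inter> R = R" using R(2) by auto
    ultimately show ?thesis by (simp add: subtopology_subtopology)
  qed
  have hm2: "homeomorphic_map (top_of_set R) (top_of_set (\<psi> ` R)) \<psi>"
  proof -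
    have "homeomorphism R (\<psi> ` R) \<psi> \<theta>"
      using smooth_on_continuous[OF sm(1)] smooth_on_continuous[OF sm(3)] inv
      by (auto simp: homeomorphism_def image_comp)
    then have "homeomorphic_maps (top_of_set R) (top_of_set (\<psi> ` R)) \<psi> \<theta>"
      by (auto simp: homeomorphic_maps_def homeomorphism_def continuous_map_in_subtopology)
    then show ?thesis using homeomorphic_map_maps by blast
  qed
  have "chart_on M ?u"
    unfolding chart_on_def im using opW sm(2) homeomorphic_map_compose[OF hm1 hm2] by simp
  moreover have "compatible ?u c'" if c': "c' \<in> A" for c'
  proof -
    let ?O = "snd c ` (?W \<inter> fst c')"
    have O: "open ?O"
    proof -
      have "open (snd c ` ((?W \<inter> fst c') \<inter> fst c))"
        by (intro open_image openin_Int opW openin_chart c c')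
      moreover have "(?W \<inter> fst c') \<inter> fst c = ?W \<inter> fst c'" by auto
      ultimately show ?thesis by simp
    qed
    \<comment> \<open>The image is rewritten as a preimage under the inverse map \<theta>, so that
      its openness follows from continuity of \<theta>.\<close>
    have iO: "snd ?u ` (fst ?u \<inter> fst c') = {y \<in> \<psi> ` R. \<theta> y \<in> ?O}"
    proof -
      have "\<psi> (snd c p) \<in> {y \<in> \<psi> ` R. \<theta> y \<in> ?O}" if "p \<in> ?W \<inter> fst c'" for p
        using that inv by auto
      moreover have "y \<in> (\<psi> \<circ> snd c) ` (?W \<inter> fst c')" if y: "y \<in> \<psi> ` R" "\<theta> y \<in> ?O" for y
      proof -
        obtain p where p: "p \<in> ?W \<inter> fst c'" "\<theta> y = snd c p" using y by auto
        have "\<psi> (\<theta> y) = y" using y(1) inv by auto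
        then have "y = (\<psi> \<circ> snd c) p" using p(2) by simp
        then show ?thesis using p(1) by (rule image_eqI)
      qed
      ultimately show ?thesis by auto
    qed
    have opO: "open {y \<in> \<psi> ` R. \<theta> y \<in> ?O}"
      using continuous_open_preimage[OF smooth_on_continuous[OF sm(3)] sm(2) O]
      by (simp add: vimage_def Int_def)
    have c1: "smooth_on (snd ?u ` (fst ?u \<inter> fst c')) (transition ?u c')"
    proof (rule smooth_on_cong)
      show "open (snd ?u ` (fst ?u \<inter> fst c'))" unfolding iO by (rule opO)
      show "smooth_on (snd ?u ` (fst ?u \<inter> fst c')) (\<lambda>x. transition c c' (\<theta> x))"
        unfolding iO
        by (rule smooth_on_compose[OF opO smooth_on_subset[OF sm(3)] smooth_transition[OF c c']]) auto
      fix y assume "y \<in> snd ?u ` (fst ?u \<inter> fst c')"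
      then obtain p where p: "p \<in> ?W" "p \<in> fst c'" "y = \<psi> (snd c p)" by auto
      then show "transition c c' (\<theta> y) = transition ?u c' y"
        using inv c inv_u[OF p(1)] by (simp add: transition_def)
    qed
    have opc': "open (snd c' ` (fst ?u \<inter> fst c'))"
      using open_image[OF c', of ?W] opW by simp
    have c2: "smooth_on (snd c' ` (fst ?u \<inter> fst c')) (transition c' ?u)"
    proof (rule smooth_on_cong[OF opc'])
      show "smooth_on (snd c' ` (fst ?u \<inter> fst c')) (\<lambda>x. \<psi> (transition c' c x))"
        by (rule smooth_on_compose[OF opc' smooth_on_subset[OF smooth_transition[OF c' c]] sm(1)]) (use c' in auto)
      fix y assume "y \<in> snd c' ` (fst ?u \<inter> fst c')"
      then show "\<psi> (transition c' c y) = transition c' ?u y"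
        by (auto simp: transition_def)
    qed
    show ?thesis unfolding compatible_def using c1 c2 by blast
  qed
  ultimately show ?thesis
    using manifold unfolding smooth_manifold_def by blast
qed

end

section \<open>Charts of the cotangent bundle\<close>

text \<open>Inverse of the pair \<open>base\<close>, \<open>fibre\<close>: the point of an induced
  chart over \<open>x\<close> with covector components \<open>v\<close>.\<close>

definition pack :: "real^'n \<Rightarrow> real^'n \<Rightarrow> real^('n::finite + 'n)" where
  "pack x v = (\<chi> s. case s of Inl i \<Rightarrow> x $ i | Inr i \<Rightarrow> v $ i)"

lemma base_pack[simp]: "base (pack x v) = x" and fibre_pack[simp]: "fibre (pack x v) = v"
  by (simp_all add: base_def fibre_def pack_def vec_eq_iff)

lemma pack_nth[simp]: "pack x v $ Inl i = x $ i" "pack x v $ Inr i = v $ i"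
  by (simp_all add: pack_def)

lemma pack_base_fibre[simp]: "pack (base y) (fibre y) = y"
  unfolding vec_eq_iff by (auto simp: base_def fibre_def pack_def split: sum.split)

lemma pack_eq_iff: "pack x v = pack x' v' \<longleftrightarrow> x = x' \<and> v = v'"
  by (metis base_pack fibre_pack)

lemma bounded_linear_base: "bounded_linear base"
  and bounded_linear_fibre: "bounded_linear fibre"
  by (auto intro!: linear_conv_bounded_linear[THEN iffD1] linearI simp: base_def fibre_def vec_eq_iff)

lemma bounded_linear_pack: "bounded_linear (\<lambda>(x, v). pack x v)"
  by (intro linear_conv_bounded_linear[THEN iffD1] linearI)
    (auto simp: pack_def vec_eq_iff split: sum.split)

lemma continuous_on_pack[continuous_intros]:
  assumes "continuous_on S f" "continuous_on S g"
  shows "continuous_on S (\<lambda>x. pack (f x) (g x))"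
  using bounded_linear.continuous_on[OF bounded_linear_pack continuous_on_Pair[OF assms]] by simp

text \<open>The image is the union, over all fibre values \<open>v\<close>, of the preimages of
  \<open>Y\<close> under the continuous sections \<open>\<lambda>x. pack x v\<close>.\<close>

lemma open_base_image:
  assumes "open Y" shows "open (base ` Y)"
proof -
  have "base ` Y = (\<Union>v. (\<lambda>x. pack x v) -` Y)"
    by (auto simp: image_iff) (metis pack_base_fibre, metis base_pack)
  moreover have "open ((\<lambda>x. pack x v) -` Y)" for v
    by (intro open_vimage assms continuous_on_pack continuous_intros)
  ultimately show ?thesis by auto
qed

lemma open_fibre_slice:
  assumes "open Y" shows "open {v. pack x v \<in> Y}"
proof -
  have "open ((\<lambda>v. pack x v) -` Y)"
    by (intro open_vimage assms continuous_on_pack continuous_intros)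
  then show ?thesis by (simp add: vimage_def)
qed

context smooth_atlas
begin

text \<open>Inverse of reading off components in the chart \<open>c\<close>: the transformation law
  and the default value \<open>0\<close> leave no other covector at \<open>p\<close> with components
  \<open>v\<close>.\<close>

definition cot_lift :: "('a, 'n) chart \<Rightarrow> 'a \<Rightarrow> real^'n \<Rightarrow> ('a, 'n) covec" where
  "cot_lift c p v = (\<lambda>c'. if c' \<in> A \<and> p \<in> fst c' then transpose (jac c' c p) *v v else 0)"

lemma cot_lift_self: "c \<in> A \<Longrightarrow> p \<in> fst c \<Longrightarrow> cot_lift c p v c = v"
  by (simp add: cot_lift_def jac_self)

lemma cot_lift_cotangent:
  assumes "c \<in> A" "p \<in> fst c" shows "(p, cot_lift c p v) \<in> cotangent A"
proof -
  have trans: "transpose (jac c1 c p) *v v = transpose (jac c1 c2 p) *v (transpose (jac c2 c p) *v v)"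
    if "c1 \<in> A" "c2 \<in> A" "p \<in> fst c1 \<inter> fst c2" for c1 c2
    using jac_cocycle[of c1 c2 c p] assms that by (simp only: matrix_vector_mul_assoc matrix_transpose_mul Int_iff)
  have "covector_at A p (cot_lift c p v)"
    unfolding covector_at_def
  proof (intro conjI ballI impI allI)
    fix c1 c2 assume *: "c1 \<in> A" "c2 \<in> A" "p \<in> fst c1 \<inter> fst c2"
    then show "cot_lift c p v c1 = transpose (jac c1 c2 p) *v cot_lift c p v c2"
      using trans[OF *] by (simp add: cot_lift_def del: transpose_matrix_vector)
  next
    fix c' assume "\<not> (c' \<in> A \<and> p \<in> fst c')"
    then show "cot_lift c p v c' = 0" unfolding cot_lift_def by (simp only: if_False)
  qed
  then show ?thesis
    using assms unfolding cotangent_def by blast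
qed

lemma cotangent_transform:
  "\<eta> \<in> cotangent A \<Longrightarrow> c \<in> A \<Longrightarrow> c' \<in> A \<Longrightarrow> fst \<eta> \<in> fst c \<Longrightarrow> fst \<eta> \<in> fst c' \<Longrightarrow>
    snd \<eta> c = transpose (jac c c' (fst \<eta>)) *v snd \<eta> c'"
  unfolding cotangent_def covector_at_def case_prod_beta mem_Collect_eq by blast

lemma cotangent_eq_lift:
  assumes "\<eta> \<in> cotangent A" "c \<in> A" "fst \<eta> \<in> fst c"
  shows "\<eta> = (fst \<eta>, cot_lift c (fst \<eta>) (snd \<eta> c))"
proof -
  have eq: "snd \<eta> c' = cot_lift c (fst \<eta>) (snd \<eta> c) c'" for c'
  proof (cases "c' \<in> A \<and> fst \<eta> \<in> fst c'")
    case True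
    then show ?thesis using cotangent_transform[of \<eta> c' c] assms
      by (simp add: cot_lift_def del: transpose_matrix_vector)
  next
    case False
    have "covector_at A (fst \<eta>) (snd \<eta>)" using assms(1) by (simp add: cotangent_def case_prod_beta)
    then have "snd \<eta> c' = 0" using False unfolding covector_at_def by blast
    then show ?thesis using False unfolding cot_lift_def by (simp only: if_False)
  qed
  show ?thesis
  proof (rule prod_eqI)
    show "snd \<eta> = snd (fst \<eta>, cot_lift c (fst \<eta>) (snd \<eta> c))"
      unfolding snd_conv by (rule ext) (rule eq)
  qed simp
qed

lemma cot_chart_apply: "snd (cot_chart A c) \<eta> = pack (snd c (fst \<eta>)) (snd \<eta> c)"
  by (simp add: cot_chart_def pack_def)

lemma fst_cot_chart: "fst (cot_chart A c) = {\<eta> \<in> cotangent A. fst \<eta> \<in> fst c}"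
  by (simp add: cot_chart_def)

lemma inj_on_cot_chart: 
  assumes "c \<in> A" shows "inj_on (snd (cot_chart A c)) (fst (cot_chart A c))"
proof (rule inj_onI)
  fix \<eta> \<zeta> assume a: "\<eta> \<in> fst (cot_chart A c)" "\<zeta> \<in> fst (cot_chart A c)"
    "snd (cot_chart A c) \<eta> = snd (cot_chart A c) \<zeta>"
  then have "fst \<eta> = fst \<zeta>" "snd \<eta> c = snd \<zeta> c"
    using inj_on_chart[OF assms] by (auto simp: cot_chart_apply fst_cot_chart pack_eq_iff dest: inj_onD)
  then show "\<eta> = \<zeta>" using cotangent_eq_lift[of \<eta> c] cotangent_eq_lift[of \<zeta> c] a assms
    by (simp add: fst_cot_chart)
qed

lemma cot_chart_inv:
  assumes "c \<in> A" "\<eta> \<in> cotangent A" "fst \<eta> \<in> fst c"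
  shows "chart_inv (cot_chart A c) (pack (snd c (fst \<eta>)) (snd \<eta> c)) = \<eta>"
  using inv_into_f_f[OF inj_on_cot_chart[OF assms(1)], of \<eta>] assms
  by (simp add: chart_inv_def fst_cot_chart cot_chart_apply)

lemma cot_chart_inv_pack:
  assumes "c \<in> A" "p \<in> fst c"
  shows "chart_inv (cot_chart A c) (pack (snd c p) v) = (p, cot_lift c p v)"
  using cot_chart_inv[OF assms(1) cot_lift_cotangent[OF assms, of v]] assms by (simp add: cot_lift_self)

lemma cot_img_eq:
  assumes "U \<subseteq> cotangent A"
  shows "cot_img A c U = {pack (snd c (fst \<eta>)) (snd \<eta> c) |\<eta>. \<eta> \<in> U \<and> fst \<eta> \<in> fst c}"
proof -
  have "U \<inter> fst (cot_chart A c) = {\<eta>. \<eta> \<in> U \<and> fst \<eta> \<in> fst c}"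
    using assms by (auto simp: fst_cot_chart)
  then show ?thesis by (simp only: cot_img_def setcompr_eq_image cot_chart_apply[abs_def])
qed

lemma pack_in_cot_img:
  assumes "U \<subseteq> cotangent A" "c \<in> A" "p \<in> fst c"
  shows "pack (snd c p) v \<in> cot_img A c U \<longleftrightarrow> (p, cot_lift c p v) \<in> U"
proof
  assume "pack (snd c p) v \<in> cot_img A c U"
  then obtain \<eta> where \<eta>: "\<eta> \<in> U" "fst \<eta> \<in> fst c" "snd c p = snd c (fst \<eta>)" "v = snd \<eta> c"
    by (auto simp: cot_img_eq[OF assms(1)] pack_eq_iff)
  then have "p = fst \<eta>" using inj_on_chart[OF assms(2)] assms(3) by (auto dest: inj_onD)
  then show "(p, cot_lift c p v) \<in> U"
    using cotangent_eq_lift[of \<eta> c] \<eta> assms by auto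
next
  assume "(p, cot_lift c p v) \<in> U"
  then show "pack (snd c p) v \<in> cot_img A c U"
    unfolding cot_img_eq[OF assms(1)] mem_Collect_eq using assms
    by (intro exI[of _ "(p, cot_lift c p v)"]) (simp add: cot_lift_self)
qed

lemma base_cot_img:
  assumes "U \<subseteq> cotangent A"
  shows "base ` cot_img A c U = snd c ` (fst ` U \<inter> fst c)"
proof -
  have "base ` cot_img A c U = (\<lambda>\<eta>. snd c (fst \<eta>)) ` {\<eta>. \<eta> \<in> U \<and> fst \<eta> \<in> fst c}"
    unfolding cot_img_eq[OF assms] setcompr_eq_image image_image base_pack ..
  also have "\<dots> = snd c ` (fst ` {\<eta>. \<eta> \<in> U \<and> fst \<eta> \<in> fst c})" by (simp only: image_image)
  also have "fst ` {\<eta>. \<eta> \<in> U \<and> fst \<eta> \<in> fst c} = fst ` U \<inter> fst c" by blast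
  finally show ?thesis .
qed

lemma cot_imgE:
  assumes "y \<in> cot_img A c U" "U \<subseteq> cotangent A" "c \<in> A"
  obtains \<eta> where "\<eta> \<in> U" "fst \<eta> \<in> fst c" "y = pack (snd c (fst \<eta>)) (snd \<eta> c)"
    "chart_inv (cot_chart A c) y = \<eta>" "base y \<in> snd c ` fst c" "chart_inv c (base y) = fst \<eta>"
  using assms cot_chart_inv[OF assms(3)] by (auto simp: cot_img_eq[OF assms(2)])

lemma cot_openD:
  assumes "cot_open A U"
  shows "U \<subseteq> cotangent A" "c \<in> A \<Longrightarrow> open (cot_img A c U)"
  using assms by (auto simp: cot_open_def)

lemma openin_base:
  assumes "cot_open A U"
  shows "openin M (fst ` U)"
proof (rule openin_chartwise)
  show "fst ` U \<subseteq> topspace M"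
    using cot_openD(1)[OF assms] Union_charts by (auto simp: cotangent_def)
  show "open (snd c ` (fst ` U \<inter> fst c))" if "c \<in> A" for c
    using open_base_image[OF cot_openD(2)[OF assms that]] base_cot_img[OF cot_openD(1)[OF assms]] by simp
qed

text \<open>Covector and vector components transform by the transposed and the direct Jacobian, so
  their pairing does not depend on the chart that \<open>SOME\<close> picks.\<close>

lemma iota_eq:
  assumes X: "vector_field A V X" and "\<eta> \<in> cotangent A" "fst \<eta> \<in> V" "c \<in> A" "fst \<eta> \<in> fst c"
  shows "iota A X \<eta> = snd \<eta> c \<bullet> X c (snd c (fst \<eta>))"
proof -
  define c' where "c' = (SOME c. c \<in> A \<and> fst \<eta> \<in> fst c)"
  have c': "c' \<in> A" "fst \<eta> \<in> fst c'"
    using someI[of "\<lambda>c. c \<in> A \<and> fst \<eta> \<in> fst c" c] assms unfolding c'_def by auto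
  have "snd \<eta> c \<bullet> X c (snd c (fst \<eta>)) = (transpose (jac c c' (fst \<eta>)) *v snd \<eta> c') \<bullet> X c (snd c (fst \<eta>))"
    using cotangent_transform[of \<eta> c c'] assms c' by simp
  also have "\<dots> = snd \<eta> c' \<bullet> (jac c c' (fst \<eta>) *v X c (snd c (fst \<eta>)))"
    by (simp add: dot_lmul_matrix[symmetric] vector_transpose_matrix)
  also have "\<dots> = snd \<eta> c' \<bullet> X c' (snd c' (fst \<eta>))"
  proof -
    have "X c' (snd c' (fst \<eta>)) = jac c c' (fst \<eta>) *v X c (snd c (fst \<eta>))"
      using X assms c' unfolding vector_field_def by blast
    then show ?thesis by (simp only:)
  qed
  finally show ?thesis by (simp add: iota_def Let_def c'_def[symmetric])
qed

end

lemma matrix_inv_eqI: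
  fixes a b :: "real^'n::finite^'n"
  assumes "b ** a = mat 1"
  shows "matrix_inv a = b"
proof -
  have ab: "a ** b = mat 1" using assms matrix_left_right_inverse by blast
  have "a ** matrix_inv a = mat 1 \<and> matrix_inv a ** a = mat 1"
    unfolding matrix_inv_def by (rule someI[of _ b]) (simp add: ab assms)
  then show ?thesis using assms by (metis matrix_mul_assoc matrix_mul_lid matrix_mul_rid)
qed

section \<open>The Ricci tensor under a conformal change\<close>

lemma cov_coord_nth:
  "cov \<Gamma> (coord_field i) Y x $ k = pd i Y x $ k + (\<Sum>j\<in>UNIV. \<Gamma> x i j k * Y x $ j)"
  by (simp add: cov_def coord_field_def axis_def if_distrib if_distribR cong: if_cong)

lemma cov_coord_coord: "cov \<Gamma> (coord_field i) (coord_field j) = (\<lambda>y. \<chi> k. \<Gamma> y i j k)"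
proof (intro ext iffD2[OF vec_eq_iff] allI)
  fix y k
  have "pd i (coord_field j) y = 0" unfolding coord_field_def by simp
  then show "cov \<Gamma> (coord_field i) (coord_field j) y $ k = (\<chi> k. \<Gamma> y i j k) $ k"
    unfolding cov_coord_nth by (simp add: coord_field_def axis_def if_distrib cong: if_cong)
qed

text \<open>Coordinate fields commute, so the bracket term of the curvature drops out and the
  classical expression in the Christoffel symbols remains, with index order fixed by the convention
  tr(Z \<mapsto> R(Z,X)Y).\<close>

lemma ricci_nth:
  fixes \<Gamma> :: "'n::finite christoffel"
  assumes "\<And>i j k. (\<lambda>y. \<Gamma> y i j k) differentiable (at x)"
  shows "ricci \<Gamma> x $ i $ j =
    (\<Sum>k\<in>UNIV. pd k (\<lambda>y. \<Gamma> y i j k) x) - (\<Sum>k\<in>UNIV. pd i (\<lambda>y. \<Gamma> y k j k) x)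
    + (\<Sum>k\<in>UNIV. \<Sum>l\<in>UNIV. \<Gamma> x k l k * \<Gamma> x i j l) - (\<Sum>k\<in>UNIV. \<Sum>l\<in>UNIV. \<Gamma> x i l k * \<Gamma> x k j l)"
proof -
  have d: "(\<lambda>y. \<chi> k. \<Gamma> y i j k) differentiable (at x)" for i j
    by (rule differentiable_vec_componentwise) (simp add: assms)
  have *: "pd k (\<lambda>y. \<chi> m. \<Gamma> y i j m) x $ m = pd k (\<lambda>y. \<Gamma> y i j m) x" for k i j m
    using pd_component[OF d[of i j], of k m] by simp
  have "lie_bracket (coord_field k) (coord_field i) = (\<lambda>_. 0)" for k i :: 'n
  proof
    fix y have "pd a (coord_field b) y = 0" for a b :: 'n unfolding coord_field_def by simp
    then show "lie_bracket (coord_field k) (coord_field i) y = 0" by (simp add: lie_bracket_def)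
  qed
  moreover have "cov \<Gamma> (\<lambda>_. 0) Z x = 0" for Z by (simp add: cov_def vec_eq_iff)
  ultimately show ?thesis
    by (simp add: ricci_def curvature_def cov_coord_coord cov_coord_nth * sum.distrib sum_subtractf)
qed

text \<open>Tracing B = r g gives r times the dimension, so the factor is determined by the trace.
  Both the Einstein condition and the linear equation have this form, which lets them be compared as
  plain proportionality to the metric.\<close>

lemma proportional_iff_trace:
  fixes g B :: "real^'n::finite^'n"
  assumes "G ** g = mat 1" "matrix_inv g = G"
    and symm: "transpose g = g"
  shows "(\<exists>r. B = r *\<^sub>R g) \<longleftrightarrow> B = (metric_trace g B / real CARD('n)) *\<^sub>R g"
proof
  assume "\<exists>r. B = r *\<^sub>R g"
  then obtain r where r: "B = r *\<^sub>R g" ..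
  have gs: "g $ i $ j = g $ j $ i" for i j 
    using arg_cong[OF symm, of "\<lambda>m. m $ i $ j"] by (simp add: transpose_def)
  have "metric_trace g B = (\<Sum>i\<in>UNIV. r * (\<Sum>j\<in>UNIV. G $ i $ j * g $ j $ i))"
    unfolding metric_trace_def r assms(2) by (simp add: sum_distrib_left gs mult_ac)
  also have "(\<lambda>i. \<Sum>j\<in>UNIV. G $ i $ j * g $ j $ i) = (\<lambda>i. (G ** g) $ i $ i)"
    by (simp add: matrix_matrix_mult_def)
  finally have "metric_trace g B = r * real CARD('n)" by (simp add: assms(1) mat_def)
  then show "B = (metric_trace g B / real CARD('n)) *\<^sub>R g" using r by simp
qed blast

text \<open>The inverse is a smooth field \<open>G\<close> of its own: for the metrics of interest
  it has an explicit formula, from which its smoothness is read off.\<close>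

locale local_metric =
  fixes S :: "(real^'n::finite) set" and g G :: "real^'n \<Rightarrow> real^'n^'n"
  assumes open_S: "open S" and smooth_g: "smooth_on S g" and smooth_G: "smooth_on S G"
    and g_sym: "\<And>y. y \<in> S \<Longrightarrow> g y $ i $ j = g y $ j $ i"
    and G_sym: "\<And>y. y \<in> S \<Longrightarrow> G y $ i $ j = G y $ j $ i"
    and G_inv: "\<And>y. y \<in> S \<Longrightarrow> G y ** g y = mat 1"
begin

abbreviation "\<Gamma> \<equiv> levi_civita g"

lemma matrix_inv_g: "y \<in> S \<Longrightarrow> matrix_inv (g y) = G y"
  by (rule matrix_inv_eqI[OF G_inv])

lemma inv_sum: "y \<in> S \<Longrightarrow> (\<Sum>k\<in>UNIV. G y $ i $ k * g y $ k $ j) = (if i = j then 1 else 0)"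
  using arg_cong[OF G_inv, of y "\<lambda>m. m $ i $ j"] by (simp add: matrix_matrix_mult_def mat_def)

lemma inv_sum': "y \<in> S \<Longrightarrow> (\<Sum>k\<in>UNIV. g y $ i $ k * G y $ k $ j) = (if i = j then 1 else 0)"
  using inv_sum[of y j i] g_sym G_sym by (simp add: mult.commute eq_commute)

lemma smooth_g_nth: "smooth_on S (\<lambda>y. g y $ i $ j)"
  and smooth_G_nth: "smooth_on S (\<lambda>y. G y $ i $ j)"
  by (intro smooth_on_nth open_S smooth_g smooth_G)+

lemma smooth_levi_civita: "smooth_on S (\<lambda>y. \<Gamma> y i j k)"
proof (rule smooth_on_cong[OF open_S])
  show "smooth_on S (\<lambda>y. \<Sum>l\<in>UNIV. (1/2) * G y $ k $ l *
     (pd i (\<lambda>y. g y $ j $ l) y + pd j (\<lambda>y. g y $ i $ l) y - pd l (\<lambda>y. g y $ i $ j) y))"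
    by (intro smooth_on_sum smooth_on_mult smooth_on_const smooth_on_add smooth_on_diff
        smooth_G_nth smooth_on_pd[OF smooth_g_nth] open_S)
qed (simp add: levi_civita_def matrix_inv_g)

lemma levi_civita_sym: "y \<in> S \<Longrightarrow> \<Gamma> y i j k = \<Gamma> y j i k"
proof -
  assume "y \<in> S"
  then have "pd l (\<lambda>y. g y $ i $ j) y = pd l (\<lambda>y. g y $ j $ i) y" for l
    by (intro pd_cong[OF open_S] g_sym)
  then show ?thesis unfolding levi_civita_def by (simp add: add.commute)
qed

lemma levi_civita_lowered:
  assumes "y \<in> S"
  shows "(\<Sum>k\<in>UNIV. g y $ m $ k * \<Gamma> y i j k) =
    (pd i (\<lambda>y. g y $ j $ m) y + pd j (\<lambda>y. g y $ i $ m) y - pd m (\<lambda>y. g y $ i $ j) y) / 2"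
proof -
  let ?L = "\<lambda>l. pd i (\<lambda>y. g y $ j $ l) y + pd j (\<lambda>y. g y $ i $ l) y - pd l (\<lambda>y. g y $ i $ j) y"
  have "(\<Sum>k\<in>UNIV. g y $ m $ k * \<Gamma> y i j k) = (\<Sum>k\<in>UNIV. \<Sum>l\<in>UNIV. g y $ m $ k * G y $ k $ l * (?L l / 2))"
    by (simp add: levi_civita_def matrix_inv_g[OF assms] sum_distrib_left mult_ac)
  also have "\<dots> = (\<Sum>l\<in>UNIV. (\<Sum>k\<in>UNIV. g y $ m $ k * G y $ k $ l) * (?L l / 2))"
    by (subst sum.swap) (simp only: sum_distrib_right)
  also have "\<dots> = ?L m / 2"
    by (simp add: inv_sum'[OF assms] if_distrib if_distribR cong: if_cong)
  finally show ?thesis .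
qed

text \<open>Sum of two lowered Christoffel symbols; by symmetry of \<open>g\<close> the remaining
  derivatives cancel in pairs.\<close>

lemma metric_compatible:
  assumes "y \<in> S"
  shows "pd k (\<lambda>y. g y $ i $ j) y =
    (\<Sum>m\<in>UNIV. g y $ j $ m * \<Gamma> y k i m) + (\<Sum>m\<in>UNIV. g y $ i $ m * \<Gamma> y k j m)"
proof -
  have "pd l (\<lambda>y. g y $ i $ j) y = pd l (\<lambda>y. g y $ j $ i) y" for l i j
    using assms by (intro pd_cong[OF open_S] g_sym)
  then show ?thesis unfolding levi_civita_lowered[OF assms]
    by (simp add: field_simps)
qed

section \<open>The metric f^(-2) g for a positive function f\<close>

context
  fixes f :: "real^'n \<Rightarrow> real"
  assumes smooth_f: "smooth_on S f" and f_pos: "\<And>y. y \<in> S \<Longrightarrow> f y > 0"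
begin

text \<open>\<open>p\<close> is the differential of log f, \<open>P\<close> its gradient with
  respect to \<open>g\<close>, and \<open>C\<close> the tensor by which the Levi-Civita connection
  of f^(-2) g differs from that of \<open>g\<close>.\<close>

definition p :: "'n \<Rightarrow> real^'n \<Rightarrow> real" where "p i y = pd i f y / f y"
definition P :: "'n \<Rightarrow> real^'n \<Rightarrow> real" where "P k y = (\<Sum>l\<in>UNIV. G y $ k $ l * p l y)"
definition C :: "'n \<Rightarrow> 'n \<Rightarrow> 'n \<Rightarrow> real^'n \<Rightarrow> real" where
  "C i j k y = g y $ i $ j * P k y - (if i = k then p j y else 0) - (if j = k then p i y else 0)"

lemma smooth_p: "smooth_on S (p i)"
  unfolding p_def[abs_def] using f_pos
  by (intro smooth_on_divide open_S smooth_on_pd smooth_f) (metis less_irrefl)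

lemma smooth_P: "smooth_on S (P k)"
  unfolding P_def[abs_def] by (intro smooth_on_sum smooth_on_mult open_S smooth_p smooth_G_nth)

lemma smooth_C: "smooth_on S (C i j k)"
proof -
  have "smooth_on S (\<lambda>y. if b then p l y else 0)" for b l
    by (cases b) (simp_all add: smooth_p smooth_on_const)
  then show ?thesis unfolding C_def[abs_def]
    by (intro smooth_on_diff smooth_on_mult open_S smooth_P smooth_g_nth)
qed

lemma lower_P: "y \<in> S \<Longrightarrow> (\<Sum>k\<in>UNIV. g y $ j $ k * P k y) = p j y"
proof -
  assume y: "y \<in> S"
  have "(\<Sum>k\<in>UNIV. g y $ j $ k * P k y) = (\<Sum>k\<in>UNIV. \<Sum>l\<in>UNIV. g y $ j $ k * G y $ k $ l * p l y)"
    by (simp add: P_def sum_distrib_left mult_ac)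
  also have "\<dots> = (\<Sum>l\<in>UNIV. (\<Sum>k\<in>UNIV. g y $ j $ k * G y $ k $ l) * p l y)"
    by (subst sum.swap) (simp add: sum_distrib_right)
  also have "\<dots> = p j y"
    by (simp add: inv_sum'[OF y] if_distrib if_distribR cong: if_cong)
  finally show ?thesis .
qed

lemma lower_P': "y \<in> S \<Longrightarrow> (\<Sum>k\<in>UNIV. g y $ k $ j * P k y) = p j y"
  using lower_P[of y j] g_sym by simp

text \<open>A derivative of f^(-2) g is f^(-2) times the derivative of \<open>g\<close> minus 2
  \<open>p\<close> \<open>g\<close>; the factor cancels against the one of the inverse metric, and
  the extra terms assemble to \<open>C\<close>.\<close>

lemma levi_civita_conformal:
  assumes y: "y \<in> S"
  shows "levi_civita (\<lambda>z. (1 / (f z)\<^sup>2) *\<^sub>R g z) y i j k = \<Gamma> y i j k + C i j k y"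
proof -
  have fy: "f y \<noteq> 0" using f_pos[OF y] by simp
  have inv: "matrix_inv ((1 / (f y)\<^sup>2) *\<^sub>R g y) = (f y)\<^sup>2 *\<^sub>R G y"
  proof -
    have "((f y)\<^sup>2 *\<^sub>R G y) ** ((1 / (f y)\<^sup>2) *\<^sub>R g y) = mat 1"
      using G_inv[OF y] fy
      by (simp add: vec_eq_iff matrix_matrix_mult_def mult_ac)
    then show ?thesis by (rule matrix_inv_eqI)
  qed
  have d: "pd a (\<lambda>z. ((1 / (f z)\<^sup>2) *\<^sub>R g z) $ b $ c) y =
      1 / (f y)\<^sup>2 * (pd a (\<lambda>z. g z $ b $ c) y - 2 * p a y * g y $ b $ c)" for a b c
  proof -
    have e: "((\<lambda>z. (1 / (f z)\<^sup>2)) has_derivative (\<lambda>v. - 2 / (f y)^3 * (\<Sum>i\<in>UNIV. v $ i *\<^sub>R pd i f y))) (at y)"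
      using has_derivative_pd[OF smooth_on_differentiable[OF smooth_f y]] fy
      by (auto intro!: derivative_eq_intros simp: field_simps power2_eq_square power3_eq_cube)
    have m: "pd a (\<lambda>z. (1 / (f z)\<^sup>2) * g z $ b $ c) y =
      1 / (f y)\<^sup>2 * pd a (\<lambda>z. g z $ b $ c) y + pd a (\<lambda>z. 1 / (f z)\<^sup>2) y * g y $ b $ c"
      by (rule pd_mult) (use has_derivative_imp_differentiable[OF e] smooth_on_differentiable[OF smooth_g_nth y] in auto)
    have n: "pd a (\<lambda>z. 1 / (f z)\<^sup>2) y = - 2 / (f y)^3 * pd a f y"
      by (subst pd_eqI[OF e]) (simp add: axis_def if_distrib if_distribR cong: if_cong)
    show ?thesis unfolding vector_scaleR_component real_scaleR_def m n p_def
      using fy by (simp add: field_simps power2_eq_square power3_eq_cube)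
  qed
  have "levi_civita (\<lambda>z. (1 / (f z)\<^sup>2) *\<^sub>R g z) y i j k =
     (\<Sum>l\<in>UNIV. 1/2 * G y $ k $ l * (pd i (\<lambda>y. g y $ j $ l) y + pd j (\<lambda>y. g y $ i $ l) y - pd l (\<lambda>y. g y $ i $ j) y)
       + (G y $ k $ l * p l y) * g y $ i $ j - p i y * (G y $ k $ l * g y $ j $ l) - p j y * (G y $ k $ l * g y $ i $ l))"
    unfolding levi_civita_def inv d
    by (rule sum.cong) (use fy in \<open>auto simp: field_simps power2_eq_square\<close>)
  also have "\<dots> = \<Gamma> y i j k + P k y * g y $ i $ j - p i y * (\<Sum>l\<in>UNIV. G y $ k $ l * g y $ j $ l)
      - p j y * (\<Sum>l\<in>UNIV. G y $ k $ l * g y $ i $ l)"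
    by (simp add: sum.distrib sum_subtractf levi_civita_def matrix_inv_g[OF y] P_def sum_distrib_left sum_distrib_right)
  finally have *: "levi_civita (\<lambda>z. (1 / (f z)\<^sup>2) *\<^sub>R g z) y i j k = \<dots>" .
  have "(\<Sum>l\<in>UNIV. G y $ k $ l * g y $ a $ l) = (if k = a then 1 else 0)" for a
    using inv_sum[OF y, of k a] g_sym[OF y] by simp
  then show ?thesis unfolding * by (auto simp: C_def)
qed

lemma sum_C:
  assumes "y \<in> S"
  shows "(\<Sum>k\<in>UNIV. C k j k y) = - real CARD('n) * p j y"
  using lower_P'[OF assms, of j] by (simp add: C_def sum_subtractf)

text \<open>The divergence of \<open>P\<close>, corrected by a multiple of the squared norm of
  \<open>p\<close>: it collects all terms of the conformal change that are proportional to
  \<open>g\<close>.\<close>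

definition \<sigma> :: "real^'n \<Rightarrow> real" where
  "\<sigma> y = (\<Sum>k\<in>UNIV. pd k (P k) y) + (\<Sum>k\<in>UNIV. \<Sum>l\<in>UNIV. \<Gamma> y k l k * P l y)
     - (real CARD('n) - 2) * (\<Sum>k\<in>UNIV. p k y * P k y)"

text \<open>The connection \<Gamma> + C is inserted into the coordinate formula for the Ricci
  tensor. Derivatives of \<open>g\<close> are traded for Christoffel symbols by metric
  compatibility, and the derivatives of \<open>p\<close> combine with the products of
  \<open>p\<close> into the Hessian of \<open>f\<close>.\<close>

lemma ricci_conformal:
  assumes y: "y \<in> S"
  shows "ricci (levi_civita (\<lambda>z. (1 / (f z)\<^sup>2) *\<^sub>R g z)) y $ i $ j =
    ricci \<Gamma> y $ i $ j + (real CARD('n) - 2) / f y * hessian \<Gamma> f y $ i $ j + \<sigma> y * g y $ i $ j"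
proof -
  let ?L = "levi_civita (\<lambda>z. (1 / (f z)\<^sup>2) *\<^sub>R g z)" and ?n = "real CARD('n)"
  have dG: "(\<lambda>y. \<Gamma> y i j k) differentiable (at y)" for i j k
    by (rule smooth_on_differentiable[OF smooth_levi_civita y])
  have dC: "C i j k differentiable (at y)" for i j k
    by (rule smooth_on_differentiable[OF smooth_C y])
  have dL: "(\<lambda>y. ?L y i j k) differentiable (at y)" for i j k
    by (rule differentiable_cong[OF open_S y, of "\<lambda>y. \<Gamma> y i j k + C i j k y"])
      (use levi_civita_conformal dG dC in auto)
  have pdL: "pd a (\<lambda>y. ?L y i j k) y = pd a (\<lambda>y. \<Gamma> y i j k) y + pd a (C i j k) y" for a i j k
  proof -
    have "pd a (\<lambda>y. ?L y i j k) y = pd a (\<lambda>y. \<Gamma> y i j k + C i j k y) y"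
      by (rule pd_cong[OF open_S y]) (rule levi_civita_conformal)
    then show ?thesis using pd_add[OF dG dC] by simp
  qed
  have dp: "p a differentiable (at y)" "P a differentiable (at y)" "(\<lambda>y. g y $ a $ b) differentiable (at y)" for a b
    using smooth_on_differentiable[OF _ y] smooth_p smooth_P smooth_g_nth by blast+
  have pdC: "pd a (C i j k) y = pd a (\<lambda>y. g y $ i $ j) y * P k y + g y $ i $ j * pd a (P k) y
      - (if i = k then pd a (p j) y else 0) - (if j = k then pd a (p i) y else 0)" for a i j k
  proof -
    have e: "pd a (\<lambda>y. if b then p l y else 0) y = (if b then pd a (p l) y else 0)" for b l by simp
    have d: "(\<lambda>y. if b then p l y else 0) differentiable (at y)" for b l
      by (cases b) (simp_all add: dp)
    show ?thesis unfolding C_def[abs_def]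
      by (simp add: pd_diff pd_mult e d dp eta_contract_eq)
  qed
  have a1: "(\<Sum>k\<in>UNIV. pd k (C i j k) y) = (\<Sum>k\<in>UNIV. pd k (\<lambda>y. g y $ i $ j) y * P k y)
      + g y $ i $ j * (\<Sum>k\<in>UNIV. pd k (P k) y) - pd i (p j) y - pd j (p i) y"
    by (simp add: pdC sum.distrib sum_subtractf sum_distrib_left)
  have a2: "(\<Sum>k\<in>UNIV. pd i (C k j k) y) = - ?n * pd i (p j) y"
  proof -
    have "(\<Sum>k\<in>UNIV. pd i (C k j k) y) = pd i (\<lambda>y. \<Sum>k\<in>UNIV. C k j k y) y"
      by (rule pd_sum[symmetric]) (rule dC)
    also have "\<dots> = pd i (\<lambda>y. - ?n * p j y) y"
      by (rule pd_cong[OF open_S y]) (rule sum_C)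
    also have "\<dots> = - ?n * pd i (p j) y" by (rule pd_cmult) (rule dp)
    finally show ?thesis .
  qed
  have mC: "c * C i j k y = c * (g y $ i $ j * P k y) - (if i = k then c * p j y else 0)
      - (if j = k then c * p i y else 0)" for c i j k
    by (simp add: C_def right_diff_distrib)
  then have Cm: "C i j k y * c = c * (g y $ i $ j * P k y) - (if i = k then c * p j y else 0)
      - (if j = k then c * p i y else 0)" for c i j k
    by (simp add: mult.commute)
  have tr: "(\<Sum>k\<in>UNIV. \<Sum>l\<in>UNIV. C k l k y * X l) = - ?n * (\<Sum>l\<in>UNIV. p l y * X l)" for X
  proof -
    have "(\<Sum>k\<in>UNIV. \<Sum>l\<in>UNIV. C k l k y * X l) = (\<Sum>l\<in>UNIV. (\<Sum>k\<in>UNIV. C k l k y) * X l)"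
      by (subst sum.swap) (simp only: sum_distrib_right)
    also have "\<dots> = - ?n * (\<Sum>l\<in>UNIV. p l y * X l)"
      unfolding sum_C[OF y] sum_distrib_left by (simp only: mult.assoc)
    finally show ?thesis .
  qed
  \<comment> \<open>Contractions of \<open>C\<close> with an arbitrary array \<open>X\<close>,
    because they serve both the mixed products with Christoffel symbols and the products of
    \<open>C\<close> with itself.\<close>
  have t1: "(\<Sum>k\<in>UNIV. \<Sum>l\<in>UNIV. X k l * C i j l y) = g y $ i $ j * (\<Sum>k\<in>UNIV. \<Sum>l\<in>UNIV. X k l * P l y)
      - p j y * (\<Sum>k\<in>UNIV. X k i) - p i y * (\<Sum>k\<in>UNIV. X k j)" for X :: "'n \<Rightarrow> 'n \<Rightarrow> real"
    by (simp add: mC sum_subtractf sum_distrib_left mult_ac)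
  have t2: "(\<Sum>k\<in>UNIV. \<Sum>l\<in>UNIV. X l k * C k j l y) = (\<Sum>k\<in>UNIV. \<Sum>l\<in>UNIV. X l k * g y $ k $ j * P l y)
      - p j y * (\<Sum>k\<in>UNIV. X k k) - (\<Sum>k\<in>UNIV. X j k * p k y)" for X :: "'n \<Rightarrow> 'n \<Rightarrow> real"
    by (simp add: mC sum_subtractf sum_distrib_left mult_ac)
  have t3: "(\<Sum>k\<in>UNIV. \<Sum>l\<in>UNIV. C i l k y * X l k) = (\<Sum>k\<in>UNIV. \<Sum>l\<in>UNIV. g y $ i $ l * P k y * X l k)
      - (\<Sum>l\<in>UNIV. p l y * X l i) - p i y * (\<Sum>l\<in>UNIV. X l l)" for X :: "'n \<Rightarrow> 'n \<Rightarrow> real"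
  proof -
    have "(\<Sum>k\<in>UNIV. \<Sum>l\<in>UNIV. if i = k then X l k * p l y else 0) = (\<Sum>l\<in>UNIV. p l y * X l i)"
      by (subst sum.swap) (simp add: mult.commute)
    then show ?thesis
      by (simp only: Cm sum_subtractf) (simp add: sum_distrib_left mult_ac)
  qed
  \<comment> \<open>The derivative of \<open>g\<close> contained in the divergence of
    \<open>C\<close> becomes two contractions with Christoffel symbols, which cancel against those
    produced by \<open>t2\<close> and \<open>t3\<close>.\<close>
  have comp: "(\<Sum>k\<in>UNIV. pd k (\<lambda>y. g y $ i $ j) y * P k y) =
      (\<Sum>k\<in>UNIV. \<Sum>l\<in>UNIV. \<Gamma> y i l k * g y $ k $ j * P l y) + (\<Sum>k\<in>UNIV. \<Sum>l\<in>UNIV. g y $ i $ l * P k y * \<Gamma> y k j l)"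
  proof -
    have "(\<Sum>k\<in>UNIV. pd k (\<lambda>y. g y $ i $ j) y * P k y) =
        (\<Sum>k\<in>UNIV. \<Sum>l\<in>UNIV. g y $ j $ l * \<Gamma> y k i l * P k y)
        + (\<Sum>k\<in>UNIV. \<Sum>l\<in>UNIV. g y $ i $ l * \<Gamma> y k j l * P k y)"
      by (simp add: metric_compatible[OF y] distrib_right sum.distrib sum_distrib_right)
    also have "(\<Sum>k\<in>UNIV. \<Sum>l\<in>UNIV. g y $ j $ l * \<Gamma> y k i l * P k y) =
        (\<Sum>k\<in>UNIV. \<Sum>l\<in>UNIV. \<Gamma> y i l k * g y $ k $ j * P l y)"
      by (subst sum.swap) (simp add: g_sym[OF y, of j] levi_civita_sym[OF y, of _ i] mult_ac)
    finally show ?thesis by (simp add: mult_ac)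
  qed
  let ?pp = "\<Sum>k\<in>UNIV. p k y * P k y"
  have Cp: "(\<Sum>k\<in>UNIV. p k y * C i j k y) = g y $ i $ j * ?pp - 2 * p i y * p j y"
    by (simp add: mC sum_subtractf sum_distrib_left mult_ac)
  have Csym: "C i j k y = C j i k y" for i j k unfolding C_def using g_sym[OF y, of i j] by simp
  \<comment> \<open>The quadratic term is \<open>t2\<close> with \<open>t3\<close> applied inside
    it; the squared norm appears because lowering the index of \<open>P\<close> gives back
    \<open>p\<close>.\<close>
  have CC: "(\<Sum>k\<in>UNIV. \<Sum>l\<in>UNIV. C i l k y * C k j l y) = (?n + 2) * (p i y * p j y) - 2 * g y $ i $ j * ?pp"
  proof -
    have 1: "(\<Sum>k\<in>UNIV. \<Sum>l\<in>UNIV. C i l k y * (g y $ k $ j * P l y)) = - g y $ i $ j * ?pp"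
    proof -
      have "(\<Sum>k\<in>UNIV. \<Sum>l\<in>UNIV. g y $ i $ l * P k y * (g y $ k $ j * P l y))
          = (\<Sum>k\<in>UNIV. g y $ k $ j * P k y) * (\<Sum>l\<in>UNIV. g y $ i $ l * P l y)"
        unfolding sum_product by (simp add: mult_ac)
      moreover have "(\<Sum>l\<in>UNIV. p l y * (g y $ i $ j * P l y)) = g y $ i $ j * ?pp"
        by (simp add: sum_distrib_left mult_ac)
      ultimately show ?thesis
        unfolding t3[of "\<lambda>l k. g y $ k $ j * P l y"] by (simp add: lower_P[OF y] lower_P'[OF y])
    qed
    have 2: "(\<Sum>k\<in>UNIV. C i k k y) = - ?n * p i y"
      using sum_C[OF y, of i] by (simp add: Csym)
    have 3: "(\<Sum>k\<in>UNIV. C i j k y * p k y) = g y $ i $ j * ?pp - 2 * p i y * p j y"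
      using Cp by (simp add: mult.commute)
    show ?thesis
      using t2[of "\<lambda>l k. C i l k y"] unfolding 2 3 using 1 by (simp add: algebra_simps)
  qed
  have hess: "hessian \<Gamma> f y $ i $ j = f y * (pd i (p j) y + p i y * p j y - (\<Sum>k\<in>UNIV. p k y * \<Gamma> y i j k))"
    and psym: "pd j (p i) y = pd i (p j) y"
  proof -
    have fy: "f y > 0" using f_pos[OF y] .
    \<comment> \<open>Differentiating df = f p once more expresses the Hessian of \<open>f\<close>
      through \<open>p\<close>; symmetry of the second derivatives of \<open>f\<close> then makes
      the derivatives of \<open>p\<close> symmetric.\<close>
    have pf: "pd k f z = f z * p k z" if "z \<in> S" for k z using f_pos[OF that] by (simp add: p_def)
    have "pd a (pd b f) y = pd a (\<lambda>z. f z * p b z) y" for a b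
      by (rule pd_cong[OF open_S y]) (rule pf)
    also have "pd a (\<lambda>z. f z * p b z) y = f y * pd a (p b) y + pd a f y * p b y" for a b
      by (rule pd_mult) (rule smooth_on_differentiable[OF smooth_f y] dp)+
    finally have *: "pd a (pd b f) y = f y * (pd a (p b) y + p a y * p b y)" for a b
      by (simp add: pf[OF y] algebra_simps)
    then show "hessian \<Gamma> f y $ i $ j = f y * (pd i (p j) y + p i y * p j y - (\<Sum>k\<in>UNIV. p k y * \<Gamma> y i j k))"
      by (simp add: hessian_def pf[OF y] right_diff_distrib sum_distrib_left mult_ac)
    have "pd i (pd j f) y = pd j (pd i f) y" by (rule pd_commute[OF open_S y smooth_f])
    then show "pd j (p i) y = pd i (p j) y" unfolding * using fy by simp
  qed
  have "f y \<noteq> 0" using f_pos[OF y] by simp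
  then have hess': "(?n - 2) / f y * hessian \<Gamma> f y $ i $ j =
      (?n - 2) * (pd i (p j) y + p i y * p j y - (\<Sum>k\<in>UNIV. p k y * \<Gamma> y i j k))"
    unfolding hess by simp
  have e1: "(\<Sum>k\<in>UNIV. \<Sum>l\<in>UNIV. (\<Gamma> y k l k + C k l k y) * (\<Gamma> y i j l + C i j l y)) =
      (\<Sum>k\<in>UNIV. \<Sum>l\<in>UNIV. \<Gamma> y k l k * \<Gamma> y i j l) + (\<Sum>k\<in>UNIV. \<Sum>l\<in>UNIV. \<Gamma> y k l k * C i j l y)
      + (\<Sum>k\<in>UNIV. \<Sum>l\<in>UNIV. C k l k y * \<Gamma> y i j l) + (\<Sum>k\<in>UNIV. \<Sum>l\<in>UNIV. C k l k y * C i j l y)"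
    by (simp add: algebra_simps sum.distrib)
  have e2: "(\<Sum>k\<in>UNIV. \<Sum>l\<in>UNIV. (\<Gamma> y i l k + C i l k y) * (\<Gamma> y k j l + C k j l y)) =
      (\<Sum>k\<in>UNIV. \<Sum>l\<in>UNIV. \<Gamma> y i l k * \<Gamma> y k j l) + (\<Sum>k\<in>UNIV. \<Sum>l\<in>UNIV. \<Gamma> y i l k * C k j l y)
      + (\<Sum>k\<in>UNIV. \<Sum>l\<in>UNIV. C i l k y * \<Gamma> y k j l) + (\<Sum>k\<in>UNIV. \<Sum>l\<in>UNIV. C i l k y * C k j l y)"
    by (simp add: algebra_simps sum.distrib)
  have trG: "(\<Sum>k\<in>UNIV. \<Gamma> y i k k) = (\<Sum>k\<in>UNIV. \<Gamma> y k i k)"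
    using levi_civita_sym[OF y, of i] by simp
  have com: "(\<Sum>k\<in>UNIV. \<Gamma> y i j k * p k y) = (\<Sum>k\<in>UNIV. p k y * \<Gamma> y i j k)"
    by (simp add: mult.commute)
  show ?thesis
    unfolding ricci_nth[OF dL] ricci_nth[OF dG] hess' levi_civita_conformal[OF y] pdL sum.distrib a1 a2
      e1 e2 t1 t2[of "\<lambda>l k. \<Gamma> y i l k"] t3[of "\<lambda>l k. \<Gamma> y k j l"] CC tr Cp \<sigma>_def comp psym trG com
    by (simp add: sum_C[OF y] algebra_simps)
qed

text \<open>In dimension four the coefficient n - 2 is 2, so f times the new Ricci tensor is 2 Hes f
  + f \<rho> up to a multiple of \<open>g\<close>. Both sides thus say that 2 Hes f + f \<rho> is
  proportional to \<open>g\<close>.\<close>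

lemma einstein_conformal_iff:
  assumes y: "y \<in> S" and n: "CARD('n) = 4"
  shows "einstein_at (\<lambda>z. (1 / (f z)\<^sup>2) *\<^sub>R g z) y \<longleftrightarrow> conf_einstein_eq_at g f y"
proof -
  let ?g = "\<lambda>z. (1 / (f z)\<^sup>2) *\<^sub>R g z" and ?B = "2 *\<^sub>R hessian \<Gamma> f y + f y *\<^sub>R ricci \<Gamma> y"
  have fy: "f y > 0" using f_pos[OF y] .
  have sym: "transpose (g y) = g y" by (simp add: vec_eq_iff transpose_def g_sym[OF y])
  have inv: "((f y)\<^sup>2 *\<^sub>R G y) ** ?g y = mat 1"
    using G_inv[OF y] fy by (simp add: vec_eq_iff matrix_matrix_mult_def mult_ac)
  have symg: "transpose (?g y) = ?g y" using g_sym[OF y] by (simp add: vec_eq_iff transpose_def)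
  have "einstein_at ?g y \<longleftrightarrow> (\<exists>r. ricci (levi_civita ?g) y = r *\<^sub>R ?g y)"
    unfolding einstein_at_def scalar_curvature_def
    using proportional_iff_trace[OF inv matrix_inv_eqI[OF inv] symg] by simp
  also have "\<dots> \<longleftrightarrow> (\<exists>r. ?B = r *\<^sub>R g y)"
  proof
    assume "\<exists>r. ricci (levi_civita ?g) y = r *\<^sub>R ?g y"
    then obtain r where r: "ricci (levi_civita ?g) y = r *\<^sub>R ?g y" ..
    have "?B $ i $ j = (f y * (r / (f y)\<^sup>2 - \<sigma> y)) * g y $ i $ j" for i j
    proof -
      have eq: "r * (1 / (f y)\<^sup>2 * g y $ i $ j) = ricci \<Gamma> y $ i $ j + 2 / f y * hessian \<Gamma> f y $ i $ j + \<sigma> y * g y $ i $ j"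
        using ricci_conformal[OF y, of i j] unfolding r n by simp
      have "f y * (r * (1 / (f y)\<^sup>2 * g y $ i $ j)) =
          2 * hessian \<Gamma> f y $ i $ j + f y * ricci \<Gamma> y $ i $ j + f y * \<sigma> y * g y $ i $ j"
        unfolding eq using fy by (simp add: algebra_simps)
      then show ?thesis by (simp add: algebra_simps)
    qed
    then have "?B = (f y * (r / (f y)\<^sup>2 - \<sigma> y)) *\<^sub>R g y" by (simp add: vec_eq_iff)
    then show "\<exists>r. ?B = r *\<^sub>R g y" by blast
  next
    assume "\<exists>r. ?B = r *\<^sub>R g y"
    then obtain r where *: "?B = r *\<^sub>R g y" ..
    have r: "2 * hessian \<Gamma> f y $ i $ j + f y * ricci \<Gamma> y $ i $ j = r * g y $ i $ j" for i j
      using arg_cong[OF *, of "\<lambda>m. m $ i $ j"] by simp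
    have "ricci (levi_civita ?g) y $ i $ j = ((r / f y + \<sigma> y) * (f y)\<^sup>2) * ?g y $ i $ j" for i j
    proof -
      have "ricci (levi_civita ?g) y $ i $ j
          = (2 * hessian \<Gamma> f y $ i $ j + f y * ricci \<Gamma> y $ i $ j) / f y + \<sigma> y * g y $ i $ j"
        using ricci_conformal[OF y, of i j] fy unfolding n by (simp add: field_simps)
      then show ?thesis unfolding r using fy by (simp add: field_simps power2_eq_square)
    qed
    then have "ricci (levi_civita ?g) y = ((r / f y + \<sigma> y) * (f y)\<^sup>2) *\<^sub>R ?g y"
      by (simp add: vec_eq_iff)
    then show "\<exists>r. ricci (levi_civita ?g) y = r *\<^sub>R ?g y" by blast
  qed
  also have "\<dots> \<longleftrightarrow> conf_einstein_eq_at g f y"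
  proof -
    have "metric_trace (g y) ?B = 2 * laplacian g f y + f y * scalar_curvature g y"
      by (simp add: metric_trace_def laplacian_def scalar_curvature_def algebra_simps sum.distrib sum_distrib_left)
    then show ?thesis
      unfolding conf_einstein_eq_at_def proportional_iff_trace[OF G_inv[OF y] matrix_inv_g[OF y] sym] n
      by simp
  qed
  finally show ?thesis .
qed

end

end

section \<open>Walker metrics\<close>

text \<open>The metric 2 dx^i o dx_i' + w_ij dx^i o dx^j with null fibres. Leaving \<open>w\<close>
  arbitrary separates the curvature calculation from the particular dependence of \<open>w\<close>
  on the fibre coordinates.\<close>

definition walker :: "(real^('n::finite + 'n) \<Rightarrow> real^'n^'n) \<Rightarrow> real^('n + 'n) \<Rightarrow> real^('n + 'n)^('n + 'n)" where
  "walker w y = (\<chi> s t. case s of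
      Inl i \<Rightarrow> (case t of Inl j \<Rightarrow> w y $ i $ j | Inr j \<Rightarrow> if i = j then 1 else 0)
    | Inr i \<Rightarrow> (case t of Inl j \<Rightarrow> if i = j then 1 else 0 | Inr j \<Rightarrow> 0))"

definition walker_inv :: "(real^('n::finite + 'n) \<Rightarrow> real^'n^'n) \<Rightarrow> real^('n + 'n) \<Rightarrow> real^('n + 'n)^('n + 'n)" where
  "walker_inv w y = (\<chi> s t. case s of
      Inl i \<Rightarrow> (case t of Inl j \<Rightarrow> 0 | Inr j \<Rightarrow> if i = j then 1 else 0)
    | Inr i \<Rightarrow> (case t of Inl j \<Rightarrow> if i = j then 1 else 0 | Inr j \<Rightarrow> - w y $ i $ j))"

lemma walker_nth[simp]:
  "walker w y $ Inl i $ Inl j = w y $ i $ j" "walker w y $ Inl i $ Inr j = (if i = j then 1 else 0)"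
  "walker w y $ Inr i $ Inl j = (if i = j then 1 else 0)" "walker w y $ Inr i $ Inr j = 0"
  by (simp_all add: walker_def)

lemma walker_inv_nth[simp]:
  "walker_inv w y $ Inl i $ Inl j = 0" "walker_inv w y $ Inl i $ Inr j = (if i = j then 1 else 0)"
  "walker_inv w y $ Inr i $ Inl j = (if i = j then 1 else 0)" "walker_inv w y $ Inr i $ Inr j = - w y $ i $ j"
  by (simp_all add: walker_inv_def)

lemma forall_sum_type: "(\<forall>s::'a + 'b. P s) \<longleftrightarrow> (\<forall>i. P (Inl i)) \<and> (\<forall>i. P (Inr i))"
  by (metis sum.exhaust)

locale walker_metric =
  fixes S :: "(real^('n::finite + 'n)) set" and w :: "real^('n + 'n) \<Rightarrow> real^'n^'n"
  assumes opn: "open S" and smooth_w: "smooth_on S w"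
    and w_sym: "\<And>y. y \<in> S \<Longrightarrow> w y $ i $ j = w y $ j $ i"
begin

lemma smooth_w_nth: "smooth_on S (\<lambda>y. w y $ i $ j)"
  by (intro smooth_on_nth opn smooth_w)

lemma walker_inverse: "walker_inv w y ** walker w y = mat 1"
  unfolding vec_eq_iff forall_sum_type matrix_matrix_mult_def mat_def
  by (simp add: sum_UNIV_Plus if_distrib if_distribR cong: if_cong)

sublocale local_metric S "walker w" "walker_inv w"
proof
  show "smooth_on S (walker w)"
  proof (intro smooth_on_vec opn)
    show "smooth_on S (\<lambda>y. walker w y $ s $ t)" for s t
      by (cases s; cases t) (simp_all add: smooth_on_const smooth_w_nth)
  qed
  show "smooth_on S (walker_inv w)"
  proof (intro smooth_on_vec opn)
    show "smooth_on S (\<lambda>y. walker_inv w y $ s $ t)" for s t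
      by (cases s; cases t) (simp_all add: smooth_on_const smooth_on_minus opn smooth_w_nth)
  qed
  show "walker w y $ s $ t = walker w y $ t $ s" "walker_inv w y $ s $ t = walker_inv w y $ t $ s"
    if "y \<in> S" for y s t
    using w_sym[OF that] by (cases s; cases t; simp)+
qed (simp_all add: opn walker_inverse)

definition dw :: "'n + 'n \<Rightarrow> 'n \<Rightarrow> 'n \<Rightarrow> real^('n + 'n) \<Rightarrow> real" where
  "dw s i j = pd s (\<lambda>y. w y $ i $ j)"

lemma smooth_dw: "smooth_on S (dw s i j)"
  unfolding dw_def by (rule smooth_on_pd[OF smooth_w_nth])

lemma dw_sym: "y \<in> S \<Longrightarrow> dw s i j y = dw s j i y"
  unfolding dw_def by (rule pd_cong[OF opn]) (auto intro: w_sym)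

lemma christoffel_walker:
  assumes y: "y \<in> S"
  shows "\<Gamma> y (Inl i) (Inl j) (Inl k) = - dw (Inr k) i j y / 2"
    and "\<Gamma> y (Inl i) (Inl j) (Inr k) = (dw (Inl i) j k y + dw (Inl j) i k y - dw (Inl k) i j y) / 2
      + (\<Sum>l\<in>UNIV. w y $ k $ l * dw (Inr l) i j y) / 2"
    and "\<Gamma> y (Inl i) (Inr j) (Inl k) = 0" "\<Gamma> y (Inr j) (Inl i) (Inl k) = 0"
    and "\<Gamma> y (Inl i) (Inr j) (Inr k) = dw (Inr j) i k y / 2"
    and "\<Gamma> y (Inr j) (Inl i) (Inr k) = dw (Inr j) i k y / 2"
    and "\<Gamma> y (Inr i) (Inr j) s = 0"
proof -
  note simps = levi_civita_def matrix_inv_g[OF y] sum_UNIV_Plus dw_def if_distrib if_distribR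
  show "\<Gamma> y (Inl i) (Inl j) (Inl k) = - dw (Inr k) i j y / 2"
    by (simp add: simps cong: if_cong)
  show "\<Gamma> y (Inl i) (Inl j) (Inr k) = (dw (Inl i) j k y + dw (Inl j) i k y - dw (Inl k) i j y) / 2
      + (\<Sum>l\<in>UNIV. w y $ k $ l * dw (Inr l) i j y) / 2"
    by (simp add: simps sum_divide_distrib cong: if_cong)
  show "\<Gamma> y (Inl i) (Inr j) (Inl k) = 0" by (simp add: simps cong: if_cong)
  show "\<Gamma> y (Inr j) (Inl i) (Inl k) = 0" by (simp add: simps cong: if_cong)
  show "\<Gamma> y (Inl i) (Inr j) (Inr k) = dw (Inr j) i k y / 2"
    by (simp add: simps cong: if_cong)
  show "\<Gamma> y (Inr j) (Inl i) (Inr k) = dw (Inr j) i k y / 2"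
    by (simp add: simps cong: if_cong)
  show "\<Gamma> y (Inr i) (Inr j) s = 0"
    by (cases s) (simp_all add: simps cong: if_cong)
qed

text \<open>The determinant of a Walker metric is constant, and this trace is the logarithmic
  derivative of the volume density.\<close>

lemma christoffel_trace: "y \<in> S \<Longrightarrow> (\<Sum>s\<in>UNIV. \<Gamma> y s t s) = 0"
  by (cases t) (simp_all add: sum_UNIV_Plus christoffel_walker dw_sym sum_negf sum_divide_distrib[symmetric])

lemma christoffel_differentiable: "y \<in> S \<Longrightarrow> (\<lambda>y. \<Gamma> y i j k) differentiable (at y)"
  by (rule smooth_on_differentiable[OF smooth_levi_civita])

text \<open>The vanishing trace removes two of the four groups of terms in the coordinate
  formula.\<close>

lemma ricci_walker:
  assumes y: "y \<in> S"
  shows "ricci \<Gamma> y $ s $ t = (\<Sum>k\<in>UNIV. pd k (\<lambda>y. \<Gamma> y s t k) y)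
    - (\<Sum>k\<in>UNIV. \<Sum>l\<in>UNIV. \<Gamma> y s l k * \<Gamma> y k t l)"
proof -
  have "(\<Sum>k\<in>UNIV. pd s (\<lambda>y. \<Gamma> y k t k) y) = pd s (\<lambda>y. \<Sum>k\<in>UNIV. \<Gamma> y k t k) y"
    by (rule pd_sum[symmetric]) (rule christoffel_differentiable[OF y])
  also have "\<dots> = pd s (\<lambda>y. 0) y"
    by (rule pd_cong[OF opn y]) (rule christoffel_trace)
  finally have 1: "(\<Sum>k\<in>UNIV. pd s (\<lambda>y. \<Gamma> y k t k) y) = 0" by simp
  have "(\<Sum>k\<in>UNIV. \<Sum>l\<in>UNIV. \<Gamma> y k l k * \<Gamma> y s t l) = (\<Sum>l\<in>UNIV. (\<Sum>k\<in>UNIV. \<Gamma> y k l k) * \<Gamma> y s t l)"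
    by (subst sum.swap) (simp only: sum_distrib_right)
  then have 2: "(\<Sum>k\<in>UNIV. \<Sum>l\<in>UNIV. \<Gamma> y k l k * \<Gamma> y s t l) = 0"
    by (simp add: christoffel_trace[OF y])
  show ?thesis unfolding ricci_nth[OF christoffel_differentiable[OF y]] 1 2 by simp
qed

lemma pd_christoffel_walker:
  assumes y: "y \<in> S"
  shows "pd a (\<lambda>y. \<Gamma> y (Inl i) (Inl j) (Inl k)) y = - pd a (dw (Inr k) i j) y / 2"
    and "pd a (\<lambda>y. \<Gamma> y (Inl i) (Inl j) (Inr k)) y =
      (pd a (dw (Inl i) j k) y + pd a (dw (Inl j) i k) y - pd a (dw (Inl k) i j) y) / 2
      + (\<Sum>l\<in>UNIV. w y $ k $ l * pd a (dw (Inr l) i j) y + dw a k l y * dw (Inr l) i j y) / 2"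
    and "pd a (\<lambda>y. \<Gamma> y (Inl i) (Inr j) (Inl k)) y = 0" "pd a (\<lambda>y. \<Gamma> y (Inr j) (Inl i) (Inl k)) y = 0"
    and "pd a (\<lambda>y. \<Gamma> y (Inl i) (Inr j) (Inr k)) y = pd a (dw (Inr j) i k) y / 2"
    and "pd a (\<lambda>y. \<Gamma> y (Inr j) (Inl i) (Inr k)) y = pd a (dw (Inr j) i k) y / 2"
    and "pd a (\<lambda>y. \<Gamma> y (Inr i) (Inr j) s) y = 0"
proof -
  have dd: "dw s i j differentiable (at y)" for s i j
    by (rule smooth_on_differentiable[OF smooth_dw y])
  have dw': "(\<lambda>y. w y $ i $ j) differentiable (at y)" for i j
    by (rule smooth_on_differentiable[OF smooth_w_nth y])
  have half: "pd a (\<lambda>y. f y / 2) y = pd a f y / 2" if "f differentiable (at y)" for f :: "_ \<Rightarrow> real" and a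
    using pd_cmult[OF that, of a "1/2"] by simp
  show "pd a (\<lambda>y. \<Gamma> y (Inl i) (Inl j) (Inl k)) y = - pd a (dw (Inr k) i j) y / 2"
  proof -
    have "pd a (\<lambda>y. \<Gamma> y (Inl i) (Inl j) (Inl k)) y = pd a (\<lambda>y. - dw (Inr k) i j y / 2) y"
      by (rule pd_cong[OF opn y]) (rule christoffel_walker(1))
    also have "\<dots> = - pd a (dw (Inr k) i j) y / 2"
      using half[of "\<lambda>y. - dw (Inr k) i j y" a] dd by (simp add: pd_minus)
    finally show ?thesis .
  qed
  have "pd a (\<lambda>y. \<Sum>l\<in>UNIV. w y $ k $ l * dw (Inr l) i j y) y =
      (\<Sum>l\<in>UNIV. w y $ k $ l * pd a (dw (Inr l) i j) y + dw a k l y * dw (Inr l) i j y)"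
    by (subst pd_sum) (simp_all add: pd_mult dd dw' dw_def[of a])
  then show "pd a (\<lambda>y. \<Gamma> y (Inl i) (Inl j) (Inr k)) y =
      (pd a (dw (Inl i) j k) y + pd a (dw (Inl j) i k) y - pd a (dw (Inl k) i j) y) / 2
      + (\<Sum>l\<in>UNIV. w y $ k $ l * pd a (dw (Inr l) i j) y + dw a k l y * dw (Inr l) i j y) / 2"
  proof -
    assume *: "pd a (\<lambda>y. \<Sum>l\<in>UNIV. w y $ k $ l * dw (Inr l) i j y) y =
      (\<Sum>l\<in>UNIV. w y $ k $ l * pd a (dw (Inr l) i j) y + dw a k l y * dw (Inr l) i j y)"
    have ds: "(\<lambda>y. \<Sum>l\<in>UNIV. w y $ k $ l * dw (Inr l) i j y) differentiable (at y)"
      by (rule smooth_on_differentiable[OF _ y]) (intro smooth_on_sum smooth_on_mult opn smooth_w_nth smooth_dw)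
    have "pd a (\<lambda>y. \<Gamma> y (Inl i) (Inl j) (Inr k)) y = pd a (\<lambda>y. (dw (Inl i) j k y + dw (Inl j) i k y - dw (Inl k) i j y) / 2
      + (\<Sum>l\<in>UNIV. w y $ k $ l * dw (Inr l) i j y) / 2) y"
      by (rule pd_cong[OF opn y]) (rule christoffel_walker(2))
    also have "\<dots> = pd a (\<lambda>y. (dw (Inl i) j k y + dw (Inl j) i k y - dw (Inl k) i j y) / 2) y
      + pd a (\<lambda>y. (\<Sum>l\<in>UNIV. w y $ k $ l * dw (Inr l) i j y) / 2) y"
      by (rule pd_add; rule smooth_on_differentiable[OF _ y]; unfold divide_inverse;
          intro smooth_on_sum smooth_on_mult smooth_on_add smooth_on_diff smooth_on_const opn smooth_w_nth smooth_dw)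
    also have "pd a (\<lambda>y. (dw (Inl i) j k y + dw (Inl j) i k y - dw (Inl k) i j y) / 2) y =
      (pd a (dw (Inl i) j k) y + pd a (dw (Inl j) i k) y - pd a (dw (Inl k) i j) y) / 2"
      by (subst half) (simp_all add: pd_add pd_diff dd)
    finally show ?thesis unfolding half[OF ds] * .
  qed
  have zero: "pd a f y = 0" if "\<And>z. z \<in> S \<Longrightarrow> f z = 0" for f :: "_ \<Rightarrow> real"
    using pd_cong[OF opn y that, where i = a] by simp
  show "pd a (\<lambda>y. \<Gamma> y (Inl i) (Inr j) (Inl k)) y = 0" "pd a (\<lambda>y. \<Gamma> y (Inr j) (Inl i) (Inl k)) y = 0"
    "pd a (\<lambda>y. \<Gamma> y (Inr i) (Inr j) s) y = 0"
    by (rule zero, rule christoffel_walker, assumption)+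
  have half': "pd a f y = pd a (dw (Inr j) i k) y / 2" if "\<And>z. z \<in> S \<Longrightarrow> f z = dw (Inr j) i k z / 2" for f
    using pd_cong[OF opn y that, where i = a] half[OF dd] by simp
  show "pd a (\<lambda>y. \<Gamma> y (Inl i) (Inr j) (Inr k)) y = pd a (dw (Inr j) i k) y / 2"
    "pd a (\<lambda>y. \<Gamma> y (Inr j) (Inl i) (Inr k)) y = pd a (dw (Inr j) i k) y / 2"
    by (rule half', rule christoffel_walker, assumption)+
qed

lemma ricci_walker_fibre:
  assumes y: "y \<in> S"
  shows "ricci \<Gamma> y $ Inr i $ Inr j = 0"
    and "ricci \<Gamma> y $ Inl i $ Inr j = (\<Sum>k\<in>UNIV. pd (Inr k) (dw (Inr j) i k) y) / 2"
    and "ricci \<Gamma> y $ Inr j $ Inl i = (\<Sum>k\<in>UNIV. pd (Inr k) (dw (Inr j) i k) y) / 2"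
  unfolding ricci_walker[OF y]
  by (simp_all add: sum_UNIV_Plus christoffel_walker[OF y] pd_christoffel_walker[OF y] sum_divide_distrib)

lemma ricci_walker_base:
  assumes y: "y \<in> S"
  shows "ricci \<Gamma> y $ Inl i $ Inl j =
    (\<Sum>k\<in>UNIV. pd (Inl i) (dw (Inr k) j k) y + pd (Inl j) (dw (Inr k) i k) y) / 2
    - (\<Sum>k\<in>UNIV. pd (Inl k) (dw (Inr k) i j) y)
    + (\<Sum>k\<in>UNIV. \<Sum>l\<in>UNIV. dw (Inr k) k l y * dw (Inr l) i j y - dw (Inr l) i k y * dw (Inr k) j l y
         + w y $ k $ l * pd (Inr k) (dw (Inr l) i j) y) / 2"
proof -
  \<comment> \<open>Mixed second derivatives of \<open>w\<close> arise in both orders, from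
    different Christoffel symbols; one common order lets them combine.\<close>
  have comm: "pd (Inr k) (dw (Inl a) b c) y = pd (Inl a) (dw (Inr k) b c) y" for k a b c
    unfolding dw_def by (rule pd_commute[OF opn y smooth_w_nth])
  have sw: "(\<Sum>k\<in>UNIV. \<Sum>l\<in>UNIV. dw (Inr k) j l y * dw (Inr l) i k y) =
    (\<Sum>k\<in>UNIV. \<Sum>l\<in>UNIV. dw (Inr k) i l y * dw (Inr l) j k y)"
    by (subst sum.swap) (simp add: mult.commute)
  have sw': "(\<Sum>k\<in>UNIV. \<Sum>l\<in>UNIV. dw (Inr l) i k y * dw (Inr k) j l y) =
    (\<Sum>k\<in>UNIV. \<Sum>l\<in>UNIV. dw (Inr k) i l y * dw (Inr l) j k y)"
    by (rule sum.swap)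
  show ?thesis
    unfolding ricci_walker[OF y]
    using sw sw'
    by (simp add: sum_UNIV_Plus christoffel_walker[OF y] pd_christoffel_walker[OF y] comm dw_sym[OF y, of _ _ j]
        sum.distrib sum_subtractf sum_negf sum_divide_distrib[symmetric] add_divide_distrib diff_divide_distrib)
qed

lemma metric_trace_walker:
  assumes y: "y \<in> S"
  shows "metric_trace (walker w y) B = (\<Sum>k\<in>UNIV. B $ Inl k $ Inr k + B $ Inr k $ Inl k)
    - (\<Sum>k\<in>UNIV. \<Sum>l\<in>UNIV. w y $ k $ l * B $ Inr k $ Inr l)"
  by (simp add: metric_trace_def matrix_inv_g[OF y] sum_UNIV_Plus if_distrib if_distribR sum.distrib sum_negf cong: if_cong)

end

section \<open>The metric on the cotangent bundle in an induced chart\<close>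

lemma differentiable_base: "base differentiable (at y)"
  and differentiable_fibre: "fibre differentiable (at y)"
  by (rule bounded_linear_imp_differentiable bounded_linear_base bounded_linear_fibre)+

lemma pd_base: "pd s base y = base (axis s 1)" and pd_fibre: "pd s fibre y = fibre (axis s 1)"
  by (simp_all add: pd_eqI[OF bounded_linear_imp_has_derivative[OF bounded_linear_base]]
      pd_eqI[OF bounded_linear_imp_has_derivative[OF bounded_linear_fibre]])

lemma smooth_on_base: "open S \<Longrightarrow> smooth_on S base" and smooth_on_fibre: "open S \<Longrightarrow> smooth_on S fibre"
  using smooth_on_linear[OF _ bounded_linear_base smooth_on_id] smooth_on_linear[OF _ bounded_linear_fibre smooth_on_id]
  by auto

lemma open_base_vimage: "open V \<Longrightarrow> open (base -` V)"
  by (intro open_vimage bounded_linear.continuous_on[OF bounded_linear_base] continuous_intros)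

lemma smooth_on_comp_base: "open V \<Longrightarrow> smooth_on V f \<Longrightarrow> smooth_on (base -` V) (\<lambda>y. f (base y))"
  by (rule smooth_on_compose[OF open_base_vimage smooth_on_base[OF open_base_vimage]]) auto

lemma smooth_on_fibre_nth: "open S \<Longrightarrow> smooth_on S (\<lambda>y. fibre y $ k)"
  by (intro smooth_on_nth smooth_on_fibre)

lemma pd_comp_base:
  assumes "f differentiable (at (base y))"
  shows "pd (Inl i) (\<lambda>y. f (base y)) y = pd i f (base y)" "pd (Inr i) (\<lambda>y. f (base y)) y = 0"
  using pd_compose[OF differentiable_base assms]
  by (simp_all add: pd_base base_axis) (simp add: axis_def if_distrib if_distribR cong: if_cong)

lemma pd_fibre_nth: "pd (Inl i) (\<lambda>y. fibre y $ k) y = 0" "pd (Inr i) (\<lambda>y. fibre y $ k) y = (if i = k then 1 else 0)"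
  unfolding pd_component[OF differentiable_fibre] pd_fibre fibre_axis by (simp_all add: axis_def)

lemma differentiable_comp_base: "f differentiable (at (base y)) \<Longrightarrow> (\<lambda>y. f (base y)) differentiable (at y)"
  using differentiable_chain_at[OF differentiable_base] by (simp add: o_def)

lemma differentiable_fibre_nth: "(\<lambda>y. fibre y $ k) differentiable (at y)"
  by (rule differentiable_nth[OF differentiable_fibre])

text \<open>The base block of the metric. The summands come from \<iota>T o \<iota>T, from the
  Riemannian extension of the connection and from \<Phi>, and are of degree two, one and zero in the
  fibre coordinates.\<close>

definition ext_matrix ::
  "'n::finite christoffel \<Rightarrow> (real^'n \<Rightarrow> real^'n^'n) \<Rightarrow> (real^'n \<Rightarrow> real^'n^'n) \<Rightarrow> real^('n + 'n) \<Rightarrow> real^'n^'n" where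
  "ext_matrix \<Gamma> T \<Phi> y = (\<chi> i j.
     (\<Sum>r\<in>UNIV. fibre y $ r * T (base y) $ r $ i) * (\<Sum>r\<in>UNIV. fibre y $ r * T (base y) $ r $ j)
     - 2 * (\<Sum>k\<in>UNIV. fibre y $ k * \<Gamma> (base y) i j k) + \<Phi> (base y) $ i $ j)"

lemma mod_riem_ext_walker: "mod_riem_ext D \<Phi> T c = walker (ext_matrix (D c) (T c) (\<Phi> c))"
  by (rule ext) (simp add: mod_riem_ext_def vec_eq_iff forall_sum_type sym_prod_def iota_tensor_def
      riem_ext_def pullback02_def ext_matrix_def)

locale local_extension =
  fixes V :: "(real^2) set" and L :: "2 christoffel" and T \<Phi> :: "real^2 \<Rightarrow> real^2^2"
  assumes open_V: "open V"
    and smooth_L: "\<And>i j k. smooth_on V (\<lambda>x. L x i j k)"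
    and smooth_T: "smooth_on V T" and smooth_\<Phi>: "smooth_on V \<Phi>"
    and L_sym: "\<And>x i j k. x \<in> V \<Longrightarrow> L x i j k = L x j i k"
    and \<Phi>_sym: "\<And>x i j. x \<in> V \<Longrightarrow> \<Phi> x $ i $ j = \<Phi> x $ j $ i"
    and T_parallel: "\<And>x i j. x \<in> V \<Longrightarrow> cov11 L T i j x = 0"
    and T_nilpotent: "\<And>x. x \<in> V \<Longrightarrow> T x ** T x = 0"
begin

abbreviation "w \<equiv> ext_matrix L T \<Phi>"
abbreviation "gr \<equiv> walker w"
abbreviation "Y \<equiv> base -` V"

text \<open>The base components of the one-form \<iota>T, linear in the fibre coordinates.\<close>

definition t :: "2 \<Rightarrow> real^(2 + 2) \<Rightarrow> real" where
  "t i y = (\<Sum>r\<in>UNIV. fibre y $ r * T (base y) $ r $ i)"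

lemma open_Y: "open Y" by (rule open_base_vimage[OF open_V])

lemma smooth_T_nth: "smooth_on V (\<lambda>x. T x $ i $ j)"
  and smooth_\<Phi>_nth: "smooth_on V (\<lambda>x. \<Phi> x $ i $ j)"
  by (intro smooth_on_nth open_V smooth_T smooth_\<Phi>)+

lemma smooth_t: "smooth_on Y (t i)"
  unfolding t_def[abs_def]
  by (intro smooth_on_sum smooth_on_mult open_Y smooth_on_fibre_nth smooth_on_comp_base[OF open_V smooth_T_nth])

lemma w_nth: "w y $ i $ j = t i y * t j y - 2 * (\<Sum>k\<in>UNIV. fibre y $ k * L (base y) i j k) + \<Phi> (base y) $ i $ j"
  by (simp add: ext_matrix_def t_def)

sublocale walker_metric Y w
proof
  show "smooth_on Y w"
  proof (intro smooth_on_vec open_Y)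
    show "smooth_on Y (\<lambda>y. w y $ i $ j)" for i j
      unfolding w_nth
      by (intro smooth_on_sum smooth_on_mult smooth_on_add smooth_on_diff smooth_on_const smooth_t open_Y
          smooth_on_fibre_nth smooth_on_comp_base[OF open_V smooth_L] smooth_on_comp_base[OF open_V smooth_\<Phi>_nth])
  qed
qed (simp_all add: open_Y w_nth L_sym \<Phi>_sym mult.commute)

lemma diff_base:
  assumes "x \<in> V"
  shows "(\<lambda>x. L x i j k) differentiable (at x)" "(\<lambda>x. T x $ i $ j) differentiable (at x)"
    "(\<lambda>x. \<Phi> x $ i $ j) differentiable (at x)"
  using smooth_on_differentiable[OF _ assms] smooth_L smooth_T_nth smooth_\<Phi>_nth by blast+

lemma pd_t:
  assumes "y \<in> Y"
  shows "pd (Inr k) (t i) y = T (base y) $ k $ i"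
    and "pd (Inl k) (t i) y = (\<Sum>r\<in>UNIV. fibre y $ r * pd k (\<lambda>x. T x $ r $ i) (base y))"
proof -
  have x: "base y \<in> V" using assms by simp
  have "pd s (t i) y = (\<Sum>r\<in>UNIV. fibre y $ r * pd s (\<lambda>y. T (base y) $ r $ i) y + pd s (\<lambda>y. fibre y $ r) y * T (base y) $ r $ i)" for s
    unfolding t_def[abs_def]
    by (subst pd_sum) (simp_all add: pd_mult differentiable_fibre_nth differentiable_comp_base[OF diff_base(2)[OF x]])
  then show "pd (Inr k) (t i) y = T (base y) $ k $ i"
    "pd (Inl k) (t i) y = (\<Sum>r\<in>UNIV. fibre y $ r * pd k (\<lambda>x. T x $ r $ i) (base y))"
    by (simp_all add: pd_comp_base[OF diff_base(2)[OF x]] pd_fibre_nth if_distrib if_distribR cong: if_cong)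
qed

lemma diff_t: "y \<in> Y \<Longrightarrow> t i differentiable (at y)"
  by (rule smooth_on_differentiable[OF smooth_t])

lemma pd_w:
  assumes "y \<in> Y"
  shows "dw (Inr k) i j y = T (base y) $ k $ i * t j y + t i y * T (base y) $ k $ j - 2 * L (base y) i j k"
    and "dw (Inl k) i j y = pd (Inl k) (t i) y * t j y + t i y * pd (Inl k) (t j) y
      - 2 * (\<Sum>m\<in>UNIV. fibre y $ m * pd k (\<lambda>x. L x i j m) (base y)) + pd k (\<lambda>x. \<Phi> x $ i $ j) (base y)"
proof -
  have x: "base y \<in> V" using assms by simp
  note d = differentiable_comp_base[OF diff_base(1)[OF x]] differentiable_comp_base[OF diff_base(3)[OF x]]
    diff_t[OF assms] differentiable_fibre_nth
  have s: "(\<lambda>y. \<Sum>k\<in>UNIV. fibre y $ k * L (base y) i j k) differentiable (at y)"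
    by (intro differentiable_sum ballI differentiable_mult d) simp_all
  have s': "pd a (\<lambda>y. \<Sum>k\<in>UNIV. fibre y $ k * L (base y) i j k) y =
      (\<Sum>m\<in>UNIV. fibre y $ m * pd a (\<lambda>y. L (base y) i j m) y + pd a (\<lambda>y. fibre y $ m) y * L (base y) i j m)" for a
    by (subst pd_sum) (simp_all add: pd_mult d)
  have "dw a i j y = pd a (\<lambda>y. t i y * t j y - 2 * (\<Sum>k\<in>UNIV. fibre y $ k * L (base y) i j k) + \<Phi> (base y) $ i $ j) y" for a
    unfolding dw_def w_nth ..
  also have "\<dots> a = pd a (t i) y * t j y + t i y * pd a (t j) y
      - 2 * (\<Sum>m\<in>UNIV. fibre y $ m * pd a (\<lambda>y. L (base y) i j m) y + pd a (\<lambda>y. fibre y $ m) y * L (base y) i j m)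
      + pd a (\<lambda>y. \<Phi> (base y) $ i $ j) y" for a
    by (simp add: pd_add pd_diff pd_mult pd_cmult d s s')
  finally have "dw a i j y = pd a (t i) y * t j y + t i y * pd a (t j) y
      - 2 * (\<Sum>m\<in>UNIV. fibre y $ m * pd a (\<lambda>y. L (base y) i j m) y + pd a (\<lambda>y. fibre y $ m) y * L (base y) i j m)
      + pd a (\<lambda>y. \<Phi> (base y) $ i $ j) y" for a .
  then show "dw (Inr k) i j y = T (base y) $ k $ i * t j y + t i y * T (base y) $ k $ j - 2 * L (base y) i j k"
    "dw (Inl k) i j y = pd (Inl k) (t i) y * t j y + t i y * pd (Inl k) (t j) y
      - 2 * (\<Sum>m\<in>UNIV. fibre y $ m * pd k (\<lambda>x. L x i j m) (base y)) + pd k (\<lambda>x. \<Phi> x $ i $ j) (base y)"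
    by (simp_all add: pd_comp_base[OF diff_base(1)[OF x]] pd_comp_base[OF diff_base(3)[OF x]] pd_fibre_nth
        pd_t[OF assms] if_distrib if_distribR cong: if_cong)
qed

lemma pd_dw_fibre:
  assumes "y \<in> Y"
  shows "pd (Inr l) (dw (Inr k) i j) y = T (base y) $ k $ i * T (base y) $ l $ j + T (base y) $ l $ i * T (base y) $ k $ j"
    and "pd (Inl l) (dw (Inr k) i j) y = pd l (\<lambda>x. T x $ k $ i) (base y) * t j y + T (base y) $ k $ i * pd (Inl l) (t j) y
      + pd (Inl l) (t i) y * T (base y) $ k $ j + t i y * pd l (\<lambda>x. T x $ k $ j) (base y)
      - 2 * pd l (\<lambda>x. L x i j k) (base y)"
proof -
  have x: "base y \<in> V" using assms by simp
  note d = differentiable_comp_base[OF diff_base(1)[OF x]] differentiable_comp_base[OF diff_base(2)[OF x]]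
    diff_t[OF assms] 
  have "pd a (dw (Inr k) i j) y =
      pd a (\<lambda>y. T (base y) $ k $ i * t j y + t i y * T (base y) $ k $ j - 2 * L (base y) i j k) y" for a
    by (rule pd_cong[OF open_Y assms]) (rule pd_w(1))
  then show "pd (Inr l) (dw (Inr k) i j) y = T (base y) $ k $ i * T (base y) $ l $ j + T (base y) $ l $ i * T (base y) $ k $ j"
    "pd (Inl l) (dw (Inr k) i j) y = pd l (\<lambda>x. T x $ k $ i) (base y) * t j y + T (base y) $ k $ i * pd (Inl l) (t j) y
      + pd (Inl l) (t i) y * T (base y) $ k $ j + t i y * pd l (\<lambda>x. T x $ k $ j) (base y)
      - 2 * pd l (\<lambda>x. L x i j k) (base y)"
    by (simp_all add: pd_add pd_diff pd_mult pd_cmult d pd_comp_base[OF diff_base(1)[OF x]]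
        pd_comp_base[OF diff_base(2)[OF x]] pd_t[OF assms])
qed

text \<open>The equation DT = 0 solved for the derivatives of \<open>T\<close>: with it the
  curvature identities involve \<open>T\<close> only algebraically.\<close>

lemma pd_T:
  assumes "x \<in> V"
  shows "pd i (\<lambda>x. T x $ k $ j) x = (\<Sum>l\<in>UNIV. T x $ k $ l * L x i j l) - (\<Sum>l\<in>UNIV. L x i l k * T x $ l $ j)"
proof -
  have *: "(\<lambda>y. T y *v coord_field j y) = (\<lambda>y. \<chi> k. T y $ k $ j)"
    by (simp add: coord_field_def matrix_vector_mul_component fun_eq_iff vec_eq_iff inner_axis)
  have d: "(\<lambda>y. \<chi> k. T y $ k $ j) differentiable (at x)"
    by (rule differentiable_vec_componentwise) (simp add: diff_base(2)[OF assms])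
  have "cov11 L T i j x $ k = 0" using T_parallel[OF assms] by simp
  then have "pd i (\<lambda>y. \<chi> k. T y $ k $ j) x $ k + (\<Sum>l\<in>UNIV. L x i l k * T x $ l $ j) - (\<Sum>l\<in>UNIV. T x $ k $ l * L x i j l) = 0"
    unfolding cov11_def * by (simp add: cov_coord_nth cov_coord_coord matrix_vector_mult_def)
  then show ?thesis using pd_component[OF d, of i k] by simp
qed

lemma T_entries:
  assumes "x \<in> V"
  shows "T x $ 2 $ 2 = - T x $ 1 $ 1" "T x $ 1 $ 1 * T x $ 1 $ 1 = - (T x $ 1 $ 2 * T x $ 2 $ 1)"
proof -
  let ?a = "T x $ 1 $ 1" and ?b = "T x $ 1 $ 2" and ?c = "T x $ 2 $ 1" and ?d = "T x $ 2 $ 2"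
  have e: "?a * ?a + ?b * ?c = 0" "?a * ?b + ?b * ?d = 0" "?c * ?a + ?d * ?c = 0" "?c * ?b + ?d * ?d = 0"
    using T_nilpotent[OF assms] by (simp_all add: vec_eq_iff matrix_matrix_mult_def sum_2 forall_2)
  then show "?a * ?a = - (?b * ?c)" by simp
  \<comment> \<open>The cube of the trace lies in the ideal generated by the entries of the square
    of the matrix.\<close>
  have "(?a + ?d) * (?a + ?d) * (?a + ?d) = 0" using e by algebra
  then show "?d = - ?a" by simp
qed

text \<open>Normal form of a nilpotent matrix as s times the column (p,q) times the row (q,-p),
  whose kernel contains (p,q) and whose image lies in its span. Inserting it builds the relations
  between the entries into the formulas, so identities can be verified by expansion. When the upper
  right entry b is not zero, the witnesses are s = -b, p = 1, q = -a/b.\<close>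

lemma T_param:
  assumes "x \<in> V"
  obtains s p q where "T x $ 1 $ 1 = s * p * q" "T x $ 1 $ 2 = - (s * p * p)" "T x $ 2 $ 1 = s * q * q" "T x $ 2 $ 2 = - (s * p * q)"
proof -
  let ?a = "T x $ 1 $ 1" and ?b = "T x $ 1 $ 2" and ?c = "T x $ 2 $ 1" and ?d = "T x $ 2 $ 2"
  show thesis
  proof (cases "?b = 0")
    case True
    then have "?a = 0" using T_entries(2)[OF assms] by simp
    then show thesis using that[of ?c 0 1] T_entries(1)[OF assms] True by simp
  next
    case False
    then show thesis using that[of "- ?b" 1 "- ?a / ?b"] T_entries[OF assms]
      by (simp add: field_simps)
  qed
qed

text \<open>By the formula for the second fibre derivatives of \<open>w\<close>, the sum is T_ji
  tr(T) + (T^2)_ji in matrix entries, and both terms vanish.\<close>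

lemma ricci_mixed:
  assumes "y \<in> Y"
  shows "ricci \<Gamma> y $ Inl i $ Inr j = 0" "ricci \<Gamma> y $ Inr j $ Inl i = 0"
proof -
  have x: "base y \<in> V" using assms by simp
  have "(\<Sum>k\<in>UNIV. pd (Inr k) (dw (Inr j) i k) y) = 0"
    using T_entries[OF x] exhaust_2[of i] exhaust_2[of j]
    by (auto simp: pd_dw_fibre[OF assms] sum_2)
  then show "ricci \<Gamma> y $ Inl i $ Inr j = 0" "ricci \<Gamma> y $ Inr j $ Inl i = 0"
    by (simp_all add: ricci_walker_fibre[OF assms])
qed

text \<open>Nilpotency and parallelism of \<open>T\<close> cancel every term that depends on the
  fibre coordinates. The summand \<open>hat\<close> comes from the product of \<open>w\<close> with
  its second fibre derivatives, where \<Phi> is contracted with two factors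
  \<open>T\<close>.\<close>

lemma ricci_base:
  assumes "y \<in> Y"
  shows "ricci \<Gamma> y $ Inl i $ Inl j = (2 *\<^sub>R ricci_sym L (base y) + hat (T (base y)) (\<Phi> (base y))) $ i $ j"
proof -
  have x: "base y \<in> V" using assms by simp
  obtain s p q where T: "T (base y) $ 1 $ 1 = s * p * q" "T (base y) $ 1 $ 2 = - (s * p * p)"
    "T (base y) $ 2 $ 1 = s * q * q" "T (base y) $ 2 $ 2 = - (s * p * q)" using T_param[OF x] by blast
  have Ls: "L (base y) 2 1 k = L (base y) 1 2 k" for k by (rule L_sym[OF x])
  have dLs: "pd l (\<lambda>x. L x 2 1 k) (base y) = pd l (\<lambda>x. L x 1 2 k) (base y)" for k l
    by (rule pd_cong[OF open_V x]) (rule L_sym)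
  have Ps: "\<Phi> (base y) $ 2 $ 1 = \<Phi> (base y) $ 1 $ 2" by (rule \<Phi>_sym[OF x])
  have t: "t i y = fibre y $ 1 * T (base y) $ 1 $ i + fibre y $ 2 * T (base y) $ 2 $ i" for i
    by (simp add: t_def sum_2)
  have r: "i = 1 \<or> i = 2" "j = 1 \<or> j = 2" using exhaust_2 by auto
  show ?thesis
    unfolding ricci_walker_base[OF assms] using r
    by (elim disjE) (simp_all only: sum_2 pd_dw_fibre[OF assms] pd_w[OF assms] w_nth pd_t[OF assms] ricci_sym_def
      vector_add_component vector_scaleR_component transpose_def vec_lambda_beta hat_def matrix_matrix_mult_def
      ricci_nth[OF diff_base(1)[OF x]] pd_T[OF x] t T Ls dLs Ps real_scaleR_def,
      simp_all add: algebra_simps add_divide_distrib diff_divide_distrib)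
qed

end

section \<open>The conformally Einstein equation in an induced chart\<close>

lemma pd_fibre_affine:
  fixes a :: "'n::finite \<Rightarrow> real^'n \<Rightarrow> real"
  assumes "open R" "y \<in> R" "open V" "R \<subseteq> base -` V"
    and sm: "\<And>k. smooth_on V (a k)" "smooth_on V f"
    and eq: "\<And>z. z \<in> R \<Longrightarrow> \<phi> z = (\<Sum>k\<in>UNIV. fibre z $ k * a k (base z)) + f (base z)"
  shows "pd (Inr j) \<phi> y = a j (base y)"
    and "pd (Inl j) \<phi> y = (\<Sum>k\<in>UNIV. fibre y $ k * pd j (a k) (base y)) + pd j f (base y)"
proof -
  have x: "base y \<in> V" using assms by auto
  have da: "a k differentiable (at (base y))" for k by (rule smooth_on_differentiable[OF sm(1) x])
  have df: "f differentiable (at (base y))" by (rule smooth_on_differentiable[OF sm(2) x])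
  have dda: "(\<lambda>z. a k (base z)) differentiable (at y)" for k by (rule differentiable_comp_base[OF da])
  have ddf: "(\<lambda>z. f (base z)) differentiable (at y)" by (rule differentiable_comp_base[OF df])
  have "pd s \<phi> y = pd s (\<lambda>z. (\<Sum>k\<in>UNIV. fibre z $ k * a k (base z)) + f (base z)) y" for s
    by (rule pd_cong[OF assms(1,2) eq])
  also have "\<dots> s = pd s (\<lambda>z. \<Sum>k\<in>UNIV. fibre z $ k * a k (base z)) y + pd s (\<lambda>z. f (base z)) y" for s
    by (rule pd_add) (intro differentiable_sum ballI differentiable_mult differentiable_fibre_nth dda ddf finite)+
  also have "pd s (\<lambda>z. \<Sum>k\<in>UNIV. fibre z $ k * a k (base z)) y =
      (\<Sum>k\<in>UNIV. fibre y $ k * pd s (\<lambda>z. a k (base z)) y + pd s (\<lambda>z. fibre z $ k) y * a k (base y))" for s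
    by (subst pd_sum) (auto intro!: sum.cong pd_mult differentiable_mult differentiable_fibre_nth dda)
  finally have *: "pd s \<phi> y = (\<Sum>k\<in>UNIV. fibre y $ k * pd s (\<lambda>z. a k (base z)) y + pd s (\<lambda>z. fibre z $ k) y * a k (base y))
      + pd s (\<lambda>z. f (base z)) y" for s .
  show "pd (Inr j) \<phi> y = a j (base y)"
    and "pd (Inl j) \<phi> y = (\<Sum>k\<in>UNIV. fibre y $ k * pd j (a k) (base y)) + pd j f (base y)"
    unfolding * by (simp_all add: pd_comp_base[OF da] pd_comp_base[OF df] pd_fibre_nth if_distrib if_distribR cong: if_cong)
qed

lemma pd2_fibre_affine:
  fixes a :: "'n::finite \<Rightarrow> real^'n \<Rightarrow> real"
  assumes R: "open R" "y \<in> R" "open V" "R \<subseteq> base -` V"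
    and sm: "\<And>k. smooth_on V (a k)" "smooth_on V f"
    and eq: "\<And>z. z \<in> R \<Longrightarrow> \<phi> z = (\<Sum>k\<in>UNIV. fibre z $ k * a k (base z)) + f (base z)"
  shows "pd (Inr i) (pd (Inr j) \<phi>) y = 0"
    and "pd (Inl i) (pd (Inr j) \<phi>) y = pd i (a j) (base y)"
    and "pd (Inl i) (pd (Inl j) \<phi>) y = (\<Sum>k\<in>UNIV. fibre y $ k * pd i (pd j (a k)) (base y)) + pd i (pd j f) (base y)"
proof -
  have 1: "pd (Inr j) \<phi> z = (\<Sum>k\<in>UNIV. fibre z $ k * (\<lambda>_. 0) (base z)) + a j (base z)" if "z \<in> R" for z
    using pd_fibre_affine(1)[OF R(1) that R(3,4) sm eq] by simp
  have 2: "pd (Inl j) \<phi> z = (\<Sum>k\<in>UNIV. fibre z $ k * pd j (a k) (base z)) + pd j f (base z)" if "z \<in> R" for z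
    using pd_fibre_affine(2)[OF R(1) that R(3,4) sm eq] .
  show "pd (Inr i) (pd (Inr j) \<phi>) y = 0"
    by (rule pd_fibre_affine(1)[where a = "\<lambda>_ _. 0", OF R smooth_on_const sm(1) 1])
  show "pd (Inl i) (pd (Inr j) \<phi>) y = pd i (a j) (base y)"
    using pd_fibre_affine(2)[where a = "\<lambda>_ _. 0", OF R smooth_on_const sm(1) 1] by simp
  show "pd (Inl i) (pd (Inl j) \<phi>) y = (\<Sum>k\<in>UNIV. fibre y $ k * pd i (pd j (a k)) (base y)) + pd i (pd j f) (base y)"
    by (rule pd_fibre_affine(2)[OF R smooth_on_pd[OF sm(1)] smooth_on_pd[OF sm(2)] 2])
qed

context local_extension
begin

text \<open>The mixed block of the Hessian, and below it the base block, written through derivatives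
  of \<open>w\<close> in place of Christoffel symbols; the polynomial dependence on the fibre
  coordinates can be read off from this form.\<close>

definition mixed_hessian :: "(real^(2 + 2) \<Rightarrow> real) \<Rightarrow> 2 \<Rightarrow> 2 \<Rightarrow> real^(2 + 2) \<Rightarrow> real" where
  "mixed_hessian \<phi> i j y = pd (Inl i) (pd (Inr j) \<phi>) y - (\<Sum>k\<in>UNIV. dw (Inr j) i k y * pd (Inr k) \<phi> y) / 2"

definition base_hessian :: "(real^(2 + 2) \<Rightarrow> real) \<Rightarrow> 2 \<Rightarrow> 2 \<Rightarrow> real^(2 + 2) \<Rightarrow> real" where
  "base_hessian \<phi> i j y = pd (Inl i) (pd (Inl j) \<phi>) y + (\<Sum>k\<in>UNIV. dw (Inr k) i j y * pd (Inl k) \<phi> y) / 2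
     - (\<Sum>k\<in>UNIV. ((dw (Inl i) j k y + dw (Inl j) i k y - dw (Inl k) i j y)
          + (\<Sum>l\<in>UNIV. w y $ k $ l * dw (Inr l) i j y)) / 2 * pd (Inr k) \<phi> y)"

text \<open>The Ricci tensor has only a base block, and in that block the inverse of a Walker metric
  is zero.\<close>

lemma scalar_curvature_zero: "y \<in> Y \<Longrightarrow> scalar_curvature gr y = 0"
  unfolding scalar_curvature_def
  by (simp add: metric_trace_walker ricci_mixed ricci_walker_fibre(1))

lemma hessian_entries:
  assumes "open R" "y \<in> R" "R \<subseteq> Y" "smooth_on R \<phi>"
  shows "hessian \<Gamma> \<phi> y $ Inr i $ Inr j = pd (Inr i) (pd (Inr j) \<phi>) y"
    and "hessian \<Gamma> \<phi> y $ Inl i $ Inr j = mixed_hessian \<phi> i j y"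
    and "hessian \<Gamma> \<phi> y $ Inr j $ Inl i = mixed_hessian \<phi> i j y"
    and "hessian \<Gamma> \<phi> y $ Inl i $ Inl j = base_hessian \<phi> i j y"
proof -
  have y: "y \<in> Y" using assms by auto
  show "hessian \<Gamma> \<phi> y $ Inr i $ Inr j = pd (Inr i) (pd (Inr j) \<phi>) y"
    by (simp add: hessian_def christoffel_walker[OF y])
  show "hessian \<Gamma> \<phi> y $ Inl i $ Inr j = mixed_hessian \<phi> i j y"
    by (simp add: hessian_def christoffel_walker[OF y] sum_UNIV_Plus mixed_hessian_def sum_divide_distrib)
  have "pd (Inr j) (pd (Inl i) \<phi>) y = pd (Inl i) (pd (Inr j) \<phi>) y"
    by (rule pd_commute[OF assms(1,2,4)])
  then show "hessian \<Gamma> \<phi> y $ Inr j $ Inl i = mixed_hessian \<phi> i j y"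
    by (simp add: hessian_def christoffel_walker[OF y] sum_UNIV_Plus mixed_hessian_def sum_divide_distrib)
  show "hessian \<Gamma> \<phi> y $ Inl i $ Inl j = base_hessian \<phi> i j y"
    by (simp add: hessian_def christoffel_walker[OF y] sum_UNIV_Plus base_hessian_def sum_divide_distrib
        sum_negf add_divide_distrib)
qed

text \<open>The fibre blocks of the metric and of its Ricci tensor are zero, which forces the fibre
  Hessian to vanish. The Laplacian is then twice the trace of the mixed block, and as the scalar
  curvature is zero, this trace is the whole coefficient of the metric.\<close>

lemma conf_einstein_iff:
  assumes "open R" "y \<in> R" "R \<subseteq> Y" "smooth_on R \<phi>"
  shows "conf_einstein_eq_at gr \<phi> y \<longleftrightarrow>
    (\<forall>i j. pd (Inr i) (pd (Inr j) \<phi>) y = 0) \<and>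
    (\<forall>i j. 2 * mixed_hessian \<phi> i j y = (if i = j then \<Sum>m\<in>UNIV. mixed_hessian \<phi> m m y else 0)) \<and>
    (\<forall>i j. 2 * base_hessian \<phi> i j y + \<phi> y * (2 *\<^sub>R ricci_sym L (base y) + hat (T (base y)) (\<Phi> (base y))) $ i $ j
       - (\<Sum>m\<in>UNIV. mixed_hessian \<phi> m m y) * w y $ i $ j = 0)" (is "?L \<longleftrightarrow> ?A \<and> ?B \<and> ?C")
proof -
  have y: "y \<in> Y" using assms by auto
  note he = hessian_entries[OF assms]
  let ?M = "\<Sum>m\<in>UNIV. mixed_hessian \<phi> m m y"
  have lap: "laplacian gr \<phi> y = 2 * ?M" if ?A
    using that unfolding laplacian_def metric_trace_walker[OF y] by (simp add: he sum.distrib sum_distrib_left)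
  define c where "c = (1/4) * (2 * laplacian gr \<phi> y + \<phi> y * scalar_curvature gr y)"
  have cM: "c = ?M" if ?A
    using lap[OF that] by (simp add: c_def scalar_curvature_zero[OF y])
  have eq: "?L \<longleftrightarrow> (\<forall>i j. 2 * hessian \<Gamma> \<phi> y $ i $ j + \<phi> y * ricci \<Gamma> y $ i $ j - c * gr y $ i $ j = 0)"
    unfolding conf_einstein_eq_at_def vec_eq_iff c_def by simp
  have "?L \<longleftrightarrow> (\<forall>i j. 2 * pd (Inr i) (pd (Inr j) \<phi>) y = 0) \<and>
     (\<forall>i j. 2 * mixed_hessian \<phi> i j y = (if i = j then c else 0)) \<and>
     (\<forall>i j. 2 * base_hessian \<phi> i j y + \<phi> y * (2 *\<^sub>R ricci_sym L (base y) + hat (T (base y)) (\<Phi> (base y))) $ i $ j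
       - c * w y $ i $ j = 0)"
    unfolding eq forall_sum_type he ricci_base[OF y]
    by (auto simp: he ricci_mixed[OF y] ricci_walker_fibre(1)[OF y])
  also have "\<dots> \<longleftrightarrow> ?A \<and> ?B \<and> ?C"
  \<comment> \<open>The coefficient \<open>c\<close> is identified with the trace under
    \<open>?A\<close>; when \<open>?A\<close> fails, both sides are false.\<close>
  proof (cases ?A)
    case True
    show ?thesis unfolding cM[OF True] by simp
  next
    case False
    then have "\<not> (\<forall>i j. 2 * pd (Inr i) (pd (Inr j) \<phi>) y = 0)" by simp
    with False show ?thesis by blast
  qed
  finally show ?thesis .
qed

lemma conf_einstein_fibre_hessian:
  assumes "open R" "y \<in> R" "R \<subseteq> Y" "smooth_on R \<phi>" "conf_einstein_eq_at gr \<phi> y"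
  shows "pd (Inr i) (pd (Inr j) \<phi>) y = 0"
  using conf_einstein_iff[OF assms(1-4)] assms(5) by blast

text \<open>The base block of the Ricci tensor of the extension, a function on the surface by
  \<open>ricci_base\<close>.\<close>

definition cylinder_matrix :: "real^2 \<Rightarrow> real^2^2" where
  "cylinder_matrix x = 2 *\<^sub>R ricci_sym L x + hat (T x) (\<Phi> x)"

section \<open>Functions affine along the fibres: evaluation of a vector field plus a function on
  the surface\<close>

context
  fixes N R X f \<phi>
  assumes open_N: "open N" and N: "N \<subseteq> V" and open_R: "open R" and R: "R \<subseteq> base -` N"
    and smooth_X: "smooth_on N X" and smooth_f: "smooth_on N f"
    and \<phi>: "\<And>z. z \<in> R \<Longrightarrow> \<phi> z = fibre z \<bullet> X (base z) + f (base z)"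
begin

lemma R_Y: "R \<subseteq> Y" using R N by auto

lemma \<phi>_sum: "z \<in> R \<Longrightarrow> \<phi> z = (\<Sum>k\<in>UNIV. fibre z $ k * X (base z) $ k) + f (base z)"
  using \<phi> by (simp add: inner_vec_def)

lemma smooth_X_nth: "smooth_on N (\<lambda>x. X x $ k)"
  by (intro smooth_on_nth open_N smooth_X)

lemma smooth_affine: "smooth_on R \<phi>"
proof (rule smooth_on_cong[OF open_R])
  show "smooth_on R (\<lambda>z. (\<Sum>k\<in>UNIV. fibre z $ k * X (base z) $ k) + f (base z))"
    by (intro smooth_on_add smooth_on_sum smooth_on_mult open_R smooth_on_fibre_nth
        smooth_on_subset[OF smooth_on_comp_base[OF open_N smooth_X_nth] R]
        smooth_on_subset[OF smooth_on_comp_base[OF open_N smooth_f] R])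
qed (simp add: \<phi>_sum)

lemmas pd_affine = pd_fibre_affine[OF open_R _ open_N R smooth_X_nth smooth_f \<phi>_sum]
  pd2_fibre_affine[OF open_R _ open_N R smooth_X_nth smooth_f \<phi>_sum]

lemma cov_X_nth:
  assumes "x \<in> N"
  shows "cov L (coord_field i) X x $ k = pd i (\<lambda>x. X x $ k) x + (\<Sum>j\<in>UNIV. L x i j k * X x $ j)"
  unfolding cov_coord_nth using pd_component[OF smooth_on_differentiable[OF smooth_X assms]] by simp

text \<open>The conditions on \<open>X\<close> separate here: the covariant derivative of
  \<open>X\<close> is constant along a fibre, and the rest is linear in the fibre coordinates and
  built from \<open>T\<close> and TX.\<close>

lemma mixed_hessian_affine:
  assumes "y \<in> R"
  shows "mixed_hessian \<phi> i j y = cov L (coord_field i) X (base y) $ j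
    - (T (base y) $ j $ i * (\<Sum>s\<in>UNIV. fibre y $ s * (T (base y) *v X (base y)) $ s)
       + t i y * (T (base y) *v X (base y)) $ j) / 2"
proof -
  have y: "y \<in> Y" and x: "base y \<in> N" using assms R_Y R by auto
  show ?thesis
    unfolding mixed_hessian_def cov_X_nth[OF x]
    by (simp add: pd_affine[OF assms] pd_w[OF y] matrix_vector_mult_def sum_2 t_def algebra_simps add_divide_distrib diff_divide_distrib)
qed

text \<open>The mixed block has to be a multiple of the identity at every point of an open piece of
  a fibre. Hence its linear coefficients are multiples of the identity; being trace free they
  vanish, and TX = 0 follows. What remains is that DX is a multiple of the identity, and it is zero
  because \<open>T\<close> annihilates it. The second conclusion takes the first on all of
  \<open>R\<close> as a hypothesis, since TX = 0 is differentiated.\<close>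

lemma parallel_kernel_of_solution:
  assumes sol: "\<And>y. y \<in> R \<Longrightarrow> conf_einstein_eq_at gr \<phi> y" and y: "y \<in> R"
  shows "T (base y) *v X (base y) = 0"
    and "(\<And>z. z \<in> R \<Longrightarrow> T (base z) *v X (base z) = 0) \<Longrightarrow> T (base y) \<noteq> 0 \<Longrightarrow> cov L (coord_field i) X (base y) = 0"
proof -
  have yY: "y \<in> Y" and x: "base y \<in> N" "base y \<in> V" using y R_Y R N by auto
  let ?x = "base y" and ?T = "T (base y)" and ?u = "T (base y) *v X (base y)"
  have B: "2 * mixed_hessian \<phi> i j z = (if i = j then \<Sum>m\<in>UNIV. mixed_hessian \<phi> m m z else 0)" if "z \<in> R" for i j z
    using conf_einstein_iff[OF open_R that R_Y smooth_affine] sol[OF that] by blast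
  have B12: "mixed_hessian \<phi> 1 2 z = 0" "mixed_hessian \<phi> 2 1 z = 0" "mixed_hessian \<phi> 1 1 z = mixed_hessian \<phi> 2 2 z"
    if "z \<in> R" for z
    using B[OF that, of 1 2] B[OF that, of 2 1] B[OF that, of 1 1] by (simp_all add: sum_2)
  obtain e where e: "e > 0" "\<And>v. norm v \<le> e \<Longrightarrow> pack ?x (fibre y + v) \<in> R"
  proof -
    have "open {v. pack ?x v \<in> R}" by (rule open_fibre_slice[OF open_R])
    moreover have "fibre y \<in> {v. pack ?x v \<in> R}" using y by simp
    ultimately obtain e where "e > 0" "cball (fibre y) e \<subseteq> {v. pack ?x v \<in> R}"
      using open_contains_cball by metis
    then show thesis using that[of e] by (auto simp: subset_iff dist_norm)
  qed
  \<comment> \<open>Minus twice the coefficient of the fibre coordinate with index s in the mixed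
    block.\<close>
  define D where "D i j s = ?T $ j $ i * ?u $ s + ?T $ s $ i * ?u $ j" for i j s
  have diff: "mixed_hessian \<phi> i j y - mixed_hessian \<phi> i j (pack ?x (fibre y + e *\<^sub>R axis s 1)) = e / 2 * D i j s" for i j s
  proof -
    have "pack ?x (fibre y + e *\<^sub>R axis s 1) \<in> R" using e by (simp add: norm_axis_1)
    then show ?thesis
      unfolding mixed_hessian_affine[OF y] D_def
      using exhaust_2[of s] by (auto simp: mixed_hessian_affine t_def sum_2 axis_def algebra_simps
        add_divide_distrib diff_divide_distrib)
  qed
  have "D 1 2 s = 0" "D 2 1 s = 0" "D 1 1 s = D 2 2 s" for s
  proof -
    have "pack ?x (fibre y + e *\<^sub>R axis s 1) \<in> R" using e by (simp add: norm_axis_1)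
    note B = B12[OF this] B12[OF y]
    have "e / 2 * D 1 2 s = 0" "e / 2 * D 2 1 s = 0" "e / 2 * D 1 1 s = e / 2 * D 2 2 s"
      using B unfolding diff[symmetric] by simp_all
    then show "D 1 2 s = 0" "D 2 1 s = 0" "D 1 1 s = D 2 2 s" using e(1) by simp_all
  qed
  \<comment> \<open>With u = TX this trace is tr(T) u_s + (T u)_s; both terms vanish because
    \<open>T\<close> squares to zero.\<close>
  moreover have "D 1 1 s + D 2 2 s = 0" for s
  proof -
    have u: "?u $ 1 = ?T $ 1 $ 1 * X ?x $ 1 + ?T $ 1 $ 2 * X ?x $ 2" "?u $ 2 = ?T $ 2 $ 1 * X ?x $ 1 + ?T $ 2 $ 2 * X ?x $ 2"
      by (simp_all add: matrix_vector_mult_def sum_2)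
    have "?T $ 1 $ 1 * ?u $ 1 + ?T $ 1 $ 2 * ?u $ 2 = 0" "?T $ 2 $ 1 * ?u $ 1 + ?T $ 2 $ 2 * ?u $ 2 = 0"
      using T_entries[OF x(2)] unfolding u by algebra+
    then show ?thesis unfolding D_def using exhaust_2[of s] T_entries(1)[OF x(2)] by auto
  qed
  ultimately have D: "D i j s = 0" for i j s
    using exhaust_2[of i] exhaust_2[of j] by (metis add_self_div_2 double_zero)
  \<comment> \<open>For s = j the vanishing of \<open>D\<close> reads 2 T_ji u_j = 0 for every i; if
    u_j were not zero, row j of \<open>T\<close> would be, and with it u_j.\<close>
  have "?u $ j = 0" for j
  proof (rule ccontr)
    assume "?u $ j \<noteq> 0"
    then have "?T $ j $ i = 0" for i using D[of i j j] by (simp add: D_def)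
    then show False using \<open>?u $ j \<noteq> 0\<close> by (simp add: matrix_vector_mult_def)
  qed
  then show u0: "?u = 0" by (simp add: vec_eq_iff)
  assume ker: "\<And>z. z \<in> R \<Longrightarrow> T (base z) *v X (base z) = 0" and T0: "?T \<noteq> 0"
  define c where "c i j = cov L (coord_field i) X ?x $ j" for i j
  have mc: "mixed_hessian \<phi> i j y = c i j" for i j
    unfolding mixed_hessian_affine[OF y] u0 c_def by simp
  have c: "c 1 2 = 0" "c 2 1 = 0" "c 1 1 = c 2 2" using B12[OF y] by (simp_all add: mc)
  \<comment> \<open>Differentiating TX = 0 along the surface, with \<open>T\<close> parallel, shows
    that \<open>T\<close> annihilates DX. As DX = \<lambda> id, this becomes \<lambda> T =
    0.\<close>
  have tc: "(\<Sum>k\<in>UNIV. ?T $ a $ k * c i k) = 0" for a i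
  proof -
    have dX: "(\<lambda>x. X x $ k) differentiable (at ?x)" for k by (rule smooth_on_differentiable[OF smooth_X_nth x(1)])
    have "pd i (\<lambda>x. \<Sum>k\<in>UNIV. T x $ a $ k * X x $ k) ?x = pd i (\<lambda>x. 0) ?x"
    proof (rule pd_cong)
      show "open (base ` R)" by (rule open_base_image[OF open_R])
      show "(\<Sum>k\<in>UNIV. T x $ a $ k * X x $ k) = 0" if "x \<in> base ` R" for x
        using ker that by (auto simp: matrix_vector_mult_def vec_eq_iff)
    qed (use y in simp)
    then have e: "(\<Sum>k\<in>UNIV. ?T $ a $ k * pd i (\<lambda>x. X x $ k) ?x + pd i (\<lambda>x. T x $ a $ k) ?x * X ?x $ k) = 0"
      by (subst (asm) pd_sum) (simp_all add: pd_mult dX diff_base(2)[OF x(2)])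
    have K: "(\<Sum>k\<in>UNIV. ?T $ b $ k * X ?x $ k) = 0" for b
      using u0 by (simp add: matrix_vector_mult_def vec_eq_iff)
    show ?thesis
      using e K[of 1] K[of 2] unfolding c_def cov_X_nth[OF x(1)] pd_T[OF x(2)] sum_2
      by algebra
  qed
  have "c 1 1 = 0"
  proof (rule ccontr)
    assume "c 1 1 \<noteq> 0"
    then have "?T $ a $ 1 = 0" "?T $ a $ 2 = 0" for a
      using tc[of a 1] tc[of a 2] c by (simp_all add: sum_2)
    then have "?T = 0" by (simp add: vec_eq_iff forall_2)
    then show False using T0 by contradiction
  qed
  then have "c i j = 0" for i j using c exhaust_2[of i] exhaust_2[of j] by auto
  then show "cov L (coord_field i) X ?x = 0" by (simp add: c_def vec_eq_iff)
qed

lemma conf_einstein_parallel_iff: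
  assumes y: "y \<in> R" and ker: "T (base y) *v X (base y) = 0"
    and par: "\<And>i. cov L (coord_field i) X (base y) = 0"
  shows "conf_einstein_eq_at gr \<phi> y \<longleftrightarrow>
    (\<forall>i j. 2 * base_hessian \<phi> i j y + \<phi> y * cylinder_matrix (base y) $ i $ j = 0)"
proof -
  have "mixed_hessian \<phi> i j y = 0" for i j
    unfolding mixed_hessian_affine[OF y] ker by (simp add: par)
  then show ?thesis
    unfolding conf_einstein_iff[OF open_R y R_Y smooth_affine]
    by (simp add: pd_affine[OF y] cylinder_matrix_def)
qed

lemma base_hessian_affine:
  assumes y: "y \<in> R"
  shows "base_hessian \<phi> i j y = (\<Sum>k\<in>UNIV. fibre y $ k * pd i (pd j (\<lambda>x. X x $ k)) (base y)) + pd i (pd j f) (base y)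
     + (\<Sum>k\<in>UNIV. dw (Inr k) i j y * ((\<Sum>l\<in>UNIV. fibre y $ l * pd k (\<lambda>x. X x $ l) (base y)) + pd k f (base y))) / 2
     - (\<Sum>k\<in>UNIV. ((dw (Inl i) j k y + dw (Inl j) i k y - dw (Inl k) i j y)
          + (\<Sum>l\<in>UNIV. w y $ k $ l * dw (Inr l) i j y)) / 2 * X (base y) $ k)"
  unfolding base_hessian_def by (simp add: pd_affine[OF y])

end

end

lemma pd_const_fun[simp]: "pd i (\<lambda>_::real^'n::finite. c) = (\<lambda>_. 0)"
  by (rule ext) simp

text \<open>On the line from \<open>v\<close> to \<open>u\<close> the function is a polynomial in
  one variable with infinitely many zeros near the parameter 0.\<close>

lemma real_polynomial_function_zero_open:
  fixes p :: "real^'n::finite \<Rightarrow> real"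
  assumes p: "real_polynomial_function p" and "open U" "v \<in> U" "\<And>u. u \<in> U \<Longrightarrow> p u = 0"
  shows "p u = 0"
proof -
  have "polynomial_function (\<lambda>s. v + s *\<^sub>R (u - v))"
    by (intro polynomial_function_add polynomial_function_const polynomial_function_bounded_linear
        bounded_linear_scaleR_left)
  from real_polynomial_function_compose[OF this p]
  obtain a n where an: "(\<lambda>s::real. p (v + s *\<^sub>R (u - v))) = (\<lambda>s. \<Sum>i\<le>n. a i * s ^ i)"
    unfolding o_def real_polynomial_function_iff_sum by blast
  have "open ((\<lambda>s::real. v + s *\<^sub>R (u - v)) -` U)"
    by (intro open_vimage assms continuous_intros)
  moreover have "0 \<in> (\<lambda>s::real. v + s *\<^sub>R (u - v)) -` U" using assms(3) by simp
  ultimately obtain e where "e > 0" "ball 0 e \<subseteq> (\<lambda>s::real. v + s *\<^sub>R (u - v)) -` U"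
    using openE by blast
  then have "{0<..<e} \<subseteq> (\<lambda>s::real. v + s *\<^sub>R (u - v)) -` U" "infinite {0<..<e}"
    by (auto simp: subset_iff)
  then have "infinite ((\<lambda>s::real. v + s *\<^sub>R (u - v)) -` U)"
    using finite_subset by blast
  moreover have "(\<lambda>s::real. v + s *\<^sub>R (u - v)) -` U \<subseteq> {s. (\<Sum>i\<le>n. a i * s ^ i) = 0}"
    using assms(4) fun_cong[OF an, symmetric] by auto
  ultimately have "infinite {s. (\<Sum>i\<le>n. a i * s ^ i) = 0}"
    using finite_subset by blast
  then have "a i = 0" if "i \<le> n" for i
    using polyfun_finite_roots[of a n] that by blast
  then have "p (v + 1 *\<^sub>R (u - v)) = 0" using fun_cong[OF an, of 1] by simp
  then show ?thesis by simp
qed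

section \<open>Pullback solutions, dependence on the fibre and the equation in adapted
  coordinates\<close>

context local_extension
begin

lemma pullback_solution_iff:
  assumes "open N" "N \<subseteq> V" "open R" "R \<subseteq> base -` N" "smooth_on N f" "y \<in> R"
    and \<phi>: "\<And>z. z \<in> R \<Longrightarrow> \<phi> z = f (base z)"
  shows "conf_einstein_eq_at gr \<phi> y \<longleftrightarrow> (\<forall>i j. 2 * hessian L f (base y) $ i $ j
    + t i y * (\<Sum>k\<in>UNIV. pd k f (base y) * T (base y) $ k $ j)
    + t j y * (\<Sum>k\<in>UNIV. pd k f (base y) * T (base y) $ k $ i) + f (base y) * cylinder_matrix (base y) $ i $ j = 0)"
proof -
  have \<phi>': "\<phi> z = fibre z \<bullet> (\<lambda>_. 0) (base z) + f (base z)" if "z \<in> R" for z using \<phi>[OF that] by simp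
  note A = assms(1-4) smooth_on_const[of N 0] assms(5) \<phi>'
  have y: "y \<in> Y" using assms by auto
  have "cov L (coord_field i) (\<lambda>_. 0) (base y) = 0" for i by (simp add: cov_def vec_eq_iff)
  then have "conf_einstein_eq_at gr \<phi> y \<longleftrightarrow> (\<forall>i j. 2 * base_hessian \<phi> i j y + \<phi> y * cylinder_matrix (base y) $ i $ j = 0)"
    by (intro conf_einstein_parallel_iff[where X = "\<lambda>_. 0", OF A assms(6)]) simp_all
  moreover have "2 * base_hessian \<phi> i j y = 2 * hessian L f (base y) $ i $ j
    + t i y * (\<Sum>k\<in>UNIV. pd k f (base y) * T (base y) $ k $ j)
    + t j y * (\<Sum>k\<in>UNIV. pd k f (base y) * T (base y) $ k $ i)" for i j
    by (simp add: base_hessian_affine[where X = "\<lambda>_. 0", OF A assms(6)] hessian_def pd_w[OF y] sum_2 algebra_simps add_divide_distrib diff_divide_distrib)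
  ultimately show ?thesis using \<phi>[OF assms(6)] by simp
qed

text \<open>With b = df o T, the equation depends on the fibre coordinates through t_i b_j + t_j
  b_i. Moving a little along the fibre isolates T_si b_j + T_sj b_i = 0, which gives b = 0; the rest
  of the equation lives on the surface.\<close>

lemma pullback_solution:
  assumes "open N" "N \<subseteq> V" "open R" "R \<subseteq> base -` N" "smooth_on N f" "y \<in> R"
    and \<phi>: "\<And>z. z \<in> R \<Longrightarrow> \<phi> z = f (base z)" and sol: "\<And>z. z \<in> R \<Longrightarrow> conf_einstein_eq_at gr \<phi> z"
  shows "(\<Sum>k\<in>UNIV. pd k f (base y) * T (base y) $ k $ i) = 0"
    and "2 * hessian L f (base y) $ i $ j + f (base y) * cylinder_matrix (base y) $ i $ j = 0"
proof -
  let ?x = "base y"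
  define b where "b i = (\<Sum>k\<in>UNIV. pd k f ?x * T ?x $ k $ i)" for i
  obtain e where e: "e > 0" "\<And>v. norm v \<le> e \<Longrightarrow> pack ?x (fibre y + v) \<in> R"
  proof -
    have "open {v. pack ?x v \<in> R}" by (rule open_fibre_slice[OF assms(3)])
    moreover have "fibre y \<in> {v. pack ?x v \<in> R}" using assms(6) by simp
    ultimately obtain e where "e > 0" "cball (fibre y) e \<subseteq> {v. pack ?x v \<in> R}"
      using open_contains_cball by metis
    then show thesis using that[of e] by (auto simp: subset_iff dist_norm)
  qed
  have E: "2 * hessian L f ?x $ i $ j + t i z * b j + t j z * b i + f ?x * cylinder_matrix ?x $ i $ j = 0"
    if "z \<in> R" "base z = ?x" for z i j
    using pullback_solution_iff[OF assms(1-5) that(1) \<phi>] sol[OF that(1)] unfolding that(2) b_def by blast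
  have "T ?x $ s $ i * b j + T ?x $ s $ j * b i = 0" for s i j
  proof -
    let ?z = "pack ?x (fibre y + e *\<^sub>R axis s 1)"
    have "t i ?z = t i y + e * T ?x $ s $ i" for i
      using exhaust_2[of s] by (auto simp: t_def sum_2 axis_def algebra_simps)
    moreover have "?z \<in> R" using e by (simp add: norm_axis_1)
    ultimately have "e * (T ?x $ s $ i * b j + T ?x $ s $ j * b i) = 0"
      using E[of ?z i j] E[OF assms(6) refl, of i j] by (simp add: algebra_simps)
    then show ?thesis using e(1) by simp
  qed
  note * = this
  have "T ?x $ s $ i * b i = 0" for s i using *[of s i i] by (simp add: disj_commute)
  \<comment> \<open>\<open>b i\<close> is a combination of the entries \<open>T ?x $ s $ i\<close>,
    and by the previous line each of these vanishes unless \<open>b i\<close> does.\<close>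
  then have b: "b i = 0" for i
    using b_def[of i] by (metis (no_types, lifting) mult_eq_0_iff sum.neutral)
  then show "(\<Sum>k\<in>UNIV. pd k f ?x * T ?x $ k $ i) = 0" by (simp add: b_def)
  show "2 * hessian L f ?x $ i $ j + f ?x * cylinder_matrix ?x $ i $ j = 0"
    using E[OF assms(6) refl, of i j] by (simp add: b)
qed

lemma fibre_polynomials:
  assumes x: "x \<in> V"
  shows "real_polynomial_function (\<lambda>v. t i (pack x v))"
    and "real_polynomial_function (\<lambda>v. pd (Inl k) (t i) (pack x v))"
    and "real_polynomial_function (\<lambda>v. w (pack x v) $ i $ j)"
    and "real_polynomial_function (\<lambda>v. dw s i j (pack x v))"
proof -
  have y: "pack x v \<in> Y" for v using x by simp
  have nth: "real_polynomial_function (\<lambda>v::real^2. v $ k)" for k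
    by (rule real_polynomial_function.intros(1)[OF bounded_linear_vec_nth])
  note intros = real_polynomial_function_sum real_polynomial_function.intros(4) real_polynomial_function.intros(3)
    real_polynomial_function_diff real_polynomial_function.intros(2) nth finite
  show t: "real_polynomial_function (\<lambda>v. t i (pack x v))" for i
    unfolding t_def base_pack fibre_pack by (intro intros)
  show pt: "real_polynomial_function (\<lambda>v. pd (Inl k) (t i) (pack x v))" for k i
    unfolding pd_t[OF y] base_pack fibre_pack by (intro intros)
  show "real_polynomial_function (\<lambda>v. w (pack x v) $ i $ j)"
    unfolding w_nth base_pack fibre_pack by (intro intros t)
  show "real_polynomial_function (\<lambda>v. dw s i j (pack x v))"
    by (cases s; simp only: pd_w[OF y] base_pack fibre_pack; intro intros t pt)
qed

text \<open>Over a fixed base point the equation is polynomial in the fibre coordinates.\<close>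

lemma parallel_solution_extends:
  assumes N: "open N" "N \<subseteq> V" and R: "open R" "R \<subseteq> base -` N"
    and sm: "smooth_on N X" "smooth_on N f"
    and ker: "\<And>x. x \<in> N \<Longrightarrow> T x *v X x = 0" and par: "\<And>x i. x \<in> N \<Longrightarrow> cov L (coord_field i) X x = 0"
    and sol: "\<And>z. z \<in> R \<Longrightarrow> conf_einstein_eq_at gr (\<lambda>z. fibre z \<bullet> X (base z) + f (base z)) z"
    and y: "base y \<in> base ` R"
  shows "conf_einstein_eq_at gr (\<lambda>z. fibre z \<bullet> X (base z) + f (base z)) y"
proof -
  let ?\<phi> = "\<lambda>z. fibre z \<bullet> X (base z) + f (base z)"
  let ?E = "\<lambda>i j z. 2 * base_hessian ?\<phi> i j z + ?\<phi> z * cylinder_matrix (base z) $ i $ j"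
  note A = N open_base_vimage[OF N(1)] subset_refl sm refl
  have iff: "conf_einstein_eq_at gr ?\<phi> z \<longleftrightarrow> (\<forall>i j. ?E i j z = 0)" if "base z \<in> N" for z
    by (rule conf_einstein_parallel_iff[OF A]) (use that ker par in auto)
  obtain z0 where z0: "z0 \<in> R" "base z0 = base y" using y by auto
  let ?x = "base y"
  have x: "?x \<in> N" "?x \<in> V" using z0 R N by auto
  have "?E i j y = 0" for i j
  proof -
    have bh: "base_hessian ?\<phi> i j (pack ?x v) = (\<Sum>k\<in>UNIV. v $ k * pd i (pd j (\<lambda>x. X x $ k)) ?x) + pd i (pd j f) ?x
     + (\<Sum>k\<in>UNIV. dw (Inr k) i j (pack ?x v) * ((\<Sum>l\<in>UNIV. v $ l * pd k (\<lambda>x. X x $ l) ?x) + pd k f ?x)) / 2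
     - (\<Sum>k\<in>UNIV. ((dw (Inl i) j k (pack ?x v) + dw (Inl j) i k (pack ?x v) - dw (Inl k) i j (pack ?x v))
          + (\<Sum>l\<in>UNIV. w (pack ?x v) $ k $ l * dw (Inr l) i j (pack ?x v))) / 2 * X ?x $ k)" for v
      using base_hessian_affine[OF A, of "pack ?x v" i j] x by simp
    have nth: "real_polynomial_function (\<lambda>v::real^2. v $ k)" for k
      by (rule real_polynomial_function.intros(1)[OF bounded_linear_vec_nth])
    have "real_polynomial_function (\<lambda>v. ?E i j (pack ?x v))"
      unfolding bh unfolding fibre_pack base_pack inner_vec_def inner_real_def
      by (intro real_polynomial_function_sum real_polynomial_function.intros(4) real_polynomial_function.intros(3)
        real_polynomial_function_diff real_polynomial_function.intros(2) real_polynomial_function_divide nth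
        fibre_polynomials x finite)
    moreover have "open {v. pack ?x v \<in> R}" by (rule open_fibre_slice[OF R(1)])
    moreover have "fibre z0 \<in> {v. pack ?x v \<in> R}" using z0 by (metis mem_Collect_eq pack_base_fibre)
    moreover have "?E i j (pack ?x v) = 0" if "v \<in> {v. pack ?x v \<in> R}" for v
      using iff[of "pack ?x v"] sol[of "pack ?x v"] that x by simp
    ultimately have "?E i j (pack ?x (fibre y)) = 0"
      by (rule real_polynomial_function_zero_open)
    then show ?thesis by simp
  qed
  then show ?thesis using iff x by blast
qed

text \<open>The second coordinate field is parallel and lies in ker T, so only the base block of the
  equation remains; its entries 22, 12 and 11 give the three conditions. The first two are the
  derivatives of the factor that multiplies the fibre coordinate in the third.\<close>

lemma adapted_solution_iff:
  assumes Tad: "\<And>x. x \<in> V \<Longrightarrow> T x $ 1 $ 1 = 0 \<and> T x $ 1 $ 2 = 0 \<and> T x $ 2 $ 1 = 1 \<and> T x $ 2 $ 2 = 0"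
    and Lad: "\<And>x i j k. x \<in> V \<Longrightarrow> (i, j, k) \<noteq> (1, 1, 2) \<Longrightarrow> L x i j k = 0"
    and N: "open N" "N \<subseteq> V" and R: "open R" "R \<subseteq> base -` N" and h: "smooth_on N h" and y: "y \<in> R"
    and \<phi>: "\<And>z. z \<in> R \<Longrightarrow> \<phi> z = \<kappa> * fibre z $ 2 + h (base z)"
  shows "conf_einstein_eq_at gr \<phi> y \<longleftrightarrow>
    pd 2 (pd 2 h) (base y) = \<kappa> / 2 * pd 2 (\<lambda>x. \<Phi> x $ 2 $ 2) (base y) \<and>
    pd 1 (pd 2 h) (base y) = \<kappa> / 2 * pd 1 (\<lambda>x. \<Phi> x $ 2 $ 2) (base y) \<and>
    fibre y $ 2 * (pd 2 h (base y) - \<kappa> / 2 * \<Phi> (base y) $ 2 $ 2) +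
    (pd 1 (pd 1 h) (base y) - L (base y) 1 1 2 * pd 2 h (base y) + h (base y) * pd 2 (\<lambda>x. L x 1 1 2) (base y)
     - \<kappa> * pd 1 (\<lambda>x. \<Phi> x $ 2 $ 1) (base y) + \<kappa> / 2 * pd 2 (\<lambda>x. \<Phi> x $ 1 $ 1) (base y)
     + \<kappa> * L (base y) 1 1 2 * \<Phi> (base y) $ 2 $ 2 + h (base y) / 2 * \<Phi> (base y) $ 2 $ 2) = 0"
proof -
  let ?x = "base y"
  have yY: "y \<in> Y" and x: "?x \<in> V" "?x \<in> N" using y R N by auto
  have \<phi>': "\<phi> z = fibre z \<bullet> (\<lambda>_. axis 2 \<kappa>) (base z) + h (base z)" if "z \<in> R" for z
    using \<phi>[OF that] by (simp add: inner_axis)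
  note A = N R smooth_on_const h \<phi>'
  have T: "T ?x $ 1 $ 1 = 0" "T ?x $ 1 $ 2 = 0" "T ?x $ 2 $ 1 = 1" "T ?x $ 2 $ 2 = 0" using Tad[OF x(1)] by auto
  have L0: "L ?x i j k = 0" "pd a (\<lambda>x. L x i j k) ?x = 0" if "(i, j, k) \<noteq> (1, 1, 2)" for i j k a
    using Lad[OF x(1) that] pd_cong[OF open_V x(1), of "\<lambda>x. L x i j k" "\<lambda>_. 0" a] Lad[OF _ that] by simp_all
  have L: "L ?x 1 1 1 = 0" "L ?x 1 2 k = 0" "L ?x 2 1 k = 0" "L ?x 2 2 k = 0"
    "pd a (\<lambda>x. L x 1 1 1) ?x = 0" "pd a (\<lambda>x. L x 1 2 k) ?x = 0" "pd a (\<lambda>x. L x 2 1 k) ?x = 0"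
    "pd a (\<lambda>x. L x 2 2 k) ?x = 0" for a k
    by (rule L0; simp)+
  have pT: "pd a (\<lambda>x. T x $ i $ j) ?x = 0" for a i j
  proof -
    have c: "pd a (\<lambda>x. T x $ i $ j) ?x = pd a (\<lambda>_. T ?x $ i $ j) ?x"
      by (rule pd_cong[OF open_V x(1)]) (use Tad T exhaust_2[of i] exhaust_2[of j] in auto)
    show ?thesis unfolding c by simp
  qed
  have ker: "T ?x *v axis 2 \<kappa> = 0" by (simp add: vec_eq_iff forall_2 matrix_vector_mult_def sum_2 T axis_def)
  have par: "cov L (coord_field i) (\<lambda>_. axis 2 \<kappa>) ?x = 0" for i
    using exhaust_2[of i] by (auto simp: vec_eq_iff cov_coord_nth sum_2 L axis_def)
  have Ps: "\<Phi> ?x $ 1 $ 2 = \<Phi> ?x $ 2 $ 1" and dPs: "pd a (\<lambda>x. \<Phi> x $ 1 $ 2) ?x = pd a (\<lambda>x. \<Phi> x $ 2 $ 1) ?x" for a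
    using \<Phi>_sym[OF x(1)] pd_cong[OF open_V x(1) \<Phi>_sym] by auto
  have hc: "pd 2 (pd 1 h) ?x = pd 1 (pd 2 h) ?x" by (rule pd_commute[OF N(1) x(2) h])
  have r: "cylinder_matrix ?x $ 1 $ 1 = 2 * pd 2 (\<lambda>x. L x 1 1 2) ?x + \<Phi> ?x $ 2 $ 2"
    "cylinder_matrix ?x $ 1 $ 2 = 0" "cylinder_matrix ?x $ 2 $ 1 = 0" "cylinder_matrix ?x $ 2 $ 2 = 0"
    by (simp_all add: cylinder_matrix_def ricci_sym_def transpose_def hat_def matrix_matrix_mult_def sum_2 T
        ricci_nth[OF diff_base(1)[OF x(1)]] L)
  have t: "t 1 y = fibre y $ 2" "t 2 y = 0" by (simp_all add: t_def sum_2 T)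
  have pt: "pd (Inl k) (t i) y = 0" for k i by (simp add: pd_t[OF yY] pT)
  show ?thesis
    by (simp add: conf_einstein_parallel_iff[where X = "\<lambda>_. axis 2 \<kappa>", OF A y ker par] forall_2
        base_hessian_affine[where X = "\<lambda>_. axis 2 \<kappa>", OF A y] \<phi>[OF y] r
        sum_2 pd_w[OF yY] T L t pt w_nth Ps dPs hc axis_def)
      (auto simp: algebra_simps add_divide_distrib diff_divide_distrib)
qed

end

section \<open>Change of coordinates on a surface\<close>

text \<open>Tensor behaviour is established for objects on the surface only. The map
  \<open>F\<close> plays the part of a transition map and \<open>law\<close> is the transformation
  law of connection coefficients; an inverse Jacobian enters as the array \<open>K\<close> where a
  trace is taken.\<close>

locale coordinate_change =
  fixes U U' :: "(real^2) set" and F :: "real^2 \<Rightarrow> real^2" and \<Gamma> \<Gamma>' :: "2 christoffel"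
  assumes open_U: "open U" and open_U': "open U'" and smooth_F: "smooth_on U F" and F_U: "F ` U \<subseteq> U'"
    and smooth_\<Gamma>: "\<And>i j k. smooth_on U (\<lambda>x. \<Gamma> x i j k)" and smooth_\<Gamma>': "\<And>i j k. smooth_on U' (\<lambda>x. \<Gamma>' x i j k)"
    and \<Gamma>_sym: "\<And>x i j k. x \<in> U \<Longrightarrow> \<Gamma> x i j k = \<Gamma> x j i k"
    and \<Gamma>'_sym: "\<And>x i j k. x \<in> U' \<Longrightarrow> \<Gamma>' x i j k = \<Gamma>' x j i k"
    and law: "\<And>x i j k. x \<in> U \<Longrightarrow> (\<Sum>l\<in>UNIV. pd l F x $ k * \<Gamma> x i j l) =
      pd i (pd j F) x $ k + (\<Sum>a\<in>UNIV. \<Sum>b\<in>UNIV. pd i F x $ a * pd j F x $ b * \<Gamma>' (F x) a b k)"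
begin

definition J :: "2 \<Rightarrow> 2 \<Rightarrow> real^2 \<Rightarrow> real" where "J k i x = pd i F x $ k"

lemma smooth_J: "smooth_on U (J k i)"
  unfolding J_def[abs_def] by (intro smooth_on_nth open_U smooth_on_pd smooth_F)

lemma diff_J: "x \<in> U \<Longrightarrow> J k i differentiable (at x)"
  by (rule smooth_on_differentiable[OF smooth_J])

lemma pd_compF:
  fixes g :: "real^2 \<Rightarrow> real"
  assumes x: "x \<in> U" and g: "smooth_on U' g"
  shows "pd i (\<lambda>x. g (F x)) x = (\<Sum>a\<in>UNIV. J a i x * pd a g (F x))" "(\<lambda>x. g (F x)) differentiable (at x)"
proof -
  have 1: "F differentiable (at x)" by (rule smooth_on_differentiable[OF smooth_F x])
  have 2: "g differentiable (at (F x))" using x F_U by (intro smooth_on_differentiable[OF g]) auto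
  show "pd i (\<lambda>x. g (F x)) x = (\<Sum>a\<in>UNIV. J a i x * pd a g (F x))"
    using pd_compose[OF 1 2] by (simp add: J_def)
  show "(\<lambda>x. g (F x)) differentiable (at x)"
    using differentiable_chain_at[OF 1 2] by (simp add: o_def)
qed

text \<open>The transformation law solved for the second derivatives of \<open>F\<close>, which can
  then be eliminated from every later identity.\<close>

lemma pd_J:
  assumes x: "x \<in> U"
  shows "pd i (J k j) x = (\<Sum>l\<in>UNIV. J k l x * \<Gamma> x i j l) - (\<Sum>a\<in>UNIV. \<Sum>b\<in>UNIV. J a i x * J b j x * \<Gamma>' (F x) a b k)"
proof -
  have "pd i (J k j) x = pd i (pd j F) x $ k"
    unfolding J_def[abs_def] by (rule pd_component[OF smooth_on_differentiable[OF smooth_on_pd[OF smooth_F] x]])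
  then show ?thesis using law[OF x, of k i j] by (simp add: J_def)
qed

lemma hessian_change:
  assumes x: "x \<in> U" and f': "smooth_on U' f'" and f: "\<And>x. x \<in> U \<Longrightarrow> f x = f' (F x)"
  shows "hessian \<Gamma> f x $ i $ j = (\<Sum>a\<in>UNIV. \<Sum>b\<in>UNIV. J a i x * J b j x * hessian \<Gamma>' f' (F x) $ a $ b)"
proof -
  have p1: "pd i f z = (\<Sum>a\<in>UNIV. J a i z * pd a f' (F z))" if "z \<in> U" for z i
    using pd_cong[OF open_U that f, where i = i] pd_compF(1)[OF that f', of i] by simp
  have "pd i (pd j f) x = pd i (\<lambda>z. \<Sum>a\<in>UNIV. J a j z * pd a f' (F z)) x"
    by (rule pd_cong[OF open_U x]) (rule p1)
  also have "\<dots> = (\<Sum>a\<in>UNIV. J a j x * (\<Sum>b\<in>UNIV. J b i x * pd b (pd a f') (F x)) + pd i (J a j) x * pd a f' (F x))"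
    by (subst pd_sum) (simp_all add: pd_mult diff_J[OF x] pd_compF[OF x smooth_on_pd[OF f']] differentiable_mult)
  finally have "pd i (pd j f) x = \<dots>" .
  then show ?thesis
    unfolding hessian_def p1[OF x] pd_J[OF x] by (simp add: p1[OF x] sum_2 algebra_simps)
qed

lemma cov02_change:
  assumes x: "x \<in> U" and P': "\<And>a b. smooth_on U' (\<lambda>x. P' x $ a $ b)"
    and P: "\<And>x i j. x \<in> U \<Longrightarrow> P x $ i $ j = (\<Sum>a\<in>UNIV. \<Sum>b\<in>UNIV. J a i x * J b j x * P' (F x) $ a $ b)"
  shows "cov02 \<Gamma> P l x $ i $ j =
    (\<Sum>c\<in>UNIV. \<Sum>a\<in>UNIV. \<Sum>b\<in>UNIV. J c l x * J a i x * J b j x * cov02 \<Gamma>' P' c (F x) $ a $ b)"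
proof -
  have "pd l (\<lambda>x. P x $ i $ j) x = pd l (\<lambda>x. \<Sum>a\<in>UNIV. \<Sum>b\<in>UNIV. J a i x * J b j x * P' (F x) $ a $ b) x"
    by (rule pd_cong[OF open_U x]) (rule P)
  also have "\<dots> = (\<Sum>a\<in>UNIV. \<Sum>b\<in>UNIV. J a i x * J b j x * (\<Sum>c\<in>UNIV. J c l x * pd c (\<lambda>x. P' x $ a $ b) (F x))
      + (J a i x * pd l (J b j) x + pd l (J a i) x * J b j x) * P' (F x) $ a $ b)"
    by (simp add: sum_2 pd_add pd_mult diff_J[OF x] pd_compF[OF x P'])
  finally show ?thesis
    unfolding cov02_def pd_J[OF x] by (simp add: P[OF x] sum_2 algebra_simps)
qed

text \<open>The coefficient of the l-th coordinate field in R(\<partial>_m, \<partial>_i)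
  \<partial>_j.\<close>

definition curv :: "2 christoffel \<Rightarrow> 2 \<Rightarrow> 2 \<Rightarrow> 2 \<Rightarrow> 2 \<Rightarrow> real^2 \<Rightarrow> real" where
  "curv G m i j l x = pd m (\<lambda>x. G x i j l) x - pd i (\<lambda>x. G x m j l) x
     + (\<Sum>n\<in>UNIV. G x m n l * G x i j n) - (\<Sum>n\<in>UNIV. G x i n l * G x m j n)"

text \<open>The transformation law is differentiated and antisymmetrised in m and i; the third
  derivatives of \<open>F\<close> cancel because partial derivatives commute, and the second ones
  are eliminated by \<open>pd_J\<close>.\<close>

lemma curv_change:
  assumes x: "x \<in> U"
  shows "(\<Sum>l\<in>UNIV. J k l x * curv \<Gamma> m i j l x) =
    (\<Sum>d\<in>UNIV. \<Sum>a\<in>UNIV. \<Sum>b\<in>UNIV. J d m x * J a i x * J b j x * curv \<Gamma>' d a b k (F x))"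
proof -
  have Fx: "F x \<in> U'" using x F_U by auto
  have dG: "(\<lambda>x. \<Gamma> x i j k) differentiable (at x)" for i j k
    by (rule smooth_on_differentiable[OF smooth_\<Gamma> x])
  have star: "(\<Sum>l\<in>UNIV. pd m (J k l) x * \<Gamma> x i j l + J k l x * pd m (\<lambda>x. \<Gamma> x i j l) x) = pd m (pd i (J k j)) x
     + (\<Sum>a\<in>UNIV. \<Sum>b\<in>UNIV. (pd m (J a i) x * J b j x + J a i x * pd m (J b j) x) * \<Gamma>' (F x) a b k
       + J a i x * J b j x * (\<Sum>d\<in>UNIV. J d m x * pd d (\<lambda>x. \<Gamma>' x a b k) (F x)))" for m i
  proof -
    have 0: "pd i (J k j) z + (\<Sum>a\<in>UNIV. \<Sum>b\<in>UNIV. J a i z * J b j z * \<Gamma>' (F z) a b k) = (\<Sum>l\<in>UNIV. J k l z * \<Gamma> z i j l)"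
      if "z \<in> U" for z using pd_J[OF that, of i k j] by simp
    have "pd m (\<lambda>z. pd i (J k j) z + (\<Sum>a\<in>UNIV. \<Sum>b\<in>UNIV. J a i z * J b j z * \<Gamma>' (F z) a b k)) x
        = pd m (\<lambda>z. \<Sum>l\<in>UNIV. J k l z * \<Gamma> z i j l) x"
      by (rule pd_cong[OF open_U x]) (rule 0)
    moreover have "pd i (J k j) differentiable (at x)"
      by (rule smooth_on_differentiable[OF smooth_on_pd[OF smooth_J] x])
    ultimately show ?thesis
      by (simp add: sum_2 pd_add pd_mult diff_J[OF x] dG pd_compF[OF x smooth_\<Gamma>'] algebra_simps)
  qed
  have comm: "pd m (pd i (J k j)) x = pd i (pd m (J k j)) x" by (rule pd_commute[OF open_U x smooth_J])
  have s: "\<Gamma> x 2 1 k = \<Gamma> x 1 2 k" "\<Gamma>' (F x) 2 1 k = \<Gamma>' (F x) 1 2 k" for k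
    using \<Gamma>_sym[OF x] \<Gamma>'_sym[OF Fx] by auto
  have eq: "(\<Sum>l\<in>UNIV. pd m (J k l) x * \<Gamma> x i j l + J k l x * pd m (\<lambda>x. \<Gamma> x i j l) x)
      - (\<Sum>a\<in>UNIV. \<Sum>b\<in>UNIV. (pd m (J a i) x * J b j x + J a i x * pd m (J b j) x) * \<Gamma>' (F x) a b k
       + J a i x * J b j x * (\<Sum>d\<in>UNIV. J d m x * pd d (\<lambda>x. \<Gamma>' x a b k) (F x)))
      = (\<Sum>l\<in>UNIV. pd i (J k l) x * \<Gamma> x m j l + J k l x * pd i (\<lambda>x. \<Gamma> x m j l) x)
      - (\<Sum>a\<in>UNIV. \<Sum>b\<in>UNIV. (pd i (J a m) x * J b j x + J a m x * pd i (J b j) x) * \<Gamma>' (F x) a b k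
       + J a m x * J b j x * (\<Sum>d\<in>UNIV. J d i x * pd d (\<lambda>x. \<Gamma>' x a b k) (F x)))"
    unfolding star comm by simp
  \<comment> \<open>Both sides are antisymmetric in m and i, so in dimension two the only content is
    the pair 1, 2.\<close>
  have "m = i \<or> m = 1 \<and> i = 2 \<or> m = 2 \<and> i = 1" using exhaust_2[of m] exhaust_2[of i] by auto
  then show ?thesis
  proof (elim disjE conjE)
    assume "m = i"
    then show ?thesis by (simp add: curv_def sum_2 algebra_simps s)
  next
    assume mi: "m = 1" "i = 2"
    show ?thesis using eq unfolding mi curv_def pd_J[OF x] sum_2 s by algebra
  next
    assume mi: "m = 2" "i = 1"
    show ?thesis using eq unfolding mi curv_def pd_J[OF x] sum_2 s by algebra
  qed
qed

lemma ricci_curv: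
  assumes "\<And>i j k. (\<lambda>x. G x i j k) differentiable (at x)"
  shows "ricci G x $ i $ j = (\<Sum>m\<in>UNIV. curv G m i j m x)"
  unfolding ricci_nth[OF assms] curv_def by (simp add: sum.distrib sum_subtractf)

text \<open>Similar 2x2 matrices have equal traces, spelled out in entries: \<open>j\<close> and
  \<open>k\<close> are inverse to each other, and the last four hypotheses say that \<open>j\<close>
  intertwines \<open>c\<close> and \<open>s\<close>.\<close>

lemma trace_change:
  fixes j11 :: real
  assumes "j11 * k11 + j12 * k21 = 1" "j11 * k12 + j12 * k22 = 0" "j21 * k11 + j22 * k21 = 0" "j21 * k12 + j22 * k22 = 1"
    "k11 * j11 + k12 * j21 = 1" "k11 * j12 + k12 * j22 = 0" "k21 * j11 + k22 * j21 = 0" "k21 * j12 + k22 * j22 = 1"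
    "j11 * c11 + j12 * c12 = j11 * s11 + j21 * s21" "j21 * c11 + j22 * c12 = j11 * s12 + j21 * s22"
    "j11 * c21 + j12 * c22 = j12 * s11 + j22 * s21" "j21 * c21 + j22 * c22 = j12 * s12 + j22 * s22"
  shows "c11 + c22 = s11 + s22"
proof -
  have "c11 = k11 * (j11 * c11 + j12 * c12) + k12 * (j21 * c11 + j22 * c12)"
    using assms(5,6) by algebra
  moreover have "c22 = k21 * (j11 * c21 + j12 * c22) + k22 * (j21 * c21 + j22 * c22)"
    using assms(7,8) by algebra
  ultimately have "c11 + c22 = k11 * (j11 * s11 + j21 * s21) + k12 * (j11 * s12 + j21 * s22)
      + k21 * (j12 * s11 + j22 * s21) + k22 * (j12 * s12 + j22 * s22)"
    unfolding assms(9-12) by simp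
  also have "\<dots> = (j11 * k11 + j12 * k21) * s11 + (j21 * k11 + j22 * k21) * s21
      + (j11 * k12 + j12 * k22) * s12 + (j21 * k12 + j22 * k22) * s22" by algebra
  finally show ?thesis unfolding assms(1-4) by simp
qed

text \<open>The Ricci tensor contracts an upper with a lower index of the curvature. For fixed i and
  j the transformation of the curvature is a similarity by the Jacobian, so its trace is
  preserved.\<close>

lemma ricci_change:
  assumes x: "x \<in> U" and K: "\<And>a b. (\<Sum>m\<in>UNIV. J a m x * K m b) = (if a = b then 1 else 0)"
    and K': "\<And>a b. (\<Sum>m\<in>UNIV. K a m * J m b x) = (if a = b then 1 else 0)"
  shows "ricci \<Gamma> x $ i $ j = (\<Sum>a\<in>UNIV. \<Sum>b\<in>UNIV. J a i x * J b j x * ricci \<Gamma>' (F x) $ a $ b)"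
proof -
  have Fx: "F x \<in> U'" using x F_U by auto
  have r: "ricci \<Gamma> x $ i $ j = (\<Sum>m\<in>UNIV. curv \<Gamma> m i j m x)" "ricci \<Gamma>' (F x) $ a $ b = (\<Sum>m\<in>UNIV. curv \<Gamma>' m a b m (F x))" for a b
    by (intro ricci_curv smooth_on_differentiable[OF smooth_\<Gamma> x] smooth_on_differentiable[OF smooth_\<Gamma>' Fx])+
  have k: "J 1 1 x * K 1 1 + J 1 2 x * K 2 1 = 1" "J 1 1 x * K 1 2 + J 1 2 x * K 2 2 = 0"
    "J 2 1 x * K 1 1 + J 2 2 x * K 2 1 = 0" "J 2 1 x * K 1 2 + J 2 2 x * K 2 2 = 1"
    using K[of 1 1] K[of 1 2] K[of 2 1] K[of 2 2] by (simp_all add: sum_2)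
  have k': "K 1 1 * J 1 1 x + K 1 2 * J 2 1 x = 1" "K 1 1 * J 1 2 x + K 1 2 * J 2 2 x = 0"
    "K 2 1 * J 1 1 x + K 2 2 * J 2 1 x = 0" "K 2 1 * J 1 2 x + K 2 2 * J 2 2 x = 1"
    using K'[of 1 1] K'[of 1 2] K'[of 2 1] K'[of 2 2] by (simp_all add: sum_2)
  let ?S = "\<lambda>d k. \<Sum>a\<in>UNIV. \<Sum>b\<in>UNIV. J a i x * J b j x * curv \<Gamma>' d a b k (F x)"
  have e: "(\<Sum>l\<in>UNIV. J k l x * curv \<Gamma> m i j l x) = (\<Sum>d\<in>UNIV. J d m x * ?S d k)" for k m
    unfolding curv_change[OF x] by (simp add: sum_distrib_left mult.assoc)
  have e': "J k 1 x * curv \<Gamma> m i j 1 x + J k 2 x * curv \<Gamma> m i j 2 x = J 1 m x * ?S 1 k + J 2 m x * ?S 2 k" for k m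
    using e[of k m] by (simp only: sum_2)
  have "curv \<Gamma> 1 i j 1 x + curv \<Gamma> 2 i j 2 x = ?S 1 1 + ?S 2 2"
    using k k' e'[of 1 1] e'[of 2 1] e'[of 1 2] e'[of 2 2]
    by (rule trace_change)
  then show ?thesis unfolding r by (simp add: sum_2 algebra_simps)
qed

end

section \<open>Primitives of smooth functions on a box\<close>

text \<open>The derivative with partial derivatives \<open>d\<close> as an element of the normed
  space of bounded linear maps, the form in which differentiation under the integral sign and the
  inverse function theorem take derivatives.\<close>

definition grad_blinfun :: "('n::finite \<Rightarrow> 'b::real_normed_vector) \<Rightarrow> (real^'n) \<Rightarrow>\<^sub>L 'b" where
  "grad_blinfun d = (\<Sum>i\<in>UNIV. blinfun_scaleR_left (d i) o\<^sub>L blinfun_inner_left (axis i 1))"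

lemma blinfun_apply_sum: "blinfun_apply (\<Sum>i\<in>I. f i) v = (\<Sum>i\<in>I. blinfun_apply (f i) v)"
  by (induction I rule: infinite_finite_induct) (simp_all add: blinfun.add_left blinfun.zero_left)

lemma grad_blinfun_apply: "blinfun_apply (grad_blinfun d) v = (\<Sum>i\<in>UNIV. v $ i *\<^sub>R d i)"
  by (simp add: grad_blinfun_def blinfun_apply_sum inner_axis)

lemma continuous_on_grad_blinfun:
  "(\<And>i. continuous_on S (\<lambda>x. d i x)) \<Longrightarrow> continuous_on S (\<lambda>x. grad_blinfun (\<lambda>i. d i x))"
  unfolding grad_blinfun_def by (intro continuous_intros) auto

text \<open>The segment parallel to the i-th axis from the hyperplane x_i = c, reached at s = 0, to
  \<open>x\<close>, reached at s = 1.\<close>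

definition slide :: "'n::finite \<Rightarrow> real \<Rightarrow> real^'n \<Rightarrow> real \<Rightarrow> real^'n" where
  "slide i c x s = x + ((s - 1) * (x $ i - c)) *\<^sub>R axis i 1"

lemma slide_in_box:
  assumes "x \<in> box a b" "a $ i < c" "c < b $ i" "0 \<le> s" "s \<le> 1"
  shows "slide i c x s \<in> box a b"
proof -
  have *: "x $ i + (s - 1) * (x $ i - c) = s * x $ i + (1 - s) * c" by (simp add: algebra_simps)
  have xi: "a $ i < x $ i" "x $ i < b $ i" using assms(1) by (auto simp: mem_box_cart)
  have "a $ i < s * x $ i + (1 - s) * c \<and> s * x $ i + (1 - s) * c < b $ i"
  proof (cases "s = 0")
    case False
    then have "s * a $ i < s * x $ i" "s * x $ i < s * b $ i" using assms xi by auto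
    moreover have "(1 - s) * a $ i \<le> (1 - s) * c" "(1 - s) * c \<le> (1 - s) * b $ i"
      using assms by (auto intro!: mult_left_mono)
    ultimately show ?thesis by (auto simp: algebra_simps)
  qed (use assms in simp)
  then show ?thesis
    using assms(1) * by (auto simp: mem_box_cart slide_def axis_def)
qed

lemma has_derivative_slide: "((\<lambda>x. slide i c x s) has_derivative (\<lambda>v. v + ((s - 1) * v $ i) *\<^sub>R axis i 1)) (at x)"
  unfolding slide_def
  by (auto intro!: derivative_eq_intros bounded_linear.has_derivative[OF bounded_linear_vec_nth])

text \<open>Each derivative in direction \<open>i\<close> brings down a factor s. The weight s^m
  makes the family closed under partial differentiation, so smoothness follows by induction.\<close>

definition slide_integral :: "'n::finite \<Rightarrow> real \<Rightarrow> nat \<Rightarrow> (real^'n \<Rightarrow> real) \<Rightarrow> real^'n \<Rightarrow> real" where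
  "slide_integral i c m q x = integral (cbox 0 1) (\<lambda>s. s ^ m * q (slide i c x s))"

context
  fixes a b :: "real^'n::finite" and i :: 'n and c :: real
  assumes c: "a $ i < c" "c < b $ i"
begin

lemma continuous_on_slide: "continuous_on S (\<lambda>z. slide i c (fst z) (snd z))"
  unfolding slide_def by (intro continuous_intros)

lemma continuous_on_slide_comp:
  assumes "smooth_on (box a b) q"
  shows "continuous_on (box a b \<times> cbox 0 1) (\<lambda>z. q (slide i c (fst z) (snd z)))"
  by (rule continuous_on_compose2[OF smooth_on_continuous[OF assms] continuous_on_slide])
    (auto intro!: slide_in_box c)

lemma continuous_on_slide_comp1:
  assumes "smooth_on (box a b) q" "x \<in> box a b"
  shows "continuous_on (cbox 0 1) (\<lambda>s. q (slide i c x s))"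
  using continuous_on_compose2[OF continuous_on_slide_comp[OF assms(1)]
      continuous_on_Pair[OF continuous_on_const[of _ x] continuous_on_id], of "cbox 0 1"] assms(2)
  by auto

lemma slide_integral_derivative:
  assumes q: "smooth_on (box a b) q" and x: "x \<in> box a b"
  shows "slide_integral i c m q differentiable (at x)"
    and "pd j (slide_integral i c m q) x = slide_integral i c (if j = i then Suc m else m) (pd j q) x"
proof -
  define d where "d j x s = s ^ m * (if j = i then s else 1) * pd j q (slide i c x s)" for j x s
  have qx: "((\<lambda>x. s ^ m * q (slide i c x s)) has_derivative blinfun_apply (grad_blinfun (\<lambda>j. d j x s))) (at x within box a b)"
    if "x \<in> box a b" "s \<in> cbox 0 1" for x s
  proof -
    have "slide i c x s \<in> box a b" using that c by (intro slide_in_box) auto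
    from has_derivative_compose[OF has_derivative_slide has_derivative_pd[OF smooth_on_differentiable[OF q this]]]
    have "((\<lambda>x. q (slide i c x s)) has_derivative
        (\<lambda>v. \<Sum>k\<in>UNIV. (v + ((s - 1) * v $ i) *\<^sub>R axis i 1) $ k *\<^sub>R pd k q (slide i c x s))) (at x)" .
    then have "((\<lambda>x. s ^ m * q (slide i c x s)) has_derivative
        (\<lambda>v. s ^ m * (\<Sum>k\<in>UNIV. (v + ((s - 1) * v $ i) *\<^sub>R axis i 1) $ k *\<^sub>R pd k q (slide i c x s)))) (at x)"
      by (rule has_derivative_mult_right)
    moreover have "(\<lambda>v. s ^ m * (\<Sum>k\<in>UNIV. (v + ((s - 1) * v $ i) *\<^sub>R axis i 1) $ k *\<^sub>R pd k q (slide i c x s)))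
        = blinfun_apply (grad_blinfun (\<lambda>j. d j x s))"
    proof
      fix v
      have "(v + ((s - 1) * v $ i) *\<^sub>R axis i 1) $ k = (if k = i then s else 1) * v $ k" for k
        by (simp add: axis_def algebra_simps)
      then show "s ^ m * (\<Sum>k\<in>UNIV. (v + ((s - 1) * v $ i) *\<^sub>R axis i 1) $ k *\<^sub>R pd k q (slide i c x s))
          = blinfun_apply (grad_blinfun (\<lambda>j. d j x s)) v"
        unfolding grad_blinfun_apply d_def by (simp add: sum_distrib_left mult_ac)
    qed
    ultimately show ?thesis by (simp add: has_derivative_at_withinI)
  qed
  have cd: "continuous_on (box a b \<times> cbox 0 1) (\<lambda>z. d j (fst z) (snd z))" for j
  proof -
    have "continuous_on (box a b \<times> cbox 0 1) (\<lambda>z. pd j q (slide i c (fst z) (snd z)))"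
      by (rule continuous_on_slide_comp[OF smooth_on_pd[OF q]])
    moreover have "continuous_on (box a b \<times> cbox 0 1) (\<lambda>z::(real^'n) \<times> real. if j = i then snd z else 1)"
      by (cases "j = i") (simp_all add: continuous_on_snd continuous_on_id)
    ultimately show ?thesis unfolding d_def by (intro continuous_intros)
  qed
  have cf: "continuous_on (box a b \<times> cbox 0 1) (\<lambda>(x, s). grad_blinfun (\<lambda>j. d j x s))"
    unfolding case_prod_beta by (rule continuous_on_grad_blinfun) (rule cd)
  have "((\<lambda>x. integral (cbox 0 1) (\<lambda>s. s ^ m * q (slide i c x s))) has_derivative
      blinfun_apply (integral (cbox 0 1) (\<lambda>s. grad_blinfun (\<lambda>j. d j x s)))) (at x within box a b)"
  proof (rule leibniz_rule[OF _ _ cf x])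
    show "(\<lambda>s. s ^ m * q (slide i c x s)) integrable_on cbox 0 1" if "x \<in> box a b" for x
      by (intro integrable_continuous continuous_intros continuous_on_slide_comp1 q that)
  qed (auto intro: qx convex_box)
  then have der: "(slide_integral i c m q has_derivative
      blinfun_apply (integral (cbox 0 1) (\<lambda>s. grad_blinfun (\<lambda>j. d j x s)))) (at x)"
    unfolding slide_integral_def[abs_def] using at_within_open[OF x open_box] by simp
  then show "slide_integral i c m q differentiable (at x)" by (rule has_derivative_imp_differentiable)
  have cs: "continuous_on (cbox 0 1) (\<lambda>s. d j x s)" for j
    using continuous_on_compose2[OF cd continuous_on_Pair[OF continuous_on_const[of _ x] continuous_on_id], of "cbox 0 1"] x
    by auto
  have "pd j (slide_integral i c m q) x = blinfun_apply (integral (cbox 0 1) (\<lambda>s. grad_blinfun (\<lambda>j. d j x s))) (axis j 1)"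
    by (rule pd_eqI[OF der])
  also have "\<dots> = integral (cbox 0 1) (\<lambda>s. blinfun_apply (grad_blinfun (\<lambda>j. d j x s)) (axis j 1))"
    by (rule blinfun_apply_integral) (intro integrable_continuous continuous_on_grad_blinfun cs)
  also have "\<dots> = slide_integral i c (if j = i then Suc m else m) (pd j q) x"
  proof -
    have "blinfun_apply (grad_blinfun (\<lambda>j. d j x s)) (axis j 1) = d j x s" for s
      unfolding grad_blinfun_apply axis_def by (simp add: if_distrib if_distribR cong: if_cong)
    moreover have "d j x = (\<lambda>s. s ^ (if j = i then Suc m else m) * pd j q (slide i c x s))"
      by (auto simp: d_def)
    ultimately show ?thesis by (simp only: slide_integral_def)
  qed
  finally show "pd j (slide_integral i c m q) x = slide_integral i c (if j = i then Suc m else m) (pd j q) x" .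
qed

lemma smooth_slide_integral:
  assumes "smooth_on (box a b) q"
  shows "smooth_on (box a b) (slide_integral i c m q)"
  unfolding smooth_on_def
proof
  fix k
  show "Ck_on k (box a b) (slide_integral i c m q)"
    using assms
  proof (induction k arbitrary: m q)
    case 0
    then show ?case
      by (auto intro!: continuous_at_imp_continuous_on differentiable_imp_continuous_within slide_integral_derivative)
  next
    case (Suc k)
    have "Ck_on k (box a b) (pd j (slide_integral i c m q))" for j
      by (rule Ck_on_cong[OF open_box _ Suc.IH[OF smooth_on_pd[OF Suc.prems]]])
        (rule slide_integral_derivative(2)[OF Suc.prems, symmetric])
    then show ?case using slide_integral_derivative(1)[OF Suc.prems] by simp
  qed
qed

text \<open>The integral of \<open>q\<close> from c to x_i in direction \<open>i\<close>, rescaled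
  to the fixed interval from 0 to 1 so that it can be differentiated under the integral
  sign.\<close>

definition primitive :: "(real^'n \<Rightarrow> real) \<Rightarrow> real^'n \<Rightarrow> real" where
  "primitive q x = (x $ i - c) * slide_integral i c 0 q x"

lemma primitive:
  assumes q: "smooth_on (box a b) q"
  shows "smooth_on (box a b) (primitive q)"
    and "x \<in> box a b \<Longrightarrow> pd i (primitive q) x = q x"
    and "x \<in> box a b \<Longrightarrow> j \<noteq> i \<Longrightarrow> (\<And>y. y \<in> box a b \<Longrightarrow> pd j q y = 0) \<Longrightarrow> pd j (primitive q) x = 0"
proof -
  have lin: "smooth_on S (\<lambda>x. x $ i - c)" if "open S" for S :: "(real^'n) set"
    by (intro smooth_on_diff smooth_on_const smooth_on_nth smooth_on_id that)
  show "smooth_on (box a b) (primitive q)"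
    unfolding primitive_def[abs_def] by (intro smooth_on_mult lin smooth_slide_integral q open_box)
  have pd: "pd j (primitive q) x = (x $ i - c) * pd j (slide_integral i c 0 q) x
      + (if j = i then 1 else 0) * slide_integral i c 0 q x" if x: "x \<in> box a b" for j x
  proof -
    have d: "(\<lambda>x::real^'n. x $ i) differentiable (at x)"
      by (intro differentiable_nth) simp
    then have "pd j (\<lambda>x::real^'n. x $ i - c) x = (if j = i then 1 else 0)"
      by (subst pd_diff) simp_all
    then show ?thesis
      unfolding primitive_def[abs_def]
      using smooth_on_differentiable[OF lin[OF open_UNIV]] slide_integral_derivative(1)[OF q x, of 0]
      by (subst pd_mult) auto
  qed
  show "pd j (primitive q) x = 0" if x: "x \<in> box a b" "j \<noteq> i" and z: "\<And>y. y \<in> box a b \<Longrightarrow> pd j q y = 0"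
  proof -
    have "slide_integral i c 0 (pd j q) x = integral (cbox 0 1) (\<lambda>s::real. 0)"
      unfolding slide_integral_def
      by (rule Henstock_Kurzweil_Integration.integral_cong) (use z slide_in_box[OF x(1) c] in auto)
    then show ?thesis unfolding pd[OF x(1)] slide_integral_derivative(2)[OF q x(1)] using x(2) by simp
  qed
  show "pd i (primitive q) x = q x" if x: "x \<in> box a b"
  proof -
    \<comment> \<open>\<open>?g\<close> is the derivative in s of s q(\<open>slide i c x s\<close>),
      so its integral is q(x); it is also the integrand that the product rule produces for the
      derivative of \<open>primitive\<close>.\<close>
    let ?g = "\<lambda>s. (x $ i - c) * (s * pd i q (slide i c x s)) + q (slide i c x s)"
    have "((\<lambda>s. s * q (slide i c x s)) has_vector_derivative ?g s) (at s within {0..1})" if "s \<in> {0..1}" for s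
    proof -
      have "slide i c x s \<in> box a b" using that c x by (intro slide_in_box) auto
      note q' = has_derivative_pd[OF smooth_on_differentiable[OF q this]]
      have "((\<lambda>s. slide i c x s) has_derivative (\<lambda>h. (h * (x $ i - c)) *\<^sub>R axis i 1)) (at s)"
        unfolding slide_def by (auto intro!: derivative_eq_intros)
      from has_derivative_compose[OF this q']
      have "((\<lambda>s. q (slide i c x s)) has_real_derivative (x $ i - c) * pd i q (slide i c x s)) (at s)"
      proof -
        assume "((\<lambda>s. q (slide i c x s)) has_derivative
          (\<lambda>h. \<Sum>k\<in>UNIV. ((h * (x $ i - c)) *\<^sub>R axis i 1) $ k *\<^sub>R pd k q (slide i c x s))) (at s)"
        moreover have "(\<lambda>h. \<Sum>k\<in>UNIV. ((h * (x $ i - c)) *\<^sub>R axis i 1) $ k *\<^sub>R pd k q (slide i c x s)) =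
            times ((x $ i - c) * pd i q (slide i c x s))"
          by (simp add: fun_eq_iff axis_def if_distrib if_distribR mult_ac cong: if_cong)
        ultimately show ?thesis by (simp add: has_field_derivative_def)
      qed
      then have "((\<lambda>s. s * q (slide i c x s)) has_real_derivative ?g s) (at s)"
        by (auto intro!: derivative_eq_intros simp: algebra_simps)
      then show ?thesis
        by (simp add: has_real_derivative_iff_has_vector_derivative has_vector_derivative_at_within)
    qed
    from fundamental_theorem_of_calculus[OF zero_le_one this]
    have "(?g has_integral q (slide i c x 1)) {0..1}" by simp
    then have "integral (cbox 0 1) ?g = q x" by (simp add: slide_def integral_unique)
    moreover have "integral (cbox 0 1) ?g = (x $ i - c) * slide_integral i c 1 (pd i q) x + slide_integral i c 0 q x"
    proof -
      have "integral (cbox 0 1) ?g = integral (cbox 0 1) (\<lambda>s. (x $ i - c) * (s * pd i q (slide i c x s)))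
          + integral (cbox 0 1) (\<lambda>s. q (slide i c x s))"
        by (rule integral_add) (intro integrable_continuous continuous_intros continuous_on_slide_comp1 smooth_on_pd q x)+
      then show ?thesis by (simp add: slide_integral_def)
    qed
    ultimately show ?thesis unfolding pd[OF x] slide_integral_derivative(2)[OF q x] by simp
  qed
qed

end

text \<open>Poincare lemma on a box: \<open>P\<close> integrates \<theta>2 in direction 2. By
  closedness the difference of \<theta>1 and the first derivative of \<open>P\<close> does not
  depend on x_2, so its primitive in direction 1 corrects \<open>P\<close> without disturbing the
  second derivative.\<close>

lemma potential_on_box:
  fixes a b :: "real^2" and \<theta>1 \<theta>2 :: "real^2 \<Rightarrow> real"
  assumes ne: "box a b \<noteq> {}" and sm: "smooth_on (box a b) \<theta>1" "smooth_on (box a b) \<theta>2"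
    and closed: "\<And>x. x \<in> box a b \<Longrightarrow> pd 1 \<theta>2 x = pd 2 \<theta>1 x"
  obtains u where "smooth_on (box a b) u" "\<And>x. x \<in> box a b \<Longrightarrow> pd 1 u x = \<theta>1 x" "\<And>x. x \<in> box a b \<Longrightarrow> pd 2 u x = \<theta>2 x"
proof -
  obtain c where "c \<in> box a b" using ne by auto
  then have c: "a $ i < c $ i" "c $ i < b $ i" for i by (auto simp: mem_box_cart)
  let ?B = "box a b"
  define P where "P = primitive 2 (c $ 2) \<theta>2"
  have P: "smooth_on ?B P" "\<And>x. x \<in> ?B \<Longrightarrow> pd 2 P x = \<theta>2 x"
    unfolding P_def by (rule primitive[OF c sm(2)], rule primitive[OF c sm(2)])
  define q where "q x = \<theta>1 x - pd 1 P x" for x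
  have q: "smooth_on ?B q" unfolding q_def by (intro smooth_on_diff open_box sm smooth_on_pd P)
  have q2: "pd 2 q x = 0" if x: "x \<in> ?B" for x
  proof -
    have "pd 2 (pd 1 P) x = pd 1 (pd 2 P) x" by (rule pd_commute[OF open_box x P(1)])
    also have "\<dots> = pd 1 \<theta>2 x" by (rule pd_cong[OF open_box x]) (rule P)
    also have "\<dots> = pd 2 \<theta>1 x" by (rule closed[OF x])
    finally show ?thesis unfolding q_def
      by (subst pd_diff) (use smooth_on_differentiable[OF sm(1) x] smooth_on_differentiable[OF smooth_on_pd[OF P(1)] x] in auto)
  qed
  define Q where "Q = primitive 1 (c $ 1) q"
  have Q: "smooth_on ?B Q" "\<And>x. x \<in> ?B \<Longrightarrow> pd 1 Q x = q x" "\<And>x. x \<in> ?B \<Longrightarrow> pd 2 Q x = 0"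
    unfolding Q_def by (rule primitive[OF c q], rule primitive(2)[OF c q], assumption, rule primitive(3)[OF c q]) (auto intro: q2)
  show thesis
  proof (rule that[of "\<lambda>x. P x + Q x"])
    show "smooth_on ?B (\<lambda>x. P x + Q x)" by (intro smooth_on_add open_box P Q)
    fix x assume x: "x \<in> ?B"
    have "pd i (\<lambda>x. P x + Q x) x = pd i P x + pd i Q x" for i
      using smooth_on_differentiable[OF P(1) x] smooth_on_differentiable[OF Q(1) x] by (rule pd_add)
    then show "pd 1 (\<lambda>x. P x + Q x) x = \<theta>1 x" "pd 2 (\<lambda>x. P x + Q x) x = \<theta>2 x"
      using P(2)[OF x] Q(2,3)[OF x] by (simp_all add: q_def)
  qed
qed

section \<open>Parallel fields vanish everywhere or nowhere\<close>

text \<open>The squared norm of \<open>f\<close> times exp(-2Kt) is nonincreasing, and it is zero at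
  t = 0.\<close>

lemma gronwall_zero:
  fixes f :: "real \<Rightarrow> 'b::real_inner"
  assumes der: "\<And>t. 0 \<le> t \<Longrightarrow> t \<le> 1 \<Longrightarrow> (f has_derivative (\<lambda>h. h *\<^sub>R f' t)) (at t)"
    and bound: "\<And>t. 0 \<le> t \<Longrightarrow> t \<le> 1 \<Longrightarrow> norm (f' t) \<le> K * norm (f t)" and "f 0 = 0"
  shows "f 1 = 0"
proof -
  let ?g = "\<lambda>t. (f t \<bullet> f t) * exp (- (2 * K * t))"
  have "?g 1 \<le> ?g 0"
  proof (rule DERIV_nonpos_imp_nonincreasing[of 0 1 ?g])
    fix t :: real assume t: "0 \<le> t" "t \<le> 1"
    have "((\<lambda>t. f t \<bullet> f t) has_real_derivative 2 * (f t \<bullet> f' t)) (at t)"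
    proof -
      have "((\<lambda>t. f t \<bullet> f t) has_derivative (\<lambda>h. f t \<bullet> (h *\<^sub>R f' t) + (h *\<^sub>R f' t) \<bullet> f t)) (at t)"
        by (rule has_derivative_inner[OF der[OF t] der[OF t]])
      moreover have "(\<lambda>h. f t \<bullet> (h *\<^sub>R f' t) + (h *\<^sub>R f' t) \<bullet> f t) = times (2 * (f t \<bullet> f' t))"
        by (auto simp: fun_eq_iff inner_commute algebra_simps)
      ultimately show ?thesis by (simp add: has_field_derivative_def)
    qed
    then have d: "(?g has_real_derivative (2 * (f t \<bullet> f' t) - 2 * K * (f t \<bullet> f t)) * exp (- (2 * K * t))) (at t)"
      by (auto intro!: derivative_eq_intros simp: algebra_simps)
    have "f t \<bullet> f' t \<le> norm (f t) * norm (f' t)" by (rule norm_cauchy_schwarz)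
    also have "\<dots> \<le> norm (f t) * (K * norm (f t))" by (intro mult_left_mono bound t) simp
    also have "\<dots> = K * (f t \<bullet> f t)" by (simp add: power2_norm_eq_inner[symmetric] power2_eq_square)
    finally have "(2 * (f t \<bullet> f' t) - 2 * K * (f t \<bullet> f t)) * exp (- (2 * K * t)) \<le> 0"
      by (intro mult_nonpos_nonneg) auto
    then show "\<exists>y. (?g has_real_derivative y) (at t) \<and> y \<le> 0" using d by blast
  qed simp
  then have "f 1 \<bullet> f 1 \<le> 0" using \<open>f 0 = 0\<close> by (simp add: mult_le_0_iff)
  then show ?thesis using inner_ge_zero[of "f 1"] inner_eq_zero_iff[of "f 1"] by linarith
qed

text \<open>Along the segment from \<open>z\<close> to \<open>x\<close> the differential inequality
  becomes one for a function of a single variable.\<close>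

lemma zero_propagates:
  fixes f :: "real^'n::finite \<Rightarrow> 'b::real_inner"
  assumes diff: "\<And>y. y \<in> ball z e \<Longrightarrow> f differentiable (at y)"
    and bound: "\<And>y i. y \<in> ball z e \<Longrightarrow> norm (pd i f y) \<le> K * norm (f y)"
    and z: "f z = 0" and x: "x \<in> ball z e"
  shows "f x = 0"
proof -
  let ?l = "\<lambda>t. z + t *\<^sub>R (x - z)"
  have l: "?l t \<in> ball z e" if "0 \<le> t" "t \<le> 1" for t
  proof -
    have "norm (t *\<^sub>R (x - z)) \<le> 1 * norm (x - z)"
      unfolding norm_scaleR using that by (intro mult_right_mono) auto
    then show ?thesis using x by (simp add: dist_norm norm_minus_commute)
  qed
  have "f (?l 1) = 0"
  proof (rule gronwall_zero)
    fix t :: real assume t: "0 \<le> t" "t \<le> 1"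
    have "((\<lambda>t. ?l t) has_derivative (\<lambda>h. h *\<^sub>R (x - z))) (at t)"
      by (auto intro!: derivative_eq_intros)
    from has_derivative_compose[OF this has_derivative_pd[OF diff[OF l[OF t]]]]
    show "((\<lambda>t. f (?l t)) has_derivative (\<lambda>h. h *\<^sub>R (\<Sum>i\<in>UNIV. (x - z) $ i *\<^sub>R pd i f (?l t)))) (at t)"
      by (simp add: scaleR_sum_right)
    have "norm (\<Sum>i\<in>UNIV. (x - z) $ i *\<^sub>R pd i f (?l t)) \<le> (\<Sum>i\<in>UNIV. \<bar>(x - z) $ i\<bar> * (K * norm (f (?l t))))"
      by (rule order_trans[OF norm_sum]) (auto intro!: sum_mono mult_left_mono bound l t)
    then show "norm (\<Sum>i\<in>UNIV. (x - z) $ i *\<^sub>R pd i f (?l t)) \<le> ((\<Sum>i\<in>UNIV. \<bar>(x - z) $ i\<bar>) * K) * norm (f (?l t))"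
      by (simp add: sum_distrib_right mult.assoc)
  qed (simp add: z)
  then show ?thesis by simp
qed

lemma bounded_coefficients:
  fixes G :: "real^'n::finite \<Rightarrow> 'i::finite \<Rightarrow> 'j::finite \<Rightarrow> 'k::finite \<Rightarrow> real"
  assumes S: "open S" "z \<in> S" and cont: "\<And>i j k. continuous_on S (\<lambda>x. G x i j k)"
  obtains e K where "e > 0" "ball z e \<subseteq> S" "K \<ge> 0" "\<And>x i j k. x \<in> ball z e \<Longrightarrow> \<bar>G x i j k\<bar> \<le> K"
proof -
  obtain e where e: "e > 0" "cball z e \<subseteq> S" using open_contains_cball S by metis
  let ?h = "\<lambda>x. \<Sum>i\<in>UNIV. \<Sum>j\<in>UNIV. \<Sum>k\<in>UNIV. \<bar>G x i j k\<bar>"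
  have "continuous_on (cball z e) ?h"
    by (intro continuous_intros continuous_on_subset[OF cont e(2)])
  then have "bounded (?h ` cball z e)"
    by (intro compact_imp_bounded compact_continuous_image compact_cball)
  then obtain K where K: "\<And>x. x \<in> cball z e \<Longrightarrow> \<bar>?h x\<bar> \<le> K" unfolding bounded_real by blast
  show thesis
  proof (rule that[of e K])
    have "0 \<le> \<bar>?h z\<bar>" by simp
    also have "\<bar>?h z\<bar> \<le> K" by (rule K) (use e in simp)
    finally show "K \<ge> 0" .
    fix x i j k assume "x \<in> ball z e"
    then have x: "x \<in> cball z e" by simp
    have "\<bar>G x i j k\<bar> \<le> (\<Sum>k\<in>UNIV. \<bar>G x i j k\<bar>)" by (rule member_le_sum) auto
    also have "\<dots> \<le> (\<Sum>j\<in>UNIV. \<Sum>k\<in>UNIV. \<bar>G x i j k\<bar>)"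
      by (rule member_le_sum[of j UNIV "\<lambda>j. \<Sum>k\<in>UNIV. \<bar>G x i j k\<bar>"]) (auto intro: sum_nonneg)
    also have "\<dots> \<le> ?h x"
      by (rule member_le_sum[of i UNIV "\<lambda>i. \<Sum>j\<in>UNIV. \<Sum>k\<in>UNIV. \<bar>G x i j k\<bar>"]) (auto intro: sum_nonneg)
    also have "\<dots> \<le> K" using K[OF x] by simp
    finally show "\<bar>G x i j k\<bar> \<le> K" .
  qed (use e in auto)
qed

context local_extension
begin

lemma parallel_vector_zero:
  assumes N: "open N" "N \<subseteq> V" and X: "smooth_on N X"
    and par: "\<And>x i. x \<in> N \<Longrightarrow> cov L (coord_field i) X x = 0" and z: "z \<in> N" "X z = 0"
  obtains e where "e > 0" "ball z e \<subseteq> N" "\<And>x. x \<in> ball z e \<Longrightarrow> X x = 0"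
proof -
  have "continuous_on N (\<lambda>x. L x i j k)" for i j k
    using smooth_on_continuous[OF smooth_L] N(2) by (rule continuous_on_subset)
  then obtain e K where e: "e > 0" "ball z e \<subseteq> N" "K \<ge> 0" "\<And>x i j k. x \<in> ball z e \<Longrightarrow> \<bar>L x i j k\<bar> \<le> K"
    using bounded_coefficients[OF N(1) z(1)] by metis
  \<comment> \<open>Each of the two components of the derivative is a sum of two products, each
    bounded by \<open>K\<close> times the norm.\<close>
  have "norm (pd i X x) \<le> (4 * K) * norm (X x)" if x: "x \<in> ball z e" for x i
  proof -
    have n: "\<bar>X x $ j\<bar> \<le> norm (X x)" for j by (rule component_le_norm_cart)
    have "\<bar>pd i X x $ k\<bar> \<le> 2 * (K * norm (X x))" for k
    proof -
      have "cov L (coord_field i) X x $ k = 0" using par[of x i] x e(2) by auto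
      then have "pd i X x $ k = - (\<Sum>j\<in>UNIV. L x i j k * X x $ j)" unfolding cov_coord_nth by simp
      then have "\<bar>pd i X x $ k\<bar> \<le> (\<Sum>j\<in>UNIV. \<bar>L x i j k * X x $ j\<bar>)" using sum_abs by simp
      also have "\<dots> \<le> (\<Sum>j\<in>(UNIV::2 set). K * norm (X x))"
        unfolding abs_mult by (intro sum_mono mult_mono e n x) simp_all
      finally show ?thesis by simp
    qed
    then have "(\<Sum>k\<in>UNIV. \<bar>pd i X x $ k\<bar>) \<le> (\<Sum>k\<in>(UNIV::2 set). 2 * (K * norm (X x)))" by (intro sum_mono)
    then show ?thesis using norm_le_l1_cart[of "pd i X x"] by simp
  qed
  note bound = this
  have "X x = 0" if "x \<in> ball z e" for x
  proof (rule zero_propagates[where f = X and z = z and e = e and K = "4 * K"])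
    show "X differentiable (at y)" if "y \<in> ball z e" for y
      using that e(2) by (intro smooth_on_differentiable[OF X]) blast
  qed (rule bound z(2) that; assumption?)+
  then show thesis using that e by blast
qed

lemma parallel_tensor_zero:
  assumes z: "z \<in> V" "T z = 0"
  obtains e where "e > 0" "ball z e \<subseteq> V" "\<And>x. x \<in> ball z e \<Longrightarrow> T x = 0"
proof -
  have "continuous_on V (\<lambda>x. L x i j k)" for i j k by (rule smooth_on_continuous[OF smooth_L])
  then obtain e K where e: "e > 0" "ball z e \<subseteq> V" "K \<ge> 0" "\<And>x i j k. x \<in> ball z e \<Longrightarrow> \<bar>L x i j k\<bar> \<le> K"
    using bounded_coefficients[OF open_V z(1)] by metis
  have nrm: "\<bar>B $ k $ j\<bar> \<le> norm B" for B :: "real^2^2" and k j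
    by (meson component_le_norm_cart Finite_Cartesian_Product.norm_nth_le order_trans)
  \<comment> \<open>Each of the four entries of the derivative is a combination of four products of
    an entry of \<open>T\<close> with a connection coefficient.\<close>
  have "norm (pd i T x) \<le> (16 * K) * norm (T x)" if x: "x \<in> ball z e" for x i
  proof -
    have xV: "x \<in> V" using x e by auto
    have dT: "T differentiable (at x)" by (rule smooth_on_differentiable[OF smooth_T xV])
    have "\<bar>pd i T x $ k $ j\<bar> \<le> 4 * (K * norm (T x))" for k j
    proof -
      have "pd i T x $ k $ j = pd i (\<lambda>x. T x $ k $ j) x"
        using pd_component[OF dT] pd_component[OF differentiable_nth[OF dT]] by metis
      also have "\<dots> = (\<Sum>l\<in>UNIV. T x $ k $ l * L x i j l) - (\<Sum>l\<in>UNIV. L x i l k * T x $ l $ j)"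
        by (rule pd_T[OF xV])
      finally have "\<bar>pd i T x $ k $ j\<bar> = \<bar>(\<Sum>l\<in>UNIV. T x $ k $ l * L x i j l) - (\<Sum>l\<in>UNIV. L x i l k * T x $ l $ j)\<bar>"
        by (rule arg_cong)
      also have "\<dots> \<le> \<bar>\<Sum>l\<in>UNIV. T x $ k $ l * L x i j l\<bar> + \<bar>\<Sum>l\<in>UNIV. L x i l k * T x $ l $ j\<bar>"
        by (rule abs_triangle_ineq4)
      also have "\<dots> \<le> (\<Sum>l\<in>UNIV. \<bar>T x $ k $ l * L x i j l\<bar>) + (\<Sum>l\<in>UNIV. \<bar>L x i l k * T x $ l $ j\<bar>)"
        by (intro add_mono sum_abs)
      also have "\<dots> \<le> (\<Sum>l\<in>(UNIV::2 set). norm (T x) * K) + (\<Sum>l\<in>(UNIV::2 set). K * norm (T x))"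
        unfolding abs_mult by (intro add_mono sum_mono mult_mono e nrm x) simp_all
      finally show ?thesis by simp
    qed
    then have "(\<Sum>k\<in>UNIV. \<Sum>j\<in>UNIV. \<bar>pd i T x $ k $ j\<bar>) \<le> (\<Sum>k\<in>(UNIV::2 set). \<Sum>j\<in>(UNIV::2 set). 4 * (K * norm (T x)))"
      by (intro sum_mono)
    moreover have "norm (pd i T x) \<le> (\<Sum>k\<in>UNIV. \<Sum>j\<in>UNIV. \<bar>pd i T x $ k $ j\<bar>)"
    proof -
      have "norm (pd i T x) \<le> (\<Sum>k\<in>UNIV. norm (pd i T x $ k))"
        unfolding norm_vec_def[of "pd i T x"] by (rule L2_set_le_sum) simp
      also have "\<dots> \<le> (\<Sum>k\<in>UNIV. \<Sum>j\<in>UNIV. \<bar>pd i T x $ k $ j\<bar>)"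
        by (intro sum_mono norm_le_l1_cart)
      finally show ?thesis .
    qed
    ultimately show ?thesis by simp
  qed
  note bound = this
  have "T x = 0" if "x \<in> ball z e" for x
  proof (rule zero_propagates[where f = T and z = z and e = e and K = "16 * K"])
    show "T differentiable (at y)" if "y \<in> ball z e" for y
      using that e(2) by (intro smooth_on_differentiable[OF smooth_T]) blast
  qed (rule bound z(2) that; assumption?)+
  then show thesis using that e by blast
qed

end

section \<open>New charts from local diffeomorphisms\<close>

text \<open>The inverse function theorem supplies a differentiable inverse \<open>g\<close>; its
  smoothness is bootstrapped from the identity between its partial derivatives and
  \<open>H i\<close> composed with \<open>g\<close>, which raises the order by one.\<close>

lemma local_diffeo:
  fixes \<psi> :: "real^2 \<Rightarrow> real^2"
  assumes R: "open R" "z \<in> R" and sm: "smooth_on R \<psi>"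
    and det: "pd 1 \<psi> z $ 1 * pd 2 \<psi> z $ 2 - pd 2 \<psi> z $ 1 * pd 1 \<psi> z $ 2 \<noteq> 0"
  obtains R' g where "open R'" "z \<in> R'" "R' \<subseteq> R" "open (\<psi> ` R')" "smooth_on (\<psi> ` R') g" "\<And>x. x \<in> R' \<Longrightarrow> g (\<psi> x) = x"
proof -
  define dt where "dt x = pd 1 \<psi> x $ 1 * pd 2 \<psi> x $ 2 - pd 2 \<psi> x $ 1 * pd 1 \<psi> x $ 2" for x
  have smc: "smooth_on R (\<lambda>x. pd i \<psi> x $ k)" for i k by (intro smooth_on_nth R smooth_on_pd sm)
  have smdt: "smooth_on R dt" unfolding dt_def[abs_def] by (intro smooth_on_diff smooth_on_mult R smc)
  define R0 where "R0 = R \<inter> dt -` (- {0})"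
  have R0: "open R0" "R0 \<subseteq> R" "z \<in> R0"
    unfolding R0_def using det R continuous_open_preimage[OF smooth_on_continuous[OF smdt] R(1), of "- {0}"]
    by (auto simp: dt_def)
  \<comment> \<open>The i-th column of the inverse Jacobian, by Cramer's rule.\<close>
  define H where "H i x = (if i = 1 then \<chi> k. if k = 1 then pd 2 \<psi> x $ 2 / dt x else - pd 1 \<psi> x $ 2 / dt x
     else \<chi> k. if k = 1 then - pd 2 \<psi> x $ 1 / dt x else pd 1 \<psi> x $ 1 / dt x :: real^2)" for i :: 2 and x
  have smH: "smooth_on R0 (H i)" for i
  proof (rule smooth_on_vec[OF R0(1)])
    have s: "smooth_on R0 dt" "smooth_on R0 (\<lambda>x. pd i \<psi> x $ k)" "\<And>x. x \<in> R0 \<Longrightarrow> dt x \<noteq> 0" for i k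
      using smooth_on_subset[OF smdt R0(2)] smooth_on_subset[OF smc R0(2)] by (auto simp: R0_def)
    show "smooth_on R0 (\<lambda>x. H i x $ k)" for k
      unfolding H_def by (cases "i = 1"; cases "k = 1"; simp; intro smooth_on_divide smooth_on_minus R0 s)
  qed
  let ?d = "\<lambda>x. grad_blinfun (\<lambda>i. pd i \<psi> x)"
  have dH: "blinfun_apply (?d x) (H i x) = axis i 1" if "x \<in> R0" for x i
  proof -
    have "dt x \<noteq> 0" using that by (auto simp: R0_def)
    then show ?thesis using exhaust_2[of i]
      by (auto simp: grad_blinfun_apply sum_2 vec_eq_iff forall_2 H_def axis_def field_simps) (auto simp: dt_def algebra_simps)
  qed
  have inv0: "grad_blinfun (\<lambda>i. H i z) o\<^sub>L ?d z = id_blinfun"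
  proof (rule blinfun_eqI)
    fix v
    have "dt z \<noteq> 0" using R0 by (auto simp: R0_def)
    then show "blinfun_apply (grad_blinfun (\<lambda>i. H i z) o\<^sub>L ?d z) v = blinfun_apply id_blinfun v"
      by (simp add: grad_blinfun_apply sum_2 vec_eq_iff forall_2 H_def field_simps) (simp add: dt_def algebra_simps)
  qed
  have der: "(\<psi> has_derivative blinfun_apply (?d x)) (at x)" if "x \<in> R0" for x
    using has_derivative_pd[OF smooth_on_differentiable[OF sm]] that R0(2)
    by (auto simp: grad_blinfun_apply[abs_def])
  have cont: "continuous_on R0 ?d"
    using smooth_on_continuous[OF smooth_on_pd[OF sm]] R0(2) by (intro continuous_on_grad_blinfun) (rule continuous_on_subset)
  obtain U' V' g g' where g: "open U'" "U' \<subseteq> R0" "z \<in> U'" "open V'" "homeomorphism U' V' \<psi> g"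
    and g': "\<And>y. y \<in> V' \<Longrightarrow> (g has_derivative (g' y)) (at y)"
      "\<And>y. y \<in> V' \<Longrightarrow> g' y = inv (blinfun_apply (?d (g y)))" "\<And>y. y \<in> V' \<Longrightarrow> bij (blinfun_apply (?d (g y)))"
    using inverse_function_theorem[OF R0(1) der cont R0(3) inv0] by metis
  have V': "\<psi> ` U' = V'" and gU: "g y \<in> R0" if "y \<in> V'" for y
    using g(2,5) that by (auto simp: homeomorphism_def)
  have pdg: "pd i g y = H i (g y)" if y: "y \<in> V'" for i y
    using pd_eqI[OF g'(1)[OF y], of i] inv_f_eq[OF bij_is_inj[OF g'(3)[OF y]] dH[OF gU[OF y]]] g'(2)[OF y] by simp
  have "Ck_on k V' g" for k
  proof (induction k)
    case 0
    then show ?case using g(5) by (simp add: homeomorphism_def)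
  next
    case (Suc k)
    have "Ck_on k V' (\<lambda>y. H i (g y))" for i
      by (rule Ck_on_compose[OF g(4) Suc]) (use smH[unfolded smooth_on_def] gU in auto)
    then have "Ck_on k V' (pd i g)" for i
      by (rule Ck_on_cong[OF g(4), rotated]) (simp add: pdg)
    moreover have "g differentiable (at y)" if "y \<in> V'" for y
      by (rule has_derivative_imp_differentiable[OF g'(1)[OF that]])
    ultimately show ?case by simp
  qed
  moreover have "\<psi> ` U' = V'" using g(5) by (simp add: homeomorphism_def)
  ultimately show thesis
    using that[of U' g] g R0(2) by (auto simp: smooth_on_def homeomorphism_def)
qed

text \<open>The Jacobian of the new chart relative to \<open>c\<close> is part of the conclusion
  because the components of \<open>T\<close> and \<open>X\<close> in the new chart are computed from
  it.\<close>

lemma chart_from_local_diffeo: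
  fixes A :: "('a, 2) chart set"
  assumes atl: "smooth_atlas M A" and c: "c \<in> A" "p \<in> fst c" and R: "open R" "snd c p \<in> R" "R \<subseteq> snd c ` fst c"
    and sm: "smooth_on R \<psi>"
    and det: "pd 1 \<psi> (snd c p) $ 1 * pd 2 \<psi> (snd c p) $ 2 - pd 2 \<psi> (snd c p) $ 1 * pd 1 \<psi> (snd c p) $ 2 \<noteq> 0"
  obtains R' v where "R' \<subseteq> R" "v \<in> A" "p \<in> fst v" "fst v = {q \<in> fst c. snd c q \<in> R'}"
    "\<forall>q\<in>fst v. \<forall>i k. jac c v q $ k $ i = pd i \<psi> (snd c q) $ k"
proof -
  interpret smooth_atlas M A by (rule atl)
  obtain R' g where R': "open R'" "snd c p \<in> R'" "R' \<subseteq> R" "open (\<psi> ` R')" "smooth_on (\<psi> ` R') g" "\<And>x. x \<in> R' \<Longrightarrow> g (\<psi> x) = x"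
    using local_diffeo[OF R(1,2) sm det] by metis
  let ?v = "({q \<in> fst c. snd c q \<in> R'}, \<psi> \<circ> snd c)"
  have v: "?v \<in> A"
    by (rule chart_from_diffeo[OF c(1) R'(1) _ smooth_on_subset[OF sm R'(3)] R'(4,5,6)]) (use R' R in auto)
  have tr: "transition c ?v x = \<psi> x" if "x \<in> R'" for x
    using that R' R by (auto simp: transition_def)
  have "jac c ?v q $ k $ i = pd i \<psi> (snd c q) $ k" if "q \<in> fst ?v" for q i k
    unfolding jac_nth using pd_cong[OF R'(1) _ tr, of "snd c q", where i = i] that by simp
  then show thesis using that[OF R'(3) v] R' c by simp
qed

section \<open>Adapted coordinates\<close>

lemma open_contains_box_at:
  fixes S :: "'b::euclidean_space set"
  assumes "open S" "x \<in> S"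
  obtains a b where "x \<in> box a b" "box a b \<subseteq> S"
proof -
  obtain e where "e > 0" "ball x e \<subseteq> S" using assms openE by blast
  then show thesis using rational_boxes[of e x] that by (metis subset_trans)
qed

text \<open>Inside \<open>V\<close> the zero set is open by \<open>loc\<close> and its complement by
  continuity in charts; chart independence makes them disjoint, and connectedness leaves one of
  them. It serves both \<open>T\<close> on a component and \<open>X\<close> on the base of a
  solution.\<close>

lemma (in smooth_atlas) zero_set_clopen:
  fixes f :: "('a, 'n) chart \<Rightarrow> real^'n \<Rightarrow> 'b::real_normed_vector"
  assumes V: "openin M V" and C: "connectedin M C" "C \<subseteq> V"
    and cont: "\<And>c. c \<in> A \<Longrightarrow> continuous_on (snd c ` (V \<inter> fst c)) (f c)"
    and indep: "\<And>c c' p. c \<in> A \<Longrightarrow> c' \<in> A \<Longrightarrow> p \<in> V \<Longrightarrow> p \<in> fst c \<Longrightarrow> p \<in> fst c' \<Longrightarrow>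
      f c (snd c p) = 0 \<Longrightarrow> f c' (snd c' p) = 0"
    and loc: "\<And>c x. c \<in> A \<Longrightarrow> x \<in> snd c ` (V \<inter> fst c) \<Longrightarrow> f c x = 0 \<Longrightarrow>
      \<exists>e>0. ball x e \<subseteq> snd c ` (V \<inter> fst c) \<and> (\<forall>y\<in>ball x e. f c y = 0)"
    and p: "p \<in> C" "c \<in> A" "p \<in> fst c" "f c (snd c p) = 0"
    and q: "q \<in> C" "c' \<in> A" "q \<in> fst c'"
  shows "f c' (snd c' q) = 0"
proof (rule ccontr)
  assume nz: "f c' (snd c' q) \<noteq> 0"
  let ?E1 = "{p \<in> V. \<exists>c\<in>A. p \<in> fst c \<and> f c (snd c p) = 0}"
  let ?E2 = "{p \<in> V. \<exists>c\<in>A. p \<in> fst c \<and> f c (snd c p) \<noteq> 0}"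
  have in_V: "r \<in> V" if "c \<in> A" "r \<in> fst c" "snd c r \<in> snd c ` (V \<inter> fst c)" for c r
    using that inj_on_chart[OF that(1)] by (auto dest: inj_onD)
  have "openin M ?E1"
  proof (subst openin_subopen, intro ballI)
    fix r assume "r \<in> ?E1"
    then obtain c where c: "r \<in> V" "c \<in> A" "r \<in> fst c" "f c (snd c r) = 0" by blast
    then obtain e where e: "e > 0" "ball (snd c r) e \<subseteq> snd c ` (V \<inter> fst c)" "\<forall>y\<in>ball (snd c r) e. f c y = 0"
      using loc[OF c(2), of "snd c r"] by auto
    show "\<exists>S. openin M S \<and> r \<in> S \<and> S \<subseteq> ?E1"
    proof (intro exI conjI)
      show "openin M {p \<in> fst c. snd c p \<in> ball (snd c r) e}" by (rule openin_preimage[OF c(2) open_ball])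
      show "r \<in> {p \<in> fst c. snd c p \<in> ball (snd c r) e}" using c e by simp
      show "{p \<in> fst c. snd c p \<in> ball (snd c r) e} \<subseteq> ?E1" using c(2) e in_V[OF c(2)] by blast
    qed
  qed
  moreover have "openin M ?E2"
  proof (subst openin_subopen, intro ballI)
    fix r assume "r \<in> ?E2"
    then obtain c where c: "r \<in> V" "c \<in> A" "r \<in> fst c" "f c (snd c r) \<noteq> 0" by blast
    let ?S = "snd c ` (V \<inter> fst c) \<inter> f c -` (- {0})"
    have S: "open ?S"
      by (rule continuous_open_preimage[OF cont[OF c(2)] open_image[OF c(2) V]]) auto
    show "\<exists>S. openin M S \<and> r \<in> S \<and> S \<subseteq> ?E2"
    proof (intro exI conjI)
      show "openin M {p \<in> fst c. snd c p \<in> ?S}" by (rule openin_preimage[OF c(2) S])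
      show "r \<in> {p \<in> fst c. snd c p \<in> ?S}" using c by auto
      show "{p \<in> fst c. snd c p \<in> ?S} \<subseteq> ?E2" using c(2) in_V[OF c(2)] by blast
    qed
  qed
  moreover have "C \<subseteq> ?E1 \<union> ?E2"
  proof
    fix r assume "r \<in> C"
    moreover from this obtain c where "c \<in> A" "r \<in> fst c"
      using connectedin_subset_topspace[OF C(1)] Union_charts by blast
    ultimately show "r \<in> ?E1 \<union> ?E2" using C(2) by blast
  qed
  moreover have "?E1 \<inter> ?E2 \<inter> C = {}" using indep by blast
  moreover have "?E1 \<inter> C \<noteq> {}" "?E2 \<inter> C \<noteq> {}" using p q nz C(2) by blast+
  ultimately show False using C(1) unfolding connectedin by blast
qed

lemma pd_vec_lambda:
  fixes f :: "'m::finite \<Rightarrow> real^'n::finite \<Rightarrow> real"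
  assumes "\<And>k. f k differentiable (at x)"
  shows "pd i (\<lambda>x. \<chi> k. f k x) x $ k = pd i (f k) x"
  using pd_component[OF differentiable_vec_componentwise, of "\<lambda>x. \<chi> k. f k x" x i k] assms by simp

context local_extension
begin

context
  fixes N X
  assumes open_N: "open N" and N: "N \<subseteq> V" and X: "smooth_on N X"
    and ker: "\<And>x. x \<in> N \<Longrightarrow> T x *v X x = 0" and par: "\<And>x i. x \<in> N \<Longrightarrow> cov L (coord_field i) X x = 0"
    and nz: "\<And>x. x \<in> N \<Longrightarrow> X x \<noteq> 0"
begin

text \<open>The one-form \<open>\<theta>\<close> with \<open>T = \<theta> \<otimes> X\<close>; it is parallel, hence closed.\<close>

definition \<theta> :: "2 \<Rightarrow> real^2 \<Rightarrow> real" where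
  "\<theta> i x = (\<Sum>k\<in>UNIV. T x $ k $ i * X x $ k) / (\<Sum>k\<in>UNIV. X x $ k * X x $ k)"

lemma denominator: "x \<in> N \<Longrightarrow> (\<Sum>k\<in>UNIV. X x $ k * X x $ k) \<noteq> 0"
  using nz[of x] by (auto simp: sum_2 vec_eq_iff forall_2 add_nonneg_eq_0_iff)

lemma smooth_\<theta>: "smooth_on N (\<theta> i)"
proof -
  have "smooth_on N (\<lambda>x. T x $ k $ i)" "smooth_on N (\<lambda>x. X x $ k)" for k
    using smooth_on_subset[OF smooth_T_nth N] smooth_on_nth[OF open_N X] by auto
  then show ?thesis unfolding \<theta>_def[abs_def]
    by (intro smooth_on_divide smooth_on_sum smooth_on_mult open_N denominator)
qed

text \<open>The nonzero field \<open>X\<close> lies in the kernel and \<open>T\<close> has trace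
  zero, so each column of \<open>T\<close> is proportional to \<open>X\<close>; the quotient
  defining \<theta> is the factor.\<close>

lemma T_\<theta>: assumes x: "x \<in> N" shows "T x $ k $ i = X x $ k * \<theta> i x"
proof -
  have xV: "x \<in> V" using x N by auto
  have K: "T x $ 1 $ 1 * X x $ 1 + T x $ 1 $ 2 * X x $ 2 = 0" "T x $ 2 $ 1 * X x $ 1 + T x $ 2 $ 2 * X x $ 2 = 0"
    using ker[OF x] by (simp_all add: vec_eq_iff forall_2 matrix_vector_mult_def sum_2)
  have "X x $ 1 * T x $ 2 $ i = X x $ 2 * T x $ 1 $ i"
    using exhaust_2[of i] K T_entries(1)[OF xV] by (auto simp: algebra_simps)
  then have "T x $ k $ i * (X x $ 1 * X x $ 1 + X x $ 2 * X x $ 2) = X x $ k * (T x $ 1 $ i * X x $ 1 + T x $ 2 $ i * X x $ 2)"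
    using exhaust_2[of k] by (auto simp: algebra_simps)
  then show ?thesis using denominator[OF x] by (simp add: \<theta>_def sum_2 field_simps)
qed

lemma \<theta>_X: assumes x: "x \<in> N" shows "(\<Sum>i\<in>UNIV. \<theta> i x * X x $ i) = 0"
proof -
  obtain k where k: "X x $ k \<noteq> 0" using nz[OF x] by (auto simp: vec_eq_iff)
  have "(T x *v X x) $ k = X x $ k * (\<Sum>i\<in>UNIV. \<theta> i x * X x $ i)"
    by (simp add: matrix_vector_mult_def T_\<theta>[OF x] sum_2 algebra_simps)
  then show ?thesis using ker[OF x] k by simp
qed

text \<open>Differentiate T = \<theta> \<otimes> X and insert DT = 0 and DX = 0; a nonzero component
  of \<open>X\<close> can be cancelled.\<close>

lemma \<theta>_parallel: assumes x: "x \<in> N" shows "pd j (\<theta> i) x = (\<Sum>l\<in>UNIV. L x j i l * \<theta> l x)"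
proof -
  have xV: "x \<in> V" using x N by auto
  obtain k where k: "X x $ k \<noteq> 0" using nz[OF x] by (auto simp: vec_eq_iff)
  have dX: "X differentiable (at x)" and dX': "(\<lambda>x. X x $ k) differentiable (at x)" and dt: "\<theta> i differentiable (at x)"
    using smooth_on_differentiable[OF X x] smooth_on_differentiable[OF smooth_\<theta> x]
    by (auto intro: differentiable_nth)
  have "cov L (coord_field j) X x $ k = 0" using par[OF x] by simp
  then have pX: "pd j (\<lambda>x. X x $ k) x = - (\<Sum>l\<in>UNIV. L x j l k * X x $ l)"
    unfolding cov_coord_nth pd_component[OF dX] by simp
  have "pd j (\<lambda>x. T x $ k $ i) x = pd j (\<lambda>x. X x $ k * \<theta> i x) x"
    by (rule pd_cong[OF open_N x]) (rule T_\<theta>)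
  also have "\<dots> = X x $ k * pd j (\<theta> i) x + pd j (\<lambda>x. X x $ k) x * \<theta> i x"
    by (rule pd_mult[OF dX' dt])
  finally have "X x $ k * pd j (\<theta> i) x = X x $ k * (\<Sum>l\<in>UNIV. L x j i l * \<theta> l x)"
    unfolding pd_T[OF xV] pX by (simp add: T_\<theta>[OF x] sum_2 algebra_simps)
  then show ?thesis using k by simp
qed

lemma \<theta>_closed: "x \<in> N \<Longrightarrow> pd 1 (\<theta> 2) x = pd 2 (\<theta> 1) x"
  using N L_sym[of x 1 2] by (auto simp: \<theta>_parallel)

text \<open>\<theta> annihilates \<open>X\<close> and is not zero, so where the component m of
  \<open>X\<close> is nonzero the other component of \<theta> is. This is the determinant condition
  for a potential of \<theta> together with x_m to form coordinates.\<close>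

lemma \<theta>_nonzero:
  assumes x: "x \<in> N" and T0: "T x \<noteq> 0" and m: "X x $ m \<noteq> 0"
  shows "m = 1 \<Longrightarrow> \<theta> 2 x \<noteq> 0" "m = 2 \<Longrightarrow> \<theta> 1 x \<noteq> 0"
proof -
  have "\<not> (\<theta> 1 x = 0 \<and> \<theta> 2 x = 0)" using T0 by (auto simp: vec_eq_iff forall_2 T_\<theta>[OF x])
  then show "m = 1 \<Longrightarrow> \<theta> 2 x \<noteq> 0" "m = 2 \<Longrightarrow> \<theta> 1 x \<noteq> 0" using \<theta>_X[OF x] m by (auto simp: sum_2)
qed

end

end

section \<open>The surface as a whole: tensor fields in all charts\<close>

locale extension_surface =
  fixes M :: "'a topology" and A :: "('a, 2) chart set" and D :: "('a, 2) chart \<Rightarrow> 2 christoffel"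
    and T \<Phi> :: "('a, 2, real^2^2) field"
  assumes surface: "parallel_nilpotent_surface M A D T"
    and deformation: "symmetric_tensor02 A (topspace M) \<Phi>"
begin

sublocale smooth_atlas M A
  using surface unfolding parallel_nilpotent_surface_def by unfold_locales blast

lemma surfaceD: "affine_connection A D" "torsion_free A D" "tensor11 A (topspace M) T"
  "c \<in> A \<Longrightarrow> x \<in> snd c ` fst c \<Longrightarrow> cov11 (D c) (T c) i j x = 0"
  "c \<in> A \<Longrightarrow> x \<in> snd c ` fst c \<Longrightarrow> T c x ** T c x = 0"
  "p \<in> topspace M \<Longrightarrow> \<exists>q\<in>connected_component_of_set M p. \<exists>c\<in>A. q \<in> fst c \<and> T c (snd c q) \<noteq> 0"
  using surface unfolding parallel_nilpotent_surface_def by blast+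

lemma chart_subset: "c \<in> A \<Longrightarrow> topspace M \<inter> fst c = fst c"
  using openin_subset[OF openin_chart] by blast

lemma local_extension:
  assumes c: "c \<in> A"
  shows "local_extension (snd c ` fst c) (D c) (T c) (\<Phi> c)"
proof
  show "open (snd c ` fst c)" by (rule open_chart_image[OF c])
  show "smooth_on (snd c ` fst c) (\<lambda>x. D c x i j k)" for i j k
    using surfaceD(1) c unfolding affine_connection_def by simp
  have "smooth_on (snd c ` (topspace M \<inter> fst c)) (T c)"
    using surfaceD(3) c unfolding tensor11_def by simp
  then show "smooth_on (snd c ` fst c) (T c)" using chart_subset[OF c] by simp
  have "smooth_on (snd c ` (topspace M \<inter> fst c)) (\<Phi> c)"
    using deformation c unfolding symmetric_tensor02_def tensor02_def by simp
  then show "smooth_on (snd c ` fst c) (\<Phi> c)" using chart_subset[OF c] by simp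
  fix x assume x: "x \<in> snd c ` fst c"
  show "D c x i j k = D c x j i k" for i j k
    using surfaceD(2) c x unfolding torsion_free_def by blast
  show "cov11 (D c) (T c) i j x = 0" for i j
    by (rule surfaceD(4)[OF c x])
  show "T c x ** T c x = 0"
    by (rule surfaceD(5)[OF c x])
  obtain p where p: "p \<in> fst c" "x = snd c p" using x by blast
  have sym: "transpose (\<Phi> c (snd c p)) = \<Phi> c (snd c p)"
    using deformation c p chart_subset[OF c] unfolding symmetric_tensor02_def by blast
  show "\<Phi> c x $ i $ j = \<Phi> c x $ j $ i" for i j
    unfolding p(2) using arg_cong[OF sym, of "\<lambda>m. m $ j $ i"] by (simp add: transpose_def)
qed

lemma T_law:
  assumes "c \<in> A" "c' \<in> A" "p \<in> fst c" "p \<in> fst c'"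
  shows "T c' (snd c' p) ** jac c c' p = jac c c' p ** T c (snd c p)"
proof -
  have "p \<in> topspace M \<inter> fst c \<inter> fst c'" using assms chart_subset by blast
  then show ?thesis
    using surfaceD(3) assms unfolding tensor11_def by blast
qed

lemma jac_cancel:
  assumes "c \<in> A" "c' \<in> A" "p \<in> fst c" "p \<in> fst c'" "P ** jac c c' p = Q ** jac c c' p"
  shows "P = Q"
proof -
  have "P ** jac c c' p ** jac c' c p = Q ** jac c c' p ** jac c' c p" by (simp only: assms(5))
  then show ?thesis
    by (simp only: matrix_mul_assoc[symmetric] jac_inverse[OF assms(2,1,4,3)] matrix_mul_rid)
qed

text \<open>A parallel \<open>T\<close> that vanishes at a point vanishes near it, hence on the
  whole component, against the assumption that it is nonzero somewhere on each component.\<close>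

lemma T_nonzero:
  assumes c: "c \<in> A" "p \<in> fst c"
  shows "T c (snd c p) \<noteq> 0"
proof
  assume z: "T c (snd c p) = 0"
  have pM: "p \<in> topspace M" using c chart_subset by blast
  obtain q c' where q: "q \<in> connected_component_of_set M p" "c' \<in> A" "q \<in> fst c'" "T c' (snd c' q) \<noteq> 0"
    using surfaceD(6)[OF pM] by blast
  have "T c' (snd c' q) = 0"
  proof (rule zero_set_clopen[where V = "topspace M" and f = T])
    show "openin M (topspace M)" by simp
    show "connectedin M (connected_component_of_set M p)" by (rule connectedin_connected_component_of)
    then show "connected_component_of_set M p \<subseteq> topspace M" by (rule connectedin_subset_topspace)
    show "p \<in> connected_component_of_set M p" using pM by (simp add: connected_component_of_refl)
    show "c \<in> A" "p \<in> fst c" "T c (snd c p) = 0" "q \<in> connected_component_of_set M p" "c' \<in> A" "q \<in> fst c'"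
      by (fact c z q)+
    fix c assume c: "c \<in> A"
    interpret local_extension "snd c ` fst c" "D c" "T c" "\<Phi> c" by (rule local_extension[OF c])
    show "continuous_on (snd c ` (topspace M \<inter> fst c)) (T c)"
      unfolding chart_subset[OF c] by (rule smooth_on_continuous[OF smooth_T])
    show "T c' (snd c' p) = 0" if "c' \<in> A" "p \<in> topspace M" "p \<in> fst c" "p \<in> fst c'" "T c (snd c p) = 0" for c' p
    proof (rule jac_cancel[OF c that(1,3,4)])
      show "T c' (snd c' p) ** jac c c' p = 0 ** jac c c' p"
        unfolding T_law[OF c that(1,3,4)] that(5) by (simp add: matrix_matrix_mult_def vec_eq_iff)
    qed
    show "\<exists>e>0. ball x e \<subseteq> snd c ` (topspace M \<inter> fst c) \<and> (\<forall>y\<in>ball x e. T c y = 0)"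
      if "x \<in> snd c ` (topspace M \<inter> fst c)" "T c x = 0" for x
      using parallel_tensor_zero[of x] that unfolding chart_subset[OF c] by metis
  qed
  then show False using q(4) by contradiction
qed

text \<open>Two changes of chart: the first makes a potential of \<theta> the first coordinate,
  which aligns \<open>X\<close> with the second axis; the second normalises its length. The
  connection coefficients are then read off from DX = 0 and DT = 0.\<close>

lemma adapted_chart:
  assumes V: "openin M V" and X: "vector_field A V X"
    and ker: "\<And>c x. c \<in> A \<Longrightarrow> x \<in> snd c ` (V \<inter> fst c) \<Longrightarrow> T c x *v X c x = 0"
    and par: "\<And>c x i. c \<in> A \<Longrightarrow> x \<in> snd c ` (V \<inter> fst c) \<Longrightarrow> cov (D c) (coord_field i) (X c) x = 0"
    and nz: "\<And>c x. c \<in> A \<Longrightarrow> x \<in> snd c ` (V \<inter> fst c) \<Longrightarrow> X c x \<noteq> 0"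
    and p: "p \<in> V"
  obtains u where "u \<in> A" "p \<in> fst u" "fst u \<subseteq> V" "adapted_coordinates D T u"
    "\<And>x. x \<in> snd u ` fst u \<Longrightarrow> X u x = axis 2 1"
proof -
  obtain c where c: "c \<in> A" "p \<in> fst c" using p openin_subset[OF V] Union_charts by blast
  have X_law: "X c' (snd c' q) = jac c c' q *v X c (snd c q)"
    if "c \<in> A" "c' \<in> A" "q \<in> V" "q \<in> fst c" "q \<in> fst c'" for c c' q
    using X that unfolding vector_field_def by blast
  have smX: "smooth_on (snd c ` (V \<inter> fst c)) (X c)" if "c \<in> A" for c
    using X that unfolding vector_field_def by blast
  let ?N = "snd c ` (V \<inter> fst c)"
  interpret C: local_extension "snd c ` fst c" "D c" "T c" "\<Phi> c" by (rule local_extension[OF c(1)])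
  have N: "open ?N" "?N \<subseteq> snd c ` fst c" using open_image[OF c(1) V] by auto
  note th = N smX[OF c(1)] ker[OF c(1)] par[OF c(1)] nz[OF c(1)]
  let ?\<theta> = "C.\<theta> (X c)"
  note \<theta>_simps = C.T_\<theta>[OF th] C.\<theta>_X[OF th]
  let ?z = "snd c p"
  have z: "?z \<in> ?N" using p c by auto
  obtain a b where ab: "?z \<in> box a b" "box a b \<subseteq> ?N" using open_contains_box_at[OF N(1) z] .
  have sm\<theta>: "smooth_on (box a b) (?\<theta> i)" for i
    using C.smooth_\<theta>[OF th] ab(2) smooth_on_subset by blast
  have "box a b \<noteq> {}" using ab(1) by blast
  moreover have "pd 1 (?\<theta> 2) x = pd 2 (?\<theta> 1) x" if "x \<in> box a b" for x
    using C.\<theta>_closed[OF th] that ab(2) by blast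
  ultimately obtain u1 where u1: "smooth_on (box a b) u1" "\<And>x. x \<in> box a b \<Longrightarrow> pd 1 u1 x = ?\<theta> 1 x"
    "\<And>x. x \<in> box a b \<Longrightarrow> pd 2 u1 x = ?\<theta> 2 x"
    using potential_on_box[OF _ sm\<theta> sm\<theta>] by metis
  have u1': "pd i u1 x = ?\<theta> i x" if "x \<in> box a b" for i x using u1(2,3)[OF that] exhaust_2[of i] by auto
  \<comment> \<open>A coordinate along which \<open>X\<close> moves; the potential of \<theta> is
    constant along \<open>X\<close>, so the two are independent at \<open>p\<close>.\<close>
  obtain m where m: "X c ?z $ m \<noteq> 0" using nz[OF c(1) z] by (auto simp: vec_eq_iff)
  define h where "h k x = (if k = 1 then u1 x else x $ m)" for k :: 2 and x :: "real^2"
  have smh: "smooth_on (box a b) (h k)" for k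
    unfolding h_def by (cases "k = 1") (simp_all add: u1 smooth_on_nth[OF open_box smooth_on_id])
  have pdh: "pd i (\<lambda>x. \<chi> k. h k x) x $ k = (if k = 1 then ?\<theta> i x else if i = m then 1 else 0)" if "x \<in> box a b" for i k x
  proof -
    have "pd i (\<lambda>x. \<chi> k. h k x) x $ k = pd i (h k) x"
      by (rule pd_vec_lambda) (rule smooth_on_differentiable[OF smh that])
    also have "\<dots> = (if k = 1 then ?\<theta> i x else if i = m then 1 else 0)"
      unfolding h_def using u1'[OF that] by simp
    finally show ?thesis .
  qed
  have smh': "smooth_on (box a b) (\<lambda>x. \<chi> k. h k x)"
    by (intro smooth_on_vec open_box) (simp add: smh)
  have det: "pd 1 (\<lambda>x. \<chi> k. h k x) ?z $ 1 * pd 2 (\<lambda>x. \<chi> k. h k x) ?z $ 2 - pd 2 (\<lambda>x. \<chi> k. h k x) ?z $ 1 * pd 1 (\<lambda>x. \<chi> k. h k x) ?z $ 2 \<noteq> 0"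
    unfolding pdh[OF ab(1)] using C.\<theta>_nonzero[OF th z T_nonzero[OF c] m] exhaust_2[of m] by auto
  obtain R' v where v: "R' \<subseteq> box a b" "v \<in> A" "p \<in> fst v" "fst v = {q \<in> fst c. snd c q \<in> R'}"
    and jv: "\<forall>q\<in>fst v. \<forall>i k. jac c v q $ k $ i = pd i (\<lambda>x. \<chi> k. h k x) (snd c q) $ k"
    using chart_from_local_diffeo[OF smooth_atlas_axioms c open_box ab(1) subset_trans[OF ab(2) N(2)] smh' det] .
  have vV: "fst v \<subseteq> V" 
    using v(1,4) ab(2) inj_on_chart[OF c(1)] by (auto dest!: subsetD inj_onD)
  \<comment> \<open>The differential of the first coordinate of \<open>v\<close> is \<theta>. So
    \<theta>(X) = 0 removes the first component of \<open>X\<close>, and T = \<theta> \<otimes> X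
    becomes the matrix with first column \<open>X\<close> and second column zero.\<close>
  have v_facts: "X v (snd v q) $ 1 = 0" "T v (snd v q) $ k $ 1 = X v (snd v q) $ k" "T v (snd v q) $ k $ 2 = 0"
    if q: "q \<in> fst v" for q k
  proof -
    have qc: "q \<in> fst c" "snd c q \<in> box a b" "q \<in> V" and qN: "snd c q \<in> ?N" using q v vV ab by auto
    have J: "jac c v q $ k $ i = (if k = 1 then ?\<theta> i (snd c q) else if i = m then 1 else 0)" for i k
      using jv q pdh[OF qc(2)] by simp
    have Xv: "X v (snd v q) = jac c v q *v X c (snd c q)" by (rule X_law[OF c(1) v(2) qc(3,1) q])
    show X1: "X v (snd v q) $ 1 = 0"
      using C.\<theta>_X[OF th qN] unfolding Xv by (simp add: matrix_vector_mult_def J)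
    define B :: "real^2^2" where "B = (\<chi> k i. if i = 1 then X v (snd v q) $ k else 0)"
    have "T v (snd v q) = B"
    proof (rule jac_cancel[OF c(1) v(2) qc(1) q])
      show "T v (snd v q) ** jac c v q = B ** jac c v q"
        unfolding T_law[OF c(1) v(2) qc(1) q]
        by (simp add: vec_eq_iff matrix_matrix_mult_def B_def Xv matrix_vector_mult_def sum_2 C.T_\<theta>[OF th qN])
          (simp add: J algebra_simps)
    qed
    then show "T v (snd v q) $ k $ 1 = X v (snd v q) $ k" "T v (snd v q) $ k $ 2 = 0" by (simp_all add: B_def)
  qed
  have X2: "X v (snd v q) $ 2 \<noteq> 0" if q: "q \<in> fst v" for q
  proof -
    have "X v (snd v q) \<noteq> 0" using nz[OF v(2)] q vV by blast
    then show ?thesis using v_facts(1)[OF q] by (auto simp: vec_eq_iff forall_2)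
  qed
  let ?y = "snd v p"
  have y: "?y \<in> snd v ` fst v" using v(3) by auto
  obtain a' b' where ab': "?y \<in> box a' b'" "box a' b' \<subseteq> snd v ` fst v"
    using open_contains_box_at[OF open_chart_image[OF v(2)] y] .
  define g where "g x = X v x $ 2" for x
  have g0: "g x \<noteq> 0" if "x \<in> box a' b'" for x using ab'(2) that X2 by (auto simp: g_def)
  have "smooth_on (snd v ` fst v) (X v)" using smX[OF v(2)] vV by (simp add: Int_absorb1)
  then have smg: "smooth_on (box a' b') (\<lambda>x. 1 / g x)"
    unfolding g_def using ab'(2) g0
    by (intro smooth_on_divide open_box smooth_on_const smooth_on_nth) (auto simp: g_def intro: smooth_on_subset)
  have y2: "a' $ 2 < ?y $ 2" "?y $ 2 < b' $ 2" using ab'(1) by (auto simp: mem_box_cart)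
  \<comment> \<open>Integrating the reciprocal of the remaining component of \<open>X\<close> turns
    \<open>X\<close> into the second coordinate field; the first coordinate is kept.\<close>
  define u2 where "u2 = primitive 2 (?y $ 2) (\<lambda>x. 1 / g x)"
  have u2: "smooth_on (box a' b') u2" "\<And>x. x \<in> box a' b' \<Longrightarrow> pd 2 u2 x = 1 / g x"
    unfolding u2_def by (rule primitive[OF y2 smg], rule primitive(2)[OF y2 smg])
  define h' where "h' k x = (if k = 1 then x $ 1 else u2 x)" for k :: 2 and x :: "real^2"
  have smh2: "smooth_on (box a' b') (h' k)" for k
    unfolding h'_def by (cases "k = 1") (simp_all add: u2 smooth_on_nth[OF open_box smooth_on_id])
  have pdh2: "pd i (\<lambda>x. \<chi> k. h' k x) x $ k = (if k = 1 then (if i = 1 then 1 else 0) else pd i u2 x)" if "x \<in> box a' b'" for i k x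
  proof -
    have "pd i (\<lambda>x. \<chi> k. h' k x) x $ k = pd i (h' k) x"
      by (rule pd_vec_lambda) (rule smooth_on_differentiable[OF smh2 that])
    also have "\<dots> = (if k = 1 then (if i = 1 then 1 else 0) else pd i u2 x)"
      unfolding h'_def by simp
    finally show ?thesis .
  qed
  have smh2': "smooth_on (box a' b') (\<lambda>x. \<chi> k. h' k x)"
    by (intro smooth_on_vec open_box) (simp add: smh2)
  have det2: "pd 1 (\<lambda>x. \<chi> k. h' k x) ?y $ 1 * pd 2 (\<lambda>x. \<chi> k. h' k x) ?y $ 2 - pd 2 (\<lambda>x. \<chi> k. h' k x) ?y $ 1 * pd 1 (\<lambda>x. \<chi> k. h' k x) ?y $ 2 \<noteq> 0"
    unfolding pdh2[OF ab'(1)] using u2(2)[OF ab'(1)] g0[OF ab'(1)] by simp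
  obtain R2 u where u: "R2 \<subseteq> box a' b'" "u \<in> A" "p \<in> fst u" "fst u = {q \<in> fst v. snd v q \<in> R2}"
    and ju: "\<forall>q\<in>fst u. \<forall>i k. jac v u q $ k $ i = pd i (\<lambda>x. \<chi> k. h' k x) (snd v q) $ k"
    using chart_from_local_diffeo[OF smooth_atlas_axioms v(2,3) open_box ab'(1,2) smh2' det2] .
  have uV: "fst u \<subseteq> V" using u(4) vV by auto
  have u_facts: "X u (snd u q) = axis 2 1" "T u (snd u q) = (\<chi> k i. if k = 2 \<and> i = 1 then 1 else 0)"
    if q: "q \<in> fst u" for q
  proof -
    have qv: "q \<in> fst v" "snd v q \<in> box a' b'" "q \<in> V" using q u uV by auto
    have J: "jac v u q $ k $ i = (if k = 1 then (if i = 1 then 1 else 0) else pd i u2 (snd v q))" for i k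
      using ju q pdh2[OF qv(2)] by simp
    have p2: "pd 2 u2 (snd v q) * X v (snd v q) $ 2 = 1"
      using u2(2)[OF qv(2)] X2[OF qv(1)] by (simp add: g_def)
    show "X u (snd u q) = axis 2 1"
      unfolding X_law[OF v(2) u(2) qv(3,1) q]
      by (simp add: vec_eq_iff forall_2 matrix_vector_mult_def sum_2 J v_facts(1)[OF qv(1)] p2 axis_def)
    show "T u (snd u q) = (\<chi> k i. if k = 2 \<and> i = 1 then 1 else 0)"
    proof (rule jac_cancel[OF v(2) u(2) qv(1) q])
      show "T u (snd u q) ** jac v u q = (\<chi> k i. if k = 2 \<and> i = 1 then 1 else 0) ** jac v u q"
        unfolding T_law[OF v(2) u(2) qv(1) q]
        by (simp add: vec_eq_iff forall_2 matrix_matrix_mult_def sum_2 J v_facts[OF qv(1)] p2)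
    qed
  qed
  have Xu: "X u x = axis 2 1" and Tu: "T u x = (\<chi> k i. if k = 2 \<and> i = 1 then 1 else 0)" if "x \<in> snd u ` fst u" for x
    using that u_facts by auto
  interpret U: local_extension "snd u ` fst u" "D u" "T u" "\<Phi> u" by (rule local_extension[OF u(2)])
  have Du: "D u x i j k = 0" if x: "x \<in> snd u ` fst u" and ne: "(i, j, k) \<noteq> (1, 1, 2)" for x i j k
  proof -
    have o: "open (snd u ` fst u)" by (rule open_chart_image[OF u(2)])
    \<comment> \<open>\<open>X\<close> is the constant second coordinate field, so DX = 0 is exactly
      the vanishing of these symbols.\<close>
    have c0: "D u x i 2 k = 0" for i k
    proof -
      have "pd i (X u) x = pd i (\<lambda>_. axis 2 1) x" by (rule pd_cong[OF o x]) (rule Xu)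
      then have "pd i (X u) x = 0" by simp
      moreover have "cov (D u) (coord_field i) (X u) x $ k = 0"
        using par[OF u(2), of x i] x uV by (simp add: Int_absorb1)
      ultimately show ?thesis unfolding cov_coord_nth by (simp add: Xu[OF x] sum_2 axis_def)
    qed
    \<comment> \<open>The entry \<open>T u x $ 2 $ 1\<close> is constant, so DT = 0 equates this
      symbol with the one of indices 1, 2, 2, which is zero by \<open>c0\<close>.\<close>
    have c1: "D u x 1 1 1 = 0"
    proof -
      have "pd 1 (\<lambda>x. T u x $ 2 $ 1) x = pd 1 (\<lambda>_. 1) x"
        by (rule pd_cong[OF o x]) (simp add: Tu)
      then show ?thesis using U.pd_T[OF x, of 1 2 1] by (simp add: Tu[OF x] sum_2 c0)
    qed
    show ?thesis
      using ne c0 c1 U.L_sym[OF x, of 2 1] exhaust_2[of i] exhaust_2[of j] exhaust_2[of k] by auto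
  qed
  have "adapted_coordinates D T u"
    unfolding adapted_coordinates_def
    using Du by (auto simp: Tu vec_eq_iff forall_2 matrix_vector_mult_def sum_2 axis_def)
  then show thesis using that[OF u(2,3) uV _ Xu] by blast
qed

end

section \<open>Solutions on the cotangent bundle\<close>

lemma smooth_on_pack_const: "open S \<Longrightarrow> smooth_on S (\<lambda>x. pack x v)"
proof (rule smooth_on_vec)
  show "smooth_on S (\<lambda>x. pack x v $ s)" if "open S" for s
    using that by (cases s) (simp_all add: smooth_on_const smooth_on_nth[OF _ smooth_on_id])
qed

lemma pd_pack:
  fixes F :: "real^('n::finite + 'n) \<Rightarrow> real"
  assumes "F differentiable (at (pack x v))"
  shows "((\<lambda>v. F (pack x v)) has_derivative (\<lambda>h. \<Sum>j\<in>UNIV. h $ j * pd (Inr j) F (pack x v))) (at v)"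
proof -
  have eq: "(\<lambda>v. pack x v) = (\<lambda>v. pack x 0 + pack 0 v)"
    by (rule ext) (simp add: vec_eq_iff forall_sum_type)
  have "linear (\<lambda>h::real^'n. pack 0 h :: real^('n + 'n))"
    by (rule linearI) (simp_all add: vec_eq_iff forall_sum_type)
  then have "((\<lambda>h. pack 0 h) has_derivative (\<lambda>h. pack 0 h)) (at v)"
    by (intro bounded_linear_imp_has_derivative) (simp add: linear_conv_bounded_linear)
  from has_derivative_add[OF has_derivative_const[of "pack x 0"] this]
  have "((\<lambda>v. pack x v) has_derivative (\<lambda>h. pack 0 h)) (at v)"
    unfolding add_0 by (subst eq)
  from has_derivative_compose[OF this has_derivative_pd[OF assms]]
  show ?thesis by (simp add: sum_UNIV_Plus)
qed

text \<open>Vanishing second fibre derivatives make the first ones locally constant; on a connected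
  slice they are constant, and so is the difference of \<psi> and the resulting linear
  function.\<close>

lemma affine_on_fibre:
  fixes \<psi> :: "real^('n::finite + 'n) \<Rightarrow> real"
  assumes R: "open R" and sm: "smooth_on R \<psi>"
    and zero: "\<And>y i j. y \<in> R \<Longrightarrow> pd (Inr i) (pd (Inr j) \<psi>) y = 0"
    and conn: "connected {v. pack x v \<in> R}" and v: "pack x v0 \<in> R" "pack x v \<in> R"
  shows "pd (Inr j) \<psi> (pack x v) = pd (Inr j) \<psi> (pack x v0)"
    and "\<psi> (pack x v) = \<psi> (pack x v0) + (\<Sum>j\<in>UNIV. (v - v0) $ j * pd (Inr j) \<psi> (pack x v0))"
proof -
  let ?F = "{v. pack x v \<in> R}"
  have F: "open ?F" by (rule open_fibre_slice[OF R])
  have const: "G v' = G v0" if "\<And>v. v \<in> ?F \<Longrightarrow> (G has_derivative (\<lambda>h. 0)) (at v)" "v' \<in> ?F" for G :: "_ \<Rightarrow> real" and v'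
    by (rule has_derivative_zero_unique_connected[OF F conn that]) (use v in auto)
  have c: "pd (Inr j) \<psi> (pack x v') = pd (Inr j) \<psi> (pack x v0)" if "v' \<in> ?F" for j v'
  proof (rule const[OF _ that])
    fix v assume "v \<in> ?F"
    then have y: "pack x v \<in> R" by simp
    from pd_pack[OF smooth_on_differentiable[OF smooth_on_pd[OF sm] y], of "Inr j"] zero[OF y]
    show "((\<lambda>v. pd (Inr j) \<psi> (pack x v)) has_derivative (\<lambda>h. 0)) (at v)" by simp
  qed
  show "pd (Inr j) \<psi> (pack x v) = pd (Inr j) \<psi> (pack x v0)" by (rule c) (use v in simp)
  let ?G = "\<lambda>v. \<psi> (pack x v) - (\<Sum>j\<in>UNIV. v $ j * pd (Inr j) \<psi> (pack x v0))"
  have "?G v = ?G v0"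
  proof (rule const[of ?G])
    fix v' assume v': "v' \<in> ?F"
    then have y: "pack x v' \<in> R" by simp
    have "((\<lambda>v. \<Sum>j\<in>UNIV. v $ j * pd (Inr j) \<psi> (pack x v0)) has_derivative
        (\<lambda>h. \<Sum>j\<in>UNIV. h $ j * pd (Inr j) \<psi> (pack x v0))) (at v')"
      by (intro has_derivative_sum has_derivative_mult_left bounded_linear_imp_has_derivative bounded_linear_vec_nth)
    from has_derivative_diff[OF pd_pack[OF smooth_on_differentiable[OF sm y]] this]
    show "(?G has_derivative (\<lambda>h. 0)) (at v')" by (simp add: c[OF v'])
  qed (use v in simp)
  then show "\<psi> (pack x v) = \<psi> (pack x v0) + (\<Sum>j\<in>UNIV. (v - v0) $ j * pd (Inr j) \<psi> (pack x v0))"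
    by (simp add: left_diff_distrib sum_subtractf)
qed

text \<open>Comparing \<open>v\<close> with \<open>v\<close> plus a small positive multiple of
  \<open>a\<close> gives a \<bullet> a = 0. In this way affine functions on an open part of a fibre
  are compared coefficient by coefficient.\<close>

lemma inner_constant_on_open:
  fixes a :: "'b::euclidean_space"
  assumes F: "open F" "v \<in> F" and eq: "\<And>w. w \<in> F \<Longrightarrow> w \<bullet> a = b"
  shows "a = 0"
proof -
  obtain e where e: "e > 0" "cball v e \<subseteq> F" using open_contains_cball F by metis
  have na: "norm a + 1 > 0" by (simp add: add_nonneg_pos)
  then have "e / (norm a + 1) * norm a \<le> e"
    using e(1) by (simp add: pos_divide_le_eq distrib_left)
  then have "v + (e / (norm a + 1)) *\<^sub>R a \<in> cball v e" using e(1) by (simp add: dist_norm)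
  then have "(v + (e / (norm a + 1)) *\<^sub>R a) \<bullet> a = v \<bullet> a" using e(2) eq F(2) by auto
  then have "(e / (norm a + 1)) * (a \<bullet> a) = 0" by (simp add: inner_add_left)
  then show ?thesis using e(1) na by auto
qed

lemma hessian_cong:
  assumes "open R" "y \<in> R" "\<And>z. z \<in> R \<Longrightarrow> f z = f' z"
  shows "hessian \<Gamma> f y = hessian \<Gamma> f' y"
proof -
  have 1: "pd j f z = pd j f' z" if "z \<in> R" for j z by (rule pd_cong[OF assms(1) that assms(3)])
  have "pd i (pd j f) y = pd i (pd j f') y" for i j by (rule pd_cong[OF assms(1,2) 1])
  then show ?thesis by (simp add: hessian_def 1[OF assms(2)])
qed

lemma conf_einstein_eq_cong:
  assumes "open R" "y \<in> R" "\<And>z. z \<in> R \<Longrightarrow> f z = f' z" "conf_einstein_eq_at g f y"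
  shows "conf_einstein_eq_at g f' y"
  using assms(4) hessian_cong[OF assms(1-3)] assms(3)[OF assms(2)]
  by (simp add: conf_einstein_eq_at_def laplacian_def)

text \<open>The equation is linear in the unknown function. It is applied with a = -\<kappa> to
  subtract a multiple of a known solution, and with a = \<kappa> to add it back.\<close>

lemma conf_einstein_eq_linear:
  assumes R: "open R" "y \<in> R" and sm: "smooth_on R f1" "smooth_on R f2"
    and eq: "conf_einstein_eq_at g f1 y" "conf_einstein_eq_at g f2 y"
  shows "conf_einstein_eq_at g (\<lambda>z. a * f1 z + f2 z) y"
proof -
  have 1: "pd j (\<lambda>z. a * f1 z + f2 z) z = a * pd j f1 z + pd j f2 z" if "z \<in> R" for j z
    using smooth_on_differentiable[OF sm(1) that] smooth_on_differentiable[OF sm(2) that]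
    by (simp add: pd_add pd_cmult)
  have "pd i (pd j (\<lambda>z. a * f1 z + f2 z)) y = pd i (\<lambda>z. a * pd j f1 z + pd j f2 z) y" for i j
    by (rule pd_cong[OF R 1])
  also have "\<dots> i j = a * pd i (pd j f1) y + pd i (pd j f2) y" for i j
    using smooth_on_differentiable[OF smooth_on_pd[OF sm(1)] R(2)] smooth_on_differentiable[OF smooth_on_pd[OF sm(2)] R(2)]
    by (simp add: pd_add pd_cmult)
  finally have H2: "pd i (pd j (\<lambda>z. a * f1 z + f2 z)) y = a * pd i (pd j f1) y + pd i (pd j f2) y" for i j .
  have H: "hessian \<Gamma> (\<lambda>z. a * f1 z + f2 z) y = a *\<^sub>R hessian \<Gamma> f1 y + hessian \<Gamma> f2 y" for \<Gamma>
    by (simp only: vec_eq_iff hessian_def vec_lambda_beta vector_add_component vector_scaleR_component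
        real_scaleR_def H2 1[OF R(2)]) (simp add: algebra_simps sum.distrib sum_distrib_left)
  have tr: "metric_trace G (a *\<^sub>R B1 + B2) = a * metric_trace G B1 + metric_trace G B2" for G B1 B2
    by (simp add: metric_trace_def algebra_simps sum.distrib sum_distrib_left)
  have lap: "laplacian g (\<lambda>z. a * f1 z + f2 z) y = a * laplacian g f1 y + laplacian g f2 y"
    unfolding laplacian_def H tr ..
  have e: "2 * hessian (levi_civita g) f y $ i $ j + f y * ricci (levi_civita g) y $ i $ j
      = (1/4) * (2 * laplacian g f y + f y * scalar_curvature g y) * g y $ i $ j"
    if "conf_einstein_eq_at g f y" for f i j
    using that unfolding conf_einstein_eq_at_def vec_eq_iff by simp
  have "2 * hessian (levi_civita g) (\<lambda>z. a * f1 z + f2 z) y $ i $ j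
      + (a * f1 y + f2 y) * ricci (levi_civita g) y $ i $ j
      - (1/4) * (2 * laplacian g (\<lambda>z. a * f1 z + f2 z) y + (a * f1 y + f2 y) * scalar_curvature g y) * g y $ i $ j
    = a * (2 * hessian (levi_civita g) f1 y $ i $ j + f1 y * ricci (levi_civita g) y $ i $ j
        - (1/4) * (2 * laplacian g f1 y + f1 y * scalar_curvature g y) * g y $ i $ j)
      + (2 * hessian (levi_civita g) f2 y $ i $ j + f2 y * ricci (levi_civita g) y $ i $ j
        - (1/4) * (2 * laplacian g f2 y + f2 y * scalar_curvature g y) * g y $ i $ j)" for i j
    unfolding H lap by (simp add: algebra_simps)
  then show ?thesis
    using e[OF eq(1)] e[OF eq(2)] unfolding conf_einstein_eq_at_def vec_eq_iff by simp
qed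

section \<open>Functions and open sets of the cotangent bundle in induced charts\<close>

context smooth_atlas
begin

lemma cot_img_subset_cylinder: "U \<subseteq> cotangent A \<Longrightarrow> cot_img A c U \<subseteq> base -` (snd c ` (fst ` U \<inter> fst c))"
  unfolding base_cot_img[symmetric] by blast

lemma cot_smoothD: "cot_smooth A U \<phi> \<Longrightarrow> c \<in> A \<Longrightarrow> smooth_on (cot_img A c U) (\<phi> \<circ> chart_inv (cot_chart A c))"
  unfolding cot_smooth_def smooth_fun_def cot_img_def by blast

lemma cot_smoothI:
  "(\<And>c. c \<in> A \<Longrightarrow> smooth_on (cot_img A c U) (\<phi> \<circ> chart_inv (cot_chart A c))) \<Longrightarrow> cot_smooth A U \<phi>"
  unfolding cot_smooth_def smooth_fun_def cot_img_def by blast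

lemma cot_img_fibre:
  assumes "U \<subseteq> cotangent A" "c \<in> A" "p \<in> fst c"
  shows "{v. pack (snd c p) v \<in> cot_img A c U} = {\<alpha> c |\<alpha>. (p, \<alpha>) \<in> U}"
proof -
  have "\<exists>\<alpha>. v = \<alpha> c \<and> (p, \<alpha>) \<in> U" if "(p, cot_lift c p v) \<in> U" for v
    using that cot_lift_self[OF assms(2,3), of v] by metis
  moreover have "(p, cot_lift c p (\<alpha> c)) \<in> U" if "(p, \<alpha>) \<in> U" for \<alpha>
    using that cotangent_eq_lift[of "(p, \<alpha>)" c] assms by auto
  ultimately show ?thesis unfolding pack_in_cot_img[OF assms] by blast
qed

lemma cot_chart_apply_inv:
  assumes "U \<subseteq> cotangent A" "c \<in> A" "y \<in> cot_img A c U"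
  shows "chart_inv (cot_chart A c) y \<in> U" "fst (chart_inv (cot_chart A c) y) = chart_inv c (base y)"
    "snd (chart_inv (cot_chart A c) y) c = fibre y"
  using cot_imgE[OF assms(3,1,2)] by (metis fibre_pack)+

lemma chart_form:
  assumes "cot_open A U" "vector_field A (fst ` U) X" "c \<in> A" "y \<in> cot_img A c U"
    and eq: "\<And>\<eta>. \<eta> \<in> U \<Longrightarrow> \<phi> \<eta> = iota A X \<eta> + f (fst \<eta>)"
  shows "(\<phi> \<circ> chart_inv (cot_chart A c)) y = fibre y \<bullet> X c (base y) + (f \<circ> chart_inv c) (base y)"
proof -
  note U = cot_openD(1)[OF assms(1)]
  obtain \<eta> where \<eta>: "\<eta> \<in> U" "fst \<eta> \<in> fst c" "y = pack (snd c (fst \<eta>)) (snd \<eta> c)"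
    "chart_inv (cot_chart A c) y = \<eta>" "chart_inv c (base y) = fst \<eta>"
    using cot_imgE[OF assms(4) U assms(3)] by metis
  have "iota A X \<eta> = snd \<eta> c \<bullet> X c (snd c (fst \<eta>))"
    by (rule iota_eq[OF assms(2)]) (use \<eta> U assms(3) in auto)
  then show ?thesis using eq[OF \<eta>(1)] \<eta> by simp
qed

text \<open>Open sets of the bundle are those with open image in every induced chart; cutting by a
  condition in the chart \<open>c\<close> stays open in the others because the transition maps of
  covectors are continuous.\<close>

lemma cot_open_restrict:
  assumes U: "cot_open A U" and c: "c \<in> A" and B: "open B"
  shows "cot_open A {\<eta> \<in> U. fst \<eta> \<in> fst c \<and> pack (snd c (fst \<eta>)) (snd \<eta> c) \<in> B}" (is "cot_open A ?U'")
  unfolding cot_open_def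
proof (intro conjI ballI)
  note UA = cot_openD(1)[OF U]
  show "?U' \<subseteq> cotangent A" using UA by blast
  fix c' assume c': "c' \<in> A"
  let ?J = "\<lambda>x. jac c c' (chart_inv c x)" and ?O = "base -` (snd c' ` (fst c' \<inter> fst c))"
  \<comment> \<open>The transition map from the induced chart of \<open>c'\<close> to that of
    \<open>c\<close>.\<close>
  let ?\<tau> = "\<lambda>y. pack (transition c' c (base y)) (transpose (?J (transition c' c (base y))) *v fibre y)"
  have O: "open ?O" by (rule open_base_vimage[OF open_overlap[OF c' c]])
  have ct: "continuous_on ?O (\<lambda>y. transition c' c (base y))"
    by (rule continuous_on_compose2[OF smooth_on_continuous[OF smooth_transition[OF c' c]]
          bounded_linear.continuous_on[OF bounded_linear_base continuous_on_id]]) auto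
  have cJ: "continuous_on ?O (\<lambda>y. ?J (transition c' c (base y)))"
    by (rule continuous_on_compose2[OF smooth_on_continuous[OF smooth_jac[OF c c']] ct]) (use c' in auto)
  have "continuous_on ?O (\<lambda>y. \<chi> i. \<Sum>k\<in>UNIV. ?J (transition c' c (base y)) $ k $ i * fibre y $ k)"
    by (intro continuous_on_vec_lambda continuous_intros cJ bounded_linear.continuous_on[OF bounded_linear_fibre])
  then have "continuous_on ?O (\<lambda>y. transpose (?J (transition c' c (base y))) *v fibre y)"
    by (simp add: matrix_vector_mult_def transpose_def del: transpose_matrix_vector)
  then have "open (?O \<inter> ?\<tau> -` B)"
    by (intro continuous_open_preimage continuous_on_pack ct O B)
  moreover have "cot_img A c' ?U' = cot_img A c' U \<inter> (?O \<inter> ?\<tau> -` B)"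
  proof -
    have tau: "?\<tau> (pack (snd c' (fst \<eta>)) (snd \<eta> c')) = pack (snd c (fst \<eta>)) (snd \<eta> c)"
      if "\<eta> \<in> U" "fst \<eta> \<in> fst c" "fst \<eta> \<in> fst c'" for \<eta>
      using that c c' cotangent_transform[of \<eta> c c'] UA by (auto simp del: transpose_matrix_vector)
    show ?thesis
    proof (intro equalityI subsetI)
      fix y assume "y \<in> cot_img A c' ?U'"
      then obtain \<eta> where "\<eta> \<in> ?U'" "fst \<eta> \<in> fst c'" "y = pack (snd c' (fst \<eta>)) (snd \<eta> c')"
        using cot_img_eq[of ?U' c'] UA by blast
      moreover from this have "y \<in> cot_img A c' U" unfolding cot_img_eq[OF UA] by blast
      ultimately show "y \<in> cot_img A c' U \<inter> (?O \<inter> ?\<tau> -` B)" using tau[of \<eta>] by simp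
    next
      fix y assume y: "y \<in> cot_img A c' U \<inter> (?O \<inter> ?\<tau> -` B)"
      then obtain \<eta> where \<eta>: "\<eta> \<in> U" "fst \<eta> \<in> fst c'" "y = pack (snd c' (fst \<eta>)) (snd \<eta> c')"
        using cot_img_eq[OF UA, of c'] by blast
      then have "snd c' (fst \<eta>) \<in> snd c' ` (fst c' \<inter> fst c)" using y by simp
      then have "fst \<eta> \<in> fst c" using inj_on_chart[OF c'] \<eta>(2) by (auto dest: inj_onD)
      then have "\<eta> \<in> ?U'" using tau[of \<eta>] \<eta> y by simp
      moreover have "?U' \<subseteq> cotangent A" using UA by blast
      ultimately show "y \<in> cot_img A c' ?U'" unfolding cot_img_eq[OF \<open>?U' \<subseteq> cotangent A\<close>] using \<eta>(2,3) by blast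
    qed
  qed
  ultimately show "open (cot_img A c' ?U')" using cot_openD(2)[OF U c'] by auto
qed

end

section \<open>Solutions read in induced charts\<close>

context extension_surface
begin

abbreviation "gm \<equiv> mod_riem_ext D \<Phi> T"

lemma conf_einstein_solution_cong:
  assumes U: "cot_open A U" and eq: "\<And>\<eta>. \<eta> \<in> U \<Longrightarrow> \<phi> \<eta> = \<phi>' \<eta>" and sol: "conf_einstein_solution A gm U \<phi>"
  shows "conf_einstein_solution A gm U \<phi>'"
proof -
  have e: "(\<phi> \<circ> chart_inv (cot_chart A c)) y = (\<phi>' \<circ> chart_inv (cot_chart A c)) y" if "c \<in> A" "y \<in> cot_img A c U" for c y
    using cot_chart_apply_inv(1)[OF cot_openD(1)[OF U] that] eq by simp
  show ?thesis
    unfolding conf_einstein_solution_def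
  proof (intro conjI cot_smoothI ballI)
    fix c assume c: "c \<in> A"
    show "smooth_on (cot_img A c U) (\<phi>' \<circ> chart_inv (cot_chart A c))"
    proof (rule smooth_on_cong[OF cot_openD(2)[OF U c] e[OF c] cot_smoothD[OF _ c]])
      show "cot_smooth A U \<phi>" using sol unfolding conf_einstein_solution_def by blast
    qed
    show "conf_einstein_eq_at (gm c) (\<phi>' \<circ> chart_inv (cot_chart A c)) y" if "y \<in> cot_img A c U" for y
    proof (rule conf_einstein_eq_cong[OF cot_openD(2)[OF U c] that e[OF c]])
      show "conf_einstein_eq_at (gm c) (\<phi> \<circ> chart_inv (cot_chart A c)) y"
        using sol c that unfolding conf_einstein_solution_def by blast
    qed
  qed
qed

lemma einstein_iff:
  assumes U: "cot_open A U" and sm: "cot_smooth A U \<phi>" and pos: "\<And>\<eta>. \<eta> \<in> U \<Longrightarrow> \<phi> \<eta> > 0"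
    and c: "c \<in> A" and y: "y \<in> cot_img A c U"
  shows "einstein_at (\<lambda>z. (1 / (\<phi> (chart_inv (cot_chart A c) z))\<^sup>2) *\<^sub>R gm c z) y \<longleftrightarrow>
    conf_einstein_eq_at (gm c) (\<phi> \<circ> chart_inv (cot_chart A c)) y"
proof -
  let ?R = "cot_img A c U"
  interpret local_extension "snd c ` fst c" "D c" "T c" "\<Phi> c" by (rule local_extension[OF c])
  have "?R \<subseteq> Y" using cot_img_subset_cylinder[OF cot_openD(1)[OF U], of c] by auto
  then have "local_metric ?R gr (walker_inv w)"
    by (intro local_metric.intro cot_openD(2)[OF U c] smooth_on_subset[OF smooth_g] smooth_on_subset[OF smooth_G])
      (blast intro: g_sym G_sym G_inv)+
  moreover have "(\<phi> \<circ> chart_inv (cot_chart A c)) y > 0" if "y \<in> ?R" for y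
    using pos[OF cot_chart_apply_inv(1)[OF cot_openD(1)[OF U] c that]] by simp
  moreover have "CARD(2 + 2) = 4" by simp
  ultimately show ?thesis
    using local_metric.einstein_conformal_iff[of ?R gr "walker_inv w", OF _ cot_smoothD[OF sm c] _ y]
    unfolding mod_riem_ext_walker o_def by blast
qed

lemma solution_parallel:
  assumes U: "cot_open A U" and X: "vector_field A (fst ` U) X" and f: "smooth_fun A (fst ` U) f"
    and form: "\<And>\<eta>. \<eta> \<in> U \<Longrightarrow> \<phi> \<eta> = iota A X \<eta> + f (fst \<eta>)" and sol: "conf_einstein_solution A gm U \<phi>"
    and c: "c \<in> A" and x: "x \<in> snd c ` (fst ` U \<inter> fst c)"
  shows "T c x *v X c x = 0" "cov (D c) (coord_field i) (X c) x = 0"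
proof -
  interpret local_extension "snd c ` fst c" "D c" "T c" "\<Phi> c" by (rule local_extension[OF c])
  let ?R = "cot_img A c U" and ?N = "snd c ` (fst ` U \<inter> fst c)"
  have N: "open ?N" "?N \<subseteq> snd c ` fst c" using open_image[OF c openin_base[OF U]] by auto
  have smX: "smooth_on ?N (X c)" using X c unfolding vector_field_def by blast
  have smf: "smooth_on ?N (f \<circ> chart_inv c)" using f c unfolding smooth_fun_def by blast
  note A = N cot_openD(2)[OF U c] cot_img_subset_cylinder[OF cot_openD(1)[OF U]] smX smf chart_form[OF U X c _ form]
  have s: "conf_einstein_eq_at gr (\<phi> \<circ> chart_inv (cot_chart A c)) y" if "y \<in> ?R" for y
    using sol c that by (simp add: conf_einstein_solution_def mod_riem_ext_walker)
  obtain y where y: "y \<in> ?R" "base y = x" using x base_cot_img[OF cot_openD(1)[OF U], of c] by (metis imageE)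
  have ker: "T c (base z) *v X c (base z) = 0" if "z \<in> ?R" for z
    by (rule parallel_kernel_of_solution(1)[OF A s that]) auto
  then show "T c x *v X c x = 0" using y by auto
  have "T c (base y) \<noteq> 0" using T_nonzero[OF c] x y(2) by auto
  then have "cov (D c) (coord_field i) (X c) (base y) = 0"
    using ker by (intro parallel_kernel_of_solution(2)[OF A s y(1)]) auto
  then show "cov (D c) (coord_field i) (X c) x = 0" using y by simp
qed

text \<open>A solution yields DX = 0, and the divergence is its trace.\<close>

lemma kernel_div_free_solution:
  assumes "cot_open A U" "vector_field A (fst ` U) X" "smooth_fun A (fst ` U) f"
    "\<And>\<eta>. \<eta> \<in> U \<Longrightarrow> \<phi> \<eta> = iota A X \<eta> + f (fst \<eta>)" "conf_einstein_solution A gm U \<phi>"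
  shows "kernel_div_free A D T (fst ` U) X"
  unfolding kernel_div_free_def trace_cov_def
  using assms(2) solution_parallel[OF assms] by simp

end

section \<open>Extracting the field and the function from a solution; the two cases\<close>

context extension_surface
begin

text \<open>In each chart \<open>X\<close> collects the fibre derivatives at some chosen covector
  over each point. Connected fibres make it independent of that choice, and the charts agree because
  they describe one function, affine on an open part of each fibre.\<close>

lemma solution_form:
  assumes U: "cot_open A U" and conn: "\<And>c p. c \<in> A \<Longrightarrow> p \<in> fst c \<Longrightarrow> connected {\<alpha> c |\<alpha>. (p, \<alpha>) \<in> U}"
    and sol: "conf_einstein_solution A gm U \<phi>"
  obtains X f where "kernel_div_free A D T (fst ` U) X" "vector_field A (fst ` U) X" "smooth_fun A (fst ` U) f"
    "\<forall>\<xi>\<in>U. \<phi> \<xi> = iota A X \<xi> + f (fst \<xi>)"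
proof -
  note UA = cot_openD(1)[OF U]
  let ?V = "fst ` U"
  define \<psi> where "\<psi> c = \<phi> \<circ> chart_inv (cot_chart A c)" for c
  \<comment> \<open>An arbitrary covector over \<open>x\<close> in the domain, chosen without any
    continuity in \<open>x\<close>.\<close>
  define pt where "pt c x = (SOME v. pack x v \<in> cot_img A c U)" for c and x :: "real^2"
  define X where "X c x = (\<chi> j. pd (Inr j) (\<psi> c) (pack x (pt c x)))" for c x
  define F where "F c x = \<psi> c (pack x (pt c x)) - pt c x \<bullet> X c x" for c x
  have R: "open (cot_img A c U)" "smooth_on (cot_img A c U) (\<psi> c)" if "c \<in> A" for c
    using cot_openD(2)[OF U that] cot_smoothD[OF _ that] sol unfolding conf_einstein_solution_def \<psi>_def by blast+
  have zero: "pd (Inr i) (pd (Inr j) (\<psi> c)) y = 0" if c: "c \<in> A" and y: "y \<in> cot_img A c U" for c y i j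
  proof -
    interpret local_extension "snd c ` fst c" "D c" "T c" "\<Phi> c" by (rule local_extension[OF c])
    have "cot_img A c U \<subseteq> Y" using cot_img_subset_cylinder[OF UA, of c] by auto
    moreover have "conf_einstein_eq_at gr (\<psi> c) y"
      using sol c y unfolding conf_einstein_solution_def \<psi>_def mod_riem_ext_walker by blast
    ultimately show ?thesis by (intro conf_einstein_fibre_hessian[OF R(1)[OF c] y _ R(2)[OF c]])
  qed
  have aff: "X c (snd c p) = (\<chi> j. pd (Inr j) (\<psi> c) (pack (snd c p) v))"
      "\<psi> c (pack (snd c p) v) = v \<bullet> X c (snd c p) + F c (snd c p)"
    if c: "c \<in> A" "p \<in> fst c" and v: "pack (snd c p) v \<in> cot_img A c U" for c p v
  proof -
    have p: "pack (snd c p) (pt c (snd c p)) \<in> cot_img A c U"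
      unfolding pt_def by (rule someI[of "\<lambda>v. pack (snd c p) v \<in> cot_img A c U", OF v])
    have cf: "connected {v. pack (snd c p) v \<in> cot_img A c U}"
      unfolding cot_img_fibre[OF UA c] by (rule conn[OF c])
    note a = affine_on_fibre[OF R[OF c(1)] zero[OF c(1)] cf p v]
    show "X c (snd c p) = (\<chi> j. pd (Inr j) (\<psi> c) (pack (snd c p) v))"
      unfolding X_def by (simp add: vec_eq_iff a(1))
    show "\<psi> c (pack (snd c p) v) = v \<bullet> X c (snd c p) + F c (snd c p)"
      by (simp add: a(2) F_def X_def inner_vec_def left_diff_distrib sum_subtractf)
  qed
  have \<psi>_lift: "\<psi> c (pack (snd c p) v) = \<phi> (p, cot_lift c p v)" if "c \<in> A" "p \<in> fst c" for c p v
    unfolding \<psi>_def using cot_chart_inv_pack[OF that] by simp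
  have form: "\<phi> \<eta> = snd \<eta> c \<bullet> X c (snd c (fst \<eta>)) + F c (snd c (fst \<eta>))" if "\<eta> \<in> U" "c \<in> A" "fst \<eta> \<in> fst c" for \<eta> c
  proof -
    have e: "\<eta> = (fst \<eta>, cot_lift c (fst \<eta>) (snd \<eta> c))" by (rule cotangent_eq_lift) (use that UA in auto)
    then have "(fst \<eta>, cot_lift c (fst \<eta>) (snd \<eta> c)) \<in> U" using that(1) by metis
    then have "pack (snd c (fst \<eta>)) (snd \<eta> c) \<in> cot_img A c U"
      using pack_in_cot_img[OF UA that(2,3)] by blast
    from aff(2)[OF that(2,3) this] \<psi>_lift[OF that(2,3), of "snd \<eta> c"] e show ?thesis by metis
  qed
  have law: "X c' (snd c' p) = jac c c' p *v X c (snd c p)" "F c' (snd c' p) = F c (snd c p)"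
    if c: "c \<in> A" "c' \<in> A" "p \<in> fst c" "p \<in> fst c'" and p: "p \<in> ?V" for c c' p
  proof -
    let ?O = "{v. pack (snd c' p) v \<in> cot_img A c' U}"
    have O: "open ?O" by (rule open_fibre_slice[OF R(1)[OF c(2)]])
    obtain v0 where v0: "v0 \<in> ?O"
    proof -
      obtain \<eta> where \<eta>: "\<eta> \<in> U" "p = fst \<eta>" using p by auto
      have "pack (snd c' p) (snd \<eta> c') \<in> cot_img A c' U"
        unfolding cot_img_eq[OF UA] using \<eta> c(4) by blast
      then show thesis by (intro that[of "snd \<eta> c'"] CollectI)
    qed
    \<comment> \<open>Both charts describe the same function of v; its linear and its constant part
      give the transformation law of \<open>X\<close> and the chart independence of
      \<open>F\<close>.\<close>
    have eq: "v \<bullet> (X c' (snd c' p) - jac c c' p *v X c (snd c p)) = F c (snd c p) - F c' (snd c' p)" if v: "v \<in> ?O" for v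
    proof -
      let ?\<eta> = "(p, cot_lift c' p v)"
      have \<eta>: "?\<eta> \<in> U" using v pack_in_cot_img[OF UA c(2,4)] by blast
      have s: "cot_lift c' p v c' = v" by (rule cot_lift_self[OF c(2,4)])
      have s': "cot_lift c' p v c = transpose (jac c c' p) *v v" using c by (simp add: cot_lift_def)
      have "v \<bullet> X c' (snd c' p) + F c' (snd c' p) = (transpose (jac c c' p) *v v) \<bullet> X c (snd c p) + F c (snd c p)"
        using form[OF \<eta> c(1)] form[OF \<eta> c(2)] c unfolding fst_conv snd_conv s s' by simp
      also have "(transpose (jac c c' p) *v v) \<bullet> X c (snd c p) = v \<bullet> (jac c c' p *v X c (snd c p))"
        by (simp add: dot_lmul_matrix[symmetric])
      finally show ?thesis by (simp add: inner_diff_right)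
    qed
    have z: "X c' (snd c' p) - jac c c' p *v X c (snd c p) = 0"
      by (rule inner_constant_on_open[OF O v0 eq])
    then show "X c' (snd c' p) = jac c c' p *v X c (snd c p)" by simp
    show "F c' (snd c' p) = F c (snd c p)" using eq[OF v0] unfolding z by simp
  qed
  have smooth: "smooth_on (snd c ` (?V \<inter> fst c)) (X c)" "smooth_on (snd c ` (?V \<inter> fst c)) (F c)" if c: "c \<in> A" for c
  proof -
    let ?N = "snd c ` (?V \<inter> fst c)"
    have N: "open ?N" by (rule open_image[OF c openin_base[OF U]])
    have "\<exists>S. open S \<and> x \<in> S \<and> smooth_on (?N \<inter> S) (X c) \<and> smooth_on (?N \<inter> S) (F c)" if x: "x \<in> ?N" for x
    proof -
      obtain y where y: "y \<in> cot_img A c U" "base y = x"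
        using x base_cot_img[OF UA, of c] by (metis imageE)
      \<comment> \<open>Near \<open>x\<close> the fixed value \<open>fibre y\<close> replaces the
        chosen ones: it remains in the domain over all nearby points, and it leads to the same
        \<open>X\<close> and \<open>F\<close>.\<close>
      let ?v = "fibre y" and ?S = "(\<lambda>x. pack x (fibre y)) -` cot_img A c U"
      have S: "open ?S" by (intro open_vimage R(1)[OF c] continuous_on_pack continuous_intros)
      have NS: "open (?N \<inter> ?S)" using N S by blast
      have sp: "smooth_on (?N \<inter> ?S) (\<lambda>x. G (pack x ?v))" if "smooth_on (cot_img A c U) G" for G :: "_ \<Rightarrow> real"
        by (rule smooth_on_compose[OF NS smooth_on_pack_const[OF NS] that]) auto
      have Xe: "X c x = (\<chi> j. pd (Inr j) (\<psi> c) (pack x ?v))" and Fe: "F c x = \<psi> c (pack x ?v) - ?v \<bullet> X c x"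
        if xN: "x \<in> ?N \<inter> ?S" for x
      proof -
        obtain p where p: "p \<in> fst c" "x = snd c p" using xN by blast
        then have "pack (snd c p) ?v \<in> cot_img A c U" using xN by simp
        from aff[OF c p(1) this] p(2) show "X c x = (\<chi> j. pd (Inr j) (\<psi> c) (pack x ?v))" "F c x = \<psi> c (pack x ?v) - ?v \<bullet> X c x"
          by simp_all
      qed
      have sX: "smooth_on (?N \<inter> ?S) (X c)"
      proof (rule smooth_on_cong[OF NS Xe[symmetric]])
        show "smooth_on (?N \<inter> ?S) (\<lambda>x. \<chi> j. pd (Inr j) (\<psi> c) (pack x ?v))"
          by (intro smooth_on_vec NS) (simp add: sp[OF smooth_on_pd[OF R(2)[OF c]]])
      qed
      moreover have "smooth_on (?N \<inter> ?S) (F c)"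
        by (rule smooth_on_cong[OF NS Fe[symmetric]])
          (auto intro!: smooth_on_diff NS sp R(2)[OF c] smooth_on_linear[OF NS bounded_linear_inner_right sX])
      moreover have "x \<in> ?S" using y by (metis pack_base_fibre vimageI2)
      ultimately show ?thesis using S by blast
    qed
    then show "smooth_on ?N (X c)" "smooth_on ?N (F c)" by (meson smooth_on_local)+
  qed
  have vf: "vector_field A ?V X"
    unfolding vector_field_def using smooth(1) law(1) by blast
  define f where "f p = (let c = (SOME c. c \<in> A \<and> p \<in> fst c) in F c (snd c p))" for p
  have f_eq: "f p = F c (snd c p)" if "p \<in> ?V" "c \<in> A" "p \<in> fst c" for p c
  proof -
    let ?c = "SOME c. c \<in> A \<and> p \<in> fst c"
    have "?c \<in> A \<and> p \<in> fst ?c" by (rule someI[of "\<lambda>c. c \<in> A \<and> p \<in> fst c" c]) (use that in blast)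
    then show ?thesis unfolding f_def Let_def using law(2)[of c ?c p] that by simp
  qed
  have sf: "smooth_fun A ?V f"
    unfolding smooth_fun_def
  proof
    fix c assume c: "c \<in> A"
    show "smooth_on (snd c ` (?V \<inter> fst c)) (f \<circ> chart_inv c)"
    proof (rule smooth_on_cong[OF open_image[OF c openin_base[OF U]] _ smooth(2)[OF c]])
      fix x assume "x \<in> snd c ` (?V \<inter> fst c)"
      then obtain p where p: "p \<in> ?V" "p \<in> fst c" "x = snd c p" by blast
      show "F c x = (f \<circ> chart_inv c) x" using f_eq[OF p(1) c p(2)] c p by simp
    qed
  qed
  have final: "\<phi> \<xi> = iota A X \<xi> + f (fst \<xi>)" if \<xi>: "\<xi> \<in> U" for \<xi>
  proof -
    obtain c where c: "c \<in> A" "fst \<xi> \<in> fst c" using \<xi> UA by (auto simp: cotangent_def)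
    have "iota A X \<xi> = snd \<xi> c \<bullet> X c (snd c (fst \<xi>))"
      by (rule iota_eq[OF vf]) (use that UA c in auto)
    then show ?thesis using form[OF that c] f_eq[OF _ c] that by simp
  qed
  show thesis
  proof (rule that[OF kernel_div_free_solution[OF U vf sf _ sol] vf sf])
    show "\<phi> \<xi> = iota A X \<xi> + f (fst \<xi>)" if "\<xi> \<in> U" for \<xi> by (rule final[OF that])
    show "\<forall>\<xi>\<in>U. \<phi> \<xi> = iota A X \<xi> + f (fst \<xi>)" using final by blast
  qed
qed

text \<open>The neighbourhood is cut down to a box in one induced chart. Its projection is connected
  and its fibres are convex in that chart; in every other chart they are linear images of convex
  sets, hence connected.\<close>

lemma restrict_solution:
  assumes U: "cot_open A U" and \<xi>: "\<xi> \<in> U" and sm: "cot_smooth A U \<phi>" and pos: "\<And>\<eta>. \<eta> \<in> U \<Longrightarrow> \<phi> \<eta> > 0"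
    and ein: "\<And>c y. c \<in> A \<Longrightarrow> y \<in> cot_img A c U \<Longrightarrow>
      einstein_at (\<lambda>z. (1 / (\<phi> (chart_inv (cot_chart A c) z))\<^sup>2) *\<^sub>R gm c z) y"
  obtains U' where "cot_open A U'" "\<xi> \<in> U'" "U' \<subseteq> U" "connectedin M (fst ` U')" "conf_einstein_solution A gm U' \<phi>"
    "\<And>c p. c \<in> A \<Longrightarrow> p \<in> fst c \<Longrightarrow> connected {\<alpha> c |\<alpha>. (p, \<alpha>) \<in> U'}"
proof -
  note UA = cot_openD(1)[OF U]
  obtain c where c: "c \<in> A" "fst \<xi> \<in> fst c" using \<xi> UA by (auto simp: cotangent_def)
  let ?y = "pack (snd c (fst \<xi>)) (snd \<xi> c)"
  have "?y \<in> cot_img A c U" unfolding cot_img_eq[OF UA] using \<xi> c by blast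
  then obtain a b where B: "?y \<in> box a b" "box a b \<subseteq> cot_img A c U"
    using open_contains_box_at[OF cot_openD(2)[OF U c(1)]] by metis
  let ?U' = "{\<eta> \<in> U. fst \<eta> \<in> fst c \<and> pack (snd c (fst \<eta>)) (snd \<eta> c) \<in> box a b}"
  have U': "cot_open A ?U'" by (rule cot_open_restrict[OF U c(1) open_box])
  have lift: "(p, cot_lift c p v) \<in> ?U'" if "p \<in> fst c" "pack (snd c p) v \<in> box a b" for p v
    using that B(2) pack_in_cot_img[OF UA c(1) that(1), of v] cot_lift_self[OF c(1) that(1), of v] by auto
  have "snd c ` (fst ` ?U') = base ` box a b"
  proof (intro equalityI subsetI)
    fix x assume "x \<in> snd c ` (fst ` ?U')"
    then show "x \<in> base ` box a b" by (force simp: image_iff)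
  next
    fix x assume "x \<in> base ` box a b"
    then obtain y where y: "y \<in> box a b" "x = base y" by blast
    then obtain \<eta> where \<eta>: "\<eta> \<in> U" "fst \<eta> \<in> fst c" "y = pack (snd c (fst \<eta>)) (snd \<eta> c)"
      using B(2) cot_img_eq[OF UA, of c] by blast
    then show "x \<in> snd c ` (fst ` ?U')" using y by (intro image_eqI[of _ _ "fst \<eta>"]) auto
  qed
  moreover have "connected (base ` box a b)"
    by (intro connected_continuous_image bounded_linear.continuous_on[OF bounded_linear_base]
        continuous_on_id convex_connected convex_box)
  ultimately have "connectedin (top_of_set (snd c ` fst c)) (snd c ` (fst ` ?U'))"
    by (auto simp: connectedin_subtopology)
  then have "connectedin (subtopology M (fst c)) (fst ` ?U')"
    using homeomorphic_map_connectedness_eq[OF homeomorphic_chart[OF c(1)], of "fst ` ?U'"] topspace_chart[OF c(1)] by auto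
  then have con: "connectedin M (fst ` ?U')" by (simp add: connectedin_subtopology)
  have "cot_img A c' ?U' \<subseteq> cot_img A c' U" for c' unfolding cot_img_def by blast
  then have sol: "conf_einstein_solution A gm ?U' \<phi>"
    unfolding conf_einstein_solution_def
    using cot_smoothD[OF sm] einstein_iff[OF U sm pos] ein
    by (intro conjI cot_smoothI ballI) (blast intro: smooth_on_subset)+
  have fib: "connected {\<alpha> c' |\<alpha>. (p, \<alpha>) \<in> ?U'}" if c': "c' \<in> A" "p \<in> fst c'" for c' p
  proof (cases "p \<in> fst c")
    case False
    then have "{\<alpha> c' |\<alpha>. (p, \<alpha>) \<in> ?U'} = {}" by simp
    then show ?thesis by (simp only: connected_empty)
  next
    case True
    let ?S = "{v. pack (snd c p) v \<in> box a b}"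
    have "{\<alpha> c' |\<alpha>. (p, \<alpha>) \<in> ?U'} = (\<lambda>v. transpose (jac c' c p) *v v) ` ?S"
    proof (intro equalityI subsetI)
      fix u assume "u \<in> {\<alpha> c' |\<alpha>. (p, \<alpha>) \<in> ?U'}"
      then obtain \<alpha> where \<alpha>: "u = \<alpha> c'" "(p, \<alpha>) \<in> ?U'" by blast
      then have "\<alpha> c' = transpose (jac c' c p) *v \<alpha> c"
        using cotangent_transform[of "(p, \<alpha>)" c' c] UA c' c True by auto
      then show "u \<in> (\<lambda>v. transpose (jac c' c p) *v v) ` ?S" using \<alpha> by auto
    next
      fix u assume "u \<in> (\<lambda>v. transpose (jac c' c p) *v v) ` ?S"
      then obtain v where v: "u = transpose (jac c' c p) *v v" "pack (snd c p) v \<in> box a b" by blast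
      then have "cot_lift c p v c' = u" using c' by (simp add: cot_lift_def)
      then show "u \<in> {\<alpha> c' |\<alpha>. (p, \<alpha>) \<in> ?U'}" using lift[OF True v(2)] by blast
    qed
    moreover have "convex ?S"
    proof -
      have "pack x (s *\<^sub>R v + t *\<^sub>R v') = s *\<^sub>R pack x v + t *\<^sub>R pack x v'" if "s + t = 1" for s t :: real and x v v' :: "real^2"
        using that by (simp add: vec_eq_iff forall_sum_type scaleR_add_left[symmetric] distrib_right[symmetric])
      then show ?thesis using convex_box(2)[of a b] unfolding convex_def by simp
    qed
    ultimately show ?thesis
      by (simp only:) (intro convex_connected convex_linear_image matrix_vector_mul_linear)
  qed
  show thesis
    by (rule that[OF U' _ _ con sol fib]) (use \<xi> c B in auto)
qed

text \<open>The hypothesis says that dh vanishes on the image of \<open>T\<close>, which in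
  dimension two equals the kernel of a nonzero \<open>T\<close> with square zero.\<close>

lemma kills_kernel_of_transpose:
  assumes c: "c \<in> A" "x \<in> snd c ` fst c" and b: "\<And>i. (\<Sum>k\<in>UNIV. pd k h x * T c x $ k $ i) = 0" and v: "T c x *v v = 0"
  shows "dir_deriv (\<lambda>_. v) h x = 0"
proof -
  interpret local_extension "snd c ` fst c" "D c" "T c" "\<Phi> c" by (rule local_extension[OF c(1)])
  have T0: "T c x \<noteq> 0" using T_nonzero[OF c(1)] c(2) by auto
  let ?f = "\<lambda>k. pd k h x"
  note E = T_entries[OF c(2)]
  have B: "?f 1 * T c x $ 1 $ 1 + ?f 2 * T c x $ 2 $ 1 = 0" "?f 1 * T c x $ 1 $ 2 + ?f 2 * T c x $ 2 $ 2 = 0"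
    using b[of 1] b[of 2] by (simp_all add: sum_2)
  have K: "T c x $ 1 $ 1 * v $ 1 + T c x $ 1 $ 2 * v $ 2 = 0" "T c x $ 2 $ 1 * v $ 1 + T c x $ 2 $ 2 * v $ 2 = 0"
    using v by (simp_all add: vec_eq_iff forall_2 matrix_vector_mult_def sum_2)
  have "T c x $ 1 $ 2 \<noteq> 0 \<or> T c x $ 2 $ 1 \<noteq> 0" using T0 E by (auto simp: vec_eq_iff forall_2)
  moreover have "T c x $ 1 $ 2 * (v $ 1 * ?f 1 + v $ 2 * ?f 2) = 0"
    using B K E by algebra
  moreover have "T c x $ 2 $ 1 * (v $ 1 * ?f 1 + v $ 2 * ?f 2) = 0"
    using B K E by algebra
  ultimately show ?thesis by (auto simp: dir_deriv_def sum_2)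
qed

lemma base_solution:
  assumes U: "cot_open A U" and f: "smooth_fun A (fst ` U) f"
    and sol: "conf_einstein_solution A gm U (\<lambda>\<eta>. f (fst \<eta>))"
  shows "kills_kernel A T (fst ` U) f"
    and "c \<in> A \<Longrightarrow> x \<in> snd c ` (fst ` U \<inter> fst c) \<Longrightarrow>
      f (chart_inv c x) *\<^sub>R hat (T c x) (\<Phi> c x)
        + 2 *\<^sub>R (hessian (D c) (f \<circ> chart_inv c) x + f (chart_inv c x) *\<^sub>R ricci_sym (D c) x) = 0"
proof -
  note UA = cot_openD(1)[OF U]
  have main: "(\<Sum>k\<in>UNIV. pd k (f \<circ> chart_inv c) x * T c x $ k $ i) = 0 \<and>
      2 * hessian (D c) (f \<circ> chart_inv c) x $ i $ j
        + (f \<circ> chart_inv c) x * (2 *\<^sub>R ricci_sym (D c) x + hat (T c x) (\<Phi> c x)) $ i $ j = 0"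
    if c: "c \<in> A" and x: "x \<in> snd c ` (fst ` U \<inter> fst c)" for c x i j
  proof -
    interpret local_extension "snd c ` fst c" "D c" "T c" "\<Phi> c" by (rule local_extension[OF c])
    let ?R = "cot_img A c U" and ?N = "snd c ` (fst ` U \<inter> fst c)"
    have N: "open ?N" "?N \<subseteq> snd c ` fst c" using open_image[OF c openin_base[OF U]] by auto
    have smf: "smooth_on ?N (f \<circ> chart_inv c)" using f c unfolding smooth_fun_def by blast
    obtain y where y: "y \<in> ?R" "base y = x" using x base_cot_img[OF UA, of c] by (metis imageE)
    have form: "((\<lambda>\<eta>. f (fst \<eta>)) \<circ> chart_inv (cot_chart A c)) z = (f \<circ> chart_inv c) (base z)" if "z \<in> ?R" for z
      using cot_chart_apply_inv(2)[OF UA c that] by simp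
    have s: "conf_einstein_eq_at gr ((\<lambda>\<eta>. f (fst \<eta>)) \<circ> chart_inv (cot_chart A c)) z" if "z \<in> ?R" for z
      using sol c that unfolding conf_einstein_solution_def mod_riem_ext_walker by blast
    note ps = pullback_solution[OF N cot_openD(2)[OF U c] cot_img_subset_cylinder[OF UA] smf y(1) form s, unfolded y(2) cylinder_matrix_def]
    show ?thesis by (intro conjI ps)
  qed
  show "kills_kernel A T (fst ` U) f"
    unfolding kills_kernel_def
  proof (intro ballI allI impI)
    fix c x v assume c: "c \<in> A" "x \<in> snd c ` (fst ` U \<inter> fst c)" and v: "T c x *v v = 0"
    have "x \<in> snd c ` fst c" using c by auto
    then show "dir_deriv (\<lambda>_. v) (f \<circ> chart_inv c) x = 0"
      by (rule kills_kernel_of_transpose[OF c(1)]) (use main[OF c] v in auto)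
  qed
  show "f (chart_inv c x) *\<^sub>R hat (T c x) (\<Phi> c x)
        + 2 *\<^sub>R (hessian (D c) (f \<circ> chart_inv c) x + f (chart_inv c x) *\<^sub>R ricci_sym (D c) x) = 0"
    if "c \<in> A" "x \<in> snd c ` (fst ` U \<inter> fst c)"
  proof -
    have "2 * hessian (D c) (f \<circ> chart_inv c) x $ i $ j
        + f (chart_inv c x) * (2 * ricci_sym (D c) x $ i $ j + hat (T c x) (\<Phi> c x) $ i $ j) = 0" for i j
      using main[OF that, of i j] by simp
    then show ?thesis by (simp add: vec_eq_iff algebra_simps)
  qed
qed

lemma conformally_einstein_of_solution:
  assumes "\<And>\<xi>. \<xi> \<in> cotangent A \<Longrightarrow> \<exists>U \<phi>. cot_open A U \<and> \<xi> \<in> U \<and> (\<forall>\<eta>\<in>U. \<phi> \<eta> > 0) \<and> conf_einstein_solution A gm U \<phi>"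
  shows "conformally_einstein A gm"
  unfolding conformally_einstein_def
proof
  fix \<xi> assume "\<xi> \<in> cotangent A"
  then obtain U \<phi> where U: "cot_open A U" "\<xi> \<in> U" and pos: "\<And>\<eta>. \<eta> \<in> U \<Longrightarrow> \<phi> \<eta> > 0" and sol: "conf_einstein_solution A gm U \<phi>"
    using assms by blast
  have sm: "cot_smooth A U \<phi>" and eq: "\<And>c y. c \<in> A \<Longrightarrow> y \<in> cot_img A c U \<Longrightarrow>
      conf_einstein_eq_at (gm c) (\<phi> \<circ> chart_inv (cot_chart A c)) y"
    using sol unfolding conf_einstein_solution_def by blast+
  show "\<exists>U \<phi>. cot_open A U \<and> \<xi> \<in> U \<and> cot_smooth A U \<phi> \<and> (\<forall>\<eta>\<in>U. \<phi> \<eta> > 0) \<and>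
      (\<forall>c\<in>A. \<forall>y\<in>cot_img A c U. einstein_at (\<lambda>z. (1 / (\<phi> (chart_inv (cot_chart A c) z))\<^sup>2) *\<^sub>R gm c z) y)"
    using U pos sm eq einstein_iff[OF U(1) sm pos] by blast
qed

lemma conformally_einstein_cases:
  assumes ce: "conformally_einstein A gm" and \<xi>: "\<xi> \<in> cotangent A"
  obtains U X f where "cot_open A U" "\<xi> \<in> U" "connectedin M (fst ` U)" "kernel_div_free A D T (fst ` U) X"
    "smooth_fun A (fst ` U) f" "\<forall>\<eta>\<in>U. iota A X \<eta> + f (fst \<eta>) > 0"
    "conf_einstein_solution A gm U (\<lambda>\<eta>. iota A X \<eta> + f (fst \<eta>))"
proof -
  obtain U0 \<phi> where U0: "cot_open A U0" "\<xi> \<in> U0" "cot_smooth A U0 \<phi>" "\<And>\<eta>. \<eta> \<in> U0 \<Longrightarrow> \<phi> \<eta> > 0"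
    "\<And>c y. c \<in> A \<Longrightarrow> y \<in> cot_img A c U0 \<Longrightarrow> einstein_at (\<lambda>z. (1 / (\<phi> (chart_inv (cot_chart A c) z))\<^sup>2) *\<^sub>R gm c z) y"
    using ce \<xi> unfolding conformally_einstein_def by blast
  show thesis
  proof (rule restrict_solution[OF U0(1-3)])
    show "\<phi> \<eta> > 0" if "\<eta> \<in> U0" for \<eta> by (rule U0(4)[OF that])
    show "einstein_at (\<lambda>z. (1 / (\<phi> (chart_inv (cot_chart A c) z))\<^sup>2) *\<^sub>R gm c z) y" if "c \<in> A" "y \<in> cot_img A c U0" for c y
      by (rule U0(5)[OF that])
    fix U assume U: "cot_open A U" "\<xi> \<in> U" "U \<subseteq> U0" "connectedin M (fst ` U)" "conf_einstein_solution A gm U \<phi>"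
      "\<And>c p. c \<in> A \<Longrightarrow> p \<in> fst c \<Longrightarrow> connected {\<alpha> c |\<alpha>. (p, \<alpha>) \<in> U}"
    show thesis
    proof (rule solution_form[OF U(1) _ U(5)])
      show "connected {\<alpha> c |\<alpha>. (p, \<alpha>) \<in> U}" if "c \<in> A" "p \<in> fst c" for c p by (rule U(6)[OF that])
      fix X f assume Xf: "kernel_div_free A D T (fst ` U) X" "vector_field A (fst ` U) X" "smooth_fun A (fst ` U) f"
        "\<forall>\<xi>\<in>U. \<phi> \<xi> = iota A X \<xi> + f (fst \<xi>)"
      have "conf_einstein_solution A gm U (\<lambda>\<eta>. iota A X \<eta> + f (fst \<eta>))"
        by (rule conf_einstein_solution_cong[OF U(1) _ U(5)]) (use Xf(4) in blast)
      moreover have "iota A X \<eta> + f (fst \<eta>) > 0" if "\<eta> \<in> U" for \<eta>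
      proof -
        have "\<phi> \<eta> > 0" using that U(3) U0(4) by blast
        then show ?thesis using bspec[OF Xf(4) that] by simp
      qed
      ultimately show thesis using U(1,2,4) Xf(1,3) by (intro that ballI)
    qed
  qed
qed

lemma iota_zero:
  assumes "vector_field A (fst ` U) X" "\<not> non_zero_field A (fst ` U) X" "U \<subseteq> cotangent A" "\<eta> \<in> U"
  shows "iota A X \<eta> = 0"
proof -
  obtain c where c: "c \<in> A" "fst \<eta> \<in> fst c" using assms by (auto simp: cotangent_def)
  have "iota A X \<eta> = snd \<eta> c \<bullet> X c (snd c (fst \<eta>))" by (rule iota_eq[OF assms(1)]) (use assms c in auto)
  moreover have "X c (snd c (fst \<eta>)) = 0" using assms(2,4) c unfolding non_zero_field_def by blast
  ultimately show ?thesis by simp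
qed

end

section \<open>The Ricci tensor of the surface\<close>

lemma rank_outer_square:
  fixes B :: "real^'n^'n::finite"
  assumes "B \<noteq> 0" "\<And>i j. B $ i $ j = r * a $ i * a $ j"
  shows "rank B = 1"
proof -
  have eq: "B *v v = (r * (a \<bullet> v)) *\<^sub>R a" for v
    by (simp add: vec_eq_iff matrix_vector_mult_def inner_vec_def assms(2) sum_distrib_left sum_distrib_right mult_ac)
  have "range (\<lambda>v. B *v v) \<subseteq> span {a}" unfolding eq by (intro image_subsetI span_mul span_base) simp
  then have "rank B \<le> card {a}" unfolding rank_dim_range by (rule dim_le_card) simp
  moreover have "rank B \<noteq> 0" using assms(1) by (simp add: rank_eq_0)
  ultimately show ?thesis by simp
qed

context extension_surface
begin

lemma coordinate_change_charts:
  assumes c: "c \<in> A" "c' \<in> A" and V: "openin M V"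
  shows "coordinate_change (snd c ` (V \<inter> fst c \<inter> fst c')) (snd c' ` (V \<inter> fst c \<inter> fst c')) (transition c c') (D c) (D c')"
proof -
  interpret C: local_extension "snd c ` fst c" "D c" "T c" "\<Phi> c" by (rule local_extension[OF c(1)])
  interpret C': local_extension "snd c' ` fst c'" "D c'" "T c'" "\<Phi> c'" by (rule local_extension[OF c(2)])
  have sub: "snd c ` (V \<inter> fst c \<inter> fst c') \<subseteq> snd c ` fst c" "snd c' ` (V \<inter> fst c \<inter> fst c') \<subseteq> snd c' ` fst c'"
    by blast+
  show ?thesis
  proof
    show "open (snd c ` (V \<inter> fst c \<inter> fst c'))"
      using open_image[OF c(1) openin_Int[OF V openin_chart[OF c(2)]]] by (simp add: Int_ac)
    show "open (snd c' ` (V \<inter> fst c \<inter> fst c'))"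
      using open_image[OF c(2) openin_Int[OF V openin_chart[OF c(1)]]] by simp
    show "smooth_on (snd c ` (V \<inter> fst c \<inter> fst c')) (transition c c')"
      by (rule smooth_on_subset[OF smooth_transition[OF c]]) blast
    show "transition c c' ` snd c ` (V \<inter> fst c \<inter> fst c') \<subseteq> snd c' ` (V \<inter> fst c \<inter> fst c')"
      using c by (auto simp: image_iff)
    show "smooth_on (snd c ` (V \<inter> fst c \<inter> fst c')) (\<lambda>x. D c x i j k)" for i j k
      by (rule smooth_on_subset[OF C.smooth_L sub(1)])
    show "smooth_on (snd c' ` (V \<inter> fst c \<inter> fst c')) (\<lambda>x. D c' x i j k)" for i j k
      by (rule smooth_on_subset[OF C'.smooth_L sub(2)])
    show "D c x i j k = D c x j i k" if "x \<in> snd c ` (V \<inter> fst c \<inter> fst c')" for x i j k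
      by (rule C.L_sym[OF subsetD[OF sub(1) that]])
    show "D c' x i j k = D c' x j i k" if "x \<in> snd c' ` (V \<inter> fst c \<inter> fst c')" for x i j k
      by (rule C'.L_sym[OF subsetD[OF sub(2) that]])
    show "(\<Sum>l\<in>UNIV. pd l (transition c c') x $ k * D c x i j l) = pd i (pd j (transition c c')) x $ k +
        (\<Sum>a\<in>UNIV. \<Sum>b\<in>UNIV. pd i (transition c c') x $ a * pd j (transition c c') x $ b * D c' (transition c c' x) a b k)"
      if x: "x \<in> snd c ` (V \<inter> fst c \<inter> fst c')" for x i j k
    proof -
      obtain p where p: "p \<in> fst c \<inter> fst c'" "x = snd c p" using x by blast
      have "(\<Sum>l\<in>UNIV. jac c c' p $ k $ l * D c (snd c p) i j l) = pd i (pd j (transition c c')) (snd c p) $ k +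
          (\<Sum>a\<in>UNIV. \<Sum>b\<in>UNIV. jac c c' p $ a $ i * jac c c' p $ b $ j * D c' (snd c' p) a b k)"
        using surfaceD(1) c p(1) unfolding affine_connection_def by blast
      then show ?thesis unfolding p(2) jac_nth using c p(1) by simp
    qed
  qed
qed

lemma ricci_law:
  assumes c: "c \<in> A" "c' \<in> A" and p: "p \<in> fst c" "p \<in> fst c'"
  shows "ricci (D c) (snd c p) $ i $ j =
    (\<Sum>a\<in>UNIV. \<Sum>b\<in>UNIV. jac c c' p $ a $ i * jac c c' p $ b $ j * ricci (D c') (snd c' p) $ a $ b)"
proof -
  interpret C: coordinate_change "snd c ` (topspace M \<inter> fst c \<inter> fst c')" "snd c' ` (topspace M \<inter> fst c \<inter> fst c')"
    "transition c c'" "D c" "D c'"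
    by (rule coordinate_change_charts[OF c openin_topspace])
  have J: "C.J k i (snd c p) = jac c c' p $ k $ i" for k i by (simp add: C.J_def jac_nth)
  have x: "snd c p \<in> snd c ` (topspace M \<inter> fst c \<inter> fst c')" using c p chart_subset by blast
  have "ricci (D c) (snd c p) $ i $ j =
    (\<Sum>a\<in>UNIV. \<Sum>b\<in>UNIV. C.J a i (snd c p) * C.J b j (snd c p) * ricci (D c') (transition c c' (snd c p)) $ a $ b)"
  proof (rule C.ricci_change[OF x, where K = "\<lambda>m b. jac c' c p $ m $ b"])
    show "(\<Sum>m\<in>UNIV. C.J a m (snd c p) * jac c' c p $ m $ b) = (if a = b then 1 else 0)" for a b
      using arg_cong[OF jac_inverse[OF c(2,1) p(2,1)], of "\<lambda>B. B $ a $ b"]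
      by (simp add: J matrix_matrix_mult_def mat_def)
    show "(\<Sum>m\<in>UNIV. jac c' c p $ a $ m * C.J m b (snd c p)) = (if a = b then 1 else 0)" for a b
      using arg_cong[OF jac_inverse[OF c p], of "\<lambda>B. B $ a $ b"]
      by (simp add: J matrix_matrix_mult_def mat_def)
  qed
  then show ?thesis unfolding J transition_snd[OF c(1) p(1)] .
qed

lemma smooth_ricci:
  assumes c: "c \<in> A"
  shows "smooth_on (snd c ` fst c) (\<lambda>x. ricci (D c) x $ i $ j)"
proof -
  interpret C: local_extension "snd c ` fst c" "D c" "T c" "\<Phi> c" by (rule local_extension[OF c])
  note o = open_chart_image[OF c]
  show ?thesis
    by (rule smooth_on_cong[OF o ricci_nth[OF C.diff_base(1), symmetric]])
      (assumption | intro smooth_on_diff smooth_on_add smooth_on_sum smooth_on_mult smooth_on_pd C.smooth_L o)+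
qed

lemma cov02_ricci_law:
  assumes c: "c \<in> A" "c' \<in> A" and p: "p \<in> fst c" "p \<in> fst c'"
  shows "cov02 (D c) (ricci (D c)) l (snd c p) $ i $ j =
    (\<Sum>k\<in>UNIV. \<Sum>a\<in>UNIV. \<Sum>b\<in>UNIV. jac c c' p $ k $ l * jac c c' p $ a $ i * jac c c' p $ b $ j
      * cov02 (D c') (ricci (D c')) k (snd c' p) $ a $ b)"
proof -
  let ?O = "snd c ` (topspace M \<inter> fst c \<inter> fst c')" and ?O' = "snd c' ` (topspace M \<inter> fst c \<inter> fst c')"
  interpret C: coordinate_change ?O ?O' "transition c c'" "D c" "D c'"
    by (rule coordinate_change_charts[OF c openin_topspace])
  have J: "C.J k i (snd c q) = jac c c' q $ k $ i" for k i q by (simp add: C.J_def jac_nth)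
  have x: "snd c p \<in> ?O" using c p chart_subset by blast
  have "cov02 (D c) (ricci (D c)) l (snd c p) $ i $ j =
    (\<Sum>k\<in>UNIV. \<Sum>a\<in>UNIV. \<Sum>b\<in>UNIV. C.J k l (snd c p) * C.J a i (snd c p) * C.J b j (snd c p)
      * cov02 (D c') (ricci (D c')) k (transition c c' (snd c p)) $ a $ b)"
  proof (rule C.cov02_change[OF x])
    show "smooth_on ?O' (\<lambda>x. ricci (D c') x $ a $ b)" for a b
      by (rule smooth_on_subset[OF smooth_ricci[OF c(2)]]) blast
    fix z i j assume "z \<in> ?O"
    then obtain q where q: "z = snd c q" "q \<in> fst c" "q \<in> fst c'" by blast
    show "ricci (D c) z $ i $ j = (\<Sum>a\<in>UNIV. \<Sum>b\<in>UNIV. C.J a i z * C.J b j z * ricci (D c') (transition c c' z) $ a $ b)"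
      unfolding q(1) J transition_snd[OF c(1) q(2)] by (rule ricci_law[OF c q(2,3)])
  qed
  then show ?thesis unfolding J transition_snd[OF c(1) p(1)] .
qed

lemma adapted_christoffel:
  assumes u: "u \<in> A" "adapted_coordinates D T u" and x: "x \<in> snd u ` fst u" and ijk: "(i, j, k) \<noteq> (1, 1, 2)"
  shows "D u x i j k = 0" "pd a (\<lambda>x. D u x i j k) x = 0"
proof -
  have z: "D u x i j k = 0" if "x \<in> snd u ` fst u" for x
    using u(2) that ijk unfolding adapted_coordinates_def by blast
  then show "D u x i j k = 0" using x by blast
  have "pd a (\<lambda>x. D u x i j k) x = pd a (\<lambda>_. 0) x" by (rule pd_cong[OF open_chart_image[OF u(1)] x]) (rule z)
  then show "pd a (\<lambda>x. D u x i j k) x = 0" by simp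
qed

lemma adapted_ricci:
  assumes u: "u \<in> A" "adapted_coordinates D T u" and x: "x \<in> snd u ` fst u"
  shows "ricci (D u) x $ i $ j = (if i = 1 \<and> j = 1 then pd 2 (\<lambda>x. D u x 1 1 2) x else 0)"
proof -
  interpret C: local_extension "snd u ` fst u" "D u" "T u" "\<Phi> u" by (rule local_extension[OF u(1)])
  have L: "D u x 1 1 1 = 0" "D u x 1 2 k = 0" "D u x 2 1 k = 0" "D u x 2 2 k = 0"
    "pd a (\<lambda>x. D u x 1 1 1) x = 0" "pd a (\<lambda>x. D u x 1 2 k) x = 0" "pd a (\<lambda>x. D u x 2 1 k) x = 0"
    "pd a (\<lambda>x. D u x 2 2 k) x = 0" for a k
    by (rule adapted_christoffel[OF u x]; simp)+
  have "i = 1 \<and> j = 1 \<or> i = 1 \<and> j = 2 \<or> i = 2 \<and> j = 1 \<or> i = 2 \<and> j = 2"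
    using exhaust_2[of i] exhaust_2[of j] by blast
  then show ?thesis
    by (elim disjE conjE) (simp_all add: ricci_nth[OF C.diff_base(1)[OF x]] sum_2 L)
qed

text \<open>No Christoffel symbol has upper index 1, so du^1 is parallel, and differentiating r du^1
  \<otimes> du^1 only differentiates r.\<close>

lemma adapted_cov02_ricci:
  assumes u: "u \<in> A" "adapted_coordinates D T u" and x: "x \<in> snd u ` fst u"
  shows "cov02 (D u) (ricci (D u)) l x $ i $ j = (if i = 1 \<and> j = 1 then pd l (\<lambda>x. ricci (D u) x $ 1 $ 1) x else 0)"
proof -
  have L: "D u x a b 1 = 0" for a b by (rule adapted_christoffel[OF u x]) simp
  have r: "ricci (D u) x $ 1 $ 2 = 0" "ricci (D u) x $ 2 $ 1 = 0" "ricci (D u) x $ 2 $ 2 = 0"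
    by (simp_all add: adapted_ricci[OF u x])
  have z: "pd l (\<lambda>x. ricci (D u) x $ i $ j) x = 0" if "\<not> (i = 1 \<and> j = 1)" for i j
  proof -
    have "pd l (\<lambda>x. ricci (D u) x $ i $ j) x = pd l (\<lambda>_. 0) x"
      by (rule pd_cong[OF open_chart_image[OF u(1)] x]) (use that adapted_ricci[OF u] in auto)
    then show ?thesis by simp
  qed
  have "i = 1 \<and> j = 1 \<or> i = 1 \<and> j = 2 \<or> i = 2 \<and> j = 1 \<or> i = 2 \<and> j = 2"
    using exhaust_2[of i] exhaust_2[of j] by blast
  then show ?thesis
    by (elim disjE conjE) (simp_all add: cov02_def sum_2 L r z)
qed

context
  fixes u p
  assumes u: "u \<in> A" "adapted_coordinates D T u" and p: "p \<in> fst u"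
begin

text \<open>The Ricci tensor is r du^1 \<otimes> du^1, and row 1 of the Jacobian is du^1 written in
  the chart \<open>c\<close>.\<close>

lemma ricci_rank_one:
  assumes c: "c \<in> A" "p \<in> fst c"
  shows "ricci (D c) (snd c p) $ i $ j = ricci (D u) (snd u p) $ 1 $ 1 * jac c u p $ 1 $ i * jac c u p $ 1 $ j"
  unfolding ricci_law[OF c(1) u(1) c(2) p] sum_2 using p by (simp add: adapted_ricci[OF u])

text \<open>As du^1 is parallel, the recurrence form is dr/r, with r the only nonzero entry in the
  adapted chart; the transposed Jacobian expresses it in \<open>c\<close>.\<close>

lemma ricci_recurrence:
  assumes c: "c \<in> A" "p \<in> fst c" and r: "ricci (D u) (snd u p) $ 1 $ 1 \<noteq> 0"
  shows "cov02 (D c) (ricci (D c)) l (snd c p) =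
    (transpose (jac c u p) *v (\<chi> m. pd m (\<lambda>x. ricci (D u) x $ 1 $ 1) (snd u p) / ricci (D u) (snd u p) $ 1 $ 1)) $ l
      *\<^sub>R ricci (D c) (snd c p)"
proof -
  have x: "snd u p \<in> snd u ` fst u" using p by blast
  have "cov02 (D c) (ricci (D c)) l (snd c p) $ i $ j =
    (transpose (jac c u p) *v (\<chi> m. pd m (\<lambda>x. ricci (D u) x $ 1 $ 1) (snd u p) / ricci (D u) (snd u p) $ 1 $ 1)) $ l
      * ricci (D c) (snd c p) $ i $ j" for i j
    unfolding cov02_ricci_law[OF c(1) u(1) c(2) p] ricci_rank_one[OF c] adapted_cov02_ricci[OF u x]
      matrix_vector_mult_def transpose_def sum_2 vec_lambda_beta
    using r by (simp add: field_simps)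
  then show ?thesis by (simp add: vec_eq_iff del: transpose_matrix_vector)
qed

lemma ricci_nonzero_adapted:
  assumes c: "c \<in> A" "p \<in> fst c" and r: "ricci (D c) (snd c p) \<noteq> 0"
  shows "ricci (D u) (snd u p) $ 1 $ 1 \<noteq> 0"
  using r ricci_rank_one[OF c] by (auto simp: vec_eq_iff)

end

lemma ricci_nonzero_chart:
  assumes c: "c \<in> A" "p \<in> fst c" and c': "c' \<in> A" "p \<in> fst c'" and r: "ricci (D c) (snd c p) \<noteq> 0"
  shows "ricci (D c') (snd c' p) \<noteq> 0"
proof
  assume "ricci (D c') (snd c' p) = 0"
  then have "ricci (D c) (snd c p) = 0" by (simp add: vec_eq_iff ricci_law[OF c(1) c'(1) c(2) c'(2)])
  then show False using r by contradiction
qed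

text \<open>Adapted charts exist only near each point, whereas one form is wanted on the whole set
  where the Ricci tensor is not zero. There the recurrence equation determines the form, so the
  local expressions dr/r fit together.\<close>

lemma recurrent_ricci:
  assumes V: "openin M V" and ad: "\<And>p. p \<in> V \<Longrightarrow> \<exists>u\<in>A. p \<in> fst u \<and> adapted_coordinates D T u"
  shows "recurrent_on A D (\<lambda>c. ricci (D c)) {p \<in> V. \<exists>c\<in>A. p \<in> fst c \<and> ricci (D c) (snd c p) \<noteq> 0}"
    (is "recurrent_on A D _ ?V'")
proof -
  let ?\<rho> = "\<lambda>c. ricci (D c)"
  \<comment> \<open>The recurrence equation solved for its factor with the Euclidean product of
    matrices: a smooth formula in every chart, with no adapted chart involved.\<close>
  define \<omega> where "\<omega> c x = (\<chi> l. (cov02 (D c) (?\<rho> c) l x \<bullet> ?\<rho> c x) / (?\<rho> c x \<bullet> ?\<rho> c x))" for c x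
  have nz: "?\<rho> c (snd c p) \<noteq> 0" if "c \<in> A" "p \<in> fst c" "p \<in> ?V'" for c p
    using that ricci_nonzero_chart by blast
  have key: "\<omega> c (snd c p) = transpose (jac c u p) *v \<nu>" "cov02 (D c) (?\<rho> c) l (snd c p) = \<omega> c (snd c p) $ l *\<^sub>R ?\<rho> c (snd c p)"
    if c: "c \<in> A" "p \<in> fst c" and p: "p \<in> ?V'" and u: "u \<in> A" "p \<in> fst u" "adapted_coordinates D T u"
      and \<nu>: "\<nu> = (\<chi> m. pd m (\<lambda>x. ?\<rho> u x $ 1 $ 1) (snd u p) / ?\<rho> u (snd u p) $ 1 $ 1)" for c p l u \<nu>
  proof -
    note n = nz[OF c p]
    note r = ricci_recurrence[OF u(1,3,2) c ricci_nonzero_adapted[OF u(1,3,2) c n], folded \<nu>]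
    show w: "\<omega> c (snd c p) = transpose (jac c u p) *v \<nu>"
      unfolding \<omega>_def r inner_scaleR_left using n by (simp add: vec_eq_iff del: transpose_matrix_vector)
    show "cov02 (D c) (?\<rho> c) l (snd c p) = \<omega> c (snd c p) $ l *\<^sub>R ?\<rho> c (snd c p)" unfolding w by (rule r)
  qed
  have "one_form A ?V' \<omega>"
    unfolding one_form_def
  proof (intro conjI ballI)
    fix c assume c: "c \<in> A"
    let ?N = "snd c ` fst c" and ?O = "snd c ` (?V' \<inter> fst c)"
    interpret C: local_extension ?N "D c" "T c" "\<Phi> c" by (rule local_extension[OF c])
    have "?O = (snd c ` (V \<inter> fst c)) \<inter> ?\<rho> c -` (- {0})"
      using nz[OF c] c by blast
    moreover have s\<rho>: "smooth_on ?N (?\<rho> c)"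
      by (intro smooth_on_vec open_chart_image c smooth_ricci)
    moreover have "open ((snd c ` (V \<inter> fst c)) \<inter> ?\<rho> c -` (- {0}))"
      by (intro continuous_open_preimage open_image c V continuous_on_subset[OF smooth_on_continuous[OF s\<rho>]] open_Compl closed_singleton) blast
    ultimately have O: "open ?O" by simp
    have ON: "?O \<subseteq> ?N" by blast
    have "smooth_on ?N (\<lambda>x. cov02 (D c) (?\<rho> c) l x $ i $ j)" for l i j
      unfolding cov02_def vec_lambda_beta
      by (intro smooth_on_diff smooth_on_sum smooth_on_mult smooth_on_pd C.smooth_L smooth_ricci open_chart_image c)
    then have "smooth_on ?N (cov02 (D c) (?\<rho> c) l)" for l
      by (intro smooth_on_vec open_chart_image c)
    then have s: "smooth_on ?O (cov02 (D c) (?\<rho> c) l)" "smooth_on ?O (?\<rho> c)" for l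
      using smooth_on_subset[OF _ ON] s\<rho> by blast+
    have d: "?\<rho> c x \<bullet> ?\<rho> c x \<noteq> 0" if "x \<in> ?O" for x
      using that nz[OF c] by (auto simp only: inner_eq_zero_iff)
    have "smooth_on ?O (\<lambda>x. \<omega> c x $ l)" for l
      unfolding \<omega>_def vec_lambda_beta
      by (rule smooth_on_divide[OF O smooth_on_bilinear[OF O bounded_bilinear_inner s] smooth_on_bilinear[OF O bounded_bilinear_inner s(2) s(2)] d])
    then show "smooth_on ?O (\<omega> c)" by (intro smooth_on_vec O)
    fix c' p assume c': "c' \<in> A" and p: "p \<in> ?V' \<inter> fst c \<inter> fst c'"
    obtain u where u: "u \<in> A" "p \<in> fst u" "adapted_coordinates D T u" using p ad by blast
    have p': "p \<in> ?V'" "p \<in> fst c" "p \<in> fst c'" using p by blast+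
    show "\<omega> c (snd c p) = transpose (jac c c' p) *v \<omega> c' (snd c' p)"
      unfolding key(1)[OF c p'(2,1) u refl] key(1)[OF c' p'(3,1) u refl]
        jac_cocycle[OF c c' u(1) p'(2,3) u(2)] matrix_transpose_mul matrix_vector_mul_assoc ..
  qed
  moreover have "cov02 (D c) (?\<rho> c) l x = \<omega> c x $ l *\<^sub>R ?\<rho> c x" if c: "c \<in> A" and x: "x \<in> snd c ` (?V' \<inter> fst c)" for c x l
  proof -
    obtain p where p: "p \<in> ?V'" "p \<in> fst c" "x = snd c p" using x by blast
    obtain u where u: "u \<in> A" "p \<in> fst u" "adapted_coordinates D T u" using p ad by blast
    show ?thesis unfolding p(3) by (rule key(2)[OF c p(2,1) u refl])
  qed
  ultimately show ?thesis unfolding recurrent_on_def by blast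
qed

lemma solution_field_nonzero:
  assumes U: "cot_open A U" and con: "connectedin M (fst ` U)" and X: "vector_field A (fst ` U) X"
    and f: "smooth_fun A (fst ` U) f" and nz: "non_zero_field A (fst ` U) X"
    and sol: "conf_einstein_solution A gm U (\<lambda>\<eta>. iota A X \<eta> + f (fst \<eta>))"
    and c: "c \<in> A" and x: "x \<in> snd c ` (fst ` U \<inter> fst c)"
  shows "X c x \<noteq> 0"
proof
  assume 0: "X c x = 0"
  let ?V = "fst ` U"
  obtain p where p: "p \<in> ?V" "p \<in> fst c" "x = snd c p" using x by blast
  have "X c' (snd c' q) = 0" if "c' \<in> A" "q \<in> ?V" "q \<in> fst c'" for c' q
  proof (rule zero_set_clopen[where V = ?V and f = X, OF openin_base[OF U] con subset_refl])
    show "p \<in> ?V" "c \<in> A" "p \<in> fst c" "X c (snd c p) = 0" "q \<in> ?V" "c' \<in> A" "q \<in> fst c'"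
      using p c 0 that by simp_all
    fix c assume c: "c \<in> A"
    interpret C: local_extension "snd c ` fst c" "D c" "T c" "\<Phi> c" by (rule local_extension[OF c])
    let ?N = "snd c ` (?V \<inter> fst c)"
    have sX: "smooth_on ?N (X c)" using X c unfolding vector_field_def by blast
    show "continuous_on ?N (X c)" by (rule smooth_on_continuous[OF sX])
    show "X c' (snd c' p) = 0" if "c' \<in> A" "p \<in> ?V" "p \<in> fst c" "p \<in> fst c'" "X c (snd c p) = 0" for c' p
    proof -
      have "X c' (snd c' p) = jac c c' p *v X c (snd c p)" using X c that unfolding vector_field_def by blast
      then show ?thesis by (simp add: that(5))
    qed
    show "\<exists>e>0. ball z e \<subseteq> ?N \<and> (\<forall>y\<in>ball z e. X c y = 0)" if z: "z \<in> ?N" "X c z = 0" for z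
    proof (rule C.parallel_vector_zero[OF open_image[OF c openin_base[OF U]] _ sX _ z])
      show "?N \<subseteq> snd c ` fst c" by blast
      show "cov (D c) (coord_field i) (X c) x = 0" if "x \<in> ?N" for x i
        by (rule solution_parallel(2)[OF U X f refl sol c that])
    qed blast
  qed
  then show False using nz unfolding non_zero_field_def by blast
qed

end

section \<open>Solutions in adapted coordinates\<close>

lemma bilin_axis: "bilin B (axis i 1) (axis j 1) = B $ i $ j"
  by (simp add: bilin_def inner_axis' matrix_vector_mult_basis column_def)

lemma dir_deriv_axis: "dir_deriv (\<lambda>_. axis i 1) f x = pd i f x"
  by (simp add: dir_deriv_def axis_def if_distrib if_distribR cong: if_cong)

context extension_surface
begin

lemma deformation_law:
  assumes "c \<in> A" "c' \<in> A" "p \<in> fst c" "p \<in> fst c'"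
  shows "\<Phi> c (snd c p) = transpose (jac c c' p) ** \<Phi> c' (snd c' p) ** jac c c' p"
proof -
  have "p \<in> topspace M \<inter> fst c \<inter> fst c'" using assms chart_subset by blast
  then show ?thesis
    using deformation assms unfolding symmetric_tensor02_def tensor02_def by blast
qed

lemma hat_law:
  assumes "c \<in> A" "c' \<in> A" "p \<in> fst c" "p \<in> fst c'"
  shows "hat (T c (snd c p)) (\<Phi> c (snd c p)) =
    transpose (jac c c' p) ** hat (T c' (snd c' p)) (\<Phi> c' (snd c' p)) ** jac c c' p"
proof -
  let ?J = "jac c c' p" and ?P = "\<Phi> c' (snd c' p)"
  have "hat (T c (snd c p)) (\<Phi> c (snd c p)) = transpose (?J ** T c (snd c p)) ** ?P ** (?J ** T c (snd c p))"
    unfolding hat_def deformation_law[OF assms] by (simp add: matrix_transpose_mul matrix_mul_assoc)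
  also have "\<dots> = transpose ?J ** hat (T c' (snd c' p)) ?P ** ?J"
    unfolding T_law[OF assms, symmetric] hat_def by (simp add: matrix_transpose_mul matrix_mul_assoc)
  finally show ?thesis .
qed

text \<open>A pullback satisfies the equation exactly when two tensor equations on the surface hold.
  They pass from \<open>u\<close> to \<open>c\<close> by the transformation laws of the Hessian, the
  Ricci tensor, \<open>T\<close> and \<Phi>.\<close>

lemma base_function_solution:
  assumes u: "u \<in> A" and W: "cot_open A W" "fst ` W \<subseteq> fst u" and d: "smooth_fun A (fst ` W) d"
    and sol: "\<And>y. y \<in> cot_img A u W \<Longrightarrow> conf_einstein_eq_at (gm u) (\<lambda>z. (d \<circ> chart_inv u) (base z)) y"
    and c: "c \<in> A" and y: "y \<in> cot_img A c W"
  shows "conf_einstein_eq_at (gm c) (\<lambda>z. (d \<circ> chart_inv c) (base z)) y"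
proof -
  note WA = cot_openD(1)[OF W(1)]
  let ?N = "\<lambda>c. snd c ` (fst ` W \<inter> fst c)" and ?d = "\<lambda>c. d \<circ> chart_inv c"
  interpret C: local_extension "snd c ` fst c" "D c" "T c" "\<Phi> c" by (rule local_extension[OF c])
  interpret B: local_extension "snd u ` fst u" "D u" "T u" "\<Phi> u" by (rule local_extension[OF u])
  let ?O = "snd c ` (fst ` W \<inter> fst c \<inter> fst u)" and ?O' = "snd u ` (fst ` W \<inter> fst c \<inter> fst u)"
  interpret K: coordinate_change ?O ?O' "transition c u" "D c" "D u"
    by (rule coordinate_change_charts[OF c u openin_base[OF W(1)]])
  have N: "open (?N c)" "?N c \<subseteq> snd c ` fst c" "smooth_on (?N c) (?d c)" if "c \<in> A" for c
    using open_image[OF that openin_base[OF W(1)]] d that unfolding smooth_fun_def by auto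
  have "base y \<in> ?N c" using y base_cot_img[OF WA, of c] by blast
  then obtain p where p: "p \<in> fst ` W" "p \<in> fst c" "base y = snd c p" by blast
  have pu: "p \<in> fst u" using p(1) W(2) by blast
  have x: "snd c p \<in> ?O" using p pu by blast
  have "snd u p \<in> base ` cot_img A u W" unfolding base_cot_img[OF WA] using p pu by blast
  then obtain y' where y': "y' \<in> cot_img A u W" "base y' = snd u p" by (metis imageE)
  note su = B.pullback_solution[OF N(1,2)[OF u] cot_openD(2)[OF W(1) u] cot_img_subset_cylinder[OF WA] N(3)[OF u] y'(1) refl
      sol[unfolded mod_riem_ext_walker], unfolded y'(2)]
  have b: "(\<Sum>k\<in>UNIV. pd k (?d u) (snd u p) * T u (snd u p) $ k $ i) = 0" for i by (rule su(1))
  have e: "2 * hessian (D u) (?d u) (snd u p) $ i $ j + ?d u (snd u p) * B.cylinder_matrix (snd u p) $ i $ j = 0" for i j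
    by (rule su(2))
  have sd: "smooth_on ?O' (?d u)" by (rule smooth_on_subset[OF N(3)[OF u]]) blast
  have tr: "?d c z = ?d u (transition c u z)" if "z \<in> ?O" for z
    using that c u by auto
  have J: "K.J k i (snd c p) = jac c u p $ k $ i" for k i by (simp add: K.J_def jac_nth)
  have F: "transition c u (snd c p) = snd u p" by (rule transition_snd[OF c p(2)])
  have "pd k (?d c) (snd c p) = pd k (\<lambda>z. ?d u (transition c u z)) (snd c p)" for k
    by (rule pd_cong[OF K.open_U x tr])
  then have pdc: "pd k (?d c) (snd c p) = (\<Sum>a\<in>UNIV. jac c u p $ a $ k * pd a (?d u) (snd u p))" for k
    unfolding K.pd_compF(1)[OF x sd] J F .
  have T: "jac c u p $ a $ 1 * T c (snd c p) $ 1 $ i + jac c u p $ a $ 2 * T c (snd c p) $ 2 $ i =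
      T u (snd u p) $ a $ 1 * jac c u p $ 1 $ i + T u (snd u p) $ a $ 2 * jac c u p $ 2 $ i" for a i
    using arg_cong[OF T_law[OF c u p(2) pu], of "\<lambda>B. B $ a $ i"] by (simp add: matrix_matrix_mult_def sum_2)
  have b': "(\<Sum>k\<in>UNIV. pd k (?d c) (snd c p) * T c (snd c p) $ k $ i) = 0" for i
    using b[of 1] b[of 2] T[of 1 i] T[of 2 i] unfolding pdc sum_2 by algebra
  have cyl: "C.cylinder_matrix (snd c p) $ i $ j =
      (\<Sum>a\<in>UNIV. \<Sum>b\<in>UNIV. jac c u p $ a $ i * jac c u p $ b $ j * B.cylinder_matrix (snd u p) $ a $ b)" for i j
    unfolding C.cylinder_matrix_def B.cylinder_matrix_def ricci_sym_def hat_law[OF c u p(2) pu]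
    by (simp add: ricci_law[OF c u p(2) pu] transpose_def matrix_matrix_mult_def sum_2) (simp add: algebra_simps)
  have e': "2 * hessian (D c) (?d c) (snd c p) $ i $ j + ?d c (snd c p) * C.cylinder_matrix (snd c p) $ i $ j = 0" for i j
  proof -
    have h: "hessian (D c) (?d c) (snd c p) $ i $ j =
        (\<Sum>a\<in>UNIV. \<Sum>b\<in>UNIV. jac c u p $ a $ i * jac c u p $ b $ j * hessian (D u) (?d u) (snd u p) $ a $ b)"
      using K.hessian_change[OF x sd tr] unfolding J F .
    have v: "?d c (snd c p) = ?d u (snd u p)" using tr[OF x] unfolding F .
    show ?thesis
      using e[of 1 1] e[of 1 2] e[of 2 1] e[of 2 2] unfolding h v cyl sum_2 by algebra
  qed
  have R: "cot_img A c W \<subseteq> base -` ?N c" by (rule cot_img_subset_cylinder[OF WA])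
  show ?thesis
    unfolding mod_riem_ext_walker
      C.pullback_solution_iff[OF N(1,2)[OF c] cot_openD(2)[OF W(1) c] R N(3)[OF c] y refl] p(3) b'
    using e' by simp
qed

lemma adapted_T:
  assumes "adapted_coordinates D T u" "x \<in> snd u ` fst u"
  shows "T u x $ k $ 1 = (if k = 2 then 1 else 0)" "T u x $ k $ 2 = 0"
proof -
  have "T u x *v axis 1 1 = axis 2 1" "T u x *v axis 2 1 = 0"
    using assms unfolding adapted_coordinates_def by blast+
  then show "T u x $ k $ 1 = (if k = 2 then 1 else 0)" "T u x $ k $ 2 = 0"
    unfolding matrix_vector_mult_basis column_def by (auto simp: vec_eq_iff axis_def)
qed

text \<open>\<open>Te\<close> is the second coordinate field, so each pairing is an entry of \<Phi>
  and the Hessian keeps a single Christoffel term; the derivatives of \<Phi> are those of its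
  component functions.\<close>

lemma adapted_equations_iff:
  assumes u: "u \<in> A" "adapted_coordinates D T u" and x: "x \<in> snd u ` fst u"
  shows "(let e = axis 1 1; Te = T u x *v e; h' = h \<circ> chart_inv u in
      dir_deriv (\<lambda>_. Te) h' x = \<kappa> / 2 * bilin (\<Phi> u x) Te Te \<and>
      bilin (hessian (D u) h' x) e e + h' x * bilin (ricci (D u) x) e e =
        - (1/2) * (h' x + 2 * \<kappa> * D u x 1 1 2) * bilin (\<Phi> u x) Te Te
        + \<kappa> / 2 * (2 * dir_deriv (\<lambda>_. e) (\<lambda>y. bilin (\<Phi> u y) (T u y *v e) e) x
                    - dir_deriv (\<lambda>_. Te) (\<lambda>y. bilin (\<Phi> u y) e e) x))
    \<longleftrightarrow> pd 2 (h \<circ> chart_inv u) x - \<kappa> / 2 * \<Phi> u x $ 2 $ 2 = 0 \<and>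
      pd 1 (pd 1 (h \<circ> chart_inv u)) x - D u x 1 1 2 * pd 2 (h \<circ> chart_inv u) x
        + (h \<circ> chart_inv u) x * pd 2 (\<lambda>x. D u x 1 1 2) x
        - \<kappa> * pd 1 (\<lambda>x. \<Phi> u x $ 2 $ 1) x + \<kappa> / 2 * pd 2 (\<lambda>x. \<Phi> u x $ 1 $ 1) x
        + \<kappa> * D u x 1 1 2 * \<Phi> u x $ 2 $ 2 + (h \<circ> chart_inv u) x / 2 * \<Phi> u x $ 2 $ 2 = 0"
proof -
  have Te: "T u x *v axis 1 1 = axis 2 1" if "x \<in> snd u ` fst u" for x
    using u(2) that unfolding adapted_coordinates_def by blast
  have p: "pd 1 (\<lambda>y. bilin (\<Phi> u y) (T u y *v axis 1 1) (axis 1 1)) x = pd 1 (\<lambda>y. \<Phi> u y $ 2 $ 1) x"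
    by (rule pd_cong[OF open_chart_image[OF u(1)] x]) (simp add: Te bilin_axis)
  have L: "D u x 1 1 1 = 0" by (rule adapted_christoffel[OF u x]) simp
  have H: "hessian (D u) g x $ 1 $ 1 = pd 1 (pd 1 g) x - D u x 1 1 2 * pd 2 g x" for g
    by (simp add: hessian_def sum_2 L)
  show ?thesis
    unfolding Let_def Te[OF x] bilin_axis dir_deriv_axis p H adapted_ricci[OF u x]
    by (auto simp: algebra_simps)
qed

text \<open>Over a fixed point the chart equation contains \<open>P\<close> times a fibre coordinate
  plus \<open>Q\<close>; as that coordinate varies over an open set, both vanish. Conversely, the
  remaining second order conditions are derivatives of \<open>P\<close> = 0.\<close>

lemma chart_solution_iff_adapted:
  fixes u :: "('a, 2) chart" and h :: "'a \<Rightarrow> real" and \<kappa> :: real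
  assumes u: "u \<in> A" "adapted_coordinates D T u" and W: "cot_open A W" "fst ` W \<subseteq> fst u" and h: "smooth_fun A (fst ` W) h"
  defines "P \<equiv> \<lambda>x. pd 2 (h \<circ> chart_inv u) x - \<kappa> / 2 * \<Phi> u x $ 2 $ 2"
    and "Q \<equiv> \<lambda>x. pd 1 (pd 1 (h \<circ> chart_inv u)) x - D u x 1 1 2 * pd 2 (h \<circ> chart_inv u) x
        + (h \<circ> chart_inv u) x * pd 2 (\<lambda>x. D u x 1 1 2) x
        - \<kappa> * pd 1 (\<lambda>x. \<Phi> u x $ 2 $ 1) x + \<kappa> / 2 * pd 2 (\<lambda>x. \<Phi> u x $ 1 $ 1) x
        + \<kappa> * D u x 1 1 2 * \<Phi> u x $ 2 $ 2 + (h \<circ> chart_inv u) x / 2 * \<Phi> u x $ 2 $ 2"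
  shows "(\<forall>y\<in>cot_img A u W. conf_einstein_eq_at (gm u) ((\<lambda>\<eta>. \<kappa> * snd \<eta> u $ 2 + h (fst \<eta>)) \<circ> chart_inv (cot_chart A u)) y) \<longleftrightarrow>
    (\<forall>x\<in>snd u ` fst ` W. P x = 0 \<and> Q x = 0)" (is "(\<forall>y\<in>?R. ?E y) \<longleftrightarrow> _")
proof -
  note WA = cot_openD(1)[OF W(1)]
  interpret C: local_extension "snd u ` fst u" "D u" "T u" "\<Phi> u" by (rule local_extension[OF u(1)])
  let ?N = "snd u ` fst ` W" and ?h = "h \<circ> chart_inv u"
  have NW: "fst ` W \<inter> fst u = fst ` W" using W(2) by blast
  have N: "open ?N" "?N \<subseteq> snd u ` fst u" and R: "open ?R" "?R \<subseteq> base -` ?N" and sh: "smooth_on ?N ?h"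
    using open_image[OF u(1) openin_base[OF W(1)]] W(2) cot_openD(2)[OF W(1) u(1)] cot_img_subset_cylinder[OF WA, of u] h u(1)
    unfolding NW smooth_fun_def by (blast, blast, blast, blast, metis NW)
  have iff: "?E y \<longleftrightarrow>
    pd 2 (pd 2 ?h) (base y) = \<kappa> / 2 * pd 2 (\<lambda>x. \<Phi> u x $ 2 $ 2) (base y) \<and>
    pd 1 (pd 2 ?h) (base y) = \<kappa> / 2 * pd 1 (\<lambda>x. \<Phi> u x $ 2 $ 2) (base y) \<and>
    fibre y $ 2 * P (base y) + Q (base y) = 0" if y: "y \<in> ?R" for y
    unfolding mod_riem_ext_walker P_def Q_def
  proof (rule C.adapted_solution_iff[OF _ _ N R sh y])
    show "T u x $ 1 $ 1 = 0 \<and> T u x $ 1 $ 2 = 0 \<and> T u x $ 2 $ 1 = 1 \<and> T u x $ 2 $ 2 = 0" if "x \<in> snd u ` fst u" for x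
      by (simp add: adapted_T[OF u(2) that])
    show "D u x i j k = 0" if "x \<in> snd u ` fst u" "(i, j, k) \<noteq> (1, 1, 2)" for x i j k
      by (rule adapted_christoffel(1)[OF u that])
    show "((\<lambda>\<eta>. \<kappa> * snd \<eta> u $ 2 + h (fst \<eta>)) \<circ> chart_inv (cot_chart A u)) z = \<kappa> * fibre z $ 2 + ?h (base z)"
      if "z \<in> ?R" for z
      using cot_chart_apply_inv[OF WA u(1) that] by simp
  qed
  show ?thesis
  proof (intro iffI ballI)
    fix x assume E: "\<forall>y\<in>?R. ?E y" and x: "x \<in> ?N"
    have "x \<in> base ` ?R" using x unfolding base_cot_img[OF WA] NW .
    then obtain y where y: "y \<in> ?R" "base y = x" by blast
    \<comment> \<open>The product of the second fibre coordinate with \<open>P x\<close> is written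
      as an inner product, the form in which coefficients are compared on an open set.\<close>
    have eq: "v \<bullet> axis 2 (P x) = - Q x" if "v \<in> {v. pack x v \<in> ?R}" for v
    proof -
      have v: "pack x v \<in> ?R" using that by simp
      then have "?E (pack x v)" using E by blast
      then have "v $ 2 * P x + Q x = 0" unfolding iff[OF v] base_pack fibre_pack by blast
      then show ?thesis by (simp add: inner_axis)
    qed
    have y': "fibre y \<in> {v. pack x v \<in> ?R}" using y by auto
    have "axis 2 (P x) = (0 :: real^2)"
      by (rule inner_constant_on_open[OF open_fibre_slice[OF R(1)] y' eq])
    then have P0: "P x = 0" by (simp add: axis_eq_0_iff)
    then show "P x = 0 \<and> Q x = 0" using eq[OF y'] by (simp add: axis_def inner_vec_def)
  next
    fix y assume PQ: "\<forall>x\<in>?N. P x = 0 \<and> Q x = 0" and y: "y \<in> ?R"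
    have x: "base y \<in> ?N" using y R(2) by blast
    \<comment> \<open>The equation \<open>P\<close> = 0 holds on the open set \<open>?N\<close> and
      may be differentiated.\<close>
    have h2: "pd 2 ?h z = \<kappa> / 2 * \<Phi> u z $ 2 $ 2" if "z \<in> ?N" for z
      using PQ that unfolding P_def by fastforce
    have "(\<lambda>x. \<Phi> u x $ 2 $ 2) differentiable (at (base y))"
      by (rule C.diff_base(3)[OF subsetD[OF N(2) x]])
    then have "pd i (\<lambda>z. \<kappa> / 2 * \<Phi> u z $ 2 $ 2) (base y) = \<kappa> / 2 * pd i (\<lambda>x. \<Phi> u x $ 2 $ 2) (base y)" for i
      by (rule pd_cmult)
    moreover have "pd i (pd 2 ?h) (base y) = pd i (\<lambda>z. \<kappa> / 2 * \<Phi> u z $ 2 $ 2) (base y)" for i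
      by (rule pd_cong[OF N(1) x h2])
    ultimately have "pd i (pd 2 ?h) (base y) = \<kappa> / 2 * pd i (\<lambda>x. \<Phi> u x $ 2 $ 2) (base y)" for i by simp
    moreover have "P (base y) = 0 \<and> Q (base y) = 0" using PQ x by blast
    ultimately show "?E y" unfolding iff[OF y] by simp
  qed
qed

lemma smooth_affine_cot_img:
  assumes W: "cot_open A W" and X: "vector_field A V X" "fst ` W \<subseteq> V" and h: "smooth_fun A (fst ` W) h" and c: "c \<in> A"
  shows "smooth_on (cot_img A c W) (\<lambda>z. fibre z \<bullet> X c (base z) + (h \<circ> chart_inv c) (base z))"
proof -
  interpret C: local_extension "snd c ` fst c" "D c" "T c" "\<Phi> c" by (rule local_extension[OF c])
  let ?N = "snd c ` (fst ` W \<inter> fst c)"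
  have N: "open ?N" "?N \<subseteq> snd c ` fst c" using open_image[OF c openin_base[OF W]] by auto
  have "smooth_on (snd c ` (V \<inter> fst c)) (X c)" using X c unfolding vector_field_def by blast
  then have "smooth_on ?N (X c)" by (rule smooth_on_subset) (use X in blast)
  moreover have "smooth_on ?N (h \<circ> chart_inv c)" using h c unfolding smooth_fun_def by blast
  ultimately show ?thesis
    by (rule C.smooth_affine[OF N cot_openD(2)[OF W c] cot_img_subset_cylinder[OF cot_openD(1)[OF W]]]) simp
qed

lemma smooth_fun_subset: "smooth_fun A V f \<Longrightarrow> V' \<subseteq> V \<Longrightarrow> smooth_fun A V' f"
  unfolding smooth_fun_def by (meson smooth_on_subset image_mono Int_mono order_refl)

section \<open>Carrying a solution from an adapted chart to all charts\<close>

context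
  fixes U X f
  assumes U: "cot_open A U" and X: "vector_field A (fst ` U) X" and f: "smooth_fun A (fst ` U) f"
    and sol: "conf_einstein_solution A gm U (\<lambda>\<eta>. iota A X \<eta> + f (fst \<eta>))"
begin

text \<open>The given solution satisfies the equation over all of its base, also at covectors
  outside \<open>U\<close>; a set \<open>W\<close> over the same points need not meet
  \<open>U\<close>.\<close>

lemma solution_extends:
  assumes c: "c \<in> A" and y: "base y \<in> snd c ` (fst ` U \<inter> fst c)"
  shows "conf_einstein_eq_at (gm c) (\<lambda>z. fibre z \<bullet> X c (base z) + (f \<circ> chart_inv c) (base z)) y"
proof -
  note UA = cot_openD(1)[OF U]
  interpret C: local_extension "snd c ` fst c" "D c" "T c" "\<Phi> c" by (rule local_extension[OF c])
  let ?N = "snd c ` (fst ` U \<inter> fst c)" and ?R = "cot_img A c U"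
  have N: "open ?N" "?N \<subseteq> snd c ` fst c" using open_image[OF c openin_base[OF U]] by auto
  have smX: "smooth_on ?N (X c)" and smf: "smooth_on ?N (f \<circ> chart_inv c)"
    using X f c unfolding vector_field_def smooth_fun_def by blast+
  show ?thesis
    unfolding mod_riem_ext_walker
  proof (rule C.parallel_solution_extends[OF N cot_openD(2)[OF U c] cot_img_subset_cylinder[OF UA] smX smf])
    show "T c x *v X c x = 0" "cov (D c) (coord_field i) (X c) x = 0" if "x \<in> ?N" for x i
      using solution_parallel[OF U X f refl sol c that] by blast+
    show "base y \<in> base ` ?R" unfolding base_cot_img[OF UA] by (rule y)
    fix z assume z: "z \<in> ?R"
    show "conf_einstein_eq_at C.gr (\<lambda>z. fibre z \<bullet> X c (base z) + (f \<circ> chart_inv c) (base z)) z"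
      unfolding mod_riem_ext_walker[symmetric, where D = D and T = T and \<Phi> = \<Phi> and c = c]
    proof (rule conf_einstein_eq_cong[OF cot_openD(2)[OF U c] z])
      show "conf_einstein_eq_at (gm c) ((\<lambda>\<eta>. iota A X \<eta> + f (fst \<eta>)) \<circ> chart_inv (cot_chart A c)) z"
        using sol c z unfolding conf_einstein_solution_def by blast
      show "((\<lambda>\<eta>. iota A X \<eta> + f (fst \<eta>)) \<circ> chart_inv (cot_chart A c)) z = fibre z \<bullet> X c (base z) + (f \<circ> chart_inv c) (base z)"
        if "z \<in> ?R" for z
        by (rule chart_form[OF U X c that refl])
    qed
  qed
qed

text \<open>Two solutions with the same fibre part differ by a function on the surface, whose equation
  does not involve the choice of coordinates.\<close>

lemma solution_of_chart_solution:
  assumes u: "u \<in> A" "fst u \<subseteq> fst ` U" "\<And>x. x \<in> snd u ` fst u \<Longrightarrow> X u x = axis 2 1"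
    and W: "cot_open A W" "fst ` W \<subseteq> fst u" and h: "smooth_fun A (fst ` W) h"
    and eq: "\<And>y. y \<in> cot_img A u W \<Longrightarrow>
      conf_einstein_eq_at (gm u) ((\<lambda>\<eta>. \<kappa> * snd \<eta> u $ 2 + h (fst \<eta>)) \<circ> chart_inv (cot_chart A u)) y"
  shows "conf_einstein_solution A gm W (\<lambda>\<eta>. \<kappa> * snd \<eta> u $ 2 + h (fst \<eta>))"
proof -
  let ?\<phi> = "\<lambda>\<eta>. \<kappa> * snd \<eta> u $ 2 + h (fst \<eta>)"
  let ?a = "\<lambda>c z. fibre z \<bullet> X c (base z) + (f \<circ> chart_inv c) (base z)"
  \<comment> \<open>As \<open>X\<close> is the second coordinate field in \<open>u\<close>, \<iota>X
    is the fibre coordinate with index 2, and subtracting \<kappa> times the given solution leaves a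
    function on the surface.\<close>
  define d where "d p = h p - \<kappa> * f p" for p
  note WA = cot_openD(1)[OF W(1)]
  have WU: "fst ` W \<subseteq> fst ` U" using W(2) u(2) by blast
  have fW: "smooth_fun A (fst ` W) f" by (rule smooth_fun_subset[OF f WU])
  have sd: "smooth_fun A (fst ` W) d"
    unfolding smooth_fun_def
  proof
    fix c assume c: "c \<in> A"
    have "smooth_on (snd c ` (fst ` W \<inter> fst c)) (\<lambda>x. (h \<circ> chart_inv c) x - \<kappa> * (f \<circ> chart_inv c) x)"
      using h fW c unfolding smooth_fun_def
      by (intro smooth_on_diff smooth_on_mult smooth_on_const open_image openin_base W(1)) blast+
    then show "smooth_on (snd c ` (fst ` W \<inter> fst c)) (d \<circ> chart_inv c)" by (simp add: d_def[abs_def] o_def)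
  qed
  have form: "(?\<phi> \<circ> chart_inv (cot_chart A c)) z = \<kappa> * ?a c z + (d \<circ> chart_inv c) (base z)"
    if c: "c \<in> A" and z: "z \<in> cot_img A c W" for c z
  proof -
    let ?\<eta> = "chart_inv (cot_chart A c) z"
    note \<eta> = cot_chart_apply_inv[OF WA c z]
    have \<eta>': "?\<eta> \<in> cotangent A" "fst ?\<eta> \<in> fst ` U" "fst ?\<eta> \<in> fst u" using \<eta>(1) WA WU W(2) by blast+
    have "base z \<in> snd c ` (fst ` W \<inter> fst c)" using z base_cot_img[OF WA, of c] by blast
    then have zc: "base z \<in> snd c ` fst c" by blast
    then have \<eta>c: "fst ?\<eta> \<in> fst c" "snd c (fst ?\<eta>) = base z" unfolding \<eta>(2) by (auto intro: chart_inv_in)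
    have "iota A X ?\<eta> = snd ?\<eta> u $ 2"
      using iota_eq[OF X \<eta>'(1,2) u(1) \<eta>'(3)] u(3)[OF imageI[OF \<eta>'(3)]] by (simp add: inner_axis)
    moreover have "iota A X ?\<eta> = fibre z \<bullet> X c (base z)"
      using iota_eq[OF X \<eta>'(1,2) c \<eta>c(1)] unfolding \<eta>(3) \<eta>c(2) .
    ultimately show ?thesis by (simp add: d_def \<eta>(2) algebra_simps)
  qed
  have sa: "smooth_on (cot_img A c W) (?a c)" if "c \<in> A" for c
    by (rule smooth_affine_cot_img[OF W(1) X WU fW that])
  have sb: "smooth_on (cot_img A c W) (\<lambda>z. (d \<circ> chart_inv c) (base z))" if c: "c \<in> A" for c
    using sd c unfolding smooth_fun_def
    by (intro smooth_on_subset[OF smooth_on_comp_base[OF open_image[OF c openin_base[OF W(1)]]] cot_img_subset_cylinder[OF WA]]) blast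
  have sphi: "smooth_on (cot_img A c W) (?\<phi> \<circ> chart_inv (cot_chart A c))" if c: "c \<in> A" for c
    by (rule smooth_on_cong[OF cot_openD(2)[OF W(1) c] form[OF c, symmetric]])
      (assumption | intro smooth_on_add smooth_on_mult smooth_on_const sa sb c cot_openD(2)[OF W(1) c])+
  have ext: "conf_einstein_eq_at (gm c) (?a c) y" if c: "c \<in> A" and y: "y \<in> cot_img A c W" for c y
    by (rule solution_extends[OF c]) (use y base_cot_img[OF WA, of c] WU in blast)
  have du: "conf_einstein_eq_at (gm u) (\<lambda>z. (d \<circ> chart_inv u) (base z)) y" if y: "y \<in> cot_img A u W" for y
  proof (rule conf_einstein_eq_cong[OF cot_openD(2)[OF W(1) u(1)] y])
    show "conf_einstein_eq_at (gm u) (\<lambda>z. - \<kappa> * ?a u z + (?\<phi> \<circ> chart_inv (cot_chart A u)) z) y"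
      by (rule conf_einstein_eq_linear[OF cot_openD(2)[OF W(1) u(1)] y sa[OF u(1)] sphi[OF u(1)] ext[OF u(1) y] eq[OF y]])
    show "- \<kappa> * ?a u z + (?\<phi> \<circ> chart_inv (cot_chart A u)) z = (d \<circ> chart_inv u) (base z)" if "z \<in> cot_img A u W" for z
      unfolding form[OF u(1) that] by simp
  qed
  show ?thesis
    unfolding conf_einstein_solution_def
  proof (intro conjI cot_smoothI ballI)
    fix c assume c: "c \<in> A"
    show "smooth_on (cot_img A c W) (?\<phi> \<circ> chart_inv (cot_chart A c))" by (rule sphi[OF c])
    fix y assume y: "y \<in> cot_img A c W"
    show "conf_einstein_eq_at (gm c) (?\<phi> \<circ> chart_inv (cot_chart A c)) y"
    proof (rule conf_einstein_eq_cong[OF cot_openD(2)[OF W(1) c] y form[OF c, symmetric]])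
      show "conf_einstein_eq_at (gm c) (\<lambda>z. \<kappa> * ?a c z + (d \<circ> chart_inv c) (base z)) y"
        by (rule conf_einstein_eq_linear[OF cot_openD(2)[OF W(1) c] y sa[OF c] sb[OF c] ext[OF c y]
              base_function_solution[OF u(1) W sd du c y]])
    qed
  qed
qed

end

end

section \<open>Case (ii): consequences of a solution with non-zero field on a connected base\<close>

context extension_surface
begin

context
  fixes U X f
  assumes U: "cot_open A U" and con: "connectedin M (fst ` U)" and X: "kernel_div_free A D T (fst ` U) X"
    and nz: "non_zero_field A (fst ` U) X" and f: "smooth_fun A (fst ` U) f"
    and sol: "conf_einstein_solution A gm U (\<lambda>\<eta>. iota A X \<eta> + f (fst \<eta>))"
begin

lemma field: "vector_field A (fst ` U) X"
  using X unfolding kernel_div_free_def by blast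

lemma adapted_chart_of_solution:
  assumes p: "p \<in> fst ` U"
  obtains u where "u \<in> A" "p \<in> fst u" "fst u \<subseteq> fst ` U" "adapted_coordinates D T u"
    "\<And>x. x \<in> snd u ` fst u \<Longrightarrow> X u x = axis 2 1"
proof (rule adapted_chart[OF openin_base[OF U] field _ _ _ p])
  fix c x assume c: "c \<in> A" "x \<in> snd c ` (fst ` U \<inter> fst c)"
  show "T c x *v X c x = 0" "cov (D c) (coord_field i) (X c) x = 0" for i
    using solution_parallel[OF U field f refl sol c] by blast+
  show "X c x \<noteq> 0" by (rule solution_field_nonzero[OF U con field f nz sol c])
qed (rule that)

lemma ricci_symmetric_rank_one:
  assumes c: "c \<in> A" and x: "x \<in> snd c ` (fst ` U \<inter> fst c)"
  shows "transpose (ricci (D c) x) = ricci (D c) x" "ricci (D c) x \<noteq> 0 \<Longrightarrow> rank (ricci (D c) x) = 1"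
proof -
  obtain p where p: "p \<in> fst ` U" "p \<in> fst c" "x = snd c p" using x by blast
  obtain u where u: "u \<in> A" "p \<in> fst u" "adapted_coordinates D T u"
    by (rule adapted_chart_of_solution[OF p(1)]) (rule that)
  note r = ricci_rank_one[OF u(1,3,2) c p(2), folded p(3)]
  show "transpose (ricci (D c) x) = ricci (D c) x" by (simp add: vec_eq_iff transpose_def r)
  show "rank (ricci (D c) x) = 1" if "ricci (D c) x \<noteq> 0"
    using that r by (rule rank_outer_square)
qed

lemma recurrent_ricci_of_solution:
  "recurrent_on A D (\<lambda>c. ricci (D c)) {p \<in> fst ` U. \<exists>c\<in>A. p \<in> fst c \<and> ricci (D c) (snd c p) \<noteq> 0}"
proof (rule recurrent_ricci[OF openin_base[OF U]])
  fix p assume "p \<in> fst ` U"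
  then obtain u where "u \<in> A" "p \<in> fst u" "adapted_coordinates D T u"
    by (rule adapted_chart_of_solution) (rule that)
  then show "\<exists>u\<in>A. p \<in> fst u \<and> adapted_coordinates D T u" by blast
qed

lemma solution_iff_adapted_equations:
  assumes u: "u \<in> A" "fst u \<subseteq> fst ` U" "adapted_coordinates D T u" "\<And>x. x \<in> snd u ` fst u \<Longrightarrow> X u x = axis 2 1"
    and W: "cot_open A W" "fst ` W \<subseteq> fst u" and h: "smooth_fun A (fst ` W) h"
  shows "conf_einstein_solution A gm W (\<lambda>\<eta>. \<kappa> * snd \<eta> u $ 2 + h (fst \<eta>)) \<longleftrightarrow>
    (\<forall>x\<in>snd u ` fst ` W.
      let e = axis 1 1; Te = T u x *v e; h' = h \<circ> chart_inv u in
      dir_deriv (\<lambda>_. Te) h' x = \<kappa> / 2 * bilin (\<Phi> u x) Te Te \<and>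
      bilin (hessian (D u) h' x) e e + h' x * bilin (ricci (D u) x) e e =
        - (1/2) * (h' x + 2 * \<kappa> * D u x 1 1 2) * bilin (\<Phi> u x) Te Te
        + \<kappa> / 2 * (2 * dir_deriv (\<lambda>_. e) (\<lambda>y. bilin (\<Phi> u y) (T u y *v e) e) x
                    - dir_deriv (\<lambda>_. Te) (\<lambda>y. bilin (\<Phi> u y) e e) x))"
    (is "?S \<longleftrightarrow> (\<forall>x\<in>?N. ?E x)")
proof -
  have N: "?N \<subseteq> snd u ` fst u" using W(2) by blast
  have "?S \<longleftrightarrow> (\<forall>y\<in>cot_img A u W. conf_einstein_eq_at (gm u)
      ((\<lambda>\<eta>. \<kappa> * snd \<eta> u $ 2 + h (fst \<eta>)) \<circ> chart_inv (cot_chart A u)) y)" (is "_ \<longleftrightarrow> ?C")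
  proof
    assume ?S
    then show ?C using u(1) unfolding conf_einstein_solution_def by blast
  next
    assume C: ?C
    show ?S
      by (rule solution_of_chart_solution[OF U field f sol u(1,2,4) W h bspec[OF C]])
  qed
  also have "\<dots> \<longleftrightarrow> (\<forall>x\<in>?N. ?E x)"
    unfolding chart_solution_iff_adapted[OF u(1,3) W h]
    by (rule ball_cong[OF refl], rule adapted_equations_iff[OF u(1,3) subsetD[OF N], symmetric])
  finally show ?thesis .
qed

end

end

theorem theorem6p1:
  fixes M :: "'a topology"
    and A :: "('a, 2) chart set"
    and D :: "('a, 2) chart \<Rightarrow> 2 christoffel"
    and T \<Phi> :: "('a, 2, real^2^2) field"
  assumes surface: "parallel_nilpotent_surface M A D T"
    and deformation: "symmetric_tensor02 A (topspace M) \<Phi>"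
  shows
    "(\<forall>U \<phi>. cot_open A U \<and> (\<forall>c\<in>A. \<forall>p\<in>fst c. connected {\<alpha> c |\<alpha>. (p, \<alpha>) \<in> U}) \<and>
        conf_einstein_solution A (mod_riem_ext D \<Phi> T) U \<phi> \<longrightarrow>
        (\<exists>X f. kernel_div_free A D T (fst ` U) X \<and> smooth_fun A (fst ` U) f \<and>
           (\<forall>\<xi>\<in>U. \<phi> \<xi> = iota A X \<xi> + f (fst \<xi>)))) \<and>

     (conformally_einstein A (mod_riem_ext D \<Phi> T) \<longleftrightarrow>
        (\<forall>\<xi>\<in>cotangent A. \<exists>U. cot_open A U \<and> \<xi> \<in> U \<and> connectedin M (fst ` U) \<and>
           ((\<exists>f. smooth_fun A (fst ` U) f \<and>
                (\<forall>\<eta>\<in>U. f (fst \<eta>) > 0) \<and>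
                conf_einstein_solution A (mod_riem_ext D \<Phi> T) U (\<lambda>\<eta>. f (fst \<eta>)) \<and>
                kills_kernel A T (fst ` U) f \<and>
                (\<forall>c\<in>A. \<forall>x\<in>snd c ` (fst ` U \<inter> fst c).
                   f (chart_inv c x) *\<^sub>R hat (T c x) (\<Phi> c x)
                   + 2 *\<^sub>R (hessian (D c) (f \<circ> chart_inv c) x
                          + f (chart_inv c x) *\<^sub>R ricci_sym (D c) x) = 0)) \<or>
            (\<exists>X f. kernel_div_free A D T (fst ` U) X \<and> non_zero_field A (fst ` U) X \<and>
                smooth_fun A (fst ` U) f \<and>
                (\<forall>\<eta>\<in>U. iota A X \<eta> + f (fst \<eta>) > 0) \<and>
                conf_einstein_solution A (mod_riem_ext D \<Phi> T) U (\<lambda>\<eta>. iota A X \<eta> + f (fst \<eta>)))))) \<and>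

     (\<forall>U X f. cot_open A U \<and> connectedin M (fst ` U) \<and>
        kernel_div_free A D T (fst ` U) X \<and> non_zero_field A (fst ` U) X \<and>
        smooth_fun A (fst ` U) f \<and>
        conf_einstein_solution A (mod_riem_ext D \<Phi> T) U (\<lambda>\<eta>. iota A X \<eta> + f (fst \<eta>)) \<longrightarrow>
        (\<forall>c\<in>A. \<forall>x\<in>snd c ` (fst ` U \<inter> fst c).
           transpose (ricci (D c) x) = ricci (D c) x \<and>
           (ricci (D c) x \<noteq> 0 \<longrightarrow> rank (ricci (D c) x) = 1)) \<and>
        recurrent_on A D (\<lambda>c. ricci (D c))
          {p \<in> fst ` U. \<exists>c\<in>A. p \<in> fst c \<and> ricci (D c) (snd c p) \<noteq> 0} \<and>
        (\<forall>p\<in>fst ` U. \<exists>u\<in>A. p \<in> fst u \<and> fst u \<subseteq> fst ` U \<and> adapted_coordinates D T u \<and>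
           (\<exists>\<kappa>. \<kappa> \<noteq> 0 \<and> (\<forall>x\<in>snd u ` fst u. X u x = axis 2 \<kappa>)) \<and>
           (\<forall>\<kappa> W h. \<kappa> \<noteq> 0 \<and> cot_open A W \<and> fst ` W \<subseteq> fst u \<and> smooth_fun A (fst ` W) h \<longrightarrow>
              (conf_einstein_solution A (mod_riem_ext D \<Phi> T) W (\<lambda>\<eta>. \<kappa> * snd \<eta> u $ 2 + h (fst \<eta>)) \<longleftrightarrow>
               (\<forall>x\<in>snd u ` fst ` W.
                  let e = axis 1 1; Te = T u x *v e; h' = h \<circ> chart_inv u in
                  dir_deriv (\<lambda>_. Te) h' x = \<kappa> / 2 * bilin (\<Phi> u x) Te Te \<and>
                  bilin (hessian (D u) h' x) e e + h' x * bilin (ricci (D u) x) e e =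
                    - (1/2) * (h' x + 2 * \<kappa> * D u x 1 1 2) * bilin (\<Phi> u x) Te Te
                    + \<kappa> / 2 * (2 * dir_deriv (\<lambda>_. e) (\<lambda>y. bilin (\<Phi> u y) (T u y *v e) e) x
                                - dir_deriv (\<lambda>_. Te) (\<lambda>y. bilin (\<Phi> u y) e e) x))))))"
proof -
  interpret extension_surface M A D T \<Phi>
    using surface deformation by unfold_locales
  show ?thesis
  \<comment> \<open>Five goals: the form of solutions, the equivalence, and for case (ii) the
    symmetry and rank, the recurrence and the adapted coordinates.\<close>
  proof (intro conjI allI impI, goal_cases)
    case (1 U \<phi>)
    then have U: "cot_open A U" and sol: "conf_einstein_solution A gm U \<phi>"
      and con: "\<forall>c\<in>A. \<forall>p\<in>fst c. connected {\<alpha> c |\<alpha>. (p, \<alpha>) \<in> U}"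
      by blast+
    show ?case
    proof (rule solution_form[OF U _ sol])
      show "connected {\<alpha> c |\<alpha>. (p, \<alpha>) \<in> U}" if "c \<in> A" "p \<in> fst c" for c p
        using con that by blast
    qed blast
  next
    case 2
    show ?case
    proof (intro iffI ballI, goal_cases)
      case (1 \<xi>)
      then show ?case
      proof (rule conformally_einstein_cases)
        fix U X f
        assume U: "cot_open A U" "\<xi> \<in> U" "connectedin M (fst ` U)" and X: "kernel_div_free A D T (fst ` U) X"
          and f: "smooth_fun A (fst ` U) f" and pos: "\<forall>\<eta>\<in>U. iota A X \<eta> + f (fst \<eta>) > 0"
          and sol: "conf_einstein_solution A gm U (\<lambda>\<eta>. iota A X \<eta> + f (fst \<eta>))"
        show ?thesis
        \<comment> \<open>The field decides between the alternatives: if it vanishes identically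
          over \<open>U\<close>, the solution is a pullback, and the base equations give
          (i).\<close>
        proof (cases "non_zero_field A (fst ` U) X")
          case True
          then show ?thesis
            using U X f pos sol by (intro exI[of _ U] conjI disjI2 exI[of _ X] exI[of _ f])
        next
          case False
          have "vector_field A (fst ` U) X" using X unfolding kernel_div_free_def by blast
          then have z: "iota A X \<eta> = 0" if "\<eta> \<in> U" for \<eta>
            using iota_zero False cot_openD(1)[OF U(1)] that by blast
          have sol': "conf_einstein_solution A gm U (\<lambda>\<eta>. f (fst \<eta>))"
            by (rule conf_einstein_solution_cong[OF U(1) _ sol]) (simp add: z)
          have pos': "\<forall>\<eta>\<in>U. f (fst \<eta>) > 0" using pos z by simp
          show ?thesis
            using U f pos' sol' base_solution(1)[OF U(1) f sol']
            by (intro exI[of _ U] conjI disjI1 exI[of _ f])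
              (assumption | intro ballI base_solution(2)[OF U(1) f sol'])+
        qed
      qed
    next
      case 2
      show ?case
      proof (rule conformally_einstein_of_solution)
        fix \<xi> assume "\<xi> \<in> cotangent A"
        from bspec[OF 2 this] show "\<exists>U \<phi>. cot_open A U \<and> \<xi> \<in> U \<and> (\<forall>\<eta>\<in>U. \<phi> \<eta> > 0) \<and> conf_einstein_solution A gm U \<phi>"
          by (elim exE conjE disjE) (rule exI, rule exI, intro conjI; assumption)+
      qed
    qed
  next
    case (3 U X f)
    then have "cot_open A U" "connectedin M (fst ` U)" "kernel_div_free A D T (fst ` U) X"
      "non_zero_field A (fst ` U) X" "smooth_fun A (fst ` U) f"
      "conf_einstein_solution A gm U (\<lambda>\<eta>. iota A X \<eta> + f (fst \<eta>))"
      by blast+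
    from ricci_symmetric_rank_one[OF this] show ?case by blast
  next
    case (4 U X f)
    then have "cot_open A U" "connectedin M (fst ` U)" "kernel_div_free A D T (fst ` U) X"
      "non_zero_field A (fst ` U) X" "smooth_fun A (fst ` U) f"
      "conf_einstein_solution A gm U (\<lambda>\<eta>. iota A X \<eta> + f (fst \<eta>))"
      by blast+
    then show ?case by (rule recurrent_ricci_of_solution)
  next
    case (5 U X f)
    then have h: "cot_open A U" "connectedin M (fst ` U)" "kernel_div_free A D T (fst ` U) X"
      "non_zero_field A (fst ` U) X" "smooth_fun A (fst ` U) f"
      "conf_einstein_solution A gm U (\<lambda>\<eta>. iota A X \<eta> + f (fst \<eta>))"
      by blast+
    show ?case
    proof (rule ballI, goal_cases)
      case (1 p)
      obtain u where u: "u \<in> A" "p \<in> fst u" "fst u \<subseteq> fst ` U" "adapted_coordinates D T u"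
        and Xu: "\<And>x. x \<in> snd u ` fst u \<Longrightarrow> X u x = axis 2 1"
        by (rule adapted_chart_of_solution[OF h 1]) (rule that)
      \<comment> \<open>The adapted chart is built from \<open>X\<close> itself, which normalises
        the constant to 1.\<close>
      have k: "\<exists>\<kappa>. \<kappa> \<noteq> 0 \<and> (\<forall>x\<in>snd u ` fst u. X u x = axis 2 \<kappa>)"
        using Xu by (intro exI[of _ 1]) simp
      show ?case
        by (intro bexI[OF _ u(1)] conjI u(2-4) k allI impI solution_iff_adapted_equations[OF h u(1,3,4) Xu])
          (assumption | elim conjE)+
    qed
  qed
qed


end
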